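(* Let $\Omega\subset\mathbb{C}$ be a bounded simply connected Jordan domain whose boundary contains three line segments $I_1,I_2,I_3$ lying in the positive direction in this order, such that $I_j$ and $I_{j+1}$ have a common endpoint $z_j$ with interior angle $\alpha_j\neq\pi$ for $j=1,2$. Let $\varphi$ be a solution of the minimal surface equation over $\Omega$ which tends to plus infinity on $I_2$ and tends to plus or minus infinity on each of $I_1$ and $I_3$. Let $\psi$ be the dual of $\varphi$, $f\colon\mathbb{D}\to\Omega$ the corresponding harmonic mapping, $t=\varphi\circ f$, $t^*=\psi\circ f$, and $X_{\min}=(f,t)$, $X_{\max}=(f,t^* )$, $X_{\min}^*=(f^*,t^* )$, $X_{\max}^*=(f^*,-t)$. Then there is a point $w_2\in\partial\mathbb{D}$ at which the following hold simultaneously (so that the four boundary objects below correspond to each other under conjugation and the dual operation): 1. $X_{\min}$ diverges to $+\infty$ over the horizontal segment $I_2=(z_1,z_2)$: the cluster set of $f$ at $w_2$ is $\overline{I_2}$ and $t(w)\to+\infty$ as $w\to w_2$. 2. $X_{\max}$ admits a future-directed lightlike line segment over $I_2$: the cluster set of $X_{\max}$ at $w_2$ is the closed segment joining $(z_1,\psi(z_1))$ and $(z_2,\psi(z_2))$, where $\psi(z_2)-\psi(z_1)=|z_2-z_1|$. 3. $X_{\min}^*$ diverges to a vertical line segment of length $|I_2|=|z_2-z_1|$ at infinity in $(z_1-z_2)$-direction. 4. $X_{\max}^*$ diverges to $-\infty$ at infinity in $(z_1-z_2)$-direction.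
   Context: Conventions: line segments are open; $\mathbb{D}$ is the open unit disk in $\mathbb{C}$; $\mathbb{E}^3$ is Euclidean space and $\mathbb{L}^3$ is $\mathbb{R}^3$ with the Lorentzian inner product of signature $(+,+,-)$; both are identified with $\mathbb{C}\times\mathbb{R}$; the positive direction on $\partial\Omega$ is the counterclockwise one ($\Omega$ to the left). Minimal surface equation: $\mathrm{div}\big(\nabla\varphi/\sqrt{1+|\nabla\varphi|^2}\big)=0$. Maximal surface equation: $\mathrm{div}\big(\nabla\psi/\sqrt{1-|\nabla\psi|^2}\big)=0$ with $|\nabla\psi|<1$. Dual: for a solution $\varphi$ of the minimal surface equation over a simply connected domain $\Omega$, its dual $\psi$ (unique up to an additive constant, and a solution of the maximal surface equation) is defined by $d\psi=-\frac{\varphi_y}{\sqrt{1+|\nabla\varphi|^2}}dx+\frac{\varphi_x}{\sqrt{1+|\nabla\varphi|^2}}dy$. Since $|\nabla\psi|<1$, $\psi$ extends continuously to $I_1\cup\{z_1\}\cup I_2\cup\{z_2\}\cup I_3$. Corresponding harmonic mapping: the orientation-preserving univalent (injective) complex-valued harmonic mapping $f$ from $\mathbb{D}$ onto $\Omega$ such that $(f,\varphi\circ f)$ is an isothermal parametrization of $\mathrm{graph}(\varphi)\subset\mathbb{E}^3$; it exists and is unique up to precomposition with a M\"obius automorphism of $\mathbb{D}$, and $(f,\psi\circ f)$ is then an isothermal parametrization of $\mathrm{graph}(\psi)\subset\mathbb{L}^3$. The function $\varphi\circ f+i\,\psi\circ f$ is holomorphic. "$\varphi$ tends to $\pm\infty$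 on $I$" means $\varphi(z)\to\pm\infty$ as $z\in\Omega$ tends to any point of $I$. Conjugates: for a real harmonic function $\xi$ on $\mathbb{D}$, $\xi^*$ denotes its conjugate harmonic function ($\xi+i\xi^*$ holomorphic; up to an additive constant), and $f^*=x^*+iy^*$ for $f=x+iy$. $X_{\min}^*$ and $X_{\max}^*$ are the conjugate minimal surface of $X_{\min}$ and the conjugate maximal surface of $X_{\max}$. The cluster set at $w_2$ of a map on $\mathbb{D}$ is the set of all limits along sequences $w_n\in\mathbb{D}$, $w_n\to w_2$. "$f^*$ diverges to infinity in $(z_1-z_2)$-direction" means $|f^*(w)|\to\infty$ and $f^*(w)/|f^*(w)|\to(z_1-z_2)/|z_1-z_2|$ as $w\to w_2$. "$X_{\min}^*$ diverges to a vertical line segment of length $|I_2|$ at infinity in $(z_1-z_2)$-direction" means that $f^*$ diverges to infinity in $(z_1-z_2)$-direction and the cluster set of $t^*$ at $w_2$ is an interval of length $|I_2|$. "$X_{\max}^*$ diverges to $-\infty$ at infinity in $(z_1-z_2)$-direction" means that $f^*$ diverges to infinity in $(z_1-z_2)$-direction and $-t(w)\to-\infty$ as $w\to w_2$. *)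

theory Defs
  imports "HOL-Complex_Analysis.Complex_Analysis"
begin

section \<open>Calculus in the plane, identified with the complex numbers\<close>

definition pdx :: "(complex \<Rightarrow> 'a::real_normed_vector) \<Rightarrow> complex \<Rightarrow> 'a" where
  "pdx u z = frechet_derivative u (at z) 1"

definition pdy :: "(complex \<Rightarrow> 'a::real_normed_vector) \<Rightarrow> complex \<Rightarrow> 'a" where
  "pdy u z = frechet_derivative u (at z) \<i>"

definition C1_on :: "complex set \<Rightarrow> (complex \<Rightarrow> 'a::real_normed_vector) \<Rightarrow> bool" where
  "C1_on S u \<longleftrightarrow>
     (\<forall>z\<in>S. u differentiable (at z)) \<and> continuous_on S (pdx u) \<and> continuous_on S (pdy u)"

definition C2_on :: "complex set \<Rightarrow> (complex \<Rightarrow> 'a::real_normed_vector) \<Rightarrow> bool" where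
  "C2_on S u \<longleftrightarrow> C1_on S u \<and> C1_on S (pdx u) \<and> C1_on S (pdy u)"

definition harmonic_on :: "complex set \<Rightarrow> (complex \<Rightarrow> 'a::real_normed_vector) \<Rightarrow> bool" where
  "harmonic_on S u \<longleftrightarrow> C2_on S u \<and> (\<forall>z\<in>S. pdx (pdx u) z + pdy (pdy u) z = 0)"

section \<open>Jordan domains with boundary segments\<close>

text \<open>\<open>\<Omega>\<close> is the Jordan domain bounded by the closed Jordan curve \<open>\<gamma>\<close>, and \<open>\<gamma>\<close> runs
  counterclockwise, i.e. with \<open>\<Omega>\<close> to its left.  Boundedness and simple connectedness of \<open>\<Omega>\<close>
  are automatic, see below.\<close>

definition positive_boundary_curve :: "(real \<Rightarrow> complex) \<Rightarrow> complex set \<Rightarrow> bool" where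
  "positive_boundary_curve \<gamma> \<Omega> \<longleftrightarrow>
     simple_path \<gamma> \<and> pathfinish \<gamma> = pathstart \<gamma> \<and> \<Omega> = inside (path_image \<gamma>) \<and>
     (\<forall>z\<in>\<Omega>. winding_number \<gamma> z = 1)"

lemma positive_boundary_curve_domain:
  assumes "positive_boundary_curve \<gamma> \<Omega>"
  shows "open \<Omega>" "connected \<Omega>" "\<Omega> \<noteq> {}" "bounded \<Omega>" "simply_connected \<Omega>"
    "frontier \<Omega> = path_image \<gamma>"
proof -
  have \<gamma>: "simple_path \<gamma>" "pathfinish \<gamma> = pathstart \<gamma>" "\<Omega> = inside (path_image \<gamma>)"
    using assms by (auto simp: positive_boundary_curve_def)
  note J = Jordan_inside_outside[OF \<gamma>(1,2)]
  show "open \<Omega>" "connected \<Omega>" "\<Omega> \<noteq> {}" "bounded \<Omega>" "frontier \<Omega> = path_image \<gamma>"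
    using J \<gamma>(3) by auto
  show "simply_connected \<Omega>"
    using simply_connected_inside_simple_path \<gamma> by blast
qed

text \<open>The closed segments \<open>[z0,z1]\<close>, \<open>[z1,z2]\<close>, \<open>[z2,z3]\<close> are traversed by \<open>\<gamma>\<close> one directly after
  the other.  The base point of \<open>\<gamma>\<close> is arbitrary, so that having it off the two inner
  corners is no restriction; \<open>s0 = 0\<close>, \<open>s3 = 1\<close> (a triangle, \<open>z3 = z0\<close>) is allowed.\<close>

definition consecutive_segments ::
    "(real \<Rightarrow> complex) \<Rightarrow> complex \<Rightarrow> complex \<Rightarrow> complex \<Rightarrow> complex \<Rightarrow> bool" where
  "consecutive_segments \<gamma> z0 z1 z2 z3 \<longleftrightarrow>
     (\<exists>s0 s1 s2 s3. 0 \<le> s0 \<and> s0 < s1 \<and> s1 < s2 \<and> s2 < s3 \<and> s3 \<le> 1 \<and>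
        \<gamma> s0 = z0 \<and> \<gamma> s1 = z1 \<and> \<gamma> s2 = z2 \<and> \<gamma> s3 = z3 \<and>
        \<gamma> ` {s0..s1} = closed_segment z0 z1 \<and>
        \<gamma> ` {s1..s2} = closed_segment z1 z2 \<and>
        \<gamma> ` {s2..s3} = closed_segment z2 z3)"

text \<open>Interior angle, in \<open>(0, 2\<pi>)\<close>, at the corner \<open>b\<close> where a positively oriented boundary
  arrives along the segment from \<open>a\<close> and leaves along the segment to \<open>c\<close>: the domain is swept out
  by turning counterclockwise from the outgoing to the incoming segment.\<close>

definition interior_angle :: "complex \<Rightarrow> complex \<Rightarrow> complex \<Rightarrow> real" where
  "interior_angle a b c = Arg2pi ((a - b) / (c - b))"

section \<open>Minimal graphs, their duals and the corresponding harmonic mappings\<close>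

definition area_density :: "(complex \<Rightarrow> real) \<Rightarrow> complex \<Rightarrow> real" where
  "area_density \<phi> z = sqrt (1 + (pdx \<phi> z)\<^sup>2 + (pdy \<phi> z)\<^sup>2)"

definition minimal_surface_solution :: "complex set \<Rightarrow> (complex \<Rightarrow> real) \<Rightarrow> bool" where
  "minimal_surface_solution \<Omega> \<phi> \<longleftrightarrow> C2_on \<Omega> \<phi> \<and>
     (\<forall>z\<in>\<Omega>. pdx (\<lambda>w. pdx \<phi> w / area_density \<phi> w) z
          + pdy (\<lambda>w. pdy \<phi> w / area_density \<phi> w) z = 0)"

definition is_dual :: "complex set \<Rightarrow> (complex \<Rightarrow> real) \<Rightarrow> (complex \<Rightarrow> real) \<Rightarrow> bool" where
  "is_dual \<Omega> \<phi> \<psi> \<longleftrightarrow>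
     (\<forall>z\<in>\<Omega>. (\<psi> has_derivative
        (\<lambda>h. - (pdy \<phi> z / area_density \<phi> z) * Re h + pdx \<phi> z / area_density \<phi> z * Im h)) (at z))"

text \<open>The inner product below is the Euclidean one of \<open>\<complex> \<times> \<real>\<close>.\<close>

definition isothermal_on :: "complex set \<Rightarrow> (complex \<Rightarrow> complex \<times> real) \<Rightarrow> bool" where
  "isothermal_on S X \<longleftrightarrow>
     (\<forall>w\<in>S. X differentiable (at w) \<and>
        pdx X w \<bullet> pdx X w = pdy X w \<bullet> pdy X w \<and> pdx X w \<bullet> pdy X w = 0 \<and> pdx X w \<noteq> 0)"

text \<open>\<open>Im (cnj f\<^sub>u * f\<^sub>v)\<close> is the Jacobian determinant of \<open>f\<close>.\<close>

definition orientation_preserving_on :: "complex set \<Rightarrow> (complex \<Rightarrow> complex) \<Rightarrow> bool" where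
  "orientation_preserving_on S f \<longleftrightarrow> (\<forall>w\<in>S. Im (cnj (pdx f w) * pdy f w) > 0)"

definition corresponding_harmonic_mapping ::
    "complex set \<Rightarrow> (complex \<Rightarrow> real) \<Rightarrow> (complex \<Rightarrow> complex) \<Rightarrow> bool" where
  "corresponding_harmonic_mapping \<Omega> \<phi> f \<longleftrightarrow>
     harmonic_on (ball 0 1) f \<and> orientation_preserving_on (ball 0 1) f \<and>
     bij_betw f (ball 0 1) \<Omega> \<and> isothermal_on (ball 0 1) (\<lambda>w. (f w, \<phi> (f w)))"

definition conjugate_harmonic :: "(complex \<Rightarrow> real) \<Rightarrow> (complex \<Rightarrow> real) \<Rightarrow> bool" where
  "conjugate_harmonic \<xi> \<eta> \<longleftrightarrow> (\<lambda>w. Complex (\<xi> w) (\<eta> w)) holomorphic_on ball 0 1"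

definition conjugate_mapping :: "(complex \<Rightarrow> complex) \<Rightarrow> (complex \<Rightarrow> complex) \<Rightarrow> bool" where
  "conjugate_mapping f g \<longleftrightarrow>
     conjugate_harmonic (\<lambda>w. Re (f w)) (\<lambda>w. Re (g w)) \<and>
     conjugate_harmonic (\<lambda>w. Im (f w)) (\<lambda>w. Im (g w))"

section \<open>Boundary behaviour\<close>

definition tends_on :: "complex set \<Rightarrow> (complex \<Rightarrow> real) \<Rightarrow> real filter \<Rightarrow> complex set \<Rightarrow> bool" where
  "tends_on \<Omega> \<phi> F I \<longleftrightarrow> (\<forall>p\<in>I. filterlim \<phi> F (at p within \<Omega>))"

definition cluster_set :: "(complex \<Rightarrow> 'a::topological_space) \<Rightarrow> complex \<Rightarrow> 'a set" where
  "cluster_set g w = {l. \<exists>s::nat \<Rightarrow> complex.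
     (\<forall>n. s n \<in> ball 0 1) \<and> s \<longlonglongrightarrow> w \<and> (\<lambda>n. g (s n)) \<longlonglongrightarrow> l}"

text \<open>Recall that \<open>sgn z = z / \<bar>z\<bar>\<close> for \<open>z \<noteq> 0\<close>.\<close>

definition diverges_in_direction :: "(complex \<Rightarrow> complex) \<Rightarrow> complex \<Rightarrow> complex \<Rightarrow> bool" where
  "diverges_in_direction g w d \<longleftrightarrow>
     filterlim (\<lambda>v. norm (g v)) at_top (at w within ball 0 1) \<and>
     ((\<lambda>v. sgn (g v)) \<longlongrightarrow> sgn d) (at w within ball 0 1)"

end

theory Submission imports Defs begin

text \<open>Let \<open>F\<close> be the inverse of \<open>f\<close>.  A harmonic function on the disc cannot tend to infinity along a
  boundary arc; so, by Koebe's lemma and a crosscut argument, \<open>F\<close> collapses each of the three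
  segments to a single boundary point \<open>w\<^sub>j\<close>.  If two neighbouring segments had the same \<open>w\<^sub>j\<close>, then
  the cluster set of \<open>f\<close> there would lie in a line segment by Phragmen--Lindelof, contradicting
  that the interior angle is not \<open>\<pi>\<close>.  Hence \<open>f\<close> tends to \<open>z\<^sub>1\<close> on an arc on one side of \<open>w\<^sub>2\<close> and to
  \<open>z\<^sub>2\<close> on an arc on the other side, and \<open>\<psi> \<circ> f\<close> has one-sided boundary values too.  So near \<open>w\<^sub>2\<close>
  the holomorphic functions \<open>x + i x\<^sup>*\<close>, \<open>y + i y\<^sup>*\<close>, \<open>t + i t\<^sup>*\<close> are multiples of a logarithm, with
  coefficients given by the jumps, plus remainders with bounded derivative.  The leading term
  of the null relation between their derivatives gives \<open>\<bar>\<psi>(z\<^sub>2) - \<psi>(z\<^sub>1)\<bar> = \<bar>z\<^sub>2 - z\<^sub>1\<bar>\<close>; the sign comes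
  from \<open>t \<rightarrow> +\<infinity>\<close> together with the orientation of \<open>f\<close>, which is read off with Hopf's lemma.\<close>

section \<open>Harmonic functions near a boundary arc\<close>

text \<open>Nothing is known beforehand about boundary values of \<open>f\<close>, while the
  divergence of \<phi> is given at frontier points of \<Omega>. Hence limits of the inverse
  \<open>F\<close> at those points are studied, and their outcome is carried back to the circle. The
  neighbouring segments enter through the arcs that the two corners produce on either side of the
  image point of the middle segment; divergence to minus infinity on them is handled by a minus sign
  in front of the height function. The null relation sees only squares and leaves two signs open.
  Divergence to plus infinity decides on which side of the image point the dual is larger. Which
  corner belongs to that side is a separate question of orientation. It is answered locally, without
  degree theory: on the axis of a small half disc \<open>f\<close> is close to the midpoint of the
  segment, and there \<Omega> lies to the left. Most estimates are made in the upper half plane,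
  reached by \<open>exp (\<i> * \<zeta>)\<close>: boundary arcs become straight, and the barriers
  are polynomials of degree two and three or logarithms.\<close>

lemma Re_maximum_principle:
  assumes S: "open S" "bounded S" and G: "G holomorphic_on S"
    and bd: "\<And>\<zeta> e. \<zeta> \<in> frontier S \<Longrightarrow> e > 0 \<Longrightarrow> \<forall>\<^sub>F \<xi> in at \<zeta> within S. Re (G \<xi>) < m + e"
    and x: "x \<in> S"
  shows "Re (G x) \<le> m"
proof (rule ccontr)
  assume neg: "\<not> Re (G x) \<le> m"
  define e where "e = (Re (G x) - m) / 2"
  \<comment> \<open>\<open>G\<close> has no boundary values, only an upper limit; so the maximum
    principle is applied on the superlevel set \<open>T\<close>, whose closure stays inside
    \<open>S\<close> because \<open>Re G\<close> is below \<open>m + e\<close> near the frontier.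
    The choice of \<open>e\<close> puts \<open>x\<close> into \<open>T\<close>.\<close>
  define T where "T = S \<inter> {y. Re (G y) > m + e}"
  have e: "e > 0" using neg by (simp add: e_def)
  have contG: "continuous_on S G" using G holomorphic_on_imp_continuous_on by blast
  have opT: "open T"
  proof -
    have "open (S \<inter> (\<lambda>y. Re (G y)) -` {m + e<..})"
      by (intro continuous_open_preimage S open_greaterThan continuous_intros contG)
    moreover have "S \<inter> (\<lambda>y. Re (G y)) -` {m + e<..} = T" by (auto simp: T_def)
    ultimately show ?thesis by simp
  qed
  have xT: "x \<in> T" using x neg by (simp add: T_def e_def field_simps)
  have clT: "closure T \<subseteq> S"
  proof
    fix y assume y: "y \<in> closure T"
    show "y \<in> S"
    proof (rule ccontr)
      assume yS: "y \<notin> S"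
      have "y \<in> closure S" using y closure_mono[of T S] by (auto simp: T_def)
      then have "y \<in> frontier S" using yS S(1) by (simp add: frontier_def interior_open)
      from bd[OF this e] obtain d where d: "d > 0" "\<And>\<xi>. \<xi> \<in> S \<Longrightarrow> \<xi> \<noteq> y \<Longrightarrow> dist \<xi> y < d \<Longrightarrow> Re (G \<xi>) < m + e"
        by (auto simp: eventually_at)
      from y d(1) obtain z where "z \<in> T" "dist z y < d" by (auto simp: closure_approachable)
      then show False using d(2)[of z] yS by (auto simp: T_def)
    qed
  qed
  have "Re (G x) \<le> m + e"
  proof (rule maximum_real_frontier[of G T])
    show "G holomorphic_on interior T"
      using G clT by (meson closure_subset holomorphic_on_subset interior_subset order_trans)
    show "continuous_on (closure T) G" using contG clT continuous_on_subset by blast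
    show "bounded T" using S(2) by (auto simp: T_def intro: bounded_subset)
    show "Re (G z) \<le> m + e" if "z \<in> frontier T" for z
    proof -
      have "z \<in> closure T" "z \<notin> T" using that interior_open[OF opT] by (auto simp: frontier_def)
      then show ?thesis using clT by (auto simp: T_def)
    qed
    show "x \<in> T" by fact
  qed
  then show False using e by (simp add: e_def field_simps)
qed

text \<open>At \<open>w\<close> only the bound \<open>M\<close> is available. The half plane
  condition provides a branch \<open>L\<close> of the logarithm of
  \<open>c * (\<xi> - w) / R\<close>, with real part at most 0 and tending to minus infinity at
  \<open>w\<close>; adding \<open>\<epsilon> * L\<close> beats \<open>M\<close> near
  \<open>w\<close>, and then \<epsilon> tends to 0.\<close>

lemma Phragmen_Lindelof_point:
  assumes S: "open S" "bounded S" and G: "G holomorphic_on S"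
    and half: "\<And>\<xi>. \<xi> \<in> S \<Longrightarrow> Re (c * (\<xi> - w)) > 0"
    and M: "\<And>\<xi>. \<xi> \<in> S \<Longrightarrow> Re (G \<xi>) \<le> M"
    and bd: "\<And>\<zeta> e. \<zeta> \<in> frontier S \<Longrightarrow> \<zeta> \<noteq> w \<Longrightarrow> e > 0 \<Longrightarrow> \<forall>\<^sub>F \<xi> in at \<zeta> within S. Re (G \<xi>) < m + e"
    and x: "x \<in> S"
  shows "Re (G x) \<le> m"
proof -
  obtain R where R: "R > 0" "\<And>\<xi>. \<xi> \<in> S \<Longrightarrow> norm (c * (\<xi> - w)) \<le> R"
  proof -
    obtain B where B: "\<And>\<xi>. \<xi> \<in> S \<Longrightarrow> norm \<xi> \<le> B" "B > 0" using S(2) by (auto simp: bounded_pos)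
    have "norm (c * (\<xi> - w)) \<le> norm c * (B + norm w) + 1" if "\<xi> \<in> S" for \<xi>
    proof -
      have "norm (\<xi> - w) \<le> B + norm w" using B(1)[OF that] norm_triangle_ineq4[of \<xi> w] by linarith
      then show ?thesis by (simp add: norm_mult) (smt (verit) mult_left_mono norm_ge_zero)
    qed
    moreover have "norm c * (B + norm w) + 1 > 0" using B(2) by (smt (verit) mult_nonneg_nonneg norm_ge_zero)
    ultimately show ?thesis using that by blast
  qed
  define L where "L = (\<lambda>\<xi>. Ln (c * (\<xi> - w) / of_real R))"
  have posR: "Re (c * (\<xi> - w) / of_real R) > 0" if "\<xi> \<in> S" for \<xi>
    using half[OF that] R(1) by (simp add: Re_divide_of_real)
  have L: "L holomorphic_on S" unfolding L_def
    using posR R(1) by (intro holomorphic_intros) (auto simp: complex_nonpos_Reals_iff dest!: posR)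
  have ReL: "Re (L \<xi>) = ln (norm (c * (\<xi> - w)) / R)" if "\<xi> \<in> S" for \<xi>
    using posR[OF that] R(1) unfolding L_def by (subst Re_Ln) (auto simp: norm_divide)
  have ReL0: "Re (L \<xi>) \<le> 0" if "\<xi> \<in> S" for \<xi>
  proof -
    have "norm (c * (\<xi> - w)) > 0" using half[OF that] by (auto simp del: norm_mult)
    then have "norm (c * (\<xi> - w)) / R > 0" "norm (c * (\<xi> - w)) / R \<le> 1" using R(1) R(2)[OF that] by auto
    then show ?thesis unfolding ReL[OF that] by (subst ln_le_zero_iff)
  qed
  have key: "Re (G x) \<le> m - \<epsilon> * Re (L x)" if \<epsilon>: "\<epsilon> > 0" for \<epsilon>
  proof -
    have "Re (G x + of_real \<epsilon> * L x) \<le> m"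
    proof (rule Re_maximum_principle[OF S _ _ x])
      show "(\<lambda>\<xi>. G \<xi> + of_real \<epsilon> * L \<xi>) holomorphic_on S" by (intro holomorphic_intros G L)
      fix \<zeta> and e :: real assume z: "\<zeta> \<in> frontier S" and e: "e > 0"
      show "\<forall>\<^sub>F \<xi> in at \<zeta> within S. Re (G \<xi> + of_real \<epsilon> * L \<xi>) < m + e"
      proof (cases "\<zeta> = w")
        case False
        from bd[OF z False e] obtain d where d: "d > 0"
          "\<And>\<xi>. \<xi> \<in> S \<Longrightarrow> \<xi> \<noteq> \<zeta> \<Longrightarrow> dist \<xi> \<zeta> < d \<Longrightarrow> Re (G \<xi>) < m + e"
          by (auto simp: eventually_at)
        have "Re (G \<xi> + of_real \<epsilon> * L \<xi>) < m + e" if "\<xi> \<in> S" "\<xi> \<noteq> \<zeta>" "dist \<xi> \<zeta> < d" for \<xi>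
          using d(2)[OF that] ReL0[OF that(1)] \<epsilon> mult_nonneg_nonpos[of \<epsilon> "Re (L \<xi>)"] by simp
        then show ?thesis using d(1) by (auto simp: eventually_at)
      next
        case True
        \<comment> \<open>Within distance \<open>d\<close> of \<open>w\<close> one has
          \<open>Re (L \<xi>) < K\<close>, and \<open>\<epsilon> * K = m - M\<close> is what brings
          the crude bound \<open>M\<close> down to \<open>m\<close>.\<close>
        define K where "K = (m - M) / \<epsilon>"
        have c0: "c \<noteq> 0" using half[OF x] by auto
        define d where "d = R * exp K / norm c"
        have d: "d > 0" using R(1) c0 by (simp add: d_def)
        have "Re (G \<xi> + of_real \<epsilon> * L \<xi>) < m + e" if "\<xi> \<in> S" "dist \<xi> w < d" for \<xi>
        proof -
          have "norm c * norm (\<xi> - w) < R * exp K" using that(2) c0 by (simp add: d_def dist_norm pos_less_divide_eq mult.commute)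
          then have "norm (c * (\<xi> - w)) / R < exp K" using R(1) by (simp only: norm_mult pos_divide_less_eq mult.commute)
          moreover have "norm (c * (\<xi> - w)) / R > 0" using half[OF that(1)] R(1) zero_less_norm_iff[of "c * (\<xi> - w)"] by (metis divide_pos_pos less_irrefl zero_complex.sel(1))
          ultimately have "Re (L \<xi>) < K" using ReL[OF that(1)] by (metis exp_less_cancel_iff exp_ln)
          then have "\<epsilon> * Re (L \<xi>) < m - M" using \<epsilon> by (simp add: K_def field_simps)
          then show ?thesis using M[OF that(1)] e by simp
        qed
        then show ?thesis using d True by (auto simp: eventually_at)
      qed
    qed
    then show ?thesis by simp
  qed
  show ?thesis
  proof (rule field_le_epsilon)
    fix e :: real assume e: "e > 0"
    have L0: "Re (L x) \<le> 0" using ReL0[OF x] .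
    \<comment> \<open>The choice \<open>\<epsilon> = e / (1 - Re (L x))\<close>: the denominator is
      at least 1, and \<open>- \<epsilon> * Re (L x)\<close> is at most \<open>e\<close>.\<close>
    have "Re (G x) \<le> m - (e / (1 - Re (L x))) * Re (L x)" using L0 e by (intro key) (auto intro: divide_pos_pos)
    also have "\<dots> \<le> m + e" using L0 e by (simp add: field_simps)
    finally show "Re (G x) \<le> m + e" .
  qed
qed

text \<open>The real part is a harmonic barrier for the box of half-width and height
  \<open>a\<close> over the real point \<open>s\<close>: nonnegative in the box, zero at
  \<open>s\<close>, and at least \<open>a\<^sup>2\<close> on the top and the vertical sides.
  Multiplied by \<open>M / a\<^sup>2\<close> it absorbs a bound \<open>M\<close> on these three
  sides.\<close>

definition square_barrier :: "real \<Rightarrow> real \<Rightarrow> complex \<Rightarrow> complex" where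
  "square_barrier a s \<zeta> = (\<zeta> - of_real s)\<^sup>2 - 2 * of_real a * \<i> * (\<zeta> - of_real s)"

lemma Re_square_barrier:
  "Re (square_barrier a s \<zeta>) = (Re \<zeta> - s)\<^sup>2 - (Im \<zeta>)\<^sup>2 + 2 * a * Im \<zeta>"
  by (simp add: square_barrier_def power2_eq_square algebra_simps)

lemma square_barrier_holomorphic [holomorphic_intros]: "square_barrier a s holomorphic_on S"
  unfolding square_barrier_def by (intro holomorphic_intros)

lemma square_barrier_continuous [continuous_intros]: "continuous_on S (square_barrier a s)"
  unfolding square_barrier_def by (intro continuous_intros)

lemma square_barrier_nonneg:
  assumes "0 \<le> Im \<zeta>" "Im \<zeta> \<le> a"
  shows "Re (square_barrier a s \<zeta>) \<ge> 0"
proof -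
  have "Im \<zeta> * (2 * a - Im \<zeta>) \<ge> 0" using assms by (intro mult_nonneg_nonneg) auto
  moreover have "Re (square_barrier a s \<zeta>) = (Re \<zeta> - s)\<^sup>2 + Im \<zeta> * (2 * a - Im \<zeta>)"
    by (simp add: Re_square_barrier power2_eq_square algebra_simps)
  ultimately show ?thesis by simp
qed

lemma square_barrier_side:
  assumes "0 \<le> Im \<zeta>" "Im \<zeta> \<le> a" "\<bar>Re \<zeta> - s\<bar> = a \<or> Im \<zeta> = a"
  shows "Re (square_barrier a s \<zeta>) \<ge> a\<^sup>2"
  using assms(3)
proof
  assume "\<bar>Re \<zeta> - s\<bar> = a"
  then have "(Re \<zeta> - s)\<^sup>2 = a\<^sup>2" by (metis power2_abs)
  moreover have "Im \<zeta> * (2 * a - Im \<zeta>) \<ge> 0" using assms by (intro mult_nonneg_nonneg) auto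
  moreover have "Re (square_barrier a s \<zeta>) = (Re \<zeta> - s)\<^sup>2 + Im \<zeta> * (2 * a - Im \<zeta>)"
    by (simp add: Re_square_barrier power2_eq_square algebra_simps)
  ultimately show ?thesis by simp
qed (simp add: Re_square_barrier power2_eq_square)

lemma square_barrier_tendsto:
  "((\<lambda>\<zeta>. Re (square_barrier a s \<zeta>)) \<longlongrightarrow> 0) (at (of_real s) within S)"
proof -
  have "((\<lambda>\<zeta>. Re (square_barrier a s \<zeta>)) \<longlongrightarrow> Re (square_barrier a s (of_real s))) (at (of_real s) within S)"
    unfolding square_barrier_def by (intro tendsto_intros)
  then show ?thesis by (simp add: square_barrier_def)
qed

section \<open>The upper half plane as a covering of the punctured disc\<close>

lemma exp_i_in_ball: "exp (\<i> * \<zeta>) \<in> ball 0 1 \<longleftrightarrow> Im \<zeta> > 0"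
  by (simp add: norm_exp_eq_Re)

lemma filterlim_exp_i:
  "filterlim (\<lambda>\<zeta>. exp (\<i> * \<zeta>)) (at (cis s) within ball 0 1) (at (of_real s) within {\<zeta>. Im \<zeta> > 0})"
  unfolding filterlim_at
proof
  have "((\<lambda>\<zeta>. exp (\<i> * \<zeta>)) \<longlongrightarrow> exp (\<i> * of_real s)) (at (of_real s) within {\<zeta>. Im \<zeta> > 0})"
    by (intro tendsto_intros)
  then show "((\<lambda>\<zeta>. exp (\<i> * \<zeta>)) \<longlongrightarrow> cis s) (at (of_real s) within {\<zeta>. Im \<zeta> > 0})"
    by (simp add: cis_conv_exp)
  have "exp (\<i> * \<zeta>) \<in> ball 0 1 \<and> exp (\<i> * \<zeta>) \<noteq> cis s" if "Im \<zeta> > 0" for \<zeta>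
    using that exp_i_in_ball[of \<zeta>] by (auto simp: norm_exp_eq_Re dest: arg_cong[of _ _ norm])
  then show "\<forall>\<^sub>F \<zeta> in at (of_real s) within {\<zeta>. Im \<zeta> > 0}. exp (\<i> * \<zeta>) \<in> ball 0 1 \<and> exp (\<i> * \<zeta>) \<noteq> cis s"
    by (auto simp: eventually_at_topological)
qed

lemma exp_i_holomorphic: "G holomorphic_on ball 0 1 \<Longrightarrow> (\<lambda>\<zeta>. G (exp (\<i> * \<zeta>))) holomorphic_on {\<zeta>. Im \<zeta> > 0}"
proof -
  assume G: "G holomorphic_on ball 0 1"
  have "G \<circ> (\<lambda>\<zeta>. exp (\<i> * \<zeta>)) holomorphic_on {\<zeta>. Im \<zeta> > 0}"
    by (rule holomorphic_on_compose_gen[OF _ G]) (auto intro!: holomorphic_intros simp: norm_exp_eq_Re)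
  then show ?thesis by (simp add: o_def)
qed

text \<open>With infinite boundary values along an interval, \<open>Re G\<close> plus
  \<open>N / a\<^sup>2\<close> times the barrier is at least \<open>m + N\<close> on the whole
  frontier of a box, hence inside. At \<open>p\<close> the barrier is worth only three quarters of
  \<open>a\<^sup>2\<close>, so \<open>Re (G p)\<close> is at least \<open>m + N / 4\<close> for
  every positive \<open>N\<close>.\<close>

lemma no_infinite_boundary_interval:
  assumes G: "G holomorphic_on {\<zeta>. Im \<zeta> > 0}" and a: "a > 0"
    and lim: "\<And>s. \<bar>s - s0\<bar> \<le> a \<Longrightarrow> filterlim (\<lambda>\<zeta>. Re (G \<zeta>)) at_top (at (of_real s) within {\<zeta>. Im \<zeta> > 0})"
  shows False
proof -
  \<comment> \<open>Pointwise limits become uniform: bad points with heights tending to 0 would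
    accumulate at a real point of the closed interval, against the limit there.\<close>
  have near: "\<exists>\<eta>>0. \<forall>\<zeta>. \<bar>Re \<zeta> - s0\<bar> \<le> a \<longrightarrow> 0 < Im \<zeta> \<longrightarrow> Im \<zeta> \<le> \<eta> \<longrightarrow> N \<le> Re (G \<zeta>)" for N
  proof (rule ccontr)
    assume neg: "\<not> ?thesis"
    have "\<exists>\<zeta>. \<bar>Re \<zeta> - s0\<bar> \<le> a \<and> 0 < Im \<zeta> \<and> Im \<zeta> \<le> 1 / Suc n \<and> Re (G \<zeta>) < N" for n
    proof (rule ccontr)
      assume n: "\<not> ?thesis"
      have "\<forall>\<zeta>. \<bar>Re \<zeta> - s0\<bar> \<le> a \<longrightarrow> 0 < Im \<zeta> \<longrightarrow> Im \<zeta> \<le> 1 / Suc n \<longrightarrow> N \<le> Re (G \<zeta>)"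
        using n by (meson not_le)
      moreover have "0 < 1 / real (Suc n)" by simp
      ultimately show False using neg by blast
    qed
    then obtain z where z: "\<And>n. \<bar>Re (z n) - s0\<bar> \<le> a" "\<And>n. 0 < Im (z n)" "\<And>n. Im (z n) \<le> 1 / Suc n" "\<And>n. Re (G (z n)) < N"
      by metis
    have "z n \<in> cbox (Complex (s0 - a) 0) (Complex (s0 + a) 1)" for n
    proof -
      have "Im (z n) \<le> 1" using z(3)[of n] by (rule order_trans) simp
      then show ?thesis using z(1,2)[of n] by (auto simp: in_cbox_complex_iff abs_le_iff)
    qed
    then obtain l r where l: "l \<in> cbox (Complex (s0 - a) 0) (Complex (s0 + a) 1)" "strict_mono r" "(z \<circ> r) \<longlonglongrightarrow> l"
      using compact_cbox[of "Complex (s0 - a) 0" "Complex (s0 + a) 1"] unfolding compact_def by meson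
    have "(\<lambda>n. Im ((z \<circ> r) n)) \<longlonglongrightarrow> 0"
    proof (rule tendsto_sandwich[OF _ _ tendsto_const])
      show "\<forall>\<^sub>F n in sequentially. Im ((z \<circ> r) n) \<le> 1 / Suc (r n)" using z(3) by simp
      show "\<forall>\<^sub>F n in sequentially. 0 \<le> Im ((z \<circ> r) n)" using z(2) by (simp add: less_imp_le)
      show "(\<lambda>n. 1 / Suc (r n)) \<longlonglongrightarrow> 0"
        using LIMSEQ_subseq_LIMSEQ[OF LIMSEQ_inverse_real_of_nat l(2)] by (simp add: o_def inverse_eq_divide)
    qed
    then have "Im l = 0" using tendsto_Im[OF l(3)] LIMSEQ_unique by blast
    then have lr: "l = of_real (Re l)" by (simp add: complex_eq_iff)
    have "\<bar>Re l - s0\<bar> \<le> a" using l(1) by (auto simp: in_cbox_complex_iff)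
    from lim[OF this] have "\<forall>\<^sub>F \<zeta> in at l within {\<zeta>. Im \<zeta> > 0}. N \<le> Re (G \<zeta>)"
      using lr by (simp add: filterlim_at_top)
    moreover have "filterlim (z \<circ> r) (at l within {\<zeta>. Im \<zeta> > 0}) sequentially"
    proof -
      have "(z \<circ> r) n \<noteq> l" for n using z(2)[of "r n"] \<open>Im l = 0\<close> by auto
      then show ?thesis using l(3) z(2) by (simp add: filterlim_at)
    qed
    ultimately have "\<forall>\<^sub>F n in sequentially. N \<le> Re (G ((z \<circ> r) n))"
      by (rule eventually_compose_filterlim)
    then obtain n where "N \<le> Re (G ((z \<circ> r) n))" by (auto simp: eventually_sequentially)
    then show False using z(4)[of "r n"] by simp
  qed
  have contG: "continuous_on {\<zeta>. Im \<zeta> > 0} G" using G holomorphic_on_imp_continuous_on by blast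
  obtain \<eta>0 where e0: "\<eta>0 > 0" "\<And>\<zeta>. \<bar>Re \<zeta> - s0\<bar> \<le> a \<Longrightarrow> 0 < Im \<zeta> \<Longrightarrow> Im \<zeta> \<le> \<eta>0 \<Longrightarrow> 0 \<le> Re (G \<zeta>)"
    using near[of 0] by blast
  obtain m where m: "\<And>\<zeta>. \<bar>Re \<zeta> - s0\<bar> \<le> a \<Longrightarrow> 0 < Im \<zeta> \<Longrightarrow> Im \<zeta> \<le> a \<Longrightarrow> m \<le> Re (G \<zeta>)"
  proof -
    let ?K = "cbox (Complex (s0 - a) \<eta>0) (Complex (s0 + a) a)"
    have "compact ((\<lambda>\<zeta>. Re (G \<zeta>)) ` ?K)"
      using e0(1) by (intro compact_continuous_image continuous_intros continuous_on_subset[OF contG]) (auto simp: in_cbox_complex_iff)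
    then have "bounded ((\<lambda>\<zeta>. Re (G \<zeta>)) ` ?K)" by (rule compact_imp_bounded)
    then obtain B where "\<forall>x\<in>(\<lambda>\<zeta>. Re (G \<zeta>)) ` ?K. norm x \<le> B" unfolding bounded_iff by blast
    then have B: "\<bar>Re (G \<zeta>)\<bar> \<le> B" if "\<zeta> \<in> ?K" for \<zeta> using that by simp
    have "- \<bar>B\<bar> \<le> Re (G \<zeta>)" if "\<bar>Re \<zeta> - s0\<bar> \<le> a" "0 < Im \<zeta>" "Im \<zeta> \<le> a" for \<zeta>
    proof (cases "Im \<zeta> \<le> \<eta>0")
      case True then show ?thesis using e0(2)[of \<zeta>] that by linarith
    next
      case False
      then have "\<zeta> \<in> ?K" using that by (auto simp: in_cbox_complex_iff abs_le_iff)
      from B[OF this] show ?thesis by linarith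
    qed
    then show ?thesis using that by blast
  qed
  define p where "p = Complex s0 (a/2)"
  have lower: "m + N / 4 \<le> Re (G p)" if N: "N > 0" for N
  proof -
    obtain \<eta> where e: "\<eta> > 0" "\<And>\<zeta>. \<bar>Re \<zeta> - s0\<bar> \<le> a \<Longrightarrow> 0 < Im \<zeta> \<Longrightarrow> Im \<zeta> \<le> \<eta> \<Longrightarrow> m + N \<le> Re (G \<zeta>)"
      using near[of "m + N"] by blast
    define \<mu> where "\<mu> = min \<eta> (a/4)"
    have mu: "0 < \<mu>" "\<mu> \<le> \<eta>" "\<mu> < a/2" using e a by (auto simp: \<mu>_def)
    let ?S = "box (Complex (s0 - a) \<mu>) (Complex (s0 + a) a)"
    have clS: "closure ?S \<subseteq> cbox (Complex (s0 - a) \<mu>) (Complex (s0 + a) a)"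
      by (rule closure_minimal[OF box_subset_cbox closed_cbox])
    have le: "Re (- G p - of_real (N / a\<^sup>2) * square_barrier a s0 p) \<le> - m - N"
    proof (rule maximum_real_frontier[of "\<lambda>\<zeta>. - G \<zeta> - of_real (N / a\<^sup>2) * square_barrier a s0 \<zeta>" ?S])
      show "(\<lambda>\<zeta>. - G \<zeta> - of_real (N / a\<^sup>2) * square_barrier a s0 \<zeta>) holomorphic_on interior ?S"
        unfolding interior_open[OF open_box] using mu
        by (intro holomorphic_intros holomorphic_on_subset[OF G]) (auto simp: in_box_complex_iff)
      show "continuous_on (closure ?S) (\<lambda>\<zeta>. - G \<zeta> - of_real (N / a\<^sup>2) * square_barrier a s0 \<zeta>)"
        using mu clS by (intro continuous_intros continuous_on_subset[OF contG]) (auto simp: in_cbox_complex_iff)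
      show "bounded ?S" by simp
      show "p \<in> ?S" using a mu by (simp add: p_def in_box_complex_iff)
      fix \<zeta> assume z: "\<zeta> \<in> frontier ?S"
      then have z1: "\<zeta> \<in> cbox (Complex (s0 - a) \<mu>) (Complex (s0 + a) a)" "\<zeta> \<notin> ?S"
        using clS unfolding frontier_def interior_open[OF open_box] by auto
      have zb: "\<bar>Re \<zeta> - s0\<bar> \<le> a" "\<mu> \<le> Im \<zeta>" "Im \<zeta> \<le> a" using z1 by (auto simp: in_cbox_complex_iff)
      consider "\<bar>Re \<zeta> - s0\<bar> = a \<or> Im \<zeta> = a" | "Im \<zeta> = \<mu>"
      proof -
        have "\<not> (\<bar>Re \<zeta> - s0\<bar> < a \<and> \<mu> < Im \<zeta> \<and> Im \<zeta> < a)"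
          using z1(2) by (auto simp: in_box_complex_iff abs_less_iff)
        then show thesis using zb that by argo
      qed
      then have "m + N \<le> Re (G \<zeta>) + N / a\<^sup>2 * Re (square_barrier a s0 \<zeta>)"
      proof cases
        case 1
        have "a\<^sup>2 \<le> Re (square_barrier a s0 \<zeta>)" using 1 zb mu by (intro square_barrier_side) auto
        then have "N / a\<^sup>2 * a\<^sup>2 \<le> N / a\<^sup>2 * Re (square_barrier a s0 \<zeta>)" using N by (intro mult_left_mono) auto
        then show ?thesis using m[of \<zeta>] zb mu a by simp
      next
        case 2
        have "N / a\<^sup>2 * Re (square_barrier a s0 \<zeta>) \<ge> 0" using N zb mu by (intro mult_nonneg_nonneg square_barrier_nonneg) auto
        then show ?thesis using e(2)[of \<zeta>] 2 zb mu by simp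
      qed
      then show "Re (- G \<zeta> - of_real (N / a\<^sup>2) * square_barrier a s0 \<zeta>) \<le> - m - N"
        by (simp add: Re_divide_of_real)
    qed
    have "Re (square_barrier a s0 p) = 3/4 * a\<^sup>2"
      by (simp add: p_def Re_square_barrier power2_eq_square)
    then have "Re (of_real (N / a\<^sup>2) * square_barrier a s0 p) = 3/4 * N"
      using a by (simp only: Re_complex_of_real Im_complex_of_real times_complex.sel) simp
    with le show ?thesis by (simp only: minus_complex.sel uminus_complex.sel)
  qed
  \<comment> \<open>An \<open>N\<close> exceeding \<open>4 * (Re (G p) - m)\<close> contradicts
    \<open>lower\<close>; the entry 1 keeps it positive.\<close>
  have "max 1 (4 * (Re (G p) - m + 1)) \<le> 4 * (Re (G p) - m)"
  proof -
    have "max 1 (4 * (Re (G p) - m + 1)) > 0" by (simp add: less_max_iff_disj)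
    from lower[OF this] show ?thesis by argo
  qed
  then show False by simp
qed

lemma no_infinite_boundary_arc:
  assumes G: "G holomorphic_on ball 0 1" and ab: "\<alpha> < \<beta>"
    and lim: "\<And>s. \<alpha> < s \<Longrightarrow> s < \<beta> \<Longrightarrow> filterlim (\<lambda>w. Re (G w)) at_top (at (cis s) within ball 0 1)"
  shows False
\<comment> \<open>The middle two thirds of the arc: a closed interval is wanted, all of whose points
  are strictly between \<alpha> and \<beta>.\<close>
proof (rule no_infinite_boundary_interval[OF exp_i_holomorphic[OF G], of "(\<beta> - \<alpha>) / 3" "(\<alpha> + \<beta>) / 2"])
  fix s assume "\<bar>s - (\<alpha> + \<beta>) / 2\<bar> \<le> (\<beta> - \<alpha>) / 3"
  from abs_le_D1[OF this] abs_le_D2[OF this] have "\<alpha> < s" "s < \<beta>" using ab by (simp_all add: field_simps)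
  from filterlim_compose[OF lim[OF this] filterlim_exp_i]
  show "filterlim (\<lambda>\<zeta>. Re (G (exp (\<i> * \<zeta>)))) at_top (at (of_real s) within {\<zeta>. Im \<zeta> > 0})" .
qed (use ab in simp)

section \<open>Koebe's lemma\<close>

text \<open>The crossing theorem \<open>fashoda\<close> is stated for \<open>real^2\<close>;
  \<open>T\<close> transports it to the complex plane. It is the topological fact behind Koebe's
  lemma.\<close>

lemma fashoda_complex:
  fixes f g :: "real \<Rightarrow> complex"
  assumes "path f" "path g" "path_image f \<subseteq> cbox a b" "path_image g \<subseteq> cbox a b"
    "Re (pathstart f) = Re a" "Re (pathfinish f) = Re b"
    "Im (pathstart g) = Im a" "Im (pathfinish g) = Im b"
  obtains z where "z \<in> path_image f" "z \<in> path_image g"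
proof -
  define T :: "complex \<Rightarrow> real^2" where "T = (\<lambda>z. \<chi> i. if i = 1 then Re z else Im z)"
  have T1: "T z $ 1 = Re z" and T2: "T z $ 2 = Im z" for z by (auto simp: T_def)
  have injT: "z = w" if "T z = T w" for z w
    using that T1[of z] T1[of w] T2[of z] T2[of w] by (simp add: complex_eq_iff)
  have cont: "continuous_on S T" for S
  proof -
    have "continuous_on S (\<lambda>z. if i = 1 then Re z else Im z)" for i :: 2
      by (cases "i = 1") (auto intro!: continuous_intros)
    then show ?thesis unfolding T_def by (rule continuous_on_vec_lambda)
  qed
  have box: "T z \<in> cbox (T a) (T b)" if "z \<in> cbox a b" for z
    using that by (auto simp: mem_box_cart forall_2 T1 T2 in_cbox_complex_iff)
  have "path (T \<circ> f)" "path (T \<circ> g)" using assms(1,2) cont by (auto intro!: path_continuous_image)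
  moreover have "path_image (T \<circ> f) \<subseteq> cbox (T a) (T b)" "path_image (T \<circ> g) \<subseteq> cbox (T a) (T b)"
    using assms(3,4) box by (auto simp: path_image_compose)
  moreover have "pathstart (T \<circ> f) $ 1 = T a $ 1" "pathfinish (T \<circ> f) $ 1 = T b $ 1"
    "pathstart (T \<circ> g) $ 2 = T a $ 2" "pathfinish (T \<circ> g) $ 2 = T b $ 2"
    using assms(5-8) by (auto simp: pathstart_compose pathfinish_compose T1 T2)
  ultimately obtain y where y: "y \<in> path_image (T \<circ> f)" "y \<in> path_image (T \<circ> g)"
    by (rule fashoda)
  from y obtain u v where "u \<in> path_image f" "v \<in> path_image g" "T u = y" "T v = y"
    by (auto simp: path_image_compose)
  then show ?thesis using that injT by metis
qed

text \<open>A path crossing a square from left to right shields the part above it from the lower side.\<close>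

lemma bound_above_crossing_path:
  assumes G: "G holomorphic_on {\<zeta>. Im \<zeta> > 0}" and a: "a > 0"
    and \<sigma>: "path \<sigma>" "\<And>\<zeta>. \<zeta> \<in> path_image \<sigma> \<Longrightarrow> \<bar>Re \<zeta> - s\<bar> \<le> a \<and> 0 < Im \<zeta> \<and> Im \<zeta> \<le> \<delta>"
      "Re (pathstart \<sigma>) = s - a" "Re (pathfinish \<sigma>) = s + a"
    and M: "M \<ge> 0" "\<And>\<zeta>. Im \<zeta> > 0 \<Longrightarrow> Re (G \<zeta>) \<le> M"
    and \<epsilon>: "\<epsilon> \<ge> 0" "\<And>\<zeta>. \<zeta> \<in> path_image \<sigma> \<Longrightarrow> Re (G \<zeta>) \<le> \<epsilon>"
    and z: "\<bar>Re z - s\<bar> < a" "\<delta> < Im z" "Im z < a"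
  shows "Re (G z) \<le> \<epsilon> + M / a\<^sup>2 * Re (square_barrier a s z)"
proof -
  have \<delta>: "\<delta> > 0" using \<sigma>(2)[OF pathstart_in_path_image] by linarith
  have cps: "compact (path_image \<sigma>)" using \<sigma>(1) by (rule compact_path_image)
  obtain \<eta> where \<eta>: "\<eta> > 0" "\<And>\<zeta>. \<zeta> \<in> path_image \<sigma> \<Longrightarrow> \<eta> \<le> Im \<zeta>"
  proof -
    obtain y where "y \<in> path_image \<sigma>" "\<And>\<zeta>. \<zeta> \<in> path_image \<sigma> \<Longrightarrow> Im y \<le> Im \<zeta>"
      using continuous_attains_inf[OF cps path_image_nonempty continuous_on_Im[OF continuous_on_id]] by auto
    then show ?thesis using that[of "Im y"] \<sigma>(2) by blast
  qed
  define Q where "Q = box (Complex (s - a) 0) (Complex (s + a) a)"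
  \<comment> \<open>\<open>U\<close> is the part of the box that can be reached from
    \<open>z\<close> without touching \<sigma>. It never sinks below the lowest point of \<sigma>,
    so its closure keeps off the real axis, where nothing is known about \<open>G\<close>.\<close>
  define U where "U = connected_component_set (Q - path_image \<sigma>) z"
  have opQ: "open (Q - path_image \<sigma>)" using cps by (auto simp: Q_def intro: open_Diff compact_imp_closed)
  have zQ: "z \<in> Q - path_image \<sigma>" using z \<delta> \<sigma>(2)[of z] by (auto simp: Q_def in_box_complex_iff)
  have opU: "open U" unfolding U_def by (rule open_connected_component[OF opQ])
  have UQ: "U \<subseteq> Q - path_image \<sigma>" unfolding U_def by (rule connected_component_subset)
  have zU: "z \<in> U" unfolding U_def using zQ by (simp add: connected_component_refl_eq)
  have high: "\<eta> \<le> Im \<zeta>" if "\<zeta> \<in> U" for \<zeta>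
  proof (rule ccontr)
    assume low: "\<not> \<eta> \<le> Im \<zeta>"
    have "path_connected U" using opU by (simp add: U_def connected_open_path_connected)
    then obtain g where g: "path g" "path_image g \<subseteq> U" "pathstart g = \<zeta>" "pathfinish g = z"
      using \<open>\<zeta> \<in> U\<close> zU unfolding path_connected_def by blast
    obtain y where y: "y \<in> path_image g" "\<And>x. x \<in> path_image g \<Longrightarrow> Im y \<le> Im x"
      using continuous_attains_inf[OF compact_path_image[OF g(1)] path_image_nonempty continuous_on_Im[OF continuous_on_id]] by auto
    \<comment> \<open>The level \<mu> is below both \<sigma> and the path \<open>g\<close>. Hence
      \<sigma>, and \<open>g\<close> prolonged vertically down to \<mu> and up to \<open>a\<close>,
      are opposite crossings of one box.\<close>
    define \<mu> where "\<mu> = min \<eta> (Im y) / 2"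
    have "Im y > 0" using y(1) g(2) UQ by (auto simp: Q_def in_box_complex_iff)
    then have mu: "0 < \<mu>" "\<mu> < \<eta>" "\<mu> < Im y" using \<eta>(1) by (auto simp: \<mu>_def min_def)
    define bot where "bot = Complex (Re \<zeta>) \<mu>"
    define top where "top = Complex (Re z) a"
    define k where "k = linepath bot \<zeta> +++ g +++ linepath z top"
    have zbox: "\<bar>Re \<zeta> - s\<bar> < a" "Im \<zeta> < a" using that UQ by (auto simp: Q_def in_box_complex_iff abs_less_iff)
    have imk: "path_image k = closed_segment bot \<zeta> \<union> path_image g \<union> closed_segment z top"
      using g by (auto simp: k_def path_image_join)
    have imz: "\<mu> < Im \<zeta>" using y(2)[of \<zeta>] g(3) mu by (metis less_le_trans pathstart_in_path_image)
    have seg1: "Re x = Re \<zeta> \<and> \<mu> \<le> Im x \<and> Im x \<le> Im \<zeta>" if "x \<in> closed_segment bot \<zeta>" for x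
    proof -
      obtain u where u: "0 \<le> u" "u \<le> 1" "x = (1 - u) *\<^sub>R bot + u *\<^sub>R \<zeta>"
        using \<open>x \<in> closed_segment bot \<zeta>\<close> by (auto simp: closed_segment_def)
      have "0 \<le> u * (Im \<zeta> - Im bot)" "0 \<le> (1 - u) * (Im \<zeta> - Im bot)"
        using u imz by (auto simp: bot_def intro!: mult_nonneg_nonneg)
      then show ?thesis by (auto simp: u(3) bot_def algebra_simps)
    qed
    have seg2: "Re x = Re z \<and> Im z \<le> Im x \<and> Im x \<le> a" if "x \<in> closed_segment z top" for x
    proof -
      obtain u where u: "0 \<le> u" "u \<le> 1" "x = (1 - u) *\<^sub>R z + u *\<^sub>R top"
        using \<open>x \<in> closed_segment z top\<close> by (auto simp: closed_segment_def)
      have "0 \<le> u * (Im top - Im z)" "0 \<le> (1 - u) * (Im top - Im z)"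
        using u z by (auto simp: top_def intro!: mult_nonneg_nonneg)
      then show ?thesis by (auto simp: u(3) top_def algebra_simps)
    qed
    have "path k" using g by (simp add: k_def)
    obtain x where x: "x \<in> path_image \<sigma>" "x \<in> path_image k"
    proof (rule fashoda_complex[OF \<sigma>(1) \<open>path k\<close>, of "Complex (s - a) \<mu>" "Complex (s + a) a"])
      show "path_image \<sigma> \<subseteq> cbox (Complex (s - a) \<mu>) (Complex (s + a) a)"
      proof
        fix x assume "x \<in> path_image \<sigma>"
        then show "x \<in> cbox (Complex (s - a) \<mu>) (Complex (s + a) a)"
          using \<sigma>(2)[of x] \<eta>(2)[of x] mu z by (auto simp: in_cbox_complex_iff abs_le_iff)
      qed
      show "path_image k \<subseteq> cbox (Complex (s - a) \<mu>) (Complex (s + a) a)"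
      proof
        fix x assume "x \<in> path_image k"
        then consider "x \<in> closed_segment bot \<zeta>" | "x \<in> path_image g" | "x \<in> closed_segment z top" using imk by blast
        then show "x \<in> cbox (Complex (s - a) \<mu>) (Complex (s + a) a)"
        proof cases
          case 1 then show ?thesis using seg1[of x] zbox by (auto simp: in_cbox_complex_iff abs_less_iff)
        next
          case 2 then show ?thesis using y(2)[of x] g(2) UQ mu by (auto simp: in_cbox_complex_iff Q_def in_box_complex_iff less_imp_le)
        next
          case 3 then show ?thesis using seg2[of x] z imz mu imk \<sigma> \<delta> y(2)[of z] g(4)
            by (auto simp: in_cbox_complex_iff abs_less_iff) (metis g(4) less_imp_le less_le_trans order_trans pathfinish_in_path_image)
        qed
      qed
    qed (use \<sigma> g in \<open>auto simp: k_def bot_def top_def\<close>)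
    then consider "x \<in> closed_segment bot \<zeta>" | "x \<in> path_image g" | "x \<in> closed_segment z top" using imk by blast
    then show False
    proof cases
      case 1 then show ?thesis using seg1[of x] \<eta>(2)[OF x(1)] low by auto
    next
      case 2 then show ?thesis using g(2) UQ x(1) by auto
    next
      case 3 then show ?thesis using seg2[of x] \<sigma>(2)[OF x(1)] z by auto
    qed
  qed
  have clU: "\<bar>Re \<zeta> - s\<bar> \<le> a \<and> \<eta> \<le> Im \<zeta> \<and> Im \<zeta> \<le> a" if "\<zeta> \<in> closure U" for \<zeta>
  proof -
    have "U \<subseteq> cbox (Complex (s - a) \<eta>) (Complex (s + a) a)"
      using UQ high by (auto simp: Q_def in_box_complex_iff in_cbox_complex_iff intro: less_imp_le)
    then have "closure U \<subseteq> cbox (Complex (s - a) \<eta>) (Complex (s + a) a)" by (rule closure_minimal[OF _ closed_cbox])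
    then show ?thesis using that by (auto simp: in_cbox_complex_iff abs_le_iff dest!: subsetD)
  qed
  have contG: "continuous_on {\<zeta>. Im \<zeta> > 0} G" using G holomorphic_on_imp_continuous_on by blast
  have "Re (G z - of_real (M / a\<^sup>2) * square_barrier a s z) \<le> \<epsilon>"
  proof (rule maximum_real_frontier[of "\<lambda>\<zeta>. G \<zeta> - of_real (M / a\<^sup>2) * square_barrier a s \<zeta>" U])
    show "(\<lambda>\<zeta>. G \<zeta> - of_real (M / a\<^sup>2) * square_barrier a s \<zeta>) holomorphic_on interior U"
      using UQ by (intro holomorphic_intros holomorphic_on_subset[OF G]) (auto simp: Q_def in_box_complex_iff dest!: interior_subset[THEN subsetD])
    show "continuous_on (closure U) (\<lambda>\<zeta>. G \<zeta> - of_real (M / a\<^sup>2) * square_barrier a s \<zeta>)"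
      using clU \<eta>(1) by (intro continuous_intros continuous_on_subset[OF contG]) force
    show "bounded U" using UQ by (auto simp: Q_def intro: bounded_subset[OF bounded_box])
    show "z \<in> U" by fact
    fix \<zeta> assume f: "\<zeta> \<in> frontier U"
    have c: "\<bar>Re \<zeta> - s\<bar> \<le> a" "\<eta> \<le> Im \<zeta>" "Im \<zeta> \<le> a" using f clU by (auto simp: frontier_def)
    have bnn: "M / a\<^sup>2 * Re (square_barrier a s \<zeta>) \<ge> 0"
      using M(1) c \<eta>(1) by (intro mult_nonneg_nonneg square_barrier_nonneg) auto
    have "\<zeta> \<notin> U" using f opU by (simp add: frontier_def interior_open)
    \<comment> \<open>A frontier point of a component of an open set lies outside that set, since
      otherwise its own component would meet \<open>U\<close>. So it lies on \<sigma>, where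
      \<open>Re G\<close> is at most \<epsilon>, or on the top or the sides of the box, where the
      barrier absorbs \<open>M\<close>.\<close>
    have "\<zeta> \<notin> Q - path_image \<sigma>"
    proof
      assume h: "\<zeta> \<in> Q - path_image \<sigma>"
      have opc: "open (connected_component_set (Q - path_image \<sigma>) \<zeta>)" by (rule open_connected_component[OF opQ])
      have "\<zeta> \<in> connected_component_set (Q - path_image \<sigma>) \<zeta>" using h by (simp add: connected_component_refl_eq)
      moreover have "\<zeta> \<in> closure U" using f by (simp add: frontier_def)
      ultimately have "connected_component_set (Q - path_image \<sigma>) \<zeta> \<inter> U \<noteq> {}"
        using opc by (meson closure_iff_nhds_not_empty open_subset subset_refl disjoint_iff)
      then have "connected_component_set (Q - path_image \<sigma>) \<zeta> = U"
        unfolding U_def by (meson connected_component_nonoverlap)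
      then show False using \<open>\<zeta> \<notin> U\<close> \<open>\<zeta> \<in> connected_component_set _ _\<close> by blast
    qed
    then consider "\<zeta> \<in> path_image \<sigma>" | "\<bar>Re \<zeta> - s\<bar> = a \<or> Im \<zeta> = a"
    proof -
      assume th: "\<zeta> \<in> path_image \<sigma> \<Longrightarrow> thesis" "\<bar>Re \<zeta> - s\<bar> = a \<or> Im \<zeta> = a \<Longrightarrow> thesis"
      assume "\<zeta> \<notin> Q - path_image \<sigma>"
      then have "\<zeta> \<in> path_image \<sigma> \<or> \<not> (\<bar>Re \<zeta> - s\<bar> < a \<and> 0 < Im \<zeta> \<and> Im \<zeta> < a)"
        by (auto simp: Q_def in_box_complex_iff abs_less_iff)
      then show thesis using c \<eta>(1) th by argo
    qed
    then have "Re (G \<zeta>) - M / a\<^sup>2 * Re (square_barrier a s \<zeta>) \<le> \<epsilon>"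
    proof cases
      case 1 then show ?thesis using \<epsilon>(2)[of \<zeta>] bnn by linarith
    next
      case 2
      have "a\<^sup>2 \<le> Re (square_barrier a s \<zeta>)" using 2 c \<eta>(1) by (intro square_barrier_side) auto
      then have "M / a\<^sup>2 * a\<^sup>2 \<le> M / a\<^sup>2 * Re (square_barrier a s \<zeta>)" using M(1) by (intro mult_left_mono) auto
      then show ?thesis using M(2)[of \<zeta>] c \<eta>(1) a \<epsilon>(1) by simp
    qed
    then show "Re (G \<zeta> - of_real (M / a\<^sup>2) * square_barrier a s \<zeta>) \<le> \<epsilon>"
      by (simp add: Re_divide_of_real)
  qed
  then show ?thesis by (simp add: Re_divide_of_real)
qed

text \<open>\<open>u\<close> is the last time at level \<open>l\<close>, and \<open>v\<close> the
  first time after \<open>u\<close> at level \<open>r\<close>; leaving the interval in between would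
  create a later or an earlier such time, by the intermediate value theorem.\<close>

lemma crossing_interval:
  fixes g :: "real \<Rightarrow> real"
  assumes g: "continuous_on {0..1} g" and lr: "g 0 \<le> l" "l < r" "r \<le> g 1"
  obtains u v where "0 \<le> u" "u < v" "v \<le> 1" "g u = l" "g v = r" "\<And>t. u \<le> t \<Longrightarrow> t \<le> v \<Longrightarrow> l \<le> g t \<and> g t \<le> r"
proof -
  have K: "compact {t \<in> {a..1}. g t = c}" if "0 \<le> a" for a c
  proof -
    have "closed ({a..1} \<inter> g -` {c})"
      using that by (intro continuous_closed_preimage continuous_on_subset[OF g]) auto
    moreover have "{a..1} \<inter> g -` {c} = {t \<in> {a..1}. g t = c}" by auto
    ultimately have "closed {t \<in> {a..1}. g t = c}" by simp
    from closed_Int_compact[OF this compact_Icc[of a 1]]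
    show ?thesis by (rule back_subst[of compact]) auto
  qed
  have "\<exists>t\<ge>0. t \<le> 1 \<and> g t = l" using IVT'[of g 0 l 1] g lr by auto
  then have "{t \<in> {0..1}. g t = l} \<noteq> {}" by auto
  from compact_attains_sup[OF K[of 0 l] this] obtain u where
    u: "0 \<le> u" "u \<le> 1" "g u = l" "\<And>t. 0 \<le> t \<Longrightarrow> t \<le> 1 \<Longrightarrow> g t = l \<Longrightarrow> t \<le> u" by auto
  have "\<exists>t\<ge>u. t \<le> 1 \<and> g t = r" using IVT'[of g u r 1] u lr continuous_on_subset[OF g, of "{u..1}"] by auto
  then have "{t \<in> {u..1}. g t = r} \<noteq> {}" by auto
  from compact_attains_inf[OF K[of u r] this] u obtain v where
    v: "u \<le> v" "v \<le> 1" "g v = r" "\<And>t. u \<le> t \<Longrightarrow> t \<le> 1 \<Longrightarrow> g t = r \<Longrightarrow> v \<le> t" by auto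
  have uv: "u < v" using u v lr by (metis order.strict_iff_order less_irrefl)
  have "l \<le> g t \<and> g t \<le> r" if t: "u \<le> t" "t \<le> v" for t
  proof
    show "l \<le> g t"
    proof (rule ccontr)
      assume "\<not> l \<le> g t"
      then have "\<exists>x\<ge>t. x \<le> v \<and> g x = l"
        using IVT'[of g t l v] t u v lr continuous_on_subset[OF g, of "{t..v}"] by auto
      then obtain x where "t \<le> x" "x \<le> v" "g x = l" by auto
      with u(4)[of x] t u v have "x \<le> u" by auto
      then have "t = u" using \<open>t \<le> x\<close> t by linarith
      then show False using \<open>\<not> l \<le> g t\<close> u by auto
    qed
    show "g t \<le> r"
    proof (rule ccontr)
      assume "\<not> g t \<le> r"
      then have "\<exists>x\<ge>u. x \<le> t \<and> g x = r"
        using IVT'[of g u r t] t u v lr continuous_on_subset[OF g, of "{u..t}"] by auto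
      then obtain x where "u \<le> x" "x \<le> t" "g x = r" by auto
      with v(4)[of x] t v have "v \<le> x" by auto
      then have "t = v" using \<open>x \<le> t\<close> t by linarith
      then show False using \<open>\<not> g t \<le> r\<close> v by auto
    qed
  qed
  then show ?thesis using that u v uv by blast
qed

lemma crossing_subpath:
  fixes \<sigma> :: "real \<Rightarrow> complex"
  assumes \<sigma>: "path \<sigma>" "Re (pathstart \<sigma>) \<le> l" "l < r" "r \<le> Re (pathfinish \<sigma>)"
  obtains \<tau> where "path \<tau>" "path_image \<tau> \<subseteq> path_image \<sigma>" "Re (pathstart \<tau>) = l" "Re (pathfinish \<tau>) = r"
    "\<And>z. z \<in> path_image \<tau> \<Longrightarrow> l \<le> Re z \<and> Re z \<le> r"
proof -
  have "continuous_on {0..1} (\<lambda>t. Re (\<sigma> t))" using \<sigma>(1) unfolding path_def by (intro continuous_intros)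
  from crossing_interval[OF this _ \<sigma>(3)] \<sigma> obtain u v where uv: "0 \<le> u" "u < v" "v \<le> 1" "Re (\<sigma> u) = l" "Re (\<sigma> v) = r"
    "\<And>t. u \<le> t \<Longrightarrow> t \<le> v \<Longrightarrow> l \<le> Re (\<sigma> t) \<and> Re (\<sigma> t) \<le> r" unfolding pathstart_def pathfinish_def by metis
  show ?thesis
  proof (rule that[of "subpath u v \<sigma>"])
    show "path (subpath u v \<sigma>)" using \<sigma>(1) uv by simp
    show "path_image (subpath u v \<sigma>) \<subseteq> path_image \<sigma>" using \<sigma>(1) uv by (intro path_image_subpath_subset) auto
    show "Re (pathstart (subpath u v \<sigma>)) = l" "Re (pathfinish (subpath u v \<sigma>)) = r" using uv by simp_all
    show "l \<le> Re z \<and> Re z \<le> r" if "z \<in> path_image (subpath u v \<sigma>)" for z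
      using that uv by (auto simp: path_image_subpath)
  qed
qed

text \<open>For the ends of lifted paths: closeness on the circle determines the real part of a lift
  up to a multiple of \<open>2 * pi\<close>, and \<open>m\<close> records the sheet.\<close>

lemma exp_i_near_cis:
  assumes "\<epsilon> > 0"
  obtains \<delta> where "\<delta> > 0" "\<And>\<zeta>. dist (exp (\<i> * \<zeta>)) (cis \<alpha>) < \<delta> \<Longrightarrow> \<exists>m::int. \<bar>Re \<zeta> - \<alpha> - 2 * pi * m\<bar> < \<epsilon>"
proof -
  have "isCont Ln 1" by (simp add: continuous_at_Ln)
  then have "\<exists>d>0. \<forall>x. dist x 1 < d \<longrightarrow> dist (Ln x) (Ln 1) < \<epsilon>"
    using assms unfolding continuous_at_eps_delta by blast
  then obtain d where d: "d > 0" "\<And>x. dist x 1 < d \<Longrightarrow> norm (Ln x) < \<epsilon>" by (auto simp: dist_norm)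
  show ?thesis
  proof (rule that[of d])
    fix \<zeta> assume z: "dist (exp (\<i> * \<zeta>)) (cis \<alpha>) < d"
    define x where "x = exp (\<i> * \<zeta> - \<i> * of_real \<alpha>)"
    have "x - 1 = (exp (\<i> * \<zeta>) - cis \<alpha>) / cis \<alpha>" by (simp add: x_def exp_diff cis_conv_exp field_simps)
    then have "dist x 1 < d" using z by (simp add: dist_norm norm_divide)
    then have n: "norm (Ln x) < \<epsilon>" by (rule d(2))
    have "exp (Ln x) = exp (\<i> * \<zeta> - \<i> * of_real \<alpha>)" by (simp add: x_def)
    then obtain k :: int where "Ln x = \<i> * \<zeta> - \<i> * of_real \<alpha> + of_real (2 * k * pi) * \<i>"
      unfolding exp_eq by (auto simp: algebra_simps)
    then have "Im (Ln x) = Re \<zeta> - \<alpha> - 2 * pi * of_int (- k)" by simp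
    then show "\<exists>m::int. \<bar>Re \<zeta> - \<alpha> - 2 * pi * m\<bar> < \<epsilon>"
      using n abs_Im_le_cmod[of "Ln x"] by (metis le_less_trans)
  qed (fact d)
qed

text \<open>The local inverse of the covering at \<open>cis s\<close>; dividing by
  \<open>cis s\<close> moves the point to 1, away from the cut of \<open>Ln\<close>.\<close>

lemma filterlim_Ln_cis:
  "filterlim (\<lambda>w. of_real s - \<i> * Ln (w / cis s)) (at (of_real s) within {\<zeta>. Im \<zeta> > 0}) (at (cis s) within ball 0 1)"
  unfolding filterlim_at
proof
  have "((\<lambda>w. of_real s - \<i> * Ln (w / cis s)) \<longlongrightarrow> of_real s - \<i> * Ln (cis s / cis s)) (at (cis s) within ball 0 1)"
    by (intro tendsto_intros) auto
  then show "((\<lambda>w. of_real s - \<i> * Ln (w / cis s)) \<longlongrightarrow> of_real s) (at (cis s) within ball 0 1)" by simp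
  have pos: "0 < Im (of_real s - \<i> * Ln (w / cis s)) \<and> of_real s - \<i> * Ln (w / cis s) \<noteq> of_real s" if "w \<in> ball 0 1" "w \<noteq> 0" for w
  proof -
    have "Re (Ln (w / cis s)) < 0" using that by (subst Re_Ln) (auto simp: norm_divide)
    then have "0 < Im (of_real s - \<i> * Ln (w / cis s))" by simp
    then show ?thesis by auto
  qed
  have "\<forall>\<^sub>F w in at (cis s) within ball 0 1. w \<noteq> 0"
  proof -
    have "\<forall>\<^sub>F w in nhds (cis s). w \<in> - {0}" by (rule eventually_nhds_in_open) auto
    then show ?thesis by (auto simp: eventually_at_filter elim: eventually_mono)
  qed
  moreover have "\<forall>\<^sub>F w in at (cis s) within ball 0 1. w \<in> ball (0::complex) 1"
    by (auto simp: eventually_at_topological)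
  ultimately have "\<forall>\<^sub>F w in at (cis s) within ball 0 1. w \<noteq> 0 \<and> w \<in> ball 0 1" by (rule eventually_conj)
  then show "\<forall>\<^sub>F w in at (cis s) within ball 0 1. of_real s - \<i> * Ln (w / cis s) \<in> {\<zeta>. Im \<zeta> > 0} \<and> of_real s - \<i> * Ln (w / cis s) \<noteq> of_real s"
    by (rule eventually_mono) (use pos in blast)
qed

lemma exp_i_Ln_cis: "w \<noteq> 0 \<Longrightarrow> exp (\<i> * (of_real s - \<i> * Ln (w / cis s))) = w"
  by (simp add: ring_distribs exp_add exp_diff cis_conv_exp[symmetric])

lemma tendsto_at_cis_iff:
  "(f \<longlongrightarrow> l) (at (cis s) within ball 0 1) \<longleftrightarrow> ((\<lambda>\<zeta>. f (exp (\<i> * \<zeta>))) \<longlongrightarrow> l) (at (of_real s) within {\<zeta>. Im \<zeta> > 0})"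
proof
  assume "(f \<longlongrightarrow> l) (at (cis s) within ball 0 1)"
  from filterlim_compose[OF this filterlim_exp_i] show "((\<lambda>\<zeta>. f (exp (\<i> * \<zeta>))) \<longlongrightarrow> l) (at (of_real s) within {\<zeta>. Im \<zeta> > 0})" .
next
  assume "((\<lambda>\<zeta>. f (exp (\<i> * \<zeta>))) \<longlongrightarrow> l) (at (of_real s) within {\<zeta>. Im \<zeta> > 0})"
  from filterlim_compose[OF this filterlim_Ln_cis]
  have *: "((\<lambda>w. f (exp (\<i> * (of_real s - \<i> * Ln (w / cis s))))) \<longlongrightarrow> l) (at (cis s) within ball 0 1)" .
  have "\<forall>\<^sub>F w in nhds (cis s). w \<in> - {0}" by (rule eventually_nhds_in_open) auto
  then have "\<forall>\<^sub>F w in at (cis s) within ball 0 1. w \<noteq> 0" by (auto simp: eventually_at_filter elim: eventually_mono)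
  then have "\<forall>\<^sub>F w in at (cis s) within ball 0 1. f (exp (\<i> * (of_real s - \<i> * Ln (w / cis s)))) = f w"
    by (rule eventually_mono) (subst exp_i_Ln_cis, auto)
  from tendsto_cong[OF this] * show "(f \<longlongrightarrow> l) (at (cis s) within ball 0 1)" by simp
qed

text \<open>For fixed \<open>z\<close>, a crossing path below \<open>z\<close> on which
  \<open>Re G\<close> is small bounds \<open>Re G\<close> and its negative at \<open>z\<close> by
  the barrier plus an error. Paths closer and closer to the real axis remove the error and leave the
  barrier, which vanishes at \<open>s\<close>.\<close>

lemma tendsto_zero_of_crossing_paths:
  assumes G: "G holomorphic_on {\<zeta>. Im \<zeta> > 0}" and M: "\<And>\<zeta>. Im \<zeta> > 0 \<Longrightarrow> \<bar>Re (G \<zeta>)\<bar> \<le> M"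
    and a: "a > 0"
    and paths: "\<And>e. e > 0 \<Longrightarrow> \<exists>\<sigma>. path \<sigma> \<and> (\<forall>\<zeta>\<in>path_image \<sigma>. 0 < Im \<zeta> \<and> Im \<zeta> < e \<and> \<bar>Re (G \<zeta>)\<bar> \<le> e) \<and>
        Re (pathstart \<sigma>) \<le> s - a \<and> s + a \<le> Re (pathfinish \<sigma>)"
  shows "((\<lambda>\<zeta>. Re (G \<zeta>)) \<longlongrightarrow> 0) (at (of_real s) within {\<zeta>. Im \<zeta> > 0})"
proof -
  have M0: "M \<ge> 0" using M[of \<i>] by simp
  have bound: "\<bar>Re (G z)\<bar> \<le> M / a\<^sup>2 * Re (square_barrier a s z)"
    if z: "\<bar>Re z - s\<bar> < a" "0 < Im z" "Im z < a" for z
  proof (rule field_le_epsilon)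
    fix e :: real assume e: "e > 0"
    \<comment> \<open>Half the height of \<open>z\<close> forces the path to pass below
      \<open>z\<close>.\<close>
    define e' where "e' = min e (Im z / 2)"
    have e': "0 < e'" "e' \<le> e" "e' < Im z" using e z by (auto simp: e'_def)
    from paths[OF e'(1)] obtain \<sigma> where \<sigma>: "path \<sigma>"
      "\<And>\<zeta>. \<zeta> \<in> path_image \<sigma> \<Longrightarrow> 0 < Im \<zeta> \<and> Im \<zeta> < e' \<and> \<bar>Re (G \<zeta>)\<bar> \<le> e'"
      "Re (pathstart \<sigma>) \<le> s - a" "s + a \<le> Re (pathfinish \<sigma>)" by blast
    from crossing_subpath[OF \<sigma>(1,3) _ \<sigma>(4)] a obtain \<tau> where \<tau>: "path \<tau>" "path_image \<tau> \<subseteq> path_image \<sigma>"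
      "Re (pathstart \<tau>) = s - a" "Re (pathfinish \<tau>) = s + a"
      "\<And>z. z \<in> path_image \<tau> \<Longrightarrow> s - a \<le> Re z \<and> Re z \<le> s + a" by auto
    have im: "\<bar>Re \<zeta> - s\<bar> \<le> a \<and> 0 < Im \<zeta> \<and> Im \<zeta> \<le> e'" if "\<zeta> \<in> path_image \<tau>" for \<zeta>
      using \<sigma>(2)[of \<zeta>] \<tau>(2) \<tau>(5)[OF that] that by (auto simp: abs_le_iff)
    have small: "\<bar>Re (G \<zeta>)\<bar> \<le> e'" if "\<zeta> \<in> path_image \<tau>" for \<zeta> using \<sigma>(2)[of \<zeta>] \<tau>(2) that by auto
    have "Re (G z) \<le> e' + M / a\<^sup>2 * Re (square_barrier a s z)"
      by (rule bound_above_crossing_path[OF G a \<tau>(1) im \<tau>(3,4) M0 _ _ _ z(1) e'(3) z(3)])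
         (use M small e' in \<open>auto simp: abs_le_iff\<close>)
    moreover have "Re ((\<lambda>\<zeta>. - G \<zeta>) z) \<le> e' + M / a\<^sup>2 * Re (square_barrier a s z)"
      by (rule bound_above_crossing_path[OF holomorphic_on_minus[OF G] a \<tau>(1) im \<tau>(3,4) M0 _ _ _ z(1) e'(3) z(3)])
         (use M small e' in \<open>auto simp: abs_le_iff\<close>)
    ultimately show "\<bar>Re (G z)\<bar> \<le> M / a\<^sup>2 * Re (square_barrier a s z) + e" using e'(2) by (simp add: abs_le_iff)
  qed
  show ?thesis
  proof (rule Lim_null_comparison)
    show "\<forall>\<^sub>F \<zeta> in at (of_real s) within {\<zeta>. Im \<zeta> > 0}. norm (Re (G \<zeta>)) \<le> M / a\<^sup>2 * Re (square_barrier a s \<zeta>)"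
      unfolding eventually_at
    proof (intro exI conjI ballI impI)
      fix \<zeta> assume z: "\<zeta> \<in> {\<zeta>. Im \<zeta> > 0}" "\<zeta> \<noteq> of_real s \<and> dist \<zeta> (of_real s) < a"
      have "\<bar>Re (\<zeta> - of_real s)\<bar> < a" "\<bar>Im (\<zeta> - of_real s)\<bar> < a"
        using z abs_Re_le_cmod[of "\<zeta> - of_real s"] abs_Im_le_cmod[of "\<zeta> - of_real s"] by (auto simp: dist_norm)
      then show "norm (Re (G \<zeta>)) \<le> M / a\<^sup>2 * Re (square_barrier a s \<zeta>)" using z bound[of \<zeta>] by auto
    qed (fact a)
    show "((\<lambda>\<zeta>. M / a\<^sup>2 * Re (square_barrier a s \<zeta>)) \<longlongrightarrow> 0) (at (of_real s) within {\<zeta>. Im \<zeta> > 0})"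
      by (rule tendsto_mult_right_zero[OF square_barrier_tendsto])
  qed
qed

lemma lift_path_exp_i:
  assumes "path \<sigma>" "path_image \<sigma> \<subseteq> ball 0 1 - {0}"
  obtains \<tau> where "path \<tau>" "\<And>t. t \<in> {0..1} \<Longrightarrow> exp (\<i> * \<tau> t) = \<sigma> t"
proof -
  have "continuous_on {0..1} \<sigma>" using assms(1) by (simp add: path_def)
  moreover have "contractible {0..1::real}" by (simp add: convex_imp_contractible)
  moreover have "\<And>t. t \<in> {0..1} \<Longrightarrow> \<sigma> t \<noteq> 0" using assms(2) unfolding path_image_def by (metis Diff_iff image_subset_iff singletonI)
  ultimately have "\<exists>L. continuous_on {0..1} L \<and> (\<forall>t\<in>{0..1}. \<sigma> t = exp (L t))"
    by (rule continuous_logarithm_on_contractible) auto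
  then obtain L where L: "continuous_on {0..1} L" "\<And>t. t \<in> {0..1} \<Longrightarrow> \<sigma> t = exp (L t)" by blast
  show ?thesis
  proof (rule that[of "\<lambda>t. - \<i> * L t"])
    show "path (\<lambda>t. - \<i> * L t)" unfolding path_def by (intro continuous_intros L)
    show "exp (\<i> * (- \<i> * L t)) = \<sigma> t" if "t \<in> {0..1}" for t using L(2)[OF that] by simp
  qed
qed

text \<open>Koebe's lemma, for bounded harmonic \<open>f\<close>; the conclusion holds on one of the two arcs
  between \<open>a\<close> and \<open>b\<close>.\<close>

lemma Koebe_arc:
  fixes f :: "complex \<Rightarrow> complex"
  assumes hol: "\<Phi>\<^sub>1 holomorphic_on ball 0 1" "\<Phi>\<^sub>2 holomorphic_on ball 0 1"
    and f: "\<And>w. w \<in> ball 0 1 \<Longrightarrow> f w = Complex (Re (\<Phi>\<^sub>1 w)) (Re (\<Phi>\<^sub>2 w))"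
    and B: "\<And>w. w \<in> ball 0 1 \<Longrightarrow> norm (f w) \<le> B"
    and C: "\<And>n::nat. path_connected (C n)" "\<And>n. C n \<subseteq> ball 0 1"
    and small: "\<And>e. e > 0 \<Longrightarrow> \<forall>\<^sub>F n in sequentially. \<forall>w\<in>C n. dist (f w) p < e"
    and leave: "\<And>\<rho>. \<rho> < 1 \<Longrightarrow> \<forall>\<^sub>F n in sequentially. \<forall>w\<in>C n. \<rho> < norm w"
    and ab: "norm a = 1" "norm b = 1" "a \<noteq> b" "\<And>n. a \<in> closure (C n)" "\<And>n. b \<in> closure (C n)"
  obtains \<alpha> \<beta> where "\<alpha> < \<beta>" "{cis \<alpha>, cis \<beta>} = {a, b}"
    "\<And>s. \<alpha> < s \<Longrightarrow> s < \<beta> \<Longrightarrow> (f \<longlongrightarrow> p) (at (cis s) within ball 0 1)"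
proof -
  define \<alpha> where "\<alpha> = Arg2pi a"
  define \<beta> where "\<beta> = \<alpha> + Arg2pi (b / a)"
  have a0: "a \<noteq> 0" "b \<noteq> 0" using ab by auto
  have cisa: "cis \<alpha> = a" using Arg2pi_eq[of a] ab(1) by (simp add: \<alpha>_def cis_conv_exp)
  have cisb: "cis \<beta> = b"
  proof -
    have "cis (Arg2pi (b / a)) = b / a" using Arg2pi_eq[of "b / a"] ab(1,2) by (simp add: cis_conv_exp norm_divide)
    then show ?thesis using cisa a0 by (simp add: \<beta>_def cis_mult[symmetric])
  qed
  have order: "\<alpha> < \<beta>" "\<beta> < \<alpha> + 2 * pi"
  proof -
    have "Arg2pi (b / a) \<noteq> 0" using cisa cisb ab(3) by (auto simp: \<beta>_def)
    then show "\<alpha> < \<beta>" "\<beta> < \<alpha> + 2 * pi" using Arg2pi_ge_0[of "b / a"] Arg2pi_lt_2pi[of "b / a"] by (auto simp: \<beta>_def)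
  qed
  \<comment> \<open>The half plane form of a connected set \<open>C n\<close> reaching from one
    endpoint to the other; the slack \<open>e\<close> at both ends is there because \<open>a\<close>
    and \<open>b\<close> are only in the closure of \<open>C n\<close>.\<close>
  define P where "P = (\<lambda>l r e. \<exists>\<sigma>. path \<sigma> \<and>
      (\<forall>\<zeta>\<in>path_image \<sigma>. 0 < Im \<zeta> \<and> Im \<zeta> < e \<and> dist (f (exp (\<i> * \<zeta>))) p \<le> e) \<and>
      Re (pathstart \<sigma>) \<le> l + e \<and> r - e \<le> Re (pathfinish \<sigma>))"
  have P_mono: "P l r e'" if "P l r e" "e \<le> e'" for l r e e'
    using that unfolding P_def by (elim exE conjE, intro exI conjI) (auto intro: order_trans less_le_trans)
  have either: "P \<alpha> \<beta> e \<or> P \<beta> (\<alpha> + 2 * pi) e" if e: "e > 0" for e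
  proof -
    obtain da where da: "da > 0" "\<And>\<zeta>. dist (exp (\<i> * \<zeta>)) (cis \<alpha>) < da \<Longrightarrow> \<exists>m::int. \<bar>Re \<zeta> - \<alpha> - 2 * pi * m\<bar> < e"
      using exp_i_near_cis[OF e] by metis
    obtain db where db: "db > 0" "\<And>\<zeta>. dist (exp (\<i> * \<zeta>)) (cis \<beta>) < db \<Longrightarrow> \<exists>m::int. \<bar>Re \<zeta> - \<beta> - 2 * pi * m\<bar> < e"
      using exp_i_near_cis[OF e] by metis
    \<comment> \<open>The norm of \<open>exp (\<i> * \<zeta>)\<close> is
      \<open>exp (- Im \<zeta>)\<close>, so lying outside the circle of radius
      \<open>exp (- e)\<close> means height below \<open>e\<close>.\<close>
    have "exp (- e) < 1" using e by simp
    from eventually_happens'[OF sequentially_bot eventually_conj[OF small[OF e] leave[OF this]]]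
    obtain n where n: "\<And>w. w \<in> C n \<Longrightarrow> dist (f w) p < e" "\<And>w. w \<in> C n \<Longrightarrow> exp (- e) < norm w" by blast
    obtain wa where wa: "wa \<in> C n" "dist wa a < da" using ab(4)[of n] da(1) by (auto simp: closure_approachable)
    obtain wb where wb: "wb \<in> C n" "dist wb b < db" using ab(5)[of n] db(1) by (auto simp: closure_approachable)
    obtain \<sigma> where \<sigma>: "path \<sigma>" "path_image \<sigma> \<subseteq> C n" "pathstart \<sigma> = wa" "pathfinish \<sigma> = wb"
      using C(1)[of n] wa(1) wb(1) unfolding path_connected_def by blast
    have "path_image \<sigma> \<subseteq> ball 0 1 - {0}"
    proof
      fix w assume "w \<in> path_image \<sigma>"
      then have "w \<in> C n" using \<sigma>(2) by blast
      then show "w \<in> ball 0 1 - {0}" using n(2)[of w] C(2)[of n] exp_gt_zero[of "- e"] by auto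
    qed
    from lift_path_exp_i[OF \<sigma>(1) this] obtain \<tau> where \<tau>: "path \<tau>" "\<And>t. t \<in> {0..1} \<Longrightarrow> exp (\<i> * \<tau> t) = \<sigma> t" by blast
    have good: "0 < Im \<zeta> \<and> Im \<zeta> < e \<and> dist (f (exp (\<i> * \<zeta>))) p \<le> e" if "\<zeta> \<in> path_image \<tau>" for \<zeta>
    proof -
      have "exp (\<i> * \<zeta>) \<in> C n" using that \<tau>(2) \<sigma>(2) by (auto simp: path_image_def)
      moreover from this have "0 < Im \<zeta>" using C(2)[of n] exp_i_in_ball by blast
      moreover have "Im \<zeta> < e" using n(2)[OF calculation(1)] by (simp add: norm_exp_eq_Re)
      ultimately show ?thesis using n(1) less_imp_le by blast
    qed
    have "exp (\<i> * pathstart \<tau>) = wa" "exp (\<i> * pathfinish \<tau>) = wb"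
      using \<tau>(2)[of 0] \<tau>(2)[of 1] \<sigma> by (auto simp: pathstart_def pathfinish_def)
    then obtain k l :: int where k: "\<bar>Re (pathstart \<tau>) - \<alpha> - 2 * pi * k\<bar> < e" and l: "\<bar>Re (pathfinish \<tau>) - \<beta> - 2 * pi * l\<bar> < e"
      using da(2)[of "pathstart \<tau>"] db(2)[of "pathfinish \<tau>"] wa wb cisa cisb by metis
    have per: "exp (\<i> * (\<zeta> + 2 * pi * of_int m)) = exp (\<i> * \<zeta>)" for \<zeta> :: complex and m :: int
    proof -
      have "\<i> * (\<zeta> + 2 * pi * of_int m) = \<i> * \<zeta> + of_real (of_int (2 * m) * pi) * \<i>" by (simp add: algebra_simps)
      then show ?thesis unfolding exp_eq by blast
    qed
    have shift: "path (\<lambda>t. \<tau>' t + 2 * pi * of_int m) \<and> (\<forall>\<zeta>\<in>path_image (\<lambda>t. \<tau>' t + 2 * pi * of_int m). 0 < Im \<zeta> \<and> Im \<zeta> < e \<and> dist (f (exp (\<i> * \<zeta>))) p \<le> e)"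
      if "path \<tau>'" "path_image \<tau>' \<subseteq> path_image \<tau>" for \<tau>' and m :: int
    proof
      show "path (\<lambda>t. \<tau>' t + 2 * pi * of_int m)" using that(1) unfolding path_def by (intro continuous_intros)
      show "\<forall>\<zeta>\<in>path_image (\<lambda>t. \<tau>' t + 2 * pi * of_int m). 0 < Im \<zeta> \<and> Im \<zeta> < e \<and> dist (f (exp (\<i> * \<zeta>))) p \<le> e"
      proof
        fix \<zeta> assume "\<zeta> \<in> path_image (\<lambda>t. \<tau>' t + 2 * pi * of_int m)"
        then obtain t where t: "t \<in> {0..1}" "\<zeta> = \<tau>' t + 2 * pi * of_int m" by (auto simp: path_image_def)
        then have "\<tau>' t \<in> path_image \<tau>" using that(2) by (auto simp: path_image_def)
        from good[OF this] show "0 < Im \<zeta> \<and> Im \<zeta> < e \<and> dist (f (exp (\<i> * \<zeta>))) p \<le> e"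
          unfolding t(2) per by simp
      qed
    qed
    show ?thesis
    \<comment> \<open>The lift runs from near \<open>\<alpha> + 2 * pi * k\<close> to near
      \<open>\<beta> + 2 * pi * l\<close>. If \<open>k\<close> is at most \<open>l\<close>, it spans
      a translate of the interval from \<alpha> to \<beta>; otherwise the reversed lift spans a
      translate of the interval from \<beta> to \<open>\<alpha> + 2 * pi\<close>.\<close>
    proof (cases "k \<le> l")
      case True
      then have "2 * pi * k \<le> 2 * pi * l" by simp
      moreover define \<kappa> where "\<kappa> = (\<lambda>t. \<tau> t + 2 * pi * of_int (- k))"
      moreover have "Re (pathstart \<kappa>) = Re (pathstart \<tau>) - 2 * pi * k" "Re (pathfinish \<kappa>) = Re (pathfinish \<tau>) - 2 * pi * k"
        by (simp_all add: \<kappa>_def pathstart_def pathfinish_def)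
      ultimately have "Re (pathstart \<kappa>) \<le> \<alpha> + e" "\<beta> - e \<le> Re (pathfinish \<kappa>)" using k l by linarith+
      moreover have "path \<kappa> \<and> (\<forall>\<zeta>\<in>path_image \<kappa>. 0 < Im \<zeta> \<and> Im \<zeta> < e \<and> dist (f (exp (\<i> * \<zeta>))) p \<le> e)"
        unfolding \<kappa>_def by (rule shift[OF \<tau>(1) order_refl])
      ultimately have "P \<alpha> \<beta> e" unfolding P_def by blast
      then show ?thesis ..
    next
      case False
      then have "real_of_int l + 1 \<le> k" by linarith
      then have "2 * pi * (real_of_int l + 1) \<le> 2 * pi * k" by (intro mult_left_mono) auto
      then have "2 * pi * l + 2 * pi \<le> 2 * pi * k" by argo
      moreover define \<kappa> where "\<kappa> = (\<lambda>t. reversepath \<tau> t + 2 * pi * of_int (- l))"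
      moreover have "Re (pathstart \<kappa>) = Re (pathfinish \<tau>) - 2 * pi * l" "Re (pathfinish \<kappa>) = Re (pathstart \<tau>) - 2 * pi * l"
        by (simp_all add: \<kappa>_def pathstart_def pathfinish_def reversepath_def)
      ultimately have "Re (pathstart \<kappa>) \<le> \<beta> + e" "\<alpha> + 2 * pi - e \<le> Re (pathfinish \<kappa>)" using k l by linarith+
      moreover have "path \<kappa> \<and> (\<forall>\<zeta>\<in>path_image \<kappa>. 0 < Im \<zeta> \<and> Im \<zeta> < e \<and> dist (f (exp (\<i> * \<zeta>))) p \<le> e)"
        unfolding \<kappa>_def by (rule shift) (use \<tau>(1) in auto)
      ultimately have "P \<beta> (\<alpha> + 2 * pi) e" unfolding P_def by blast
      then show ?thesis ..
    qed
  qed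
  have lim: "(f \<longlongrightarrow> p) (at (cis s) within ball 0 1)" if P: "\<And>e. e > 0 \<Longrightarrow> P l r e" and s: "l < s" "s < r" for l r s
  proof -
    define a where "a = min (s - l) (r - s) / 2"
    have a: "a > 0" "l + a \<le> s - a" "s + a \<le> r - a" using s by (auto simp: a_def min_def)
    have part: "((\<lambda>\<zeta>. Re (\<Phi> (exp (\<i> * \<zeta>)) - of_real c)) \<longlongrightarrow> 0) (at (of_real s) within {\<zeta>. Im \<zeta> > 0})"
      if \<Phi>: "\<Phi> holomorphic_on ball 0 1" and le: "\<And>w. w \<in> ball 0 1 \<Longrightarrow> \<bar>Re (\<Phi> w) - c\<bar> \<le> dist (f w) p"
      for \<Phi> and c :: real
    proof (rule tendsto_zero_of_crossing_paths[OF _ _ a(1)])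
      show "(\<lambda>\<zeta>. \<Phi> (exp (\<i> * \<zeta>)) - of_real c) holomorphic_on {\<zeta>. Im \<zeta> > 0}"
        by (intro holomorphic_intros exp_i_holomorphic \<Phi>)
      show "\<bar>Re (\<Phi> (exp (\<i> * \<zeta>)) - of_real c)\<bar> \<le> B + norm p" if "Im \<zeta> > 0" for \<zeta>
      proof -
        have w: "exp (\<i> * \<zeta>) \<in> ball 0 1" using that exp_i_in_ball by blast
        have "dist (f (exp (\<i> * \<zeta>))) p \<le> B + norm p"
          using B[OF w] norm_triangle_ineq4[of "f (exp (\<i> * \<zeta>))" p] by (simp add: dist_norm)
        then show ?thesis using le[OF w] by simp
      qed
      fix e :: real assume e: "e > 0"
      have "min e a > 0" using e a by simp
      from P[OF this] obtain \<sigma> where \<sigma>: "path \<sigma>"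
        "\<And>\<zeta>. \<zeta>\<in>path_image \<sigma> \<Longrightarrow> 0 < Im \<zeta> \<and> Im \<zeta> < min e a \<and> dist (f (exp (\<i> * \<zeta>))) p \<le> min e a"
        "Re (pathstart \<sigma>) \<le> l + min e a" "r - min e a \<le> Re (pathfinish \<sigma>)"
        unfolding P_def by blast
      have "0 < Im \<zeta> \<and> Im \<zeta> < e \<and> \<bar>Re (\<Phi> (exp (\<i> * \<zeta>)) - of_real c)\<bar> \<le> e" if "\<zeta> \<in> path_image \<sigma>" for \<zeta>
        using \<sigma>(2)[OF that] le[of "exp (\<i> * \<zeta>)"] exp_i_in_ball[of \<zeta>] by auto
      moreover have "Re (pathstart \<sigma>) \<le> s - a" "s + a \<le> Re (pathfinish \<sigma>)" using \<sigma>(3,4) a by auto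
      ultimately show "\<exists>\<sigma>. path \<sigma> \<and> (\<forall>\<zeta>\<in>path_image \<sigma>. 0 < Im \<zeta> \<and> Im \<zeta> < e \<and> \<bar>Re (\<Phi> (exp (\<i> * \<zeta>)) - of_real c)\<bar> \<le> e) \<and>
        Re (pathstart \<sigma>) \<le> s - a \<and> s + a \<le> Re (pathfinish \<sigma>)" using \<sigma>(1) by blast
    qed
    have ev: "\<forall>\<^sub>F \<zeta> in at (of_real s) within {\<zeta>. Im \<zeta> > 0}. exp (\<i> * \<zeta>) \<in> ball 0 1"
      using exp_i_in_ball by (auto simp: eventually_at_topological)
    have "((\<lambda>\<zeta>. Re (\<Phi>\<^sub>1 (exp (\<i> * \<zeta>)) - of_real (Re p))) \<longlongrightarrow> 0) (at (of_real s) within {\<zeta>. Im \<zeta> > 0})"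
    proof (rule part[OF hol(1)])
      fix w :: complex assume "w \<in> ball 0 1"
      then show "\<bar>Re (\<Phi>\<^sub>1 w) - Re p\<bar> \<le> dist (f w) p"
        using abs_Re_le_cmod[of "f w - p"] f[of w] by (simp add: dist_norm)
    qed
    moreover have "((\<lambda>\<zeta>. Re (\<Phi>\<^sub>2 (exp (\<i> * \<zeta>)) - of_real (Im p))) \<longlongrightarrow> 0) (at (of_real s) within {\<zeta>. Im \<zeta> > 0})"
    proof (rule part[OF hol(2)])
      fix w :: complex assume "w \<in> ball 0 1"
      then show "\<bar>Re (\<Phi>\<^sub>2 w) - Im p\<bar> \<le> dist (f w) p"
        using abs_Im_le_cmod[of "f w - p"] f[of w] by (simp add: dist_norm)
    qed
    ultimately have "((\<lambda>\<zeta>. Complex (Re (\<Phi>\<^sub>1 (exp (\<i> * \<zeta>)))) (Re (\<Phi>\<^sub>2 (exp (\<i> * \<zeta>))))) \<longlongrightarrow> p) (at (of_real s) within {\<zeta>. Im \<zeta> > 0})"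
      unfolding tendsto_complex_iff by (simp add: LIM_zero_iff)
    moreover have "\<forall>\<^sub>F \<zeta> in at (of_real s) within {\<zeta>. Im \<zeta> > 0}. Complex (Re (\<Phi>\<^sub>1 (exp (\<i> * \<zeta>)))) (Re (\<Phi>\<^sub>2 (exp (\<i> * \<zeta>)))) = f (exp (\<i> * \<zeta>))"
      using ev by (rule eventually_mono) (simp only: f)
    ultimately show ?thesis unfolding tendsto_at_cis_iff using tendsto_cong by force
  qed
  show ?thesis
  \<comment> \<open>The arc must not depend on \<open>e\<close>. As \<open>P\<close> is monotone,
    one failure at \<open>e0\<close> rules out the first arc for all smaller \<open>e\<close>, so
    the second arc serves for every \<open>e\<close>.\<close>
  proof (cases "\<forall>e>0. P \<alpha> \<beta> e")
    case True
    then show ?thesis using that[of \<alpha> \<beta>] lim[of \<alpha> \<beta>] order cisa cisb by blast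
  next
    case False
    then obtain e0 where e0: "e0 > 0" "\<not> P \<alpha> \<beta> e0" by blast
    have "P \<beta> (\<alpha> + 2 * pi) e" if "e > 0" for e
    proof -
      have "P \<beta> (\<alpha> + 2 * pi) (min e e0)" using either[of "min e e0"] P_mono[of \<alpha> \<beta> "min e e0" e0] e0 that by auto
      then show ?thesis by (rule P_mono) simp
    qed
    moreover have "cis (\<alpha> + 2 * pi) = a" by (simp add: cis_mult[symmetric] cisa)
    ultimately show ?thesis using that[of \<beta> "\<alpha> + 2 * pi"] lim[of \<beta> "\<alpha> + 2 * pi"] order cisb by blast
  qed
qed

section \<open>Boundary correspondence of a harmonic homeomorphism\<close>

lemma in_closureI_sequence:
  fixes l :: "'a::metric_space"
  shows "(\<And>n::nat. x n \<in> S) \<Longrightarrow> x \<longlonglongrightarrow> l \<Longrightarrow> l \<in> closure S"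
  unfolding closure_sequential by auto

text \<open>\<open>\<Phi>\<^sub>1\<close> and \<open>\<Phi>\<^sub>2\<close> are analytic completions
  of the two coordinates of \<open>f\<close>; their imaginary parts form the conjugate mapping. The
  inverse \<open>F\<close> carries all boundary information, in place of any regularity of
  \<open>f\<close> at the circle.\<close>

locale harmonic_homeomorphism =
  fixes \<Omega> :: "complex set" and f F \<Phi>\<^sub>1 \<Phi>\<^sub>2 :: "complex \<Rightarrow> complex"
  assumes open_\<Omega>: "open \<Omega>" and bounded_\<Omega>: "bounded \<Omega>"
    and hom: "homeomorphism (ball 0 1) \<Omega> f F"
    and hol1: "\<Phi>\<^sub>1 holomorphic_on ball 0 1" and hol2: "\<Phi>\<^sub>2 holomorphic_on ball 0 1"
    and f_eq: "\<And>w. w \<in> ball 0 1 \<Longrightarrow> f w = Complex (Re (\<Phi>\<^sub>1 w)) (Re (\<Phi>\<^sub>2 w))"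
begin

lemma f_in: "w \<in> ball 0 1 \<Longrightarrow> f w \<in> \<Omega>"
  and F_in: "z \<in> \<Omega> \<Longrightarrow> F z \<in> ball 0 1"
  and Ff: "w \<in> ball 0 1 \<Longrightarrow> F (f w) = w"
  and fF: "z \<in> \<Omega> \<Longrightarrow> f (F z) = z"
  using hom unfolding homeomorphism_def by blast+

lemma cont_f: "continuous_on (ball 0 1) f" and cont_F: "continuous_on \<Omega> F"
  using hom unfolding homeomorphism_def by blast+

lemma frontier_\<Omega>: "frontier \<Omega> = closure \<Omega> - \<Omega>"
  using open_\<Omega> by (simp add: frontier_def interior_open)

lemma at_frontier_nontrivial: "q \<in> frontier \<Omega> \<Longrightarrow> at q within \<Omega> \<noteq> bot"
  by (metis Diff_iff Diff_empty Diff_insert0 at_within_eq_bot_iff frontier_\<Omega>)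

lemma f_bounded: obtains B where "\<And>w. w \<in> ball 0 1 \<Longrightarrow> norm (f w) \<le> B"
proof -
  obtain B where "\<forall>x\<in>\<Omega>. norm x \<le> B" using bounded_\<Omega> unfolding bounded_iff by blast
  then show ?thesis using that f_in by blast
qed

lemma limit_of_f_in_frontier:
  assumes "\<And>n::nat. w n \<in> ball 0 1" "w \<longlonglongrightarrow> \<zeta>" "norm \<zeta> = 1" "(\<lambda>n. f (w n)) \<longlonglongrightarrow> q"
  shows "q \<in> frontier \<Omega>"
proof -
  have "q \<in> closure \<Omega>" by (rule in_closureI_sequence[OF f_in[OF assms(1)] assms(4)])
  moreover have "q \<notin> \<Omega>"
  proof
    assume q: "q \<in> \<Omega>"
    then have "isCont F q" using cont_F continuous_on_eq_continuous_at[OF open_\<Omega>] by blast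
    from isCont_tendsto_compose[OF this assms(4)] have "w \<longlonglongrightarrow> F q" using Ff[OF assms(1)] by simp
    then have "\<zeta> = F q" using assms(2) LIMSEQ_unique by blast
    then show False using F_in[OF q] assms(3) by simp
  qed
  ultimately show ?thesis by (simp add: frontier_\<Omega>)
qed

text \<open>Properness of \<open>f\<close>: the image of a closed disc of radius below 1 is a
  compact subset of \<Omega>, which a neighbourhood of a frontier point avoids.\<close>

lemma F_leaves_compacts:
  assumes "q \<in> frontier \<Omega>" "\<rho> < 1"
  shows "\<forall>\<^sub>F z in at q within \<Omega>. \<rho> < norm (F z)"
proof -
  define K where "K = f ` cball 0 \<rho>"
  have sub: "cball 0 \<rho> \<subseteq> ball (0::complex) 1" using assms(2) by auto
  have "compact K" unfolding K_def
    using continuous_on_subset[OF cont_f sub] by (intro compact_continuous_image) auto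
  then have "open (- K)" using compact_imp_closed by blast
  moreover have "q \<in> - K" using assms(1) sub f_in by (auto simp: K_def frontier_\<Omega>)
  ultimately have "\<forall>\<^sub>F z in nhds q. z \<in> - K" by (rule eventually_nhds_in_open)
  then show ?thesis unfolding eventually_at_filter
  proof (rule eventually_mono, intro impI)
    fix z assume z: "z \<in> - K" "z \<in> \<Omega>"
    show "\<rho> < norm (F z)"
    proof (rule ccontr)
      assume "\<not> \<rho> < norm (F z)"
      then have "f (F z) \<in> K" unfolding K_def by (intro imageI) auto
      then show False using z fF by simp
    qed
  qed
qed

text \<open>Closures of images of small neighbourhoods, instead of limits of sequences: Koebe's
  lemma asks for common points of the closures of the sets \<open>C n\<close>.\<close>

definition F_cluster :: "complex \<Rightarrow> complex set" where
  "F_cluster q = {a. \<forall>r>0. a \<in> closure (F ` (\<Omega> \<inter> ball q r))}"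

lemma F_clusterI:
  assumes "\<And>n::nat. z n \<in> \<Omega>" "z \<longlonglongrightarrow> q" "(\<lambda>n. F (z n)) \<longlonglongrightarrow> a"
  shows "a \<in> F_cluster q"
  unfolding F_cluster_def
proof (intro CollectI allI impI)
  fix r :: real assume "r > 0"
  then obtain N where N: "\<And>n. n \<ge> N \<Longrightarrow> dist (z n) q < r" using assms(2) unfolding lim_sequentially by blast
  have in_im: "F (z (n + N)) \<in> F ` (\<Omega> \<inter> ball q r)" for n
  proof -
    have "dist (z (n + N)) q < r" by (rule N) simp
    then show "F (z (n + N)) \<in> F ` (\<Omega> \<inter> ball q r)" using assms(1) by (auto simp: dist_commute)
  qed
  show "a \<in> closure (F ` (\<Omega> \<inter> ball q r))"
    by (rule in_closureI_sequence[OF in_im LIMSEQ_ignore_initial_segment[OF assms(3)]])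
qed

lemma F_cluster_norm:
  assumes q: "q \<in> frontier \<Omega>" and a: "a \<in> F_cluster q"
  shows "norm a = 1"
proof (rule antisym)
  have "F ` (\<Omega> \<inter> ball q 1) \<subseteq> cball 0 1" using F_in less_imp_le by fastforce
  then have "closure (F ` (\<Omega> \<inter> ball q 1)) \<subseteq> cball 0 1" by (rule closure_minimal) simp
  then show "norm a \<le> 1" using a unfolding F_cluster_def by (auto dest!: spec[of _ 1])
  show "1 \<le> norm a"
  proof (rule dense_le)
    fix \<rho> :: real assume "\<rho> < 1"
    from F_leaves_compacts[OF q this] obtain r where r: "r > 0" "\<And>z. z \<in> \<Omega> \<Longrightarrow> z \<noteq> q \<Longrightarrow> dist z q < r \<Longrightarrow> \<rho> < norm (F z)"
      unfolding eventually_at by blast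
    have "F ` (\<Omega> \<inter> ball q r) \<subseteq> {x. \<rho> \<le> norm x}"
    proof
      fix x assume "x \<in> F ` (\<Omega> \<inter> ball q r)"
      then obtain z where z: "z \<in> \<Omega>" "dist q z < r" "x = F z" by auto
      then show "x \<in> {x. \<rho> \<le> norm x}" using r(2)[of z] q by (cases "z = q") (auto simp: frontier_\<Omega> dist_commute)
    qed
    then have "closure (F ` (\<Omega> \<inter> ball q r)) \<subseteq> {x. \<rho> \<le> norm x}"
      by (rule closure_minimal) (intro closed_Collect_le continuous_intros)
    then show "\<rho> \<le> norm a" using a r(1) unfolding F_cluster_def by blast
  qed
qed

lemma F_subsequence:
  assumes "\<And>n::nat. z n \<in> \<Omega>"
  obtains r a where "strict_mono (r :: nat \<Rightarrow> nat)" "(\<lambda>n. F (z (r n))) \<longlonglongrightarrow> a"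
proof -
  have "\<forall>n. (F \<circ> z) n \<in> cball 0 1" using F_in[OF assms] by (auto simp: less_imp_le)
  then obtain a r where "strict_mono r" "((F \<circ> z) \<circ> r) \<longlonglongrightarrow> a"
    using compact_cball[of "0::complex" 1] unfolding compact_def by meson
  then show ?thesis using that by (simp add: o_def)
qed

lemma tendsto_F_of_cluster:
  assumes q: "q \<in> frontier \<Omega>" and a: "F_cluster q \<subseteq> {a}"
  shows "(F \<longlongrightarrow> a) (at q within \<Omega>)"
proof (rule ccontr)
  assume "\<not> ?thesis"
  then obtain e where e: "e > 0" "\<not> (\<forall>\<^sub>F z in at q within \<Omega>. dist (F z) a < e)" unfolding tendsto_iff by blast
  have "\<exists>z. z \<in> \<Omega> \<and> dist z q < 1 / Suc n \<and> e \<le> dist (F z) a" for n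
  proof (rule ccontr)
    assume "\<not> ?thesis"
    then have "\<forall>\<^sub>F z in at q within \<Omega>. dist (F z) a < e" unfolding eventually_at
      by (intro exI[of _ "1 / Suc n"]) (auto simp: not_le)
    then show False using e by blast
  qed
  then obtain z where z: "\<And>n. z n \<in> \<Omega>" "\<And>n. dist (z n) q < 1 / Suc n" "\<And>n. e \<le> dist (F (z n)) a" by metis
  have zq: "z \<longlonglongrightarrow> q"
  proof (rule metric_tendsto_imp_tendsto[OF LIMSEQ_inverse_real_of_nat])
    show "\<forall>\<^sub>F n in sequentially. dist (z n) q \<le> dist (inverse (real (Suc n))) 0"
      using z(2) by (auto simp: inverse_eq_divide intro!: always_eventually less_imp_le)
  qed
  obtain r b where r: "strict_mono (r :: nat \<Rightarrow> nat)" "(\<lambda>n. F (z (r n))) \<longlonglongrightarrow> b" by (rule F_subsequence[OF z(1)])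
  have "b \<in> F_cluster q" using F_clusterI[of "\<lambda>n. z (r n)" q b] z(1) r LIMSEQ_subseq_LIMSEQ[OF zq r(1)] by (simp add: o_def)
  then have "b = a" using a by blast
  have "(\<lambda>n. dist (F (z (r n))) a) \<longlonglongrightarrow> 0" using tendsto_dist[OF r(2) tendsto_const[of a]] \<open>b = a\<close> by simp
  then have "e \<le> 0" by (rule LIMSEQ_le_const) (use z(3) in blast)
  then show False using e by simp
qed

lemma F_cluster_nonempty:
  assumes "q \<in> frontier \<Omega>" shows "F_cluster q \<noteq> {}"
proof -
  have "q \<in> closure \<Omega>" using assms by (simp add: frontier_\<Omega>)
  then obtain z where z: "\<And>n. z n \<in> \<Omega>" "z \<longlonglongrightarrow> q" unfolding closure_sequential by auto
  obtain r b where r: "strict_mono (r :: nat \<Rightarrow> nat)" "(\<lambda>n. F (z (r n))) \<longlonglongrightarrow> b" by (rule F_subsequence[OF z(1)])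
  then have "b \<in> F_cluster q" using F_clusterI[of "\<lambda>n. z (r n)" q b] z r LIMSEQ_subseq_LIMSEQ[OF z(2) r(1)] by (simp add: o_def)
  then show ?thesis by blast
qed

definition locally_connected_at :: "complex \<Rightarrow> bool" where
  "locally_connected_at q \<longleftrightarrow> (\<exists>r0>0. \<forall>r. 0 < r \<longrightarrow> r < r0 \<longrightarrow> connected (\<Omega> \<inter> ball q r))"

text \<open>\<open>F\<close> maps the connected sets \<open>\<Omega> \<inter> ball q r\<close> with
  shrinking \<open>r\<close> to path-connected sets that escape to the circle, while
  \<open>f\<close> is close to \<open>q\<close> on them. Both \<open>a\<close> and \<open>b\<close>
  belong to all their closures, so Koebe's lemma applies.\<close>

lemma arc_of_two_clusters:
  assumes q: "q \<in> frontier \<Omega>" and lc: "locally_connected_at q"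
    and ab: "a \<in> F_cluster q" "b \<in> F_cluster q" "a \<noteq> b"
  obtains \<alpha> \<beta> where "\<alpha> < \<beta>" "{cis \<alpha>, cis \<beta>} = {a, b}"
    "\<And>s. \<alpha> < s \<Longrightarrow> s < \<beta> \<Longrightarrow> (f \<longlongrightarrow> q) (at (cis s) within ball 0 1)"
proof -
  obtain r0 where r0: "r0 > 0" "\<And>r. 0 < r \<Longrightarrow> r < r0 \<Longrightarrow> connected (\<Omega> \<inter> ball q r)"
    using lc unfolding locally_connected_at_def by blast
  define r where "r = (\<lambda>n::nat. r0 / (2 + real n))"
  have r: "0 < r n" "r n < r0" for n using r0(1) by (auto simp: r_def divide_less_eq)
  have rlim: "r \<longlonglongrightarrow> 0" unfolding r_def by (rule tendsto_divide_0[OF tendsto_const] filterlim_at_top_imp_at_infinity filterlim_tendsto_add_at_top tendsto_const filterlim_real_sequentially)+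
  define C where "C = (\<lambda>n. F ` (\<Omega> \<inter> ball q (r n)))"
  obtain B where B: "\<And>w. w \<in> ball 0 1 \<Longrightarrow> norm (f w) \<le> B" using f_bounded by blast
  have C: "path_connected (C n)" "C n \<subseteq> ball 0 1" for n
  proof -
    have "path_connected (\<Omega> \<inter> ball q (r n))"
      using r0(2)[OF r] open_\<Omega> by (intro connected_open_path_connected) auto
    then show "path_connected (C n)" unfolding C_def
      by (rule path_connected_continuous_image[rotated]) (auto intro: continuous_on_subset[OF cont_F])
    show "C n \<subseteq> ball 0 1" unfolding C_def using F_in by blast
  qed
  have small: "\<forall>\<^sub>F n in sequentially. \<forall>w\<in>C n. dist (f w) q < e" if "e > 0" for e
  proof -
    have "\<forall>\<^sub>F n in sequentially. r n < e" using order_tendstoD(2)[OF rlim that] .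
    then show ?thesis
    proof (rule eventually_mono, intro ballI)
      fix n w assume "r n < e" "w \<in> C n"
      then obtain z where "z \<in> \<Omega>" "dist z q < e" "w = F z" by (auto simp: C_def dist_commute)
      then show "dist (f w) q < e" by (simp add: fF)
    qed
  qed
  have leave: "\<forall>\<^sub>F n in sequentially. \<forall>w\<in>C n. \<rho> < norm w" if "\<rho> < 1" for \<rho>
  proof -
    from F_leaves_compacts[OF q that] obtain d where d: "d > 0" "\<And>z. z \<in> \<Omega> \<Longrightarrow> z \<noteq> q \<Longrightarrow> dist z q < d \<Longrightarrow> \<rho> < norm (F z)"
      unfolding eventually_at by blast
    have "\<forall>\<^sub>F n in sequentially. r n < d" using order_tendstoD(2)[OF rlim d(1)] .
    then show ?thesis
    proof (rule eventually_mono, intro ballI)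
      fix n w assume "r n < d" "w \<in> C n"
      then obtain z where "z \<in> \<Omega>" "dist z q < d" "w = F z" by (auto simp: C_def dist_commute)
      then show "\<rho> < norm w" using d(2)[of z] q by (cases "z = q") (auto simp: frontier_\<Omega>)
    qed
  qed
  have cl: "a \<in> closure (C n)" "b \<in> closure (C n)" for n using ab(1,2) r unfolding F_cluster_def C_def by blast+
  show ?thesis
    by (rule Koebe_arc[OF hol1 hol2 f_eq B C small leave F_cluster_norm[OF q ab(1)] F_cluster_norm[OF q ab(2)] ab(3) cl]) (assumption | rule that)+
qed

text \<open>Along a sequence tending to \<zeta>, \<open>f\<close> accumulates at a frontier point
  \<open>q\<close> in the closure of \<open>X\<close>. A \<open>q\<close> where \<open>F\<close>
  tends to a point other than \<zeta> cannot occur, since \<open>F \<circ> f\<close> is the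
  identity; so the limit of \<open>g\<close> is demanded only at the remaining ones.\<close>

lemma filterlim_comp_f:
  assumes \<zeta>: "norm \<zeta> = 1" and X: "\<forall>\<^sub>F w in at \<zeta> within ball 0 1. f w \<in> X"
    and lim: "\<And>q. q \<in> frontier \<Omega> \<Longrightarrow> q \<in> closure X \<Longrightarrow>
       (\<exists>e. e \<noteq> \<zeta> \<and> (F \<longlongrightarrow> e) (at q within \<Omega>)) \<or> filterlim g G (at q within \<Omega>)"
  shows "filterlim (\<lambda>w. g (f w)) G (at \<zeta> within ball 0 1)"
  unfolding filterlim_iff
proof (intro allI impI, rule ccontr)
  fix P assume P: "eventually P G" and neg: "\<not> (\<forall>\<^sub>F w in at \<zeta> within ball 0 1. P (g (f w)))"
  obtain d where d: "d > 0" "\<And>w. w \<in> ball 0 1 \<Longrightarrow> w \<noteq> \<zeta> \<Longrightarrow> dist w \<zeta> < d \<Longrightarrow> f w \<in> X"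
    using X unfolding eventually_at by blast
  have "\<exists>w. w \<in> ball 0 1 \<and> dist w \<zeta> < d / Suc n \<and> \<not> P (g (f w))" for n
  proof (rule ccontr)
    assume "\<not> ?thesis"
    then have "\<forall>\<^sub>F w in at \<zeta> within ball 0 1. P (g (f w))" unfolding eventually_at
      using d(1) by (intro exI[of _ "d / Suc n"]) auto
    then show False using neg by blast
  qed
  then obtain w where w: "\<And>n. w n \<in> ball 0 1" "\<And>n. dist (w n) \<zeta> < d / Suc n" "\<And>n. \<not> P (g (f (w n)))" by metis
  have wz: "w \<longlonglongrightarrow> \<zeta>"
  proof (rule metric_tendsto_imp_tendsto)
    show "(\<lambda>n. d / Suc n) \<longlonglongrightarrow> 0" using tendsto_mult_right_zero[OF LIMSEQ_inverse_real_of_nat, of d] by (simp add: divide_inverse)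
    show "\<forall>\<^sub>F n in sequentially. dist (w n) \<zeta> \<le> dist (d / Suc n) 0"
      using w(2) d(1) by (auto intro!: always_eventually less_imp_le)
  qed
  have fX: "f (w n) \<in> X" for n
  proof (rule d(2)[OF w(1)])
    show "w n \<noteq> \<zeta>" using w(1)[of n] \<zeta> by auto
    have "d / Suc n \<le> d" using d(1) by (simp add: divide_le_eq)
    then show "dist (w n) \<zeta> < d" using w(2)[of n] by linarith
  qed
  have "range (\<lambda>n. f (w n)) \<subseteq> \<Omega>" using f_in[OF w(1)] by blast
  with bounded_\<Omega> have "bounded (range (\<lambda>n. f (w n)))" by (rule bounded_subset)
  from bounded_imp_convergent_subsequence[OF this]
  obtain q r where r': "strict_mono (r :: nat \<Rightarrow> nat)" "((\<lambda>n. f (w n)) \<circ> r) \<longlonglongrightarrow> q" by blast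
  then have r: "strict_mono r" "(\<lambda>n. f (w (r n))) \<longlonglongrightarrow> q" by (simp_all add: o_def)
  have wr: "(\<lambda>n. w (r n)) \<longlonglongrightarrow> \<zeta>" using LIMSEQ_subseq_LIMSEQ[OF wz r(1)] by (simp add: o_def)
  have q: "q \<in> frontier \<Omega>" by (rule limit_of_f_in_frontier[OF _ wr \<zeta> r(2)]) (rule w(1))
  have qX: "q \<in> closure X" by (rule in_closureI_sequence[OF fX r(2)])
  have at_q: "filterlim (\<lambda>n. f (w (r n))) (at q within \<Omega>) sequentially"
  proof -
    have "f (w (r n)) \<in> \<Omega> \<and> f (w (r n)) \<noteq> q" for n using f_in[OF w(1)[of "r n"]] q by (auto simp: frontier_\<Omega>)
    then show ?thesis using r(2) unfolding filterlim_at by simp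
  qed
  from lim[OF q qX] show False
  proof
    assume "\<exists>e. e \<noteq> \<zeta> \<and> (F \<longlongrightarrow> e) (at q within \<Omega>)"
    then obtain e where e: "e \<noteq> \<zeta>" "(F \<longlongrightarrow> e) (at q within \<Omega>)" by blast
    have "(\<lambda>n. F (f (w (r n)))) \<longlonglongrightarrow> e" using filterlim_compose[OF e(2) at_q] .
    then have "(\<lambda>n. w (r n)) \<longlonglongrightarrow> e" using Ff w(1) by simp
    then show False using e(1) wr LIMSEQ_unique by blast
  next
    assume "filterlim g G (at q within \<Omega>)"
    from filterlim_compose[OF this at_q] have "filterlim (\<lambda>n. g (f (w (r n)))) G sequentially" .
    from this[unfolded filterlim_iff, rule_format, OF P] obtain N where "P (g (f (w (r N))))"
      unfolding eventually_sequentially by auto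
    then show False using w(3) by simp
  qed
qed

text \<open>Two cluster values of \<open>F\<close> at \<open>q\<close> would give an arc of the
  circle on which \<open>f\<close> tends to \<open>q\<close>; along that arc \<open>Re h\<close>
  would tend to infinity, which is impossible.\<close>

lemma tendsto_F_at_pole:
  assumes q: "q \<in> frontier \<Omega>" and lc: "locally_connected_at q"
    and h: "h holomorphic_on ball 0 1" and lim: "filterlim (\<lambda>z. Re (h (F z))) at_top (at q within \<Omega>)"
  obtains e where "norm e = 1" "(F \<longlongrightarrow> e) (at q within \<Omega>)"
proof -
  obtain a where a: "a \<in> F_cluster q" using F_cluster_nonempty[OF q] by blast
  have "F_cluster q \<subseteq> {a}"
  proof (rule ccontr)
    assume "\<not> ?thesis"
    then obtain b where b: "b \<in> F_cluster q" "a \<noteq> b" by blast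
    obtain \<alpha> \<beta> where ab: "\<alpha> < \<beta>" "{cis \<alpha>, cis \<beta>} = {a, b}" "\<And>s. \<alpha> < s \<Longrightarrow> s < \<beta> \<Longrightarrow> (f \<longlongrightarrow> q) (at (cis s) within ball 0 1)"
      by (rule arc_of_two_clusters[OF q lc a b]) (rule that; blast)
    show False
    proof (rule no_infinite_boundary_arc[OF h ab(1)])
      fix s assume s: "\<alpha> < s" "s < \<beta>"
      have inb: "\<forall>\<^sub>F w in at (cis s) within ball 0 1. w \<in> ball (0::complex) 1"
        by (auto simp: eventually_at_topological)
      have "filterlim f (at q within \<Omega>) (at (cis s) within ball 0 1)"
        unfolding filterlim_at
      proof
        show "(f \<longlongrightarrow> q) (at (cis s) within ball 0 1)" by (rule ab(3)[OF s])
        show "\<forall>\<^sub>F w in at (cis s) within ball 0 1. f w \<in> \<Omega> \<and> f w \<noteq> q"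
          using inb by (rule eventually_mono) (use f_in q in \<open>auto simp: frontier_\<Omega>\<close>)
      qed
      from filterlim_compose[OF lim this]
      have "filterlim (\<lambda>w. Re (h (F (f w)))) at_top (at (cis s) within ball 0 1)" .
      moreover have ev: "\<forall>\<^sub>F w in at (cis s) within ball 0 1. Re (h (F (f w))) = Re (h w)"
        using inb by (rule eventually_mono) (simp only: Ff)
      ultimately show "filterlim (\<lambda>w. Re (h w)) at_top (at (cis s) within ball 0 1)"
        using filterlim_cong[OF refl refl ev, of at_top] by simp
    qed
  qed
  then show ?thesis using that[OF F_cluster_norm[OF q a]] tendsto_F_of_cluster[OF q] by simp
qed

end

section \<open>Crosscuts, and the exclusion of a common limit at a corner\<close>

lemma Re_one_minus_pos:
  assumes "norm w = 1" "norm \<xi> < 1"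
  shows "Re (- cnj w * (\<xi> - w)) > 0"
proof -
  have "Re (cnj w * \<xi>) \<le> norm (cnj w * \<xi>)" by (rule complex_Re_le_cmod)
  also have "\<dots> < 1" using assms by (simp add: norm_mult)
  finally have "Re (cnj w * \<xi>) < 1" .
  moreover have "cnj w * w = 1" using assms(1) complex_norm_square[of w] by (simp add: mult.commute)
  ultimately show ?thesis by (simp add: right_diff_distrib del: times_complex.sel)
qed

text \<open>For \<open>w\<close> of norm 1 the expression on the right is the real part of
  \<open>1 - cnj w * \<xi>\<close>; expanding \<open>(norm (\<xi> - w))\<^sup>2\<close> gives the
  bound. It serves as a barrier on the closed disc that vanishes only at \<open>w\<close>.\<close>

lemma Re_one_minus_ge:
  assumes "norm w = 1" "norm \<xi> \<le> 1"
  shows "(norm (\<xi> - w))\<^sup>2 / 2 \<le> Re (- cnj w * (\<xi> - w))"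
proof -
  have w: "(Re w)\<^sup>2 + (Im w)\<^sup>2 = 1" using assms(1) by (simp add: cmod_def)
  have x: "(Re \<xi>)\<^sup>2 + (Im \<xi>)\<^sup>2 \<le> 1" using assms(2) by (simp add: cmod_def)
  have "(norm (\<xi> - w))\<^sup>2 = (Re \<xi> - Re w)\<^sup>2 + (Im \<xi> - Im w)\<^sup>2" by (simp add: cmod_power2)
  then show ?thesis using w x by (simp add: power2_eq_square algebra_simps)
qed

context harmonic_homeomorphism
begin

lemma F_image_open:
  assumes "open U" shows "open (F ` (\<Omega> \<inter> U))"
proof -
  have "F ` (\<Omega> \<inter> U) = ball 0 1 \<inter> f -` U"
  proof
    show "F ` (\<Omega> \<inter> U) \<subseteq> ball 0 1 \<inter> f -` U" using F_in fF by auto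
    show "ball 0 1 \<inter> f -` U \<subseteq> F ` (\<Omega> \<inter> U)"
    proof
      fix w assume "w \<in> ball 0 1 \<inter> f -` U"
      then have "w = F (f w)" "f w \<in> \<Omega> \<inter> U" using Ff f_in by auto
      then show "w \<in> F ` (\<Omega> \<inter> U)" by blast
    qed
  qed
  then show ?thesis using continuous_open_preimage[OF cont_f open_ball assms] by simp
qed

text \<open>If \<open>f\<close> met \<open>sphere c r\<close> arbitrarily close to \<zeta>, its
  values would accumulate there at a frontier point \<open>q\<close> at which \<open>F\<close> has a
  limit in \<open>E\<close>; that limit would have to be \<zeta>. Once the sphere is avoided,
  connectedness keeps \<open>f\<close> on one side of it.\<close>

lemma crosscut_neighbourhood:
  assumes lim: "\<And>q. q \<in> sphere c r \<Longrightarrow> q \<in> frontier \<Omega> \<Longrightarrow> \<exists>e\<in>E. (F \<longlongrightarrow> e) (at q within \<Omega>)"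
    and \<zeta>: "norm \<zeta> = 1" "\<zeta> \<notin> E"
  obtains \<delta> where "\<delta> > 0" "(\<forall>w\<in>ball \<zeta> \<delta> \<inter> ball 0 1. f w \<in> ball c r) \<or> (\<forall>w\<in>ball \<zeta> \<delta> \<inter> ball 0 1. f w \<notin> cball c r)"
proof -
  have "\<exists>\<delta>>0. \<forall>w\<in>ball \<zeta> \<delta> \<inter> ball 0 1. f w \<notin> sphere c r"
  proof (rule ccontr)
    assume neg: "\<not> ?thesis"
    have "\<exists>w. w \<in> ball \<zeta> (1 / Suc n) \<inter> ball 0 1 \<and> f w \<in> sphere c r" for n
    proof -
      have "1 / real (Suc n) > 0" by simp
      then show ?thesis using neg by blast
    qed
    then obtain w where w: "\<And>n. w n \<in> ball \<zeta> (1 / Suc n)" "\<And>n. w n \<in> ball 0 1" "\<And>n. f (w n) \<in> sphere c r"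
      unfolding Int_iff by metis
    have wz: "w \<longlonglongrightarrow> \<zeta>"
    proof (rule metric_tendsto_imp_tendsto[OF LIMSEQ_inverse_real_of_nat])
      have "dist (w n) \<zeta> \<le> dist (inverse (real (Suc n))) 0" for n
        using w(1)[of n] by (simp add: inverse_eq_divide dist_commute)
      then show "\<forall>\<^sub>F n in sequentially. dist (w n) \<zeta> \<le> dist (inverse (real (Suc n))) 0" by simp
    qed
    have "range (\<lambda>n. f (w n)) \<subseteq> \<Omega>" using f_in[OF w(2)] by blast
    with bounded_\<Omega> have "bounded (range (\<lambda>n. f (w n)))" by (rule bounded_subset)
    from bounded_imp_convergent_subsequence[OF this]
    obtain q s where s': "strict_mono (s :: nat \<Rightarrow> nat)" "((\<lambda>n. f (w n)) \<circ> s) \<longlonglongrightarrow> q" by blast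
    then have s: "strict_mono s" "(\<lambda>n. f (w (s n))) \<longlonglongrightarrow> q" by (simp_all add: o_def)
    have ws: "(\<lambda>n. w (s n)) \<longlonglongrightarrow> \<zeta>" using LIMSEQ_subseq_LIMSEQ[OF wz s(1)] by (simp add: o_def)
    have q: "q \<in> frontier \<Omega>" by (rule limit_of_f_in_frontier[OF _ ws \<zeta>(1) s(2)]) (rule w(2))
    have "q \<in> sphere c r" by (rule closed_sequentially[OF closed_sphere _ s(2)]) (rule w(3))
    from lim[OF this q] obtain e where e: "e \<in> E" "(F \<longlongrightarrow> e) (at q within \<Omega>)" by blast
    have "f (w (s n)) \<in> \<Omega> \<and> f (w (s n)) \<noteq> q" for n using f_in[OF w(2)[of "s n"]] q by (auto simp: frontier_\<Omega>)
    then have "filterlim (\<lambda>n. f (w (s n))) (at q within \<Omega>) sequentially" using s(2) unfolding filterlim_at by simp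
    from filterlim_compose[OF e(2) this] have "(\<lambda>n. F (f (w (s n)))) \<longlonglongrightarrow> e" .
    then have "(\<lambda>n. w (s n)) \<longlonglongrightarrow> e" using Ff[OF w(2)] by simp
    then have "\<zeta> = e" using ws LIMSEQ_unique by blast
    then show False using e(1) \<zeta>(2) by simp
  qed
  then obtain \<delta> where \<delta>: "\<delta> > 0" "\<And>w. w \<in> ball \<zeta> \<delta> \<inter> ball 0 1 \<Longrightarrow> f w \<notin> sphere c r" by blast
  define N where "N = ball \<zeta> \<delta> \<inter> ball 0 1"
  have "connected N" unfolding N_def by (intro convex_connected convex_Int convex_ball)
  then have con: "connected (f ` N)"
    by (rule connected_continuous_image[rotated]) (auto simp: N_def intro: continuous_on_subset[OF cont_f])
  have "ball c r \<inter> f ` N = {} \<or> (- cball c r) \<inter> f ` N = {}"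
  proof (rule connectedD[OF con])
    show "f ` N \<subseteq> ball c r \<union> - cball c r" using \<delta>(2) by (force simp: N_def)
    show "ball c r \<inter> - cball c r \<inter> f ` N = {}" by auto
  qed (auto simp: open_Compl)
  then show ?thesis
  proof
    assume a: "ball c r \<inter> f ` N = {}"
    have "f w \<notin> cball c r" if "w \<in> N" for w
    proof -
      have "f w \<notin> ball c r" using that a by blast
      then show ?thesis using \<delta>(2)[of w] that by (auto simp: N_def)
    qed
    then show ?thesis using that[OF \<delta>(1)] unfolding N_def by blast
  next
    assume a: "(- cball c r) \<inter> f ` N = {}"
    have "f w \<in> ball c r" if "w \<in> N" for w
    proof -
      have "f w \<in> cball c r" using that a by blast
      then show ?thesis using \<delta>(2)[of w] that by (auto simp: N_def)
    qed
    then show ?thesis using that[OF \<delta>(1)] unfolding N_def by blast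
  qed
qed

text \<open>If \<open>e\<close> were not in \<open>E\<close>, a whole neighbourhood of
  \<open>e\<close> would be mapped into \<open>ball c r\<close>; then \<open>f\<close> could
  accumulate only at poles there, and \<open>Re h\<close> would be infinite along an arc. With a
  finite \<open>E\<close> this makes the limits of \<open>F\<close> locally constant along a
  segment.\<close>

lemma F_constant_near_pole:
  assumes h: "h holomorphic_on ball 0 1"
    and pole: "\<And>q. q \<in> frontier \<Omega> \<Longrightarrow> q \<in> cball c r \<Longrightarrow> filterlim (\<lambda>z. Re (h (F z))) at_top (at q within \<Omega>)"
    and sph: "\<And>q. q \<in> sphere c r \<Longrightarrow> q \<in> frontier \<Omega> \<Longrightarrow> \<exists>e\<in>E. (F \<longlongrightarrow> e) (at q within \<Omega>)" "closed E"
    and x: "x \<in> frontier \<Omega>" "x \<in> ball c r" "(F \<longlongrightarrow> e) (at x within \<Omega>)" "norm e = 1"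
  shows "e \<in> E"
proof (rule ccontr)
  assume e: "e \<notin> E"
  obtain \<delta> where \<delta>: "\<delta> > 0" "(\<forall>w\<in>ball e \<delta> \<inter> ball 0 1. f w \<in> ball c r) \<or> (\<forall>w\<in>ball e \<delta> \<inter> ball 0 1. f w \<notin> cball c r)"
    by (rule crosscut_neighbourhood[of c r E e]) (use sph(1) x(4) e that in blast)+
  have in\<Omega>: "\<forall>\<^sub>F z in at x within \<Omega>. z \<in> \<Omega>" by (auto simp: eventually_at_topological)
  have "\<forall>\<^sub>F z in nhds x. z \<in> ball c r" using x(2) by (intro eventually_nhds_in_open) auto
  then have "\<forall>\<^sub>F z in at x within \<Omega>. z \<in> ball c r" unfolding eventually_at_filter by (rule eventually_mono) simp
  moreover have "\<forall>\<^sub>F z in at x within \<Omega>. dist (F z) e < \<delta>" using x(3) \<delta>(1) by (rule tendstoD)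
  ultimately have "\<forall>\<^sub>F z in at x within \<Omega>. z \<in> \<Omega> \<and> z \<in> ball c r \<and> dist (F z) e < \<delta>"
    using in\<Omega> by (intro eventually_conj)
  from eventually_happens'[OF at_frontier_nontrivial[OF x(1)] this]
  obtain z where z: "z \<in> \<Omega>" "z \<in> ball c r" "dist (F z) e < \<delta>" by blast
  then have "F z \<in> ball e \<delta> \<inter> ball 0 1" "f (F z) \<in> ball c r" using F_in fF by (auto simp: dist_commute)
  then have inside: "f w \<in> ball c r" if "w \<in> ball e \<delta> \<inter> ball 0 1" for w
    using \<delta>(2) that by force
  define s0 where "s0 = Arg e"
  have cis0: "cis s0 = e" using x(4) cis_Arg[of e] by (cases "e = 0") (auto simp: s0_def sgn_div_norm)
  have "isCont cis s0" unfolding cis_conv_exp[abs_def] by (intro continuous_intros)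
  then obtain d where d: "d > 0" "\<And>s. dist s s0 < d \<Longrightarrow> dist (cis s) e < \<delta>"
    using \<delta>(1) cis0 unfolding continuous_at_eps_delta by metis
  show False
  proof (rule no_infinite_boundary_arc[OF h, of "s0 - d" "s0 + d"])
    fix s assume "s0 - d < s" "s < s0 + d"
    then have near: "dist (cis s) e < \<delta>" using d(2)[of s] by (auto simp: dist_real_def)
    have inb: "\<forall>\<^sub>F w in at (cis s) within ball 0 1. w \<in> ball (0::complex) 1"
      by (auto simp: eventually_at_topological)
    have "\<forall>\<^sub>F w in nhds (cis s). w \<in> ball e \<delta>" using near by (intro eventually_nhds_in_open) (auto simp: dist_commute)
    then have "\<forall>\<^sub>F w in at (cis s) within ball 0 1. w \<in> ball e \<delta>" unfolding eventually_at_filter by (rule eventually_mono) simp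
    from eventually_conj[OF this inb] have X: "\<forall>\<^sub>F w in at (cis s) within ball 0 1. f w \<in> ball c r"
      by (rule eventually_mono) (use inside in blast)
    have "filterlim (\<lambda>w. Re (h (F (f w)))) at_top (at (cis s) within ball 0 1)"
    proof (rule filterlim_comp_f[OF _ X, of "\<lambda>z. Re (h (F z))"])
      fix q assume "q \<in> frontier \<Omega>" "q \<in> closure (ball c r)"
      then have "filterlim (\<lambda>z. Re (h (F z))) at_top (at q within \<Omega>)" using closure_minimal[OF ball_subset_cball closed_cball, of c r] by (intro pole) auto
      then show "(\<exists>e. e \<noteq> cis s \<and> (F \<longlongrightarrow> e) (at q within \<Omega>)) \<or> filterlim (\<lambda>z. Re (h (F z))) at_top (at q within \<Omega>)" ..
    qed simp
    moreover have ev: "\<forall>\<^sub>F w in at (cis s) within ball 0 1. Re (h (F (f w))) = Re (h w)"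
      using inb by (rule eventually_mono) (simp only: Ff)
    ultimately show "filterlim (\<lambda>w. Re (h w)) at_top (at (cis s) within ball 0 1)"
      using filterlim_cong[OF refl refl ev, of at_top] by simp
  qed (use d(1) in simp)
qed

end

context harmonic_homeomorphism
begin

text \<open>Phragmen--Lindelof with the exceptional point \<open>w\<close>, applied to both
  coordinates of \<open>f - c\<close> and their negatives, makes \<open>f\<close> constant, against
  injectivity.\<close>

lemma f_constant_of_boundary_limits:
  assumes w: "norm w = 1"
    and lim: "\<And>\<zeta>. norm \<zeta> = 1 \<Longrightarrow> \<zeta> \<noteq> w \<Longrightarrow> (f \<longlongrightarrow> c) (at \<zeta> within ball 0 1)"
  shows False
proof -
  obtain B where B: "\<And>w. w \<in> ball 0 1 \<Longrightarrow> norm (f w) \<le> B" using f_bounded by blast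
  have le: "Re (G x) \<le> 0" if G: "G holomorphic_on ball 0 1" and x: "x \<in> ball 0 1"
    and bd: "\<And>x. x \<in> ball 0 1 \<Longrightarrow> Re (G x) \<le> norm (f x - c)" for G x
  proof (rule Phragmen_Lindelof_point[OF open_ball bounded_ball G, of "- cnj w" w "B + norm c"])
    show "Re (- cnj w * (\<xi> - w)) > 0" if "\<xi> \<in> ball 0 1" for \<xi>
      using that by (intro Re_one_minus_pos w) auto
    show "Re (G \<xi>) \<le> B + norm c" if "\<xi> \<in> ball 0 1" for \<xi>
      using bd[OF that] B[OF that] norm_triangle_ineq4[of "f \<xi>" c] by linarith
    fix \<zeta> :: complex and e :: real
    assume z: "\<zeta> \<in> frontier (ball 0 1)" "\<zeta> \<noteq> w" "e > 0"
    then have "norm \<zeta> = 1" by (simp add: frontier_ball)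
    from tendstoD[OF lim[OF this z(2)] z(3)]
    have "\<forall>\<^sub>F \<xi> in at \<zeta> within ball 0 1. dist (f \<xi>) c < e" .
    moreover have "\<forall>\<^sub>F \<xi> in at \<zeta> within ball 0 1. \<xi> \<in> ball (0::complex) 1"
      by (auto simp: eventually_at_topological)
    ultimately have "\<forall>\<^sub>F \<xi> in at \<zeta> within ball 0 1. dist (f \<xi>) c < e \<and> \<xi> \<in> ball 0 1" by (rule eventually_conj)
    then show "\<forall>\<^sub>F \<xi> in at \<zeta> within ball 0 1. Re (G \<xi>) < 0 + e"
    proof (rule eventually_mono)
      fix \<xi> assume "dist (f \<xi>) c < e \<and> \<xi> \<in> ball 0 1"
      then show "Re (G \<xi>) < 0 + e" using bd[of \<xi>] by (auto simp: dist_norm)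
    qed
  qed (fact x)
  have "f x = c" if x: "x \<in> ball 0 1" for x
  proof -
    have re: "\<bar>Re (\<Phi>\<^sub>1 y) - Re c\<bar> \<le> norm (f y - c)" "\<bar>Re (\<Phi>\<^sub>2 y) - Im c\<bar> \<le> norm (f y - c)" if "y \<in> ball 0 1" for y
      using abs_Re_le_cmod[of "f y - c"] abs_Im_le_cmod[of "f y - c"] f_eq[OF that] by auto
    have "Re (\<Phi>\<^sub>1 x - of_real (Re c)) \<le> 0"
      by (rule le[OF _ x]) (use re(1) in \<open>auto intro!: holomorphic_intros hol1 simp: abs_le_iff\<close>)
    moreover have "Re (of_real (Re c) - \<Phi>\<^sub>1 x) \<le> 0"
      by (rule le[OF _ x]) (use re(1) in \<open>auto intro!: holomorphic_intros hol1 simp: abs_le_iff\<close>)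
    moreover have "Re (\<Phi>\<^sub>2 x - of_real (Im c)) \<le> 0"
      by (rule le[OF _ x]) (use re(2) in \<open>auto intro!: holomorphic_intros hol2 simp: abs_le_iff\<close>)
    moreover have "Re (of_real (Im c) - \<Phi>\<^sub>2 x) \<le> 0"
      by (rule le[OF _ x]) (use re(2) in \<open>auto intro!: holomorphic_intros hol2 simp: abs_le_iff\<close>)
    ultimately show ?thesis using f_eq[OF x] by (simp add: complex_eq_iff)
  qed
  then have "f 0 = f (1/2)" by simp
  then have "F (f 0) = F (f (1/2))" by simp
  then have "(0::complex) = 1/2" by (subst (asm) (1 2) Ff) auto
  then show False by simp
qed

text \<open>Seen from the disc, the part of \<Omega> near \<open>c\<close> touches the circle at
  \<open>w\<close> alone. On its frontier inside the disc \<open>f\<close> has values on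
  \<open>sphere c r\<close>, close to \<open>p\<^sub>1\<close> or \<open>p\<^sub>2\<close> when
  \<open>w\<close> is approached. So every linear functional of \<open>f\<close> is controlled at
  \<open>w\<close> by its values at these two points, and limits of \<open>f\<close> at
  \<open>w\<close> from this part lie between them.\<close>

lemma common_limit_imp_segment:
  assumes c: "c \<in> frontier \<Omega>" and w: "norm w = 1"
    and lim: "\<And>q. q \<in> frontier \<Omega> \<Longrightarrow> q \<in> cball c r \<Longrightarrow> q \<noteq> c \<Longrightarrow> (F \<longlongrightarrow> w) (at q within \<Omega>)"
    and sph: "sphere c r \<inter> frontier \<Omega> \<subseteq> {p\<^sub>1, p\<^sub>2}" "c \<notin> sphere c r"
    and q0: "q\<^sub>0 \<in> frontier \<Omega>" "q\<^sub>0 \<in> ball c r" "q\<^sub>0 \<noteq> c"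
  shows "q\<^sub>0 \<in> closed_segment p\<^sub>1 p\<^sub>2"
proof (rule ccontr)
  assume q0seg: "q\<^sub>0 \<notin> closed_segment p\<^sub>1 p\<^sub>2"
  have lims: "\<exists>e\<in>{w}. (F \<longlongrightarrow> e) (at q within \<Omega>)" if "q \<in> sphere c r" "q \<in> frontier \<Omega>" for q
    using lim[OF that(2)] that(1) sph(2) by force
  \<comment> \<open>The crosscut argument puts every point of the circle other than \<open>w\<close>
    into exactly one of \<open>A\<close> and \<open>B\<close>; the circle without \<open>w\<close>
    is connected, so one of them contains it all.\<close>
  define A where "A = {\<zeta>. \<exists>\<delta>>0. \<forall>w\<in>ball \<zeta> \<delta> \<inter> ball 0 1. f w \<in> ball c r}"
  define B where "B = {\<zeta>. \<exists>\<delta>>0. \<forall>w\<in>ball \<zeta> \<delta> \<inter> ball 0 1. f w \<notin> cball c r}"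
  have open_near: "open {\<zeta>. \<exists>\<delta>>0. \<forall>w\<in>ball \<zeta> \<delta> \<inter> ball 0 1. P w}" for P :: "complex \<Rightarrow> bool"
    unfolding open_dist
  proof (intro ballI)
    fix \<zeta> assume "\<zeta> \<in> {\<zeta>. \<exists>\<delta>>0. \<forall>w\<in>ball \<zeta> \<delta> \<inter> ball 0 1. P w}"
    then obtain \<delta> where \<delta>: "\<delta> > 0" "\<And>w. w \<in> ball \<zeta> \<delta> \<inter> ball 0 1 \<Longrightarrow> P w" by blast
    have "\<exists>d>0. \<forall>w\<in>ball y d \<inter> ball 0 1. P w" if "dist y \<zeta> < \<delta> / 2" for y
    proof (intro exI[of _ "\<delta> / 2"] conjI ballI)
      fix w assume "w \<in> ball y (\<delta> / 2) \<inter> ball 0 1"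
      then show "P w" using that dist_triangle[of \<zeta> w y] by (intro \<delta>(2)) (auto simp: dist_commute)
    qed (use \<delta>(1) in simp)
    then show "\<exists>e>0. \<forall>y. dist y \<zeta> < e \<longrightarrow> y \<in> {\<zeta>. \<exists>\<delta>>0. \<forall>w\<in>ball \<zeta> \<delta> \<inter> ball 0 1. P w}"
      using \<delta>(1) by (intro exI[of _ "\<delta> / 2"]) auto
  qed
  have opAB: "open A" "open B" unfolding A_def B_def by (rule open_near)+
  define \<theta> where "\<theta> = Arg w"
  have cisw: "cis \<theta> = w" using w cis_Arg[of w] by (cases "w = 0") (auto simp: \<theta>_def sgn_div_norm)
  define C where "C = cis ` {\<theta><..<\<theta> + 2 * pi}"
  have conC: "connected C" unfolding C_def cis_conv_exp[abs_def]
    by (intro connected_continuous_image continuous_intros) auto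
  have C_eq: "\<zeta> \<in> C \<longleftrightarrow> norm \<zeta> = 1 \<and> \<zeta> \<noteq> w" for \<zeta>
  proof
    assume "\<zeta> \<in> C"
    then obtain t where t: "\<zeta> = cis t" "\<theta> < t" "t < \<theta> + 2 * pi" by (auto simp: C_def)
    have "cis (t - \<theta>) \<noteq> 1"
    proof
      assume "cis (t - \<theta>) = 1"
      then have "cos (t - \<theta>) = 1" by (metis cis.sel(1) one_complex.sel(1))
      then obtain n :: int where "t - \<theta> = n * 2 * pi" by (auto simp: cos_one_2pi_int)
      then have e: "n * (2 * pi) = t - \<theta>" by simp
      have "0 < n * (2 * pi)" "n * (2 * pi) < 1 * (2 * pi)" unfolding e using t by auto
      then have "0 < real_of_int n" "real_of_int n < 1" by (auto simp: zero_less_mult_iff mult_less_cancel_right)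
      then show False by simp
    qed
    moreover have "cis t = cis (t - \<theta>) * w" unfolding cisw[symmetric] by (simp add: cis_mult)
    moreover have "w \<noteq> 0" using w by auto
    ultimately have "cis t \<noteq> w" by simp
    then show "norm \<zeta> = 1 \<and> \<zeta> \<noteq> w" using t(1) by simp
  next
    assume z: "norm \<zeta> = 1 \<and> \<zeta> \<noteq> w"
    define a where "a = Arg2pi (\<zeta> / w)"
    have "cis a = \<zeta> / w" using Arg2pi_eq[of "\<zeta> / w"] w z by (simp add: a_def cis_conv_exp norm_divide)
    then have eq: "cis (\<theta> + a) = \<zeta>" using cisw w by (auto simp: cis_mult[symmetric])
    have "a \<noteq> 0" using eq cisw z by auto
    then have "0 < a" "a < 2 * pi" using Arg2pi_ge_0[of "\<zeta> / w"] Arg2pi_lt_2pi[of "\<zeta> / w"] by (auto simp: a_def)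
    then show "\<zeta> \<in> C" unfolding C_def using eq by (intro image_eqI[of _ _ "\<theta> + a"]) auto
  qed
  have cover: "C \<subseteq> A \<union> B"
  proof
    fix \<zeta> assume "\<zeta> \<in> C"
    then have z: "norm \<zeta> = 1" "\<zeta> \<notin> {w}" using C_eq by auto
    show "\<zeta> \<in> A \<union> B"
      by (rule crosscut_neighbourhood[of c r "{w}" \<zeta>]) (use lims z in \<open>auto simp: A_def B_def\<close>)
  qed
  have disj: "A \<inter> B \<inter> C = {}"
  proof -
    have False if z: "\<zeta> \<in> A" "\<zeta> \<in> B" "\<zeta> \<in> C" for \<zeta>
    proof -
      obtain d1 where d1: "d1 > 0" "\<And>w. w \<in> ball \<zeta> d1 \<inter> ball 0 1 \<Longrightarrow> f w \<in> ball c r" using z(1) by (auto simp: A_def)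
      obtain d2 where d2: "d2 > 0" "\<And>w. w \<in> ball \<zeta> d2 \<inter> ball 0 1 \<Longrightarrow> f w \<notin> cball c r" using z(2) by (auto simp: B_def)
      have "\<zeta> \<in> closure (ball 0 1)" using z(3) C_eq by simp
      then obtain x where "x \<in> ball 0 1" "dist x \<zeta> < min d1 d2" using d1(1) d2(1) unfolding closure_approachable by (metis min_less_iff_conj)
      then have "f x \<in> ball c r" "f x \<notin> cball c r" using d1(2)[of x] d2(2)[of x] by (auto simp: dist_commute)
      then show False by auto
    qed
    then show ?thesis by blast
  qed
  from connectedD[OF conC opAB disj cover] show False
  proof
    \<comment> \<open>Then \<open>f\<close> stays close to \<open>c\<close> at all points of the
      circle but \<open>w\<close>. There it cannot accumulate at frontier points other than
      \<open>c\<close>, where \<open>F\<close> tends to \<open>w\<close>; so it tends to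
      \<open>c\<close>.\<close>
    assume "B \<inter> C = {}"
    then have CA: "C \<subseteq> A" using cover by blast
    show False
    proof (rule f_constant_of_boundary_limits[OF w, of c])
      fix \<zeta> :: complex assume z: "norm \<zeta> = 1" "\<zeta> \<noteq> w"
      then have "\<zeta> \<in> A" using CA C_eq by blast
      then obtain d where d: "d > 0" "\<And>w. w \<in> ball \<zeta> d \<inter> ball 0 1 \<Longrightarrow> f w \<in> ball c r" by (auto simp: A_def)
      have X: "\<forall>\<^sub>F x in at \<zeta> within ball 0 1. f x \<in> ball c r" unfolding eventually_at
        using d by (intro exI[of _ d]) (auto simp: dist_commute)
      show "(f \<longlongrightarrow> c) (at \<zeta> within ball 0 1)"
      proof (rule filterlim_comp_f[OF z(1) X, of "\<lambda>x. x" "nhds c"])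
        fix q assume q: "q \<in> frontier \<Omega>" "q \<in> closure (ball c r)"
        then have "q \<in> cball c r" using closure_minimal[OF ball_subset_cball closed_cball, of c r] by blast
        then show "(\<exists>e. e \<noteq> \<zeta> \<and> (F \<longlongrightarrow> e) (at q within \<Omega>)) \<or> ((\<lambda>x. x) \<longlongrightarrow> c) (at q within \<Omega>)"
          using lim[OF q(1)] z(2) by (cases "q = c") (auto intro: tendsto_ident_at)
      qed
    qed
  next
    assume "A \<inter> C = {}"
    then have CB: "C \<subseteq> B" using cover by blast
    \<comment> \<open>\<open>l\<close> separates \<open>q\<^sub>0\<close> from the segment. With
      \<open>Re G\<close> equal to \<open>- inner l \<circ> f\<close>, the aim is an upper bound
      tending to \<open>- m\<close> at \<open>w\<close>; approaching \<open>w\<close> along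
      \<open>F z\<close> with \<open>z\<close> tending to \<open>q\<^sub>0\<close> then contradicts
      the separation.\<close>
    obtain l m where lm: "inner l q\<^sub>0 < m" "\<And>x. x \<in> closed_segment p\<^sub>1 p\<^sub>2 \<Longrightarrow> m < inner l x"
      using separating_hyperplane_closed_point[OF convex_closed_segment closed_segment q0seg] by blast
    define G where "G = (\<lambda>\<xi>. - (of_real (Re l) * \<Phi>\<^sub>1 \<xi> + of_real (Im l) * \<Phi>\<^sub>2 \<xi>))"
    have G: "G holomorphic_on ball 0 1" unfolding G_def by (intro holomorphic_intros hol1 hol2)
    have ReG: "Re (G \<xi>) = - inner l (f \<xi>)" if "\<xi> \<in> ball 0 1" for \<xi>
      using f_eq[OF that] by (simp add: G_def inner_complex_def)
    obtain M0 where M0: "\<And>w. w \<in> ball 0 1 \<Longrightarrow> norm (f w) \<le> M0" using f_bounded by blast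
    define M where "M = max (norm l * M0) (- m)"
    have M: "Re (G \<xi>) \<le> M" "- m \<le> M" if "\<xi> \<in> ball 0 1" for \<xi>
    proof -
      have "\<bar>inner l (f \<xi>)\<bar> \<le> norm l * norm (f \<xi>)" by (rule Cauchy_Schwarz_ineq2)
      also have "\<dots> \<le> norm l * M0" using M0[OF that] by (intro mult_left_mono) auto
      finally show "Re (G \<xi>) \<le> M" using ReG[OF that] by (auto simp: M_def)
    qed (simp add: M_def)
    have "\<exists>\<rho>>0. \<forall>x\<in>ball 0 1. f x \<in> sphere c r \<longrightarrow> dist x w < \<rho> \<longrightarrow> m \<le> inner l (f x)"
    proof (rule ccontr)
      assume neg: "\<not> ?thesis"
      have "\<exists>x. x \<in> ball 0 1 \<and> f x \<in> sphere c r \<and> dist x w < 1 / Suc n \<and> inner l (f x) < m" for n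
      proof -
        have "1 / real (Suc n) > 0" by simp
        then show ?thesis using neg by (meson not_le)
      qed
      then obtain x where x: "\<And>n. x n \<in> ball 0 1" "\<And>n. f (x n) \<in> sphere c r" "\<And>n. dist (x n) w < 1 / Suc n"
        "\<And>n. inner l (f (x n)) < m" by metis
      have xw: "x \<longlonglongrightarrow> w"
      proof (rule metric_tendsto_imp_tendsto[OF LIMSEQ_inverse_real_of_nat])
        have "dist (x n) w \<le> dist (inverse (real (Suc n))) 0" for n
          using x(3)[of n] by (simp add: inverse_eq_divide dist_commute)
        then show "\<forall>\<^sub>F n in sequentially. dist (x n) w \<le> dist (inverse (real (Suc n))) 0" by simp
      qed
      have "range (\<lambda>n. f (x n)) \<subseteq> \<Omega>" using f_in[OF x(1)] by blast
      with bounded_\<Omega> have "bounded (range (\<lambda>n. f (x n)))" by (rule bounded_subset)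
      from bounded_imp_convergent_subsequence[OF this]
      obtain q s where s': "strict_mono (s :: nat \<Rightarrow> nat)" "((\<lambda>n. f (x n)) \<circ> s) \<longlonglongrightarrow> q" by blast
      then have s: "strict_mono s" "(\<lambda>n. f (x (s n))) \<longlonglongrightarrow> q" by (simp_all add: o_def)
      have ws: "(\<lambda>n. x (s n)) \<longlonglongrightarrow> w" using LIMSEQ_subseq_LIMSEQ[OF xw s(1)] by (simp add: o_def)
      have q: "q \<in> frontier \<Omega>" by (rule limit_of_f_in_frontier[OF _ ws w s(2)]) (rule x(1))
      have "q \<in> sphere c r" by (rule closed_sequentially[OF closed_sphere _ s(2)]) (rule x(2))
      then have "q = p\<^sub>1 \<or> q = p\<^sub>2" using q sph(1) by blast
      then have "m < inner l q" using lm(2)[of q] by auto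
      moreover have "inner l q \<le> m"
        by (rule LIMSEQ_le_const2[OF tendsto_inner[OF tendsto_const s(2)]]) (use x(4) less_imp_le in blast)
      ultimately show False by simp
    qed
    then obtain \<rho> where \<rho>: "\<rho> > 0" "\<And>x. x \<in> ball 0 1 \<Longrightarrow> f x \<in> sphere c r \<Longrightarrow> dist x w < \<rho> \<Longrightarrow> m \<le> inner l (f x)" by blast
    define V where "V = F ` (\<Omega> \<inter> ball c r)"
    define U where "U = V \<inter> ball w \<rho>"
    have opV: "open V" unfolding V_def by (rule F_image_open[OF open_ball])
    have opU: "open U" unfolding U_def using opV by auto
    have V_iff: "x \<in> V \<longleftrightarrow> x \<in> ball 0 1 \<and> f x \<in> ball c r" for x
    proof
      assume "x \<in> V" then show "x \<in> ball 0 1 \<and> f x \<in> ball c r" using F_in fF by (auto simp: V_def)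
    next
      assume "x \<in> ball 0 1 \<and> f x \<in> ball c r"
      then have "x = F (f x)" "f x \<in> \<Omega> \<inter> ball c r" using Ff f_in by auto
      then show "x \<in> V" unfolding V_def by blast
    qed
    \<comment> \<open>At distance at least \<rho> from \<open>w\<close> the barrier is at least half
      of \<open>\<rho>\<^sup>2\<close>, so \<open>K\<close> times it is at least
      \<open>M + m\<close> and brings the crude bound \<open>M\<close> down to
      \<open>- m\<close>.\<close>
    define K where "K = 2 * (M + m) / \<rho>\<^sup>2"
    have K: "K \<ge> 0" using M(2)[of 0] \<rho>(1) by (simp add: K_def)
    define H where "H = (\<lambda>\<xi>. G \<xi> - of_real K * (- cnj w * (\<xi> - w)))"
    have H: "H holomorphic_on ball 0 1" unfolding H_def by (intro holomorphic_intros G)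
    have ReH: "Re (H \<xi>) = Re (G \<xi>) - K * Re (- cnj w * (\<xi> - w))" for \<xi>
      by (simp add: H_def del: times_complex.sel) (simp add: algebra_simps)
    have bound: "Re (H x) \<le> - m" if x: "x \<in> U" for x
    proof (rule Phragmen_Lindelof_point[OF opU _ _ _ _ _ x, of H "- cnj w" w M])
      show "bounded U" unfolding U_def by (meson bounded_Int bounded_ball)
      show "H holomorphic_on U" using H by (rule holomorphic_on_subset) (use V_iff in \<open>auto simp: U_def\<close>)
      show pos: "Re (- cnj w * (\<xi> - w)) > 0" if "\<xi> \<in> U" for \<xi>
        using that V_iff by (intro Re_one_minus_pos w) (auto simp: U_def)
      show "Re (H \<xi>) \<le> M" if "\<xi> \<in> U" for \<xi>
      proof -
        have "K * Re (- cnj w * (\<xi> - w)) \<ge> 0" using K pos[OF that] by (intro mult_nonneg_nonneg) auto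
        moreover have "Re (G \<xi>) \<le> M" using that V_iff by (intro M) (auto simp: U_def)
        ultimately show ?thesis unfolding ReH by linarith
      qed
      fix \<zeta> :: complex and e :: real
      assume z: "\<zeta> \<in> frontier U" "\<zeta> \<noteq> w" "e > 0"
      have zU: "\<zeta> \<in> closure U" "\<zeta> \<notin> U" using z(1) interior_open[OF opU] by (auto simp: frontier_def)
      have zV: "\<zeta> \<in> closure V" using zU(1) closure_mono[of U V] by (auto simp: U_def)
      have "V \<subseteq> cball 0 1" using V_iff by auto
      then have "norm \<zeta> \<le> 1" using zV closure_minimal[OF _ closed_cball, of V 0 1] by auto
      moreover have "norm \<zeta> \<noteq> 1"
      proof
        assume "norm \<zeta> = 1"
        then have "\<zeta> \<in> B" using CB C_eq z(2) by blast
        then obtain d where d: "d > 0" "\<And>w. w \<in> ball \<zeta> d \<inter> ball 0 1 \<Longrightarrow> f w \<notin> cball c r" by (auto simp: B_def)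
        obtain y where "y \<in> V" "dist y \<zeta> < d" using zV d(1) unfolding closure_approachable by blast
        then show False using d(2)[of y] V_iff[of y] by (auto simp: dist_commute)
      qed
      ultimately have zb: "\<zeta> \<in> ball 0 1" by simp
      have contf: "isCont f \<zeta>" using cont_f zb continuous_on_eq_continuous_at[OF open_ball] by blast
      have fcb: "f \<zeta> \<in> cball c r"
      proof -
        obtain y where y: "\<And>n. y n \<in> V" "y \<longlonglongrightarrow> \<zeta>" using zV unfolding closure_sequential by auto
        have "f (y n) \<in> cball c r" for n using y(1)[of n] V_iff[of "y n"] by auto
        then show ?thesis by (rule closed_sequentially[OF closed_cball _ isCont_tendsto_compose[OF contf y(2)]])
      qed
      have "Re (H \<zeta>) \<le> - m"
      proof (cases "dist \<zeta> w < \<rho>")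
        case True
        have "f \<zeta> \<notin> ball c r" using zU(2) zb V_iff[of \<zeta>] True by (auto simp: U_def dist_commute)
        then have "f \<zeta> \<in> sphere c r" using fcb by auto
        from \<rho>(2)[OF zb this True] have "Re (G \<zeta>) \<le> - m" using ReG[OF zb] by simp
        moreover have "K * Re (- cnj w * (\<zeta> - w)) \<ge> 0"
          using K Re_one_minus_pos[OF w, of \<zeta>] zb by (intro mult_nonneg_nonneg) auto
        ultimately show ?thesis unfolding ReH by linarith
      next
        case False
        have "\<rho>\<^sup>2 / 2 \<le> (norm (\<zeta> - w))\<^sup>2 / 2" using False \<rho>(1) by (simp add: dist_norm power_mono)
        also have "\<dots> \<le> Re (- cnj w * (\<zeta> - w))" using zb by (intro Re_one_minus_ge w) auto
        finally have "K * (\<rho>\<^sup>2 / 2) \<le> K * Re (- cnj w * (\<zeta> - w))" using K by (rule mult_left_mono)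
        moreover have "K * (\<rho>\<^sup>2 / 2) = M + m" using \<rho>(1) by (simp add: K_def)
        ultimately show ?thesis unfolding ReH using M(1)[OF zb] by linarith
      qed
      moreover have "isCont H \<zeta>" using H zb holomorphic_on_imp_continuous_on continuous_on_eq_continuous_at[OF open_ball] by blast
      then have "((\<lambda>\<xi>. Re (H \<xi>)) \<longlongrightarrow> Re (H \<zeta>)) (at \<zeta> within U)" unfolding isCont_def
        by (intro tendsto_Re) (rule tendsto_within_subset[OF _ subset_UNIV])
      ultimately show "\<forall>\<^sub>F \<xi> in at \<zeta> within U. Re (H \<xi>) < - m + e" using z(3) by (intro order_tendstoD(2)) auto
    qed
    have Fl: "(F \<longlongrightarrow> w) (at q\<^sub>0 within \<Omega>)" using lim[of q\<^sub>0] q0 by auto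
    have ev: "\<forall>\<^sub>F z in at q\<^sub>0 within \<Omega>. - inner l z \<le> - m + K * Re (- cnj w * (F z - w))"
    proof -
      have in\<Omega>: "\<forall>\<^sub>F z in at q\<^sub>0 within \<Omega>. z \<in> \<Omega>" by (auto simp: eventually_at_topological)
      have "\<forall>\<^sub>F z in nhds q\<^sub>0. z \<in> ball c r" using q0(2) by (intro eventually_nhds_in_open) auto
      then have "\<forall>\<^sub>F z in at q\<^sub>0 within \<Omega>. z \<in> ball c r" unfolding eventually_at_filter by (rule eventually_mono) simp
      moreover have "\<forall>\<^sub>F z in at q\<^sub>0 within \<Omega>. dist (F z) w < \<rho>" using Fl \<rho>(1) by (rule tendstoD)
      ultimately have "\<forall>\<^sub>F z in at q\<^sub>0 within \<Omega>. z \<in> \<Omega> \<and> z \<in> ball c r \<and> dist (F z) w < \<rho>"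
        using in\<Omega> by (intro eventually_conj)
      then show ?thesis
      proof (rule eventually_mono)
        fix z assume z: "z \<in> \<Omega> \<and> z \<in> ball c r \<and> dist (F z) w < \<rho>"
        then have "F z \<in> U" using V_iff[of "F z"] F_in fF by (auto simp: U_def dist_commute)
        from bound[OF this] have "Re (G (F z)) \<le> - m + K * Re (- cnj w * (F z - w))" unfolding ReH by linarith
        then show "- inner l z \<le> - m + K * Re (- cnj w * (F z - w))" using ReG[of "F z"] F_in fF z by simp
      qed
    qed
    have "- inner l q\<^sub>0 \<le> - m + K * Re (- cnj w * (w - w))"
    proof (rule tendsto_le[OF at_frontier_nontrivial[OF q0(1)] _ _ ev])
      show "((\<lambda>z. - m + K * Re (- cnj w * (F z - w))) \<longlongrightarrow> - m + K * Re (- cnj w * (w - w))) (at q\<^sub>0 within \<Omega>)"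
        by (intro tendsto_intros Fl)
      show "((\<lambda>z. - inner l z) \<longlongrightarrow> - inner l q\<^sub>0) (at q\<^sub>0 within \<Omega>)"
        by (intro tendsto_intros)
    qed
    then show False using lm(1) by simp
  qed
qed

end

section \<open>Asymptotics at a jump of the boundary values\<close>

text \<open>The branch of the logarithm that is continuous on the closed upper half plane without \<open>0\<close>.\<close>

definition hlog :: "complex \<Rightarrow> complex" where
  "hlog \<zeta> = Ln (- \<i> * \<zeta>) + \<i> * of_real (pi / 2)"

lemma hlog_arg_domain: "Im \<zeta> \<ge> 0 \<Longrightarrow> \<zeta> \<noteq> 0 \<Longrightarrow> - \<i> * \<zeta> \<notin> \<real>\<^sub>\<le>\<^sub>0"
  by (auto simp: complex_nonpos_Reals_iff complex_eq_iff)

lemma hlog_holomorphic: "hlog holomorphic_on {\<zeta>. Im \<zeta> > 0}"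
  unfolding hlog_def using hlog_arg_domain
  by (intro holomorphic_intros) (metis less_imp_le less_irrefl mem_Collect_eq zero_complex.sel(2))

lemma deriv_hlog:
  assumes "Im \<zeta> > 0" shows "(hlog has_field_derivative 1 / \<zeta>) (at \<zeta>)"
proof -
  have "\<zeta> \<noteq> 0" using assms by auto
  then have z: "- \<i> * \<zeta> \<notin> \<real>\<^sub>\<le>\<^sub>0" "\<zeta> \<noteq> 0" using assms hlog_arg_domain[of \<zeta>] by simp_all
  have "(hlog has_field_derivative inverse (- \<i> * \<zeta>) * (- \<i>) + 0) (at \<zeta>)"
    unfolding hlog_def using z(1) by (auto intro!: derivative_eq_intros)
  then show ?thesis using z(2) by (simp add: field_simps)
qed

lemma Re_hlog: "\<zeta> \<noteq> 0 \<Longrightarrow> Re (hlog \<zeta>) = ln (norm \<zeta>)"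
  by (simp add: hlog_def norm_mult)

text \<open>Thus \<open>Im (hlog \<zeta>) / pi\<close> is the bounded harmonic function with
  boundary values 0 on the positive and 1 on the negative half axis, the model of a jump.\<close>

lemma hlog_of_real:
  "s > 0 \<Longrightarrow> Im (hlog (of_real s)) = 0" "s < 0 \<Longrightarrow> Im (hlog (of_real s)) = pi"
proof -
  show "Im (hlog (of_real s)) = 0" if "s > 0"
  proof -
    have "Ln (- \<i> * of_real s) = Ln (of_real s * (- \<i>))" by (simp add: mult.commute)
    also have "\<dots> = of_real (ln s) + Ln (- \<i>)" using that by (subst Ln_times_of_real) (auto simp: Ln_of_real)
    finally show ?thesis by (simp add: hlog_def)
  qed
  show "Im (hlog (of_real s)) = pi" if "s < 0"
  proof -
    have "Ln (- \<i> * of_real s) = Ln (of_real (- s) * \<i>)" by (simp add: mult.commute)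
    also have "\<dots> = of_real (ln (- s)) + Ln \<i>" using that by (subst Ln_times_of_real) (auto simp: Ln_of_real simp flip: of_real_minus)
    finally show ?thesis by (simp add: hlog_def)
  qed
qed

lemma hlog_tendsto: "s \<noteq> 0 \<Longrightarrow> (hlog \<longlongrightarrow> hlog (of_real s)) (at (of_real s) within S)"
  unfolding hlog_def using hlog_arg_domain[of "of_real s"] by (intro tendsto_intros) auto

lemma Im_hlog_bounds:
  assumes "Im \<zeta> > 0" shows "0 < Im (hlog \<zeta>)" "Im (hlog \<zeta>) < pi"
proof -
  have "\<bar>Im (Ln (- \<i> * \<zeta>))\<bar> < pi / 2"
    using assms by (subst Re_Ln_pos_lt) auto
  then show "0 < Im (hlog \<zeta>)" "Im (hlog \<zeta>) < pi" by (auto simp: hlog_def)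
qed

lemma hlog_polar:
  assumes "\<rho> > 0" "0 < \<theta>" "\<theta> < pi"
  shows "Im (hlog (of_real \<rho> * cis \<theta>)) = \<theta>"
proof -
  have "- \<i> * (of_real \<rho> * cis \<theta>) = of_real \<rho> * cis (\<theta> - pi / 2)"
    by (simp add: complex_eq_iff cos_diff sin_diff)
  also have "\<dots> = exp (of_real (ln \<rho>) + \<i> * of_real (\<theta> - pi / 2))"
    using assms(1) by (simp add: exp_add cis_conv_exp exp_of_real)
  finally have "Ln (- \<i> * (of_real \<rho> * cis \<theta>)) = of_real (ln \<rho>) + \<i> * of_real (\<theta> - pi / 2)"
    using assms by (simp only:) (rule Ln_exp, auto)
  then show ?thesis by (simp add: hlog_def)
qed

text \<open>Only the real part is bounded, so Cauchy's inequality is applied to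
  \<open>g = exp (G / M)\<close>, whose norm is between \<open>exp (- 1)\<close> and
  \<open>exp 1\<close>. Radius \<open>r / 2\<close> gives \<open>2 * exp 1 / r\<close> for
  \<open>deriv g\<close>, and \<open>deriv G = M * deriv g / g\<close> costs another factor
  \<open>exp 1\<close>.\<close>

lemma deriv_le_of_bounded_Re:
  assumes G: "G holomorphic_on ball z r" and r: "r > 0" and M: "M > 0"
    and le: "\<And>\<xi>. \<xi> \<in> ball z r \<Longrightarrow> \<bar>Re (G \<xi>)\<bar> \<le> M"
  shows "norm (deriv G z) \<le> 2 * exp 2 * M / r"
proof -
  define g where "g = (\<lambda>\<xi>. exp (G \<xi> / of_real M))"
  have g: "g holomorphic_on ball z r" unfolding g_def using M by (intro holomorphic_intros G) auto
  have sub: "cball z (r / 2) \<subseteq> ball z r" using r by (auto simp: dist_commute)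
  have ng: "norm (g \<xi>) \<le> exp 1" "norm (g \<xi>) \<ge> exp (- 1)" if "\<xi> \<in> ball z r" for \<xi>
    using le[OF that] M by (auto simp: g_def norm_exp_eq_Re Re_divide_of_real abs_le_iff field_simps)
  have "norm ((deriv ^^ 1) g z) \<le> fact 1 * exp 1 / (r / 2) ^ 1"
  proof (rule Cauchy_inequality)
    show "g holomorphic_on ball z (r / 2)" using g by (rule holomorphic_on_subset) (use sub ball_subset_cball in blast)
    show "continuous_on (cball z (r / 2)) g" using g sub by (meson continuous_on_subset holomorphic_on_imp_continuous_on)
    show "norm (g x) \<le> exp 1" if "norm (z - x) = r / 2" for x
      using that r by (intro ng) (simp add: dist_norm)
  qed (use r in simp)
  then have dg: "norm (deriv g z) \<le> exp 1 / (r / 2)" by simp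
  have zb: "z \<in> ball z r" using r by simp
  have Gd: "(G has_field_derivative deriv G z) (at z)"
    using G zb holomorphic_derivI[OF G open_ball] by blast
  have "(g has_field_derivative g z * (deriv G z / of_real M)) (at z)"
    unfolding g_def using M by (auto intro!: derivative_eq_intros Gd)
  then have "deriv g z = g z * (deriv G z / of_real M)" by (rule DERIV_imp_deriv)
  then have "norm (deriv g z) = norm (g z) * (norm (deriv G z) / M)" using M by (simp add: norm_mult norm_divide)
  then have "exp (- 1) * (norm (deriv G z) / M) \<le> norm (deriv g z)"
    using mult_right_mono[OF ng(2)[OF zb], of "norm (deriv G z) / M"] M by simp
  also note dg
  finally have "exp 1 * (exp (- 1) * (norm (deriv G z) / M)) \<le> exp 1 * (exp 1 / (r / 2))" by (rule mult_left_mono) simp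
  moreover have "exp 1 * (exp (- 1) * (norm (deriv G z) / M)) = norm (deriv G z) / M"
    by (simp add: exp_minus)
  ultimately have "norm (deriv G z) / M \<le> exp 1 * (exp 1 / (r / 2))" by (simp only:)
  moreover have "exp (2::real) = exp 1 * exp 1" using exp_add[of 1 "1::real"] by simp
  ultimately have "norm (deriv G z) / M \<le> 2 * exp 2 / r" by (simp add: mult_ac)
  then show ?thesis using M r by (simp add: field_simps)
qed

text \<open>The point \<open>0\<close>, where nothing is assumed about the boundary values, is removable.\<close>

lemma bounded_harmonic_boundary_zero:
  assumes G: "G holomorphic_on {\<zeta>. Im \<zeta> > 0}" and a: "a > 0" and M: "M > 0"
    and bd: "\<And>\<zeta>. \<bar>Re \<zeta>\<bar> < a \<Longrightarrow> 0 < Im \<zeta> \<Longrightarrow> Im \<zeta> < a \<Longrightarrow> \<bar>Re (G \<zeta>)\<bar> \<le> M"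
    and lim: "\<And>s. 0 < \<bar>s\<bar> \<Longrightarrow> \<bar>s\<bar> < a \<Longrightarrow> ((\<lambda>\<zeta>. Re (G \<zeta>)) \<longlongrightarrow> 0) (at (of_real s) within {\<zeta>. Im \<zeta> > 0})"
    and \<zeta>: "\<bar>Re \<zeta>\<bar> < a / 2" "0 < Im \<zeta>" "Im \<zeta> < a / 2"
  shows "\<bar>Re (G \<zeta>)\<bar> \<le> 4 * M / a * Im \<zeta>"
proof -
  \<comment> \<open>The box is centred over \<zeta> and has half the size: it stays where
    \<open>G\<close> is controlled, and on its axis the barrier is at most
    \<open>2 * b * Im \<zeta>\<close>, which gives the linear bound.\<close>
  define s0 where "s0 = Re \<zeta>"
  define b where "b = a / 2"
  have b: "b > 0" using a by (simp add: b_def)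
  define S where "S = box (Complex (s0 - b) 0) (Complex (s0 + b) b)"
  have S_iff: "\<xi> \<in> S \<longleftrightarrow> \<bar>Re \<xi> - s0\<bar> < b \<and> 0 < Im \<xi> \<and> Im \<xi> < b" for \<xi>
    by (auto simp: S_def in_box_complex_iff abs_less_iff)
  have SQ: "\<bar>Re \<xi>\<bar> < a \<and> 0 < Im \<xi> \<and> Im \<xi> < a" if "\<xi> \<in> S" for \<xi>
  proof -
    have "\<bar>Re \<xi>\<bar> \<le> \<bar>Re \<xi> - s0\<bar> + \<bar>s0\<bar>" by linarith
    moreover have "\<bar>Re \<xi> - s0\<bar> < a / 2" "\<bar>s0\<bar> < a / 2" "0 < Im \<xi>" "Im \<xi> < a / 2"
      using that \<zeta>(1) unfolding S_iff b_def s0_def by auto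
    ultimately show ?thesis using a by linarith
  qed
  have opS: "open S" by (simp add: S_def open_box)
  have half: "Re (H \<zeta>) \<le> M / b\<^sup>2 * Re (square_barrier b s0 \<zeta>)"
    if H: "H holomorphic_on {\<zeta>. Im \<zeta> > 0}" and ReH: "(\<lambda>\<zeta>. Re (H \<zeta>)) = (\<lambda>\<zeta>. Re (G \<zeta>)) \<or> (\<lambda>\<zeta>. Re (H \<zeta>)) = (\<lambda>\<zeta>. - Re (G \<zeta>))" for H
  proof -
    have HM: "Re (H \<xi>) \<le> M" if "\<xi> \<in> S" for \<xi>
    proof -
      have "\<bar>Re (G \<xi>)\<bar> \<le> M" using SQ[OF that] by (intro bd) auto
      then show ?thesis using ReH by (auto dest!: fun_cong[of _ _ \<xi>])
    qed
    have nn: "0 \<le> M / b\<^sup>2 * Re (square_barrier b s0 \<xi>)" if "\<xi> \<in> S" for \<xi>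
      using that M b by (intro mult_nonneg_nonneg square_barrier_nonneg) (auto simp: S_iff)
    have "Re (H \<zeta> - of_real (M / b\<^sup>2) * square_barrier b s0 \<zeta>) \<le> 0"
    \<comment> \<open>The exceptional point is 0; the factor \<open>- \<i>\<close> turns the upper
      half plane into the right one required for the logarithm.\<close>
    proof (rule Phragmen_Lindelof_point[where S = S and c = "- \<i>" and w = 0 and M = M and G = "\<lambda>\<zeta>. H \<zeta> - of_real (M / b\<^sup>2) * square_barrier b s0 \<zeta>"])
      show "open S" by (fact opS)
      show "bounded S" by (simp add: S_def)
      show "(\<lambda>\<zeta>. H \<zeta> - of_real (M / b\<^sup>2) * square_barrier b s0 \<zeta>) holomorphic_on S"
        by (intro holomorphic_intros holomorphic_on_subset[OF H]) (auto simp: S_iff)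
      show "0 < Re (- \<i> * (\<xi> - 0))" if "\<xi> \<in> S" for \<xi> using that by (simp add: S_iff)
      have Reeq: "Re (H \<xi> - of_real (M / b\<^sup>2) * square_barrier b s0 \<xi>) = Re (H \<xi>) - M / b\<^sup>2 * Re (square_barrier b s0 \<xi>)" for \<xi>
        by (simp add: Re_divide_of_real)
      show "Re (H \<xi> - of_real (M / b\<^sup>2) * square_barrier b s0 \<xi>) \<le> M" if "\<xi> \<in> S" for \<xi>
        unfolding Reeq using HM[OF that] nn[OF that] by linarith
      show "\<zeta> \<in> S" using \<zeta> b by (simp add: S_iff s0_def b_def)
      fix \<xi>0 :: complex and e :: real
      assume z: "\<xi>0 \<in> frontier S" "\<xi>0 \<noteq> 0" and e: "e > 0"
      have inS: "\<forall>\<^sub>F \<xi> in at \<xi>0 within S. \<xi> \<in> S" by (auto simp: eventually_at_topological)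
      have zc: "\<xi>0 \<in> cbox (Complex (s0 - b) 0) (Complex (s0 + b) b)"
        using z(1) closure_minimal[OF box_subset_cbox closed_cbox, of "Complex (s0 - b) 0" "Complex (s0 + b) b"]
        by (auto simp: frontier_def S_def)
      then have zb: "\<bar>Re \<xi>0 - s0\<bar> \<le> b" "0 \<le> Im \<xi>0" "Im \<xi>0 \<le> b" by (auto simp: in_cbox_complex_iff abs_le_iff)
      show "\<forall>\<^sub>F \<xi> in at \<xi>0 within S. Re (H \<xi> - of_real (M / b\<^sup>2) * square_barrier b s0 \<xi>) < 0 + e"
      proof (cases "Im \<xi>0 = 0")
        case True
        then have r: "\<xi>0 = of_real (Re \<xi>0)" by (simp add: complex_eq_iff)
        have "0 < \<bar>Re \<xi>0\<bar>" using r z(2) by (metis of_real_0 zero_less_abs_iff)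
        moreover have "\<bar>Re \<xi>0\<bar> < a"
        proof -
          have "\<bar>Re \<xi>0\<bar> \<le> \<bar>Re \<xi>0 - s0\<bar> + \<bar>s0\<bar>" by linarith
          then show ?thesis using zb(1) \<zeta>(1) unfolding s0_def[symmetric] b_def by linarith
        qed
        ultimately have "((\<lambda>\<zeta>. Re (G \<zeta>)) \<longlongrightarrow> 0) (at \<xi>0 within {\<zeta>. Im \<zeta> > 0})" using lim[of "Re \<xi>0"] r by simp
        then have "((\<lambda>\<zeta>. Re (G \<zeta>)) \<longlongrightarrow> 0) (at \<xi>0 within S)" by (rule tendsto_within_subset) (auto simp: S_iff)
        then have "((\<lambda>\<zeta>. Re (H \<zeta>)) \<longlongrightarrow> 0) (at \<xi>0 within S)" using ReH tendsto_minus[of "\<lambda>\<zeta>. Re (G \<zeta>)" 0] by auto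
        from order_tendstoD(2)[OF this e] inS
        have "\<forall>\<^sub>F \<xi> in at \<xi>0 within S. Re (H \<xi>) < e \<and> \<xi> \<in> S" by (rule eventually_conj)
        then show ?thesis
        proof (rule eventually_mono)
          fix \<xi> assume "Re (H \<xi>) < e \<and> \<xi> \<in> S"
          then show "Re (H \<xi> - of_real (M / b\<^sup>2) * square_barrier b s0 \<xi>) < 0 + e" unfolding Reeq using nn[of \<xi>] by linarith
        qed
      next
        case False
        have "\<xi>0 \<notin> S" using z(1) interior_open[OF opS] by (auto simp: frontier_def)
        then have "\<bar>Re \<xi>0 - s0\<bar> = b \<or> Im \<xi>0 = b" using zb False by (auto simp: S_iff)
        then have "b\<^sup>2 \<le> Re (square_barrier b s0 \<xi>0)" using zb by (intro square_barrier_side) auto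
        then have "M / b\<^sup>2 * b\<^sup>2 \<le> M / b\<^sup>2 * Re (square_barrier b s0 \<xi>0)" using M by (intro mult_left_mono) auto
        then have ge: "M - e < M / b\<^sup>2 * Re (square_barrier b s0 \<xi>0)" using b e by simp
        have "((\<lambda>\<xi>. M / b\<^sup>2 * Re (square_barrier b s0 \<xi>)) \<longlongrightarrow> M / b\<^sup>2 * Re (square_barrier b s0 \<xi>0)) (at \<xi>0 within S)"
          unfolding square_barrier_def by (intro tendsto_intros)
        from eventually_conj[OF order_tendstoD(1)[OF this ge] inS]
        show ?thesis
        proof (rule eventually_mono)
          fix \<xi> assume "M - e < M / b\<^sup>2 * Re (square_barrier b s0 \<xi>) \<and> \<xi> \<in> S"
          then show "Re (H \<xi> - of_real (M / b\<^sup>2) * square_barrier b s0 \<xi>) < 0 + e" unfolding Reeq using HM[of \<xi>] by linarith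
        qed
      qed
    qed
    then show ?thesis by (simp add: Re_divide_of_real)
  qed
  have 1: "Re (G \<zeta>) \<le> M / b\<^sup>2 * Re (square_barrier b s0 \<zeta>)" by (rule half[OF G]) simp
  have 2: "Re ((\<lambda>\<zeta>. - G \<zeta>) \<zeta>) \<le> M / b\<^sup>2 * Re (square_barrier b s0 \<zeta>)"
    by (rule half[OF holomorphic_on_minus[OF G]]) simp
  have "Re (square_barrier b s0 \<zeta>) \<le> 2 * b * Im \<zeta>" by (simp add: Re_square_barrier s0_def)
  then have "M / b\<^sup>2 * Re (square_barrier b s0 \<zeta>) \<le> M / b\<^sup>2 * (2 * b * Im \<zeta>)" using M by (intro mult_left_mono) auto
  also have "\<dots> = 4 * M / a * Im \<zeta>" using a by (simp add: b_def power2_eq_square field_simps)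
  finally show ?thesis using 1 2 by (simp add: abs_le_iff)
qed

text \<open>\<open>p + k * Im (hlog \<zeta>)\<close> with \<open>k = (n - p) / pi\<close> has the
  prescribed values on both half axes; \<open>P\<close> is what remains of \<open>G\<close> after
  its removal. \<open>Re P\<close> vanishes on the real axis off 0 and so is bounded by a multiple
  of \<open>Im \<zeta>\<close>; this bounds \<open>deriv P\<close> up to the boundary, and then
  \<open>P\<close> itself.\<close>

lemma jump_asymptotics:
  assumes G: "G holomorphic_on {\<zeta>. Im \<zeta> > 0}" and a: "a > 0"
    and bd: "\<And>\<zeta>. \<bar>Re \<zeta>\<bar> < a \<Longrightarrow> 0 < Im \<zeta> \<Longrightarrow> Im \<zeta> < a \<Longrightarrow> \<bar>Re (G \<zeta>)\<bar> \<le> M"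
    and pos: "\<And>s. 0 < s \<Longrightarrow> s < a \<Longrightarrow> ((\<lambda>\<zeta>. Re (G \<zeta>)) \<longlongrightarrow> p) (at (of_real s) within {\<zeta>. Im \<zeta> > 0})"
    and neg: "\<And>s. - a < s \<Longrightarrow> s < 0 \<Longrightarrow> ((\<lambda>\<zeta>. Re (G \<zeta>)) \<longlongrightarrow> n) (at (of_real s) within {\<zeta>. Im \<zeta> > 0})"
  obtains C \<delta> where "\<delta> > 0" "C > 0"
    "\<And>\<zeta>. norm \<zeta> < \<delta> \<Longrightarrow> Im \<zeta> > 0 \<Longrightarrow> \<bar>Re (G \<zeta>) - (p + (n - p) / pi * Im (hlog \<zeta>))\<bar> \<le> C * Im \<zeta>"
    "\<And>\<zeta>. norm \<zeta> < \<delta> \<Longrightarrow> Im \<zeta> > 0 \<Longrightarrow> \<bar>Im (G \<zeta>) + (n - p) / pi * ln (norm \<zeta>)\<bar> \<le> C"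
    "\<And>\<zeta>. norm \<zeta> < \<delta> \<Longrightarrow> Im \<zeta> > 0 \<Longrightarrow> norm (deriv G \<zeta> + \<i> * of_real ((n - p) / pi) / \<zeta>) \<le> C"
proof -
  define k where "k = (n - p) / pi"
  define P where "P = (\<lambda>\<zeta>. G \<zeta> - of_real p + \<i> * of_real k * hlog \<zeta>)"
  have P: "P holomorphic_on {\<zeta>. Im \<zeta> > 0}" unfolding P_def by (intro holomorphic_intros G hlog_holomorphic)
  have ReP: "Re (P \<zeta>) = Re (G \<zeta>) - (p + k * Im (hlog \<zeta>))" for \<zeta> by (simp add: P_def)
  have ImP: "Im (P \<zeta>) = Im (G \<zeta>) + k * Re (hlog \<zeta>)" for \<zeta> by (simp add: P_def)
  define M' where "M' = \<bar>M\<bar> + \<bar>p\<bar> + \<bar>k\<bar> * pi + 1"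
  have M': "M' > 0" unfolding M'_def by (intro add_nonneg_pos add_nonneg_nonneg) auto
  have bP: "\<bar>Re (P \<zeta>)\<bar> \<le> M'" if "\<bar>Re \<zeta>\<bar> < a" "0 < Im \<zeta>" "Im \<zeta> < a" for \<zeta>
  proof -
    have "\<bar>k * Im (hlog \<zeta>)\<bar> \<le> \<bar>k\<bar> * pi" unfolding abs_mult using Im_hlog_bounds[OF that(2)] by (intro mult_left_mono) auto
    then show ?thesis using bd[OF that] unfolding ReP M'_def by linarith
  qed
  have limP: "((\<lambda>\<zeta>. Re (P \<zeta>)) \<longlongrightarrow> 0) (at (of_real s) within {\<zeta>. Im \<zeta> > 0})" if "0 < \<bar>s\<bar>" "\<bar>s\<bar> < a" for s
  proof (cases "s > 0")
    case True
    have "((\<lambda>\<zeta>. Re (G \<zeta>) - (p + k * Im (hlog \<zeta>))) \<longlongrightarrow> p - (p + k * Im (hlog (of_real s)))) (at (of_real s) within {\<zeta>. Im \<zeta> > 0})"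
      using True that by (intro tendsto_intros pos hlog_tendsto) auto
    then show ?thesis using hlog_of_real(1)[OF True] by (simp add: ReP)
  next
    case False
    then have s: "s < 0" using that by auto
    have "((\<lambda>\<zeta>. Re (G \<zeta>) - (p + k * Im (hlog \<zeta>))) \<longlongrightarrow> n - (p + k * Im (hlog (of_real s)))) (at (of_real s) within {\<zeta>. Im \<zeta> > 0})"
      using s that by (intro tendsto_intros neg hlog_tendsto) auto
    then show ?thesis using hlog_of_real(2)[OF s] by (simp add: ReP k_def)
  qed
  define C1 where "C1 = 4 * M' / a"
  have C1: "C1 > 0" using M' a by (simp add: C1_def)
  have lin: "\<bar>Re (P \<zeta>)\<bar> \<le> C1 * Im \<zeta>" if "\<bar>Re \<zeta>\<bar> < a / 2" "0 < Im \<zeta>" "Im \<zeta> < a / 2" for \<zeta>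
    unfolding C1_def by (rule bounded_harmonic_boundary_zero[OF P a M' bP limP that])
  \<comment> \<open>A quarter of \<open>a\<close> keeps the disc of radius \<open>Im \<zeta>\<close>
    around \<zeta> where the linear bound holds. On it the imaginary part is at most
    \<open>2 * Im \<zeta>\<close>, so \<open>Im \<zeta>\<close> cancels from the gradient bound and
    \<open>4 * exp 2 * C1\<close> remains.\<close>
  define \<delta> where "\<delta> = a / 4"
  have \<delta>: "\<delta> > 0" using a by (simp add: \<delta>_def)
  have coords: "\<bar>Re \<zeta>\<bar> < \<delta>" "\<bar>Im \<zeta>\<bar> < \<delta>" if "norm \<zeta> < \<delta>" for \<zeta>
    using that abs_Re_le_cmod[of \<zeta>] abs_Im_le_cmod[of \<zeta>] by auto
  define C2 where "C2 = 4 * exp 2 * C1"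
  have C2: "C2 > 0" using C1 by (simp add: C2_def)
  have der: "norm (deriv P \<zeta>) \<le> C2" if z: "norm \<zeta> < \<delta>" "Im \<zeta> > 0" for \<zeta>
  proof -
    have "norm (deriv P \<zeta>) \<le> 2 * exp 2 * (C1 * (2 * Im \<zeta>)) / Im \<zeta>"
    proof (rule deriv_le_of_bounded_Re)
      have near: "\<bar>Re \<xi> - Re \<zeta>\<bar> < Im \<zeta> \<and> \<bar>Im \<xi> - Im \<zeta>\<bar> < Im \<zeta>" if "\<xi> \<in> ball \<zeta> (Im \<zeta>)" for \<xi>
        using that abs_Re_le_cmod[of "\<xi> - \<zeta>"] abs_Im_le_cmod[of "\<xi> - \<zeta>"] by (auto simp: dist_norm norm_minus_commute)
      show "P holomorphic_on ball \<zeta> (Im \<zeta>)"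
        by (rule holomorphic_on_subset[OF P]) (use near in \<open>force simp: abs_less_iff\<close>)
      show "\<bar>Re (P \<xi>)\<bar> \<le> C1 * (2 * Im \<zeta>)" if "\<xi> \<in> ball \<zeta> (Im \<zeta>)" for \<xi>
      proof -
        have "\<bar>Re \<xi>\<bar> < a / 2" "0 < Im \<xi>" "Im \<xi> < a / 2" "Im \<xi> \<le> 2 * Im \<zeta>"
          using near[OF that] coords[OF z(1)] by (auto simp: \<delta>_def abs_less_iff)
        from lin[OF this(1-3)] mult_left_mono[OF this(4), of C1] C1 show ?thesis by linarith
      qed
    qed (use z C1 in auto)
    then show ?thesis using z(2) by (simp add: C2_def)
  qed
  define z0 where "z0 = Complex 0 (\<delta> / 2)"
  have z0: "norm z0 < \<delta>" "Im z0 > 0" using \<delta> by (auto simp: z0_def cmod_def)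
  define S where "S = ball 0 \<delta> \<inter> {\<zeta>. Im \<zeta> > 0}"
  have "convex S" unfolding S_def by (intro convex_Int convex_ball convex_halfspace_Im_gt)
  have diffP: "norm (P \<zeta> - P z0) \<le> C2 * norm (\<zeta> - z0)" if "\<zeta> \<in> S" for \<zeta>
  proof (rule field_differentiable_bound[OF \<open>convex S\<close>, of P "deriv P"])
    show "(P has_field_derivative deriv P z) (at z within S)" if "z \<in> S" for z
      using that holomorphic_derivI[OF P open_halfspace_Im_gt] by (auto simp: S_def intro: has_field_derivative_at_within)
    show "norm (deriv P z) \<le> C2" if "z \<in> S" for z using that by (intro der) (auto simp: S_def)
    show "z0 \<in> S" using z0 by (simp add: S_def)
  qed (fact that)
  define C3 where "C3 = C2 * (2 * \<delta>) + norm (P z0)"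
  have bdP: "norm (P \<zeta>) \<le> C3" if z: "norm \<zeta> < \<delta>" "Im \<zeta> > 0" for \<zeta>
  proof -
    have "norm (\<zeta> - z0) \<le> 2 * \<delta>" using z z0 norm_triangle_ineq4[of \<zeta> z0] by linarith
    then have "C2 * norm (\<zeta> - z0) \<le> C2 * (2 * \<delta>)" using C2 by (intro mult_left_mono) auto
    moreover have "norm (P \<zeta> - P z0) \<le> C2 * norm (\<zeta> - z0)" using z by (intro diffP) (simp add: S_def)
    moreover have "norm (P \<zeta>) \<le> norm (P \<zeta> - P z0) + norm (P z0)" using norm_triangle_sub[of "P \<zeta>" "P z0"] by linarith
    ultimately show ?thesis unfolding C3_def by linarith
  qed
  define C where "C = C1 + C2 + \<bar>C3\<bar>"
  show ?thesis
  proof (rule that[OF \<delta>, of C])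
    show "C > 0" using C1 C2 by (simp add: C_def)
    fix \<zeta> assume z: "norm \<zeta> < \<delta>" "Im \<zeta> > 0"
    have "\<bar>Re (P \<zeta>)\<bar> \<le> C1 * Im \<zeta>" using coords[OF z(1)] z(2) by (intro lin) (auto simp: \<delta>_def)
    also have "\<dots> \<le> C * Im \<zeta>" using z(2) C2 by (intro mult_right_mono) (auto simp: C_def)
    finally show "\<bar>Re (G \<zeta>) - (p + (n - p) / pi * Im (hlog \<zeta>))\<bar> \<le> C * Im \<zeta>" unfolding ReP k_def .
    have "\<bar>Im (P \<zeta>)\<bar> \<le> norm (P \<zeta>)" by (rule abs_Im_le_cmod)
    also have "\<dots> \<le> C" using bdP[OF z] C1 C2 by (simp add: C_def)
    finally have "\<bar>Im (P \<zeta>)\<bar> \<le> C" .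
    moreover have "\<zeta> \<noteq> 0" using z by auto
    ultimately show "\<bar>Im (G \<zeta>) + (n - p) / pi * ln (norm \<zeta>)\<bar> \<le> C" unfolding ImP k_def by (simp add: Re_hlog)
    have "(G has_field_derivative deriv G \<zeta>) (at \<zeta>)" using holomorphic_derivI[OF G open_halfspace_Im_gt] z by simp
    then have "(P has_field_derivative deriv G \<zeta> - 0 + \<i> * of_real k * (1 / \<zeta>)) (at \<zeta>)"
      unfolding P_def by (intro derivative_intros DERIV_cmult deriv_hlog z)
    then have "deriv P \<zeta> = deriv G \<zeta> + \<i> * of_real k / \<zeta>" by (subst DERIV_imp_deriv) auto
    then show "norm (deriv G \<zeta> + \<i> * of_real ((n - p) / pi) / \<zeta>) \<le> C"
      using der[OF z] C1 by (simp add: k_def C_def)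
  qed
qed

text \<open>Multiplication by \<open>\<zeta>\<^sup>2\<close> and passage to 0 along the imaginary
  axis isolate the leading coefficients: \<open>\<zeta> * deriv G \<zeta>\<close> tends to
  \<open>- \<i> * k\<close>, whose square is \<open>- k\<^sup>2\<close>.\<close>

lemma jump_null_relation:
  assumes G: "G\<^sub>1 holomorphic_on {\<zeta>. Im \<zeta> > 0}" "G\<^sub>2 holomorphic_on {\<zeta>. Im \<zeta> > 0}" "G\<^sub>3 holomorphic_on {\<zeta>. Im \<zeta> > 0}"
    and null: "\<And>\<zeta>. Im \<zeta> > 0 \<Longrightarrow> (deriv G\<^sub>1 \<zeta>)\<^sup>2 + (deriv G\<^sub>2 \<zeta>)\<^sup>2 = (deriv G\<^sub>3 \<zeta>)\<^sup>2"
    and \<delta>: "\<delta> > 0"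
    and near: "\<And>\<zeta>. norm \<zeta> < \<delta> \<Longrightarrow> Im \<zeta> > 0 \<Longrightarrow> norm (deriv G\<^sub>1 \<zeta> + \<i> * of_real k\<^sub>1 / \<zeta>) \<le> C"
      "\<And>\<zeta>. norm \<zeta> < \<delta> \<Longrightarrow> Im \<zeta> > 0 \<Longrightarrow> norm (deriv G\<^sub>2 \<zeta> + \<i> * of_real k\<^sub>2 / \<zeta>) \<le> C"
      "\<And>\<zeta>. norm \<zeta> < \<delta> \<Longrightarrow> Im \<zeta> > 0 \<Longrightarrow> norm (deriv G\<^sub>3 \<zeta> + \<i> * of_real k\<^sub>3 / \<zeta>) \<le> C"
  shows "k\<^sub>1\<^sup>2 + k\<^sub>2\<^sup>2 = k\<^sub>3\<^sup>2"
proof -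
  have lim: "((\<lambda>q. (\<i> * of_real q) * deriv G (\<i> * of_real q)) \<longlongrightarrow> - \<i> * of_real k) (at_right 0)"
    if near: "\<And>\<zeta>. norm \<zeta> < \<delta> \<Longrightarrow> Im \<zeta> > 0 \<Longrightarrow> norm (deriv G \<zeta> + \<i> * of_real k / \<zeta>) \<le> C" for G and k :: real
  proof -
    have "((\<lambda>q. (\<i> * of_real q) * deriv G (\<i> * of_real q) - (- \<i> * of_real k)) \<longlongrightarrow> 0) (at_right 0)"
    proof (rule Lim_null_comparison)
      show "\<forall>\<^sub>F q in at_right 0. norm ((\<i> * of_real q) * deriv G (\<i> * of_real q) - (- \<i> * of_real k)) \<le> q * C"
        unfolding eventually_at
      proof (intro exI[of _ \<delta>] conjI ballI impI)
        fix q :: real assume q: "q \<in> {0<..}" "q \<noteq> 0 \<and> dist q 0 < \<delta>"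
        have "(\<i> * of_real q) * deriv G (\<i> * of_real q) - (- \<i> * of_real k) = (\<i> * of_real q) * (deriv G (\<i> * of_real q) + \<i> * of_real k / (\<i> * of_real q))"
          using q by (simp add: field_simps)
        then have "norm ((\<i> * of_real q) * deriv G (\<i> * of_real q) - (- \<i> * of_real k)) = q * norm (deriv G (\<i> * of_real q) + \<i> * of_real k / (\<i> * of_real q))"
          using q by (simp add: norm_mult)
        also have "\<dots> \<le> q * C" using q by (intro mult_left_mono near) (auto simp: norm_mult)
        finally show "norm ((\<i> * of_real q) * deriv G (\<i> * of_real q) - (- \<i> * of_real k)) \<le> q * C" .
      qed (fact \<delta>)
      show "((\<lambda>q. q * C) \<longlongrightarrow> 0) (at_right 0)" by (rule tendsto_eq_intros refl | simp)+
    qed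
    then show ?thesis by (simp only: LIM_zero_iff)
  qed
  have lim0: "((\<lambda>q. ((\<i> * of_real q) * deriv G\<^sub>1 (\<i> * of_real q))\<^sup>2 + ((\<i> * of_real q) * deriv G\<^sub>2 (\<i> * of_real q))\<^sup>2
      - ((\<i> * of_real q) * deriv G\<^sub>3 (\<i> * of_real q))\<^sup>2) \<longlongrightarrow> (- \<i> * of_real k\<^sub>1)\<^sup>2 + (- \<i> * of_real k\<^sub>2)\<^sup>2 - (- \<i> * of_real k\<^sub>3)\<^sup>2) (at_right 0)"
    by (intro tendsto_intros lim near)
  have ev0: "\<forall>\<^sub>F q in at_right 0. ((\<i> * of_real q) * deriv G\<^sub>1 (\<i> * of_real q))\<^sup>2 + ((\<i> * of_real q) * deriv G\<^sub>2 (\<i> * of_real q))\<^sup>2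
      - ((\<i> * of_real q) * deriv G\<^sub>3 (\<i> * of_real q))\<^sup>2 = 0"
    unfolding eventually_at
  proof (intro exI[of _ 1] conjI ballI impI)
    fix q :: real assume q: "q \<in> {0<..}"
    have "((\<i> * of_real q) * deriv G\<^sub>1 (\<i> * of_real q))\<^sup>2 + ((\<i> * of_real q) * deriv G\<^sub>2 (\<i> * of_real q))\<^sup>2
      - ((\<i> * of_real q) * deriv G\<^sub>3 (\<i> * of_real q))\<^sup>2 = (\<i> * of_real q)\<^sup>2 * ((deriv G\<^sub>1 (\<i> * of_real q))\<^sup>2 + (deriv G\<^sub>2 (\<i> * of_real q))\<^sup>2 - (deriv G\<^sub>3 (\<i> * of_real q))\<^sup>2)"
      by (simp add: power_mult_distrib ring_distribs)
    also have "\<dots> = 0" using null[of "\<i> * of_real q"] q by simp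
    finally show "((\<i> * of_real q) * deriv G\<^sub>1 (\<i> * of_real q))\<^sup>2 + ((\<i> * of_real q) * deriv G\<^sub>2 (\<i> * of_real q))\<^sup>2
      - ((\<i> * of_real q) * deriv G\<^sub>3 (\<i> * of_real q))\<^sup>2 = 0" .
  qed simp
  have "(- \<i> * of_real k\<^sub>1)\<^sup>2 + (- \<i> * of_real k\<^sub>2)\<^sup>2 - (- \<i> * of_real k\<^sub>3)\<^sup>2 = (0::complex)"
    by (rule tendsto_unique[OF trivial_limit_at_right_real lim0 tendsto_eventually[OF ev0]])
  then have "complex_of_real (k\<^sub>3\<^sup>2) - complex_of_real (k\<^sub>1\<^sup>2 + k\<^sub>2\<^sup>2) = 0"
    by (simp add: power_mult_distrib algebra_simps)
  then have "complex_of_real (k\<^sub>1\<^sup>2 + k\<^sub>2\<^sup>2) = complex_of_real (k\<^sub>3\<^sup>2)"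
    by (simp only: right_minus_eq)
  then show ?thesis unfolding of_real_eq_iff .
qed

text \<open>The comparison function is the real part of
  \<open>- \<i> * (\<zeta> - \<zeta> ^ 3 / (2 * a\<^sup>2))\<close>. It vanishes on the real axis,
  is at most 0 on the vertical sides of the box of width \<open>2 * a\<close> and height
  \<open>a\<close>, at most \<open>3 * a / 2\<close> on the top, and at least \<open>q\<close> at
  \<open>\<i> * q\<close>.\<close>

lemma Hopf_boundary_growth:
  assumes K: "K holomorphic_on {\<zeta>. Im \<zeta> > 0}" and pos: "\<And>\<zeta>. Im \<zeta> > 0 \<Longrightarrow> Re (K \<zeta>) > 0" and a: "a > 0"
  obtains c where "c > 0" "\<And>q. 0 < q \<Longrightarrow> q < a \<Longrightarrow> c * q \<le> Re (K (\<i> * of_real q))"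
proof -
  have contK: "continuous_on {\<zeta>. Im \<zeta> > 0} K" using K holomorphic_on_imp_continuous_on by blast
  define L where "L = cbox (Complex (- a) a) (Complex a a)"
  have "compact L" "L \<noteq> {}" using a by (auto simp: L_def in_cbox_complex_iff intro!: exI[of _ "Complex 0 a"] simp flip: ex_in_conv)
  moreover have "continuous_on L (\<lambda>\<zeta>. Re (K \<zeta>))"
    using a by (intro continuous_intros continuous_on_subset[OF contK]) (auto simp: L_def in_cbox_complex_iff)
  ultimately obtain y where y: "y \<in> L" "\<And>x. x \<in> L \<Longrightarrow> Re (K y) \<le> Re (K x)"
    using continuous_attains_inf[of L "\<lambda>\<zeta>. Re (K \<zeta>)"] by blast
  define \<tau> where "\<tau> = Re (K y)"
  have \<tau>: "\<tau> > 0" unfolding \<tau>_def using y(1) a by (intro pos) (auto simp: L_def in_cbox_complex_iff)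
  \<comment> \<open>\<tau> is the minimum of \<open>Re K\<close> on the top side; \<kappa> scales
    the comparison function, at most \<open>3 * a / 2\<close> there, down to \<tau>.\<close>
  define \<kappa> where "\<kappa> = 2 * \<tau> / (3 * a)"
  have \<kappa>: "\<kappa> > 0" using \<tau> a by (simp add: \<kappa>_def)
  define b where "b = (\<lambda>\<zeta>::complex. - \<i> * (\<zeta> - \<zeta> ^ 3 / of_real (2 * a\<^sup>2)))"
  have Reb: "Re (b \<zeta>) = Im \<zeta> * (1 - (3 * (Re \<zeta>)\<^sup>2 - (Im \<zeta>)\<^sup>2) / (2 * a\<^sup>2))" for \<zeta>
    using a by (simp add: b_def power3_eq_cube power2_eq_square Im_divide_of_real field_simps del: of_real_mult of_real_power)
  have hb: "b holomorphic_on X" for X unfolding b_def using a by (intro holomorphic_intros) auto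
  define S where "S = box (Complex (- a) 0) (Complex a a)"
  have S_iff: "\<xi> \<in> S \<longleftrightarrow> \<bar>Re \<xi>\<bar> < a \<and> 0 < Im \<xi> \<and> Im \<xi> < a" for \<xi>
    by (auto simp: S_def in_box_complex_iff abs_less_iff)
  have opS: "open S" by (simp add: S_def open_box)
  show ?thesis
  proof (rule that[OF \<kappa>])
    fix q assume q: "0 < q" "q < a"
    define p where "p = \<i> * complex_of_real q"
    have "Re (of_real \<kappa> * b p - K p) \<le> 0"
    proof (rule Re_maximum_principle[where S = S and G = "\<lambda>\<zeta>. of_real \<kappa> * b \<zeta> - K \<zeta>"])
      show "open S" by (fact opS)
      show "bounded S" by (simp add: S_def)
      show "(\<lambda>\<zeta>. of_real \<kappa> * b \<zeta> - K \<zeta>) holomorphic_on S"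
        by (intro holomorphic_intros hb holomorphic_on_subset[OF K]) (auto simp: S_iff)
      show "p \<in> S" using q a by (simp add: S_iff p_def)
      fix z :: complex and e :: real
      assume z: "z \<in> frontier S" and e: "e > 0"
      have "z \<in> cbox (Complex (- a) 0) (Complex a a)"
        using z closure_minimal[OF box_subset_cbox closed_cbox, of "Complex (- a) 0" "Complex a a"]
        by (auto simp: frontier_def S_def)
      then have zb: "\<bar>Re z\<bar> \<le> a" "0 \<le> Im z" "Im z \<le> a" by (auto simp: in_cbox_complex_iff abs_le_iff)
      have blim: "((\<lambda>\<zeta>. Re (b \<zeta>)) \<longlongrightarrow> Re (b z)) (at z within S)"
        unfolding b_def using a by (intro tendsto_intros) auto
      show "\<forall>\<^sub>F \<xi> in at z within S. Re (of_real \<kappa> * b \<xi> - K \<xi>) < 0 + e"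
      proof (cases "Im z = 0")
        case True
        then have "Re (b z) = 0" by (simp add: Reb)
        then have "((\<lambda>\<zeta>. \<kappa> * Re (b \<zeta>)) \<longlongrightarrow> 0) (at z within S)" using tendsto_mult_left[OF blim, of \<kappa>] by simp
        then have "\<forall>\<^sub>F \<xi> in at z within S. \<kappa> * Re (b \<xi>) < e" using e by (rule order_tendstoD(2))
        moreover have "\<forall>\<^sub>F \<xi> in at z within S. \<xi> \<in> S" by (auto simp: eventually_at_topological)
        ultimately have "\<forall>\<^sub>F \<xi> in at z within S. \<kappa> * Re (b \<xi>) < e \<and> \<xi> \<in> S" by (rule eventually_conj)
        then show ?thesis
        proof (rule eventually_mono)
          fix \<xi> assume "\<kappa> * Re (b \<xi>) < e \<and> \<xi> \<in> S"
          then show "Re (of_real \<kappa> * b \<xi> - K \<xi>) < 0 + e" using pos[of \<xi>] by (simp add: S_iff)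
        qed
      next
        case False
        then have imz: "Im z > 0" using zb by simp
        have "z \<notin> S" using z interior_open[OF opS] by (auto simp: frontier_def)
        then consider "\<bar>Re z\<bar> = a" | "Im z = a" using zb imz by (auto simp: S_iff)
        then have "\<kappa> * Re (b z) \<le> Re (K z)"
        proof cases
          case 1
          have "(Im z)\<^sup>2 \<le> a\<^sup>2" using zb by (simp add: power_mono)
          moreover have "(Re z)\<^sup>2 = a\<^sup>2" using 1 by (metis power2_abs)
          ultimately have "2 * a\<^sup>2 \<le> 3 * (Re z)\<^sup>2 - (Im z)\<^sup>2" by simp
          then have "1 - (3 * (Re z)\<^sup>2 - (Im z)\<^sup>2) / (2 * a\<^sup>2) \<le> 0" using a by (simp add: field_simps)
          then have "Re (b z) \<le> 0" unfolding Reb using imz by (intro mult_nonneg_nonpos) auto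
          then have "\<kappa> * Re (b z) \<le> 0" using \<kappa> by (intro mult_nonneg_nonpos) auto
          then show ?thesis using pos[OF imz] by linarith
        next
          case 2
          have "0 \<le> (Re z)\<^sup>2 / a\<^sup>2" by simp
          moreover have "1 - (3 * (Re z)\<^sup>2 - (Im z)\<^sup>2) / (2 * a\<^sup>2) = 3 / 2 - 3 / 2 * ((Re z)\<^sup>2 / a\<^sup>2)" using a 2 by (simp add: field_simps)
          ultimately have "1 - (3 * (Re z)\<^sup>2 - (Im z)\<^sup>2) / (2 * a\<^sup>2) \<le> 3 / 2" by linarith
          then have "Re (b z) \<le> a * (3 / 2)" unfolding Reb 2 using a by (intro mult_left_mono) auto
          then have "\<kappa> * Re (b z) \<le> \<kappa> * (a * (3 / 2))" using \<kappa> by (intro mult_left_mono) auto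
          also have "\<dots> = \<tau>" using a by (simp add: \<kappa>_def)
          also have "\<tau> \<le> Re (K z)" unfolding \<tau>_def using zb 2 by (intro y(2)) (auto simp: L_def in_cbox_complex_iff abs_le_iff)
          finally show ?thesis .
        qed
        then have less: "\<kappa> * Re (b z) - Re (K z) < 0 + e" using e by simp
        have lim: "((\<lambda>\<zeta>. Re (of_real \<kappa> * b \<zeta> - K \<zeta>)) \<longlongrightarrow> \<kappa> * Re (b z) - Re (K z)) (at z within S)"
        proof -
          have "isCont K z" using contK imz continuous_on_eq_continuous_at[OF open_halfspace_Im_gt] by blast
          then have "(K \<longlongrightarrow> K z) (at z within S)" unfolding isCont_def by (rule tendsto_within_subset) simp
          from tendsto_diff[OF tendsto_mult_left[OF blim, of \<kappa>] tendsto_Re[OF this]] show ?thesis by simp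
        qed
        from order_tendstoD(2)[OF lim less] show ?thesis .
      qed
    qed
    then have "\<kappa> * Re (b p) \<le> Re (K p)" by simp
    moreover have "q \<le> Re (b p)"
    proof -
      have "Re (b p) = q + q * (q\<^sup>2 / (2 * a\<^sup>2))" by (simp add: Reb p_def ring_distribs)
      moreover have "0 \<le> q * (q\<^sup>2 / (2 * a\<^sup>2))" using q by simp
      ultimately show ?thesis by linarith
    qed
    then have "\<kappa> * q \<le> \<kappa> * Re (b p)" using \<kappa> by (intro mult_left_mono) auto
    ultimately show "\<kappa> * q \<le> Re (K (\<i> * of_real q))" unfolding p_def by linarith
  qed
qed

text \<open>If the jump went the wrong way, then by Hopf's lemma for \<open>deriv G\<^sub>2 / deriv G\<^sub>1\<close> the function
  \<open>Re G\<^sub>2\<close> would decrease along the imaginary axis from its boundary value \<open>0\<close>.\<close>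

lemma jump_orientation:
  assumes G: "G\<^sub>1 holomorphic_on {\<zeta>. Im \<zeta> > 0}" "G\<^sub>2 holomorphic_on {\<zeta>. Im \<zeta> > 0}"
    and jac: "\<And>\<zeta>. Im \<zeta> > 0 \<Longrightarrow> Im (deriv G\<^sub>1 \<zeta> * cnj (deriv G\<^sub>2 \<zeta>)) > 0"
    and \<delta>: "\<delta> > 0" and C: "C > 0"
    and near1: "\<And>\<zeta>. norm \<zeta> < \<delta> \<Longrightarrow> Im \<zeta> > 0 \<Longrightarrow> norm (deriv G\<^sub>1 \<zeta> + \<i> * of_real k / \<zeta>) \<le> C"
    and near2: "\<And>\<zeta>. norm \<zeta> < \<delta> \<Longrightarrow> Im \<zeta> > 0 \<Longrightarrow> norm (deriv G\<^sub>2 \<zeta>) \<le> C"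
    and small: "\<And>\<zeta>. norm \<zeta> < \<delta> \<Longrightarrow> Im \<zeta> > 0 \<Longrightarrow> \<bar>Re (G\<^sub>2 \<zeta>)\<bar> \<le> C * Im \<zeta>"
    and up: "\<And>q. 0 < q \<Longrightarrow> q < \<delta> \<Longrightarrow> Re (G\<^sub>2 (\<i> * of_real q)) > 0"
  shows "k \<le> 0"
proof (rule ccontr)
  assume "\<not> k \<le> 0"
  then have k: "k > 0" by simp
  have d1: "deriv G\<^sub>1 \<zeta> \<noteq> 0" if "Im \<zeta> > 0" for \<zeta> using jac[OF that] by auto
  have dG: "deriv G\<^sub>1 holomorphic_on {\<zeta>. Im \<zeta> > 0}" "deriv G\<^sub>2 holomorphic_on {\<zeta>. Im \<zeta> > 0}"
    using G open_halfspace_Im_gt by (auto intro!: holomorphic_deriv)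
  \<comment> \<open>A positive Jacobian means that \<open>R\<close> has negative imaginary part, so
    \<open>\<i> * R\<close> has positive real part and Hopf's lemma applies to it.\<close>
  define R where "R = (\<lambda>\<zeta>. deriv G\<^sub>2 \<zeta> / deriv G\<^sub>1 \<zeta>)"
  have R: "R holomorphic_on {\<zeta>. Im \<zeta> > 0}" unfolding R_def using d1 by (intro holomorphic_intros dG) auto
  have ImR: "Re (\<i> * R \<zeta>) > 0" if "Im \<zeta> > 0" for \<zeta>
  proof -
    have "deriv G\<^sub>1 \<zeta> * cnj (deriv G\<^sub>2 \<zeta>) = of_real ((norm (deriv G\<^sub>1 \<zeta>))\<^sup>2) * cnj (R \<zeta>)"
      using d1[OF that] by (simp add: R_def complex_norm_square field_simps del: of_real_power)
    then have "Im (deriv G\<^sub>1 \<zeta> * cnj (deriv G\<^sub>2 \<zeta>)) = (norm (deriv G\<^sub>1 \<zeta>))\<^sup>2 * (- Im (R \<zeta>))"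
      by (simp only: Im_complex_of_real Re_complex_of_real times_complex.sel complex_cnj) simp
    then have "(norm (deriv G\<^sub>1 \<zeta>))\<^sup>2 * (- Im (R \<zeta>)) > 0" using jac[OF that] by simp
    then have "- Im (R \<zeta>) > 0" using zero_less_mult_pos d1[OF that] by (metis zero_less_norm_iff zero_less_power)
    then show ?thesis by simp
  qed
  have iR: "(\<lambda>\<zeta>. \<i> * R \<zeta>) holomorphic_on {\<zeta>. Im \<zeta> > 0}" by (intro holomorphic_intros R)
  obtain c where c: "c > 0" "\<And>q. 0 < q \<Longrightarrow> q < \<delta> \<Longrightarrow> c * q \<le> Re (\<i> * R (\<i> * of_real q))"
    by (rule Hopf_boundary_growth[OF iR ImR \<delta>]) (assumption | (rule that; blast))+
  \<comment> \<open>The bound \<open>k / (2 * C)\<close> keeps the norm of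
    \<open>deriv G\<^sub>1\<close> at least half of its leading term \<open>k / q\<close>. The last
    bound makes the Hopf term \<open>k * c\<close> at least as large as the error
    \<open>2 * C * C * q / k\<close> coming from the remainder \<open>E\<close>.\<close>
  define q0 where "q0 = min \<delta> (min (k / (2 * C)) (k * (k * c) / (2 * C * C)))"
  have q0: "q0 > 0" "q0 \<le> \<delta>" "q0 \<le> k / (2 * C)" "q0 \<le> k * (k * c) / (2 * C * C)" using \<delta> k C c by (auto simp: q0_def)
  define g where "g = (\<lambda>q. Re (G\<^sub>2 (\<i> * of_real q)))"
  have der: "(g has_real_derivative Re (\<i> * deriv G\<^sub>2 (\<i> * of_real q))) (at q)" if "q > 0" for q
  proof -
    have "(G\<^sub>2 has_field_derivative deriv G\<^sub>2 (\<i> * of_real q)) (at (\<i> * of_real q))"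
      using holomorphic_derivI[OF G(2) open_halfspace_Im_gt] that by simp
    moreover have "((\<lambda>q. \<i> * of_real q) has_vector_derivative \<i>) (at q)"
      by (auto intro!: derivative_eq_intros)
    ultimately have "((G\<^sub>2 \<circ> (\<lambda>q. \<i> * of_real q)) has_vector_derivative (\<i> * deriv G\<^sub>2 (\<i> * of_real q))) (at q)"
      by (intro field_vector_diff_chain_at)
    then have "((\<lambda>q. Re ((G\<^sub>2 \<circ> (\<lambda>q. \<i> * of_real q)) q)) has_vector_derivative Re (\<i> * deriv G\<^sub>2 (\<i> * of_real q))) (at q)"
      by (rule bounded_linear.has_vector_derivative[OF bounded_linear_Re])
    then show ?thesis by (simp add: g_def o_def has_real_derivative_iff_has_vector_derivative)
  qed
  have der_neg: "Re (\<i> * deriv G\<^sub>2 (\<i> * of_real q)) \<le> 0" if q: "0 < q" "q < q0" for q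
  proof -
    define \<zeta> where "\<zeta> = \<i> * complex_of_real q"
    have z: "norm \<zeta> < \<delta>" "Im \<zeta> > 0" using q q0 by (auto simp: \<zeta>_def norm_mult)
    define E where "E = deriv G\<^sub>1 \<zeta> + \<i> * of_real k / \<zeta>"
    have E: "norm E \<le> C" unfolding E_def by (rule near1[OF z])
    have ik: "\<i> * of_real k / \<zeta> = of_real (k / q)" using q by (simp add: \<zeta>_def)
    have G1: "deriv G\<^sub>1 \<zeta> = E - of_real (k / q)" unfolding E_def ik by simp
    have "C * q \<le> C * q0" using q C by (intro mult_left_mono) auto
    also have "\<dots> \<le> k / 2" using q0(3) C by (simp add: field_simps)
    finally have "C * q \<le> k / 2" .
    then have "C \<le> k / q / 2" using q by (simp add: field_simps)
    moreover have "k / q \<le> norm (deriv G\<^sub>1 \<zeta>) + norm E"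
    proof -
      have "norm (of_real (k / q) :: complex) \<le> norm (deriv G\<^sub>1 \<zeta>) + norm E"
        using norm_triangle_ineq4[of E "deriv G\<^sub>1 \<zeta>"] unfolding G1 by simp
      then show ?thesis using k q by (simp add: norm_divide)
    qed
    ultimately have G1n: "k / q / 2 \<le> norm (deriv G\<^sub>1 \<zeta>)" using E by linarith
    have nR: "norm (R \<zeta>) \<le> C / (k / q / 2)" unfolding R_def norm_divide
      using near2[OF z] G1n k q C by (intro frac_le) auto
    have G2: "deriv G\<^sub>2 \<zeta> = R \<zeta> * deriv G\<^sub>1 \<zeta>" using d1[OF z(2)] by (simp add: R_def)
    have "Re (\<i> * deriv G\<^sub>2 \<zeta>) = Re (\<i> * R \<zeta> * E) - (k / q) * Re (\<i> * R \<zeta>)"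
      unfolding G2 G1 by (simp add: algebra_simps)
    moreover have "Re (\<i> * R \<zeta> * E) \<le> C / (k / q / 2) * C"
    proof -
      have "Re (\<i> * R \<zeta> * E) \<le> norm (\<i> * R \<zeta> * E)" by (rule complex_Re_le_cmod)
      also have "\<dots> = norm (R \<zeta>) * norm E" by (simp add: norm_mult)
      also have "\<dots> \<le> C / (k / q / 2) * C" using nR E C k q by (intro mult_mono) auto
      finally show ?thesis .
    qed
    moreover have "(k / q) * (c * q) \<le> (k / q) * Re (\<i> * R \<zeta>)"
      using c(2)[of q] q q0 k unfolding \<zeta>_def by (intro mult_left_mono) auto
    moreover have "C / (k / q / 2) * C \<le> (k / q) * (c * q)"
    proof -
      have "2 * C * C * q \<le> 2 * C * C * q0" using q C by (intro mult_left_mono) auto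
      also have "\<dots> \<le> k * (k * c)" using q0(4) C by (simp add: field_simps)
      finally have "2 * C * C * q / k \<le> k * c" using k by (simp add: pos_divide_le_eq mult_ac)
      moreover have "C / (k / q / 2) * C = 2 * C * C * q / k" by simp
      moreover have "(k / q) * (c * q) = k * c" using q by simp
      ultimately show ?thesis by (simp only:)
    qed
    ultimately show ?thesis unfolding \<zeta>_def by linarith
  qed
  define q1 where "q1 = q0 / 2"
  have q1: "0 < q1" "q1 < q0" using q0 by (auto simp: q1_def)
  \<comment> \<open>\<open>Re G\<^sub>2\<close> does not increase along the axis away from 0, yet
    tends to 0 at 0; so it would be at most 0 at \<open>q1\<close>, against
    \<open>up\<close>.\<close>
  have "g q1 \<le> g q" if q: "0 < q" "q < q1" for q
  proof (rule DERIV_nonpos_imp_nonincreasing[of q q1 g])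
    show "\<exists>y. (g has_real_derivative y) (at x) \<and> y \<le> 0" if "q \<le> x" "x \<le> q1" for x
      using der[of x] der_neg[of x] that q(1) q1 by (intro exI[of _ "Re (\<i> * deriv G\<^sub>2 (\<i> * of_real x))"]) auto
  qed (use q in simp)
  moreover have "g q \<le> C * q" if "0 < q" "q < q1" for q
    using small[of "\<i> * of_real q"] that q1 q0 unfolding g_def by (auto simp: norm_mult)
  ultimately have le: "g q1 \<le> C * q" if "0 < q" "q < q1" for q using that by force
  have "g q1 > 0" unfolding g_def using q1 q0 by (intro up) auto
  define q where "q = min (q1 / 2) (g q1 / (2 * C))"
  have "0 < q" "q < q1" "q \<le> g q1 / (2 * C)" using q1 C \<open>g q1 > 0\<close> by (auto simp: q_def)
  then have "C * q \<le> g q1 / 2" using C by (simp add: field_simps)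
  then show False using le[OF \<open>0 < q\<close> \<open>q < q1\<close>] \<open>g q1 > 0\<close> by linarith
qed

section \<open>Logarithmic coordinates on the disc, centred at a boundary point\<close>

definition to_disc :: "real \<Rightarrow> complex \<Rightarrow> complex" where
  "to_disc \<theta> \<zeta> = exp (\<i> * (\<zeta> + of_real \<theta>))"

text \<open>The branch of the inverse of \<open>to_disc\<close> that takes
  \<open>cis \<theta>\<close> to 0. A real \<open>s\<close> goes to
  \<open>cis (\<theta> + s)\<close> under \<open>to_disc\<close>, so positive \<open>s\<close> is
  the counterclockwise side.\<close>

definition from_disc :: "real \<Rightarrow> complex \<Rightarrow> complex" where
  "from_disc \<theta> w = - \<i> * Ln (w / cis \<theta>)"

lemma to_disc_in_ball: "to_disc \<theta> \<zeta> \<in> ball 0 1 \<longleftrightarrow> Im \<zeta> > 0"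
  using exp_i_in_ball[of "\<zeta> + of_real \<theta>"] by (simp add: to_disc_def)

lemma to_disc_from_disc: "w \<noteq> 0 \<Longrightarrow> to_disc \<theta> (from_disc \<theta> w) = w"
  using exp_i_Ln_cis[of w \<theta>] by (simp add: to_disc_def from_disc_def add.commute)

lemma to_disc_holomorphic:
  assumes "G holomorphic_on ball 0 1"
  shows "(\<lambda>\<zeta>. G (to_disc \<theta> \<zeta>)) holomorphic_on {\<zeta>. Im \<zeta> > 0}"
proof -
  have "to_disc \<theta> holomorphic_on {\<zeta>. Im \<zeta> > 0}"
    unfolding to_disc_def[abs_def] by (intro holomorphic_intros)
  then have "G \<circ> to_disc \<theta> holomorphic_on {\<zeta>. Im \<zeta> > 0}"
    by (rule holomorphic_on_compose_gen[OF _ assms]) (use to_disc_in_ball in blast)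
  then show ?thesis by (simp add: o_def)
qed

lemma deriv_to_disc:
  assumes "G holomorphic_on ball 0 1" "Im \<zeta> > 0"
  shows "deriv (\<lambda>\<zeta>. G (to_disc \<theta> \<zeta>)) \<zeta> = deriv G (to_disc \<theta> \<zeta>) * (\<i> * to_disc \<theta> \<zeta>)"
proof (rule DERIV_imp_deriv)
  have "to_disc \<theta> \<zeta> \<in> ball 0 1" using assms(2) to_disc_in_ball by blast
  then have "(G has_field_derivative deriv G (to_disc \<theta> \<zeta>)) (at (to_disc \<theta> \<zeta>))"
    using holomorphic_derivI[OF assms(1) open_ball] by blast
  moreover have "(to_disc \<theta> has_field_derivative (\<i> * to_disc \<theta> \<zeta>)) (at \<zeta>)"
    unfolding to_disc_def by (auto intro!: derivative_eq_intros)
  ultimately show "((\<lambda>\<zeta>. G (to_disc \<theta> \<zeta>)) has_field_derivative deriv G (to_disc \<theta> \<zeta>) * (\<i> * to_disc \<theta> \<zeta>)) (at \<zeta>)"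
    by (rule DERIV_chain2)
qed

lemma filterlim_to_disc:
  "filterlim (to_disc \<theta>) (at (cis (\<theta> + s)) within ball 0 1) (at (of_real s) within {\<zeta>. Im \<zeta> > 0})"
proof -
  have "filterlim (\<lambda>\<zeta>. \<zeta> + of_real \<theta>) (at (of_real (\<theta> + s)) within {\<zeta>. Im \<zeta> > 0}) (at (of_real s) within {\<zeta>. Im \<zeta> > 0})"
    unfolding filterlim_at
  proof
    show "((\<lambda>\<zeta>. \<zeta> + of_real \<theta>) \<longlongrightarrow> of_real (\<theta> + s)) (at (of_real s) within {\<zeta>. Im \<zeta> > 0})"
      by (rule tendsto_eq_intros refl | simp)+
    show "\<forall>\<^sub>F x in at (of_real s) within {\<zeta>. Im \<zeta> > 0}. x + of_real \<theta> \<in> {\<zeta>. Im \<zeta> > 0} \<and> x + of_real \<theta> \<noteq> of_real (\<theta> + s)"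
      unfolding eventually_at_topological by (intro exI[of _ UNIV]) auto
  qed
  from filterlim_compose[OF filterlim_exp_i this] show ?thesis by (simp add: to_disc_def[abs_def])
qed

lemma filterlim_from_disc:
  "filterlim (from_disc \<theta>) (at 0 within {\<zeta>. Im \<zeta> > 0}) (at (cis \<theta>) within ball 0 1)"
proof -
  have "filterlim (\<lambda>\<zeta>. \<zeta> - of_real \<theta>) (at 0 within {\<zeta>. Im \<zeta> > 0}) (at (of_real \<theta>) within {\<zeta>. Im \<zeta> > 0})"
    unfolding filterlim_at
  proof
    show "((\<lambda>\<zeta>. \<zeta> - of_real \<theta>) \<longlongrightarrow> 0) (at (of_real \<theta>) within {\<zeta>. Im \<zeta> > 0})"
      by (rule tendsto_eq_intros refl | simp)+
    show "\<forall>\<^sub>F x in at (of_real \<theta>) within {\<zeta>. Im \<zeta> > 0}. x - of_real \<theta> \<in> {\<zeta>. Im \<zeta> > 0} \<and> x - of_real \<theta> \<noteq> 0"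
      unfolding eventually_at_topological by (intro exI[of _ UNIV]) auto
  qed
  from filterlim_compose[OF this filterlim_Ln_cis] show ?thesis
    by (simp add: from_disc_def[abs_def])
qed

lemma eventually_from_disc:
  assumes "\<delta> > 0"
  shows "\<forall>\<^sub>F w in at (cis \<theta>) within ball 0 1.
    w \<in> ball 0 1 \<and> norm (from_disc \<theta> w) < \<delta> \<and> Im (from_disc \<theta> w) > 0 \<and> to_disc \<theta> (from_disc \<theta> w) = w"
proof -
  note L = filterlim_from_disc[of \<theta>, unfolded filterlim_at]
  have "\<forall>\<^sub>F w in at (cis \<theta>) within ball 0 1. norm (from_disc \<theta> w) < \<delta>"
    using tendstoD[OF conjunct2[OF L] assms] by (simp add: dist_norm)
  moreover have "\<forall>\<^sub>F w in at (cis \<theta>) within ball 0 1. w \<in> ball (0::complex) 1"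
    by (auto simp: eventually_at_topological)
  moreover have "\<forall>\<^sub>F w in at (cis \<theta>) within ball 0 1. w \<noteq> 0"
  proof -
    have "\<forall>\<^sub>F w in nhds (cis \<theta>). w \<in> - {0}" by (rule eventually_nhds_in_open) auto
    then show ?thesis by (auto simp: eventually_at_filter elim: eventually_mono)
  qed
  ultimately have "\<forall>\<^sub>F w in at (cis \<theta>) within ball 0 1. norm (from_disc \<theta> w) < \<delta> \<and> w \<in> ball 0 1 \<and> w \<noteq> 0
      \<and> from_disc \<theta> w \<in> {\<zeta>. Im \<zeta> > 0} \<and> from_disc \<theta> w \<noteq> 0"
    using conjunct1[OF L] by (simp only: eventually_conj_iff simp_thms)
  then show ?thesis by (rule eventually_mono) (simp add: to_disc_from_disc)
qed

lemma to_disc_sequence: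
  assumes "\<And>n::nat. Im (z n) > 0" "z \<longlonglongrightarrow> 0"
  shows "(\<lambda>n. to_disc \<theta> (z n)) \<longlonglongrightarrow> cis \<theta>"
proof -
  have "(\<lambda>n. to_disc \<theta> (z n)) \<longlonglongrightarrow> exp (\<i> * (0 + of_real \<theta>))"
    unfolding to_disc_def by (intro tendsto_intros assms)
  then show ?thesis by (simp add: cis_conv_exp)
qed

text \<open>To leading order the map depends only on the argument of \<zeta>, which takes all values
  strictly between 0 and \<open>pi\<close> at every radius; so the values sweep the segment between
  the one-sided limits.\<close>

lemma cluster_set_of_jump:
  fixes g :: "complex \<Rightarrow> 'a::euclidean_space"
  assumes \<delta>: "\<delta> > 0"
    and near: "\<And>\<zeta>. norm \<zeta> < \<delta> \<Longrightarrow> Im \<zeta> > 0 \<Longrightarrow>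
      norm (g (to_disc \<theta> \<zeta>) - (p + (Im (hlog \<zeta>) / pi) *\<^sub>R (n - p))) \<le> C * Im \<zeta>"
  shows "cluster_set g (cis \<theta>) = closed_segment n p"
proof
  have err: "(\<lambda>k. g (to_disc \<theta> (z k)) - (p + (Im (hlog (z k)) / pi) *\<^sub>R (n - p))) \<longlonglongrightarrow> 0"
    if z: "z \<longlonglongrightarrow> 0" "\<And>k::nat. norm (z k) < \<delta>" "\<And>k. Im (z k) > 0" for z
  proof (rule Lim_null_comparison)
    show "\<forall>\<^sub>F k in sequentially. norm (g (to_disc \<theta> (z k)) - (p + (Im (hlog (z k)) / pi) *\<^sub>R (n - p))) \<le> C * Im (z k)"
      using near z by simp
    have "(\<lambda>k. C * Im (z k)) \<longlonglongrightarrow> C * Im 0" by (intro tendsto_intros z)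
    then show "(\<lambda>k. C * Im (z k)) \<longlonglongrightarrow> 0" by simp
  qed
  show "cluster_set g (cis \<theta>) \<subseteq> closed_segment n p"
  proof
    fix l assume "l \<in> cluster_set g (cis \<theta>)"
    then obtain s where s: "\<And>k. s k \<in> ball 0 1" "s \<longlonglongrightarrow> cis \<theta>" "(\<lambda>k. g (s k)) \<longlonglongrightarrow> l"
      unfolding cluster_set_def by blast
    have fs: "filterlim s (at (cis \<theta>) within ball 0 1) sequentially"
    proof -
      have "s k \<in> ball 0 1 \<and> s k \<noteq> cis \<theta>" for k using s(1)[of k] by auto
      then show ?thesis using s(2) unfolding filterlim_at by simp
    qed
    note lim = filterlim_compose[OF filterlim_from_disc fs]
    have ev: "\<forall>\<^sub>F k in sequentially. s k \<in> ball 0 1 \<and> norm (from_disc \<theta> (s k)) < \<delta> \<and> Im (from_disc \<theta> (s k)) > 0 \<and> to_disc \<theta> (from_disc \<theta> (s k)) = s k"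
      by (rule eventually_compose_filterlim[OF eventually_from_disc[OF \<delta>] fs])
    then obtain N where N: "\<And>k. k \<ge> N \<Longrightarrow> norm (from_disc \<theta> (s k)) < \<delta> \<and> Im (from_disc \<theta> (s k)) > 0 \<and> to_disc \<theta> (from_disc \<theta> (s k)) = s k"
      unfolding eventually_sequentially by blast
    define z where "z = (\<lambda>k. from_disc \<theta> (s (k + N)))"
    have z: "z \<longlonglongrightarrow> 0" "norm (z k) < \<delta>" "Im (z k) > 0" "to_disc \<theta> (z k) = s (k + N)" for k
    proof -
      have "(\<lambda>k. from_disc \<theta> (s k)) \<longlonglongrightarrow> 0" using lim unfolding filterlim_at by blast
      then show "z \<longlonglongrightarrow> 0" unfolding z_def by (rule LIMSEQ_ignore_initial_segment)
      show "norm (z k) < \<delta>" "Im (z k) > 0" "to_disc \<theta> (z k) = s (k + N)" using N[of "k + N"] by (auto simp: z_def)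
    qed
    have "(\<lambda>k. g (to_disc \<theta> (z k))) \<longlonglongrightarrow> l" unfolding z(4) by (rule LIMSEQ_ignore_initial_segment[OF s(3)])
    from tendsto_diff[OF this err[OF z(1-3)]]
    have conv: "(\<lambda>k. p + (Im (hlog (z k)) / pi) *\<^sub>R (n - p)) \<longlonglongrightarrow> l" by (simp add: add.commute)
    have mem: "p + (Im (hlog (z k)) / pi) *\<^sub>R (n - p) \<in> closed_segment n p" for k
    proof -
      have "0 \<le> Im (hlog (z k)) / pi" "Im (hlog (z k)) / pi \<le> 1" using Im_hlog_bounds[OF z(3)[of k]] by auto
      then have "p + (Im (hlog (z k)) / pi) *\<^sub>R (n - p) \<in> closed_segment p n"
        unfolding closed_segment_def by (intro CollectI exI[of _ "Im (hlog (z k)) / pi"]) (auto simp: algebra_simps)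
      then show ?thesis by (simp add: closed_segment_commute)
    qed
    show "l \<in> closed_segment n p" by (rule closed_sequentially[OF closed_segment mem conv])
  qed
  show "closed_segment n p \<subseteq> cluster_set g (cis \<theta>)"
  proof
    fix l assume "l \<in> closed_segment n p"
    then have "l \<in> closed_segment p n" by (simp add: closed_segment_commute)
    then obtain \<mu> where \<mu>: "0 \<le> \<mu>" "\<mu> \<le> 1" "l = p + \<mu> *\<^sub>R (n - p)" by (auto simp: closed_segment_def algebra_simps)
    define e where "e = (\<lambda>k::nat. inverse (real (Suc (Suc k))))"
    have e: "0 < e k" "e k < 1" for k
    proof -
      have "1 < real (Suc (Suc k))" by simp
      then show "0 < e k" "e k < 1" unfolding e_def inverse_less_1_iff inverse_positive_iff_positive by linarith+
    qed
    have elim: "e \<longlonglongrightarrow> 0" unfolding e_def using LIMSEQ_Suc[OF LIMSEQ_inverse_real_of_nat] by simp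
    \<comment> \<open>The values 0 and 1 of \<mu> do not come from arguments of points in the half
      plane; \<open>m\<close> approximates \<mu> from inside the open unit interval.\<close>
    define m where "m = (\<lambda>k. \<mu> * (1 - e k) + e k / 2)"
    have m: "0 < m k" "m k < 1" for k
    proof -
      have "0 \<le> \<mu> * (1 - e k)" "\<mu> * (1 - e k) \<le> 1 * (1 - e k)" using \<mu> e[of k] by (auto intro!: mult_right_mono)
      then show "0 < m k" "m k < 1" using e[of k] unfolding m_def by argo+
    qed
    have mlim: "m \<longlonglongrightarrow> \<mu>"
    proof -
      have "m \<longlonglongrightarrow> \<mu> * (1 - 0) + 0 / 2" unfolding m_def by (intro tendsto_intros elim) simp
      then show ?thesis by simp
    qed
    define z where "z = (\<lambda>k. of_real (\<delta> * e k) * cis (pi * m k))"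
    have nz: "norm (z k) = \<delta> * e k" for k using \<delta> e[of k] by (simp add: z_def norm_mult)
    have z: "z \<longlonglongrightarrow> 0" "norm (z k) < \<delta>" "Im (z k) > 0" "Im (hlog (z k)) / pi = m k" for k
    proof -
      have "(\<lambda>k. norm (z k)) \<longlonglongrightarrow> 0" unfolding nz using tendsto_mult_right_zero[OF elim] by simp
      then show "z \<longlonglongrightarrow> 0" by (rule tendsto_norm_zero_cancel)
      show "norm (z k) < \<delta>" unfolding nz using \<delta> e[of k] by simp
      have th: "0 < pi * m k" "pi * m k < pi" using m[of k] by auto
      then have "sin (pi * m k) > 0" by (intro sin_gt_zero)
      then show "Im (z k) > 0" using \<delta> e[of k] by (simp add: z_def)
      have "Im (hlog (z k)) = pi * m k" unfolding z_def using \<delta> e[of k] th by (intro hlog_polar) auto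
      then show "Im (hlog (z k)) / pi = m k" by simp
    qed
    have "(\<lambda>k. p + m k *\<^sub>R (n - p)) \<longlonglongrightarrow> p + \<mu> *\<^sub>R (n - p)" by (intro tendsto_intros mlim)
    then have "(\<lambda>k. p + (Im (hlog (z k)) / pi) *\<^sub>R (n - p)) \<longlonglongrightarrow> l" unfolding z(4) \<mu>(3) .
    from tendsto_add[OF err[OF z(1-3)] this] have "(\<lambda>k. g (to_disc \<theta> (z k))) \<longlonglongrightarrow> l" by simp
    moreover have "(\<lambda>k. to_disc \<theta> (z k)) \<longlonglongrightarrow> cis \<theta>" by (rule to_disc_sequence[OF z(3,1)])
    moreover have "to_disc \<theta> (z k) \<in> ball 0 1" for k using z(3) to_disc_in_ball by blast
    ultimately show "l \<in> cluster_set g (cis \<theta>)" unfolding cluster_set_def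
      by (intro CollectI exI[of _ "\<lambda>k. to_disc \<theta> (z k)"] conjI allI)
  qed
qed

lemma filterlim_ln_from_disc:
  "filterlim (\<lambda>w. - ln (norm (from_disc \<theta> w))) at_top (at (cis \<theta>) within ball 0 1)"
proof -
  note L = filterlim_from_disc[of \<theta>, unfolded filterlim_at]
  have "filterlim (\<lambda>w. norm (from_disc \<theta> w)) (at_right 0) (at (cis \<theta>) within ball 0 1)"
    unfolding filterlim_at
  proof
    show "((\<lambda>w. norm (from_disc \<theta> w)) \<longlongrightarrow> 0) (at (cis \<theta>) within ball 0 1)"
      using tendsto_norm[OF conjunct2[OF L]] by simp
    show "\<forall>\<^sub>F w in at (cis \<theta>) within ball 0 1. norm (from_disc \<theta> w) \<in> {0<..} \<and> norm (from_disc \<theta> w) \<noteq> 0"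
      using conjunct1[OF L] by (rule eventually_mono) auto
  qed
  from filterlim_compose[OF ln_at_0 this] show ?thesis
    by (simp add: filterlim_uminus_at_top)
qed

text \<open>Norm and direction both come from the leading term \<open>L * d\<close>, where
  \<open>L\<close> tends to infinity: \<open>g / L\<close> tends to \<open>d\<close>, and
  \<open>sgn\<close> ignores the positive factor \<open>L\<close>.\<close>

lemma diverges_of_log:
  assumes \<delta>: "\<delta> > 0" and d: "d \<noteq> 0"
    and near: "\<And>\<zeta>. norm \<zeta> < \<delta> \<Longrightarrow> Im \<zeta> > 0 \<Longrightarrow> norm (g (to_disc \<theta> \<zeta>) + of_real (ln (norm \<zeta>)) * d) \<le> C"
  shows "diverges_in_direction g (cis \<theta>) d"
proof -
  define L where "L = (\<lambda>w. - ln (norm (from_disc \<theta> w)))"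
  have L: "filterlim L at_top (at (cis \<theta>) within ball 0 1)" unfolding L_def by (rule filterlim_ln_from_disc)
  have ev: "\<forall>\<^sub>F w in at (cis \<theta>) within ball 0 1. norm (g w - of_real (L w) * d) \<le> C"
    using eventually_from_disc[OF \<delta>]
  proof (rule eventually_mono)
    fix w assume w: "w \<in> ball 0 1 \<and> norm (from_disc \<theta> w) < \<delta> \<and> Im (from_disc \<theta> w) > 0 \<and> to_disc \<theta> (from_disc \<theta> w) = w"
    then show "norm (g w - of_real (L w) * d) \<le> C" using near[of "from_disc \<theta> w"] by (simp add: L_def)
  qed
  have Lpos: "\<forall>\<^sub>F w in at (cis \<theta>) within ball 0 1. L w > 0" using L by (rule filterlim_at_top_dense[THEN iffD1, rule_format])
  have n1: "filterlim (\<lambda>w. norm (g w)) at_top (at (cis \<theta>) within ball 0 1)"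
  proof (rule filterlim_at_top_mono)
    have "filterlim (\<lambda>w. - C + norm d * L w) at_top (at (cis \<theta>) within ball 0 1)"
      using d by (intro filterlim_tendsto_add_at_top[OF tendsto_const] filterlim_tendsto_pos_mult_at_top[OF tendsto_const _ L]) auto
    then show "filterlim (\<lambda>w. norm d * L w - C) at_top (at (cis \<theta>) within ball 0 1)" by simp
    show "\<forall>\<^sub>F w in at (cis \<theta>) within ball 0 1. norm d * L w - C \<le> norm (g w)"
      using eventually_conj[OF ev Lpos]
    proof (rule eventually_mono)
      fix w assume w: "norm (g w - of_real (L w) * d) \<le> C \<and> L w > 0"
      have "norm (of_real (L w) * d) \<le> norm (g w) + norm (g w - of_real (L w) * d)"
        using norm_triangle_ineq4[of "g w" "g w - of_real (L w) * d"] by simp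
      moreover have "norm (of_real (L w) * d) = norm d * L w" using w by (simp add: norm_mult)
      ultimately show "norm d * L w - C \<le> norm (g w)" using w by linarith
    qed
  qed
  have "((\<lambda>w. g w / of_real (L w)) \<longlongrightarrow> d) (at (cis \<theta>) within ball 0 1)"
  proof (rule LIM_zero_cancel, rule Lim_null_comparison)
    show "\<forall>\<^sub>F w in at (cis \<theta>) within ball 0 1. norm (g w / of_real (L w) - d) \<le> C * inverse (L w)"
      using eventually_conj[OF ev Lpos]
    proof (rule eventually_mono)
      fix w assume w: "norm (g w - of_real (L w) * d) \<le> C \<and> L w > 0"
      then have "g w / of_real (L w) - d = (g w - of_real (L w) * d) / of_real (L w)" by (simp add: field_simps)
      then have "norm (g w / of_real (L w) - d) = norm (g w - of_real (L w) * d) / L w" using w by (simp add: norm_divide)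
      also have "\<dots> \<le> C / L w" using w by (intro divide_right_mono) auto
      finally show "norm (g w / of_real (L w) - d) \<le> C * inverse (L w)" by (simp add: divide_inverse)
    qed
    show "((\<lambda>w. C * inverse (L w)) \<longlongrightarrow> 0) (at (cis \<theta>) within ball 0 1)"
      by (intro tendsto_mult_right_zero tendsto_inverse_0_at_top L)
  qed
  then have "((\<lambda>w. sgn (g w / of_real (L w))) \<longlongrightarrow> sgn d) (at (cis \<theta>) within ball 0 1)" by (rule tendsto_sgn[OF _ d])
  moreover have ev2: "\<forall>\<^sub>F w in at (cis \<theta>) within ball 0 1. sgn (g w / of_real (L w)) = sgn (g w)"
    using Lpos
  proof (rule eventually_mono)
    fix w assume "L w > 0"
    then show "sgn (g w / of_real (L w)) = sgn (g w)" by (simp add: sgn_eq norm_divide)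
  qed
  ultimately have "((\<lambda>w. sgn (g w)) \<longlongrightarrow> sgn d) (at (cis \<theta>) within ball 0 1)"
    using tendsto_cong[OF ev2] by simp
  then show ?thesis using n1 by (simp add: diverges_in_direction_def)
qed

section \<open>The four surfaces at a jump of the boundary values\<close>

context harmonic_homeomorphism
begin

lemma f_tendsto_comp:
  assumes q: "q \<in> frontier \<Omega>" and f: "(f \<longlongrightarrow> q) (at \<zeta> within ball 0 1)" and g: "filterlim g G (at q within \<Omega>)"
  shows "filterlim (\<lambda>w. g (f w)) G (at \<zeta> within ball 0 1)"
proof -
  have "\<forall>\<^sub>F w in at \<zeta> within ball 0 1. w \<in> ball (0::complex) 1" by (auto simp: eventually_at_topological)
  then have "\<forall>\<^sub>F w in at \<zeta> within ball 0 1. f w \<in> \<Omega> \<and> f w \<noteq> q"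
    by (rule eventually_mono) (use f_in q in \<open>auto simp: frontier_\<Omega>\<close>)
  then have "filterlim f (at q within \<Omega>) (at \<zeta> within ball 0 1)" using f unfolding filterlim_at by simp
  from filterlim_compose[OF g this] show ?thesis .
qed

text \<open>Unbounded values near \<zeta> would occur along a sequence whose \<open>f\<close>-images
  converge to a point of the cluster set, where \<psi> has a finite limit. This supplies the bound
  near the jump that the expansion of the dual needs; no bound on all of \<Omega> is at
  hand.\<close>

lemma bounded_near_cluster:
  assumes cl: "\<And>q. q \<in> cluster_set f \<zeta> \<Longrightarrow> \<exists>l::real. (\<psi> \<longlongrightarrow> l) (at q within \<Omega>)" and \<zeta>: "norm \<zeta> = 1"
  obtains M d where "d > 0" "\<And>w. w \<in> ball 0 1 \<Longrightarrow> dist w \<zeta> < d \<Longrightarrow> \<bar>\<psi> (f w)\<bar> \<le> M"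
proof (rule ccontr)
  assume neg: "\<not> thesis"
  have "\<exists>w. w \<in> ball 0 1 \<and> dist w \<zeta> < 1 / Suc n \<and> real n < \<bar>\<psi> (f w)\<bar>" for n
  proof (rule ccontr)
    assume "\<not> ?thesis"
    then have "\<And>w. w \<in> ball 0 1 \<Longrightarrow> dist w \<zeta> < 1 / Suc n \<Longrightarrow> \<bar>\<psi> (f w)\<bar> \<le> real n" by (meson not_less)
    moreover have "1 / real (Suc n) > 0" by simp
    ultimately show False using neg that by blast
  qed
  then obtain w where w: "\<And>n. w n \<in> ball 0 1" "\<And>n. dist (w n) \<zeta> < 1 / Suc n" "\<And>n. real n < \<bar>\<psi> (f (w n))\<bar>" by metis
  have wz: "w \<longlonglongrightarrow> \<zeta>"
  proof (rule metric_tendsto_imp_tendsto[OF LIMSEQ_inverse_real_of_nat])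
    have "dist (w n) \<zeta> \<le> dist (inverse (real (Suc n))) 0" for n
      using w(2)[of n] by (simp add: inverse_eq_divide)
    then show "\<forall>\<^sub>F n in sequentially. dist (w n) \<zeta> \<le> dist (inverse (real (Suc n))) 0" by simp
  qed
  have "range (\<lambda>n. f (w n)) \<subseteq> \<Omega>" using f_in[OF w(1)] by blast
  with bounded_\<Omega> have "bounded (range (\<lambda>n. f (w n)))" by (rule bounded_subset)
  from bounded_imp_convergent_subsequence[OF this]
  obtain q s where s': "strict_mono (s :: nat \<Rightarrow> nat)" "((\<lambda>n. f (w n)) \<circ> s) \<longlonglongrightarrow> q" by blast
  then have s: "strict_mono s" "(\<lambda>n. f (w (s n))) \<longlonglongrightarrow> q" by (simp_all add: o_def)
  have ws: "(\<lambda>n. w (s n)) \<longlonglongrightarrow> \<zeta>" using LIMSEQ_subseq_LIMSEQ[OF wz s(1)] by (simp add: o_def)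
  have q: "q \<in> frontier \<Omega>" by (rule limit_of_f_in_frontier[OF _ ws \<zeta> s(2)]) (rule w(1))
  have "q \<in> cluster_set f \<zeta>" unfolding cluster_set_def
    using w(1) ws s(2) by (intro CollectI exI[of _ "\<lambda>n. w (s n)"]) auto
  from cl[OF this] obtain l where l: "(\<psi> \<longlongrightarrow> l) (at q within \<Omega>)" by blast
  have "f (w (s n)) \<in> \<Omega> \<and> f (w (s n)) \<noteq> q" for n using f_in[OF w(1)[of "s n"]] q by (auto simp: frontier_\<Omega>)
  then have "filterlim (\<lambda>n. f (w (s n))) (at q within \<Omega>) sequentially" using s(2) unfolding filterlim_at by simp
  from filterlim_compose[OF l this] have "(\<lambda>n. \<psi> (f (w (s n)))) \<longlonglongrightarrow> l" .
  then have "Bseq (\<lambda>n. \<psi> (f (w (s n))))" using convergentI convergent_imp_Bseq by blast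
  then obtain K where K: "\<And>n. \<bar>\<psi> (f (w (s n)))\<bar> \<le> K" unfolding Bseq_def by auto
  obtain n where "K < real n" using reals_Archimedean2 by blast
  moreover have "real n \<le> real (s n)" using seq_suble[OF s(1), of n] by simp
  ultimately show False using w(3)[of "s n"] K[of n] by linarith
qed

text \<open>\<open>p\<close> and \<open>n\<close> are the limits of \<open>f\<close> on the
  counterclockwise and the clockwise side of \<open>cis \<theta>\<close>, not yet matched with
  \<open>z\<^sub>1\<close> and \<open>z\<^sub>2\<close>. The null relation gives the jump of the
  dual up to sign, the pole at \<open>q\<close> fixes \<open>v p > v n\<close>, and orientation
  shows \<open>p = z\<^sub>2\<close>. The conclusions are read off from the logarithmic
  expansions.\<close>

lemma jump_behaviour:
  assumes h: "h holomorphic_on ball 0 1" and \<psi>: "\<And>w. w \<in> ball 0 1 \<Longrightarrow> \<psi> (f w) = Im (h w)"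
    and null: "\<And>w. w \<in> ball 0 1 \<Longrightarrow> (deriv \<Phi>\<^sub>1 w)\<^sup>2 + (deriv \<Phi>\<^sub>2 w)\<^sup>2 + (deriv h w)\<^sup>2 = 0"
    and jac: "\<And>w. w \<in> ball 0 1 \<Longrightarrow> Im (deriv \<Phi>\<^sub>1 w * cnj (deriv \<Phi>\<^sub>2 w)) > 0"
    and z12: "z\<^sub>1 \<noteq> z\<^sub>2" and zpn: "{p, n} = {z\<^sub>1, z\<^sub>2}" "p \<in> frontier \<Omega>" "n \<in> frontier \<Omega>"
    and a: "a > 0"
    and pos: "\<And>s. 0 < s \<Longrightarrow> s < a \<Longrightarrow> (f \<longlongrightarrow> p) (at (cis (\<theta> + s)) within ball 0 1)"
    and neg: "\<And>s. - a < s \<Longrightarrow> s < 0 \<Longrightarrow> (f \<longlongrightarrow> n) (at (cis (\<theta> + s)) within ball 0 1)"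
    and lim: "\<And>q. q \<in> closed_segment z\<^sub>1 z\<^sub>2 \<Longrightarrow> (\<psi> \<longlongrightarrow> v q) (at q within \<Omega>)"
    and left: "r > 0" "\<And>z. z \<in> \<Omega> \<Longrightarrow> dist z (midpoint z\<^sub>1 z\<^sub>2) < r \<Longrightarrow> Im (cnj (z\<^sub>2 - z\<^sub>1) * (z - z\<^sub>1)) > 0"
    and pole: "q \<in> frontier \<Omega>" "(F \<longlongrightarrow> cis \<theta>) (at q within \<Omega>)" "filterlim (\<lambda>z. Re (h (F z))) at_top (at q within \<Omega>)"
    and g: "\<And>w. w \<in> ball 0 1 \<Longrightarrow> g w = Complex (Im (\<Phi>\<^sub>1 w)) (Im (\<Phi>\<^sub>2 w))"
  shows "filterlim (\<lambda>w. Re (h w)) at_top (at (cis \<theta>) within ball 0 1)"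
    and "cluster_set f (cis \<theta>) = closed_segment z\<^sub>1 z\<^sub>2"
    and "v z\<^sub>2 - v z\<^sub>1 = norm (z\<^sub>2 - z\<^sub>1)"
    and "cluster_set (\<lambda>w. (f w, \<psi> (f w))) (cis \<theta>) = closed_segment (z\<^sub>1, v z\<^sub>1) (z\<^sub>2, v z\<^sub>2)"
    and "cluster_set (\<lambda>w. \<psi> (f w)) (cis \<theta>) = {v z\<^sub>1..v z\<^sub>2}"
    and "diverges_in_direction g (cis \<theta>) (z\<^sub>1 - z\<^sub>2)"
proof -
  define G1 where "G1 = (\<lambda>\<zeta>. \<Phi>\<^sub>1 (to_disc \<theta> \<zeta>))"
  define G2 where "G2 = (\<lambda>\<zeta>. \<Phi>\<^sub>2 (to_disc \<theta> \<zeta>))"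
  \<comment> \<open>The factor \<open>- \<i>\<close> makes \<open>\<psi> \<circ> f\<close> the real
    part, with finite one-sided limits, and moves the third square of the null relation to the other
    side.\<close>
  define G3 where "G3 = (\<lambda>\<zeta>. - \<i> * h (to_disc \<theta> \<zeta>))"
  have G: "G1 holomorphic_on {\<zeta>. Im \<zeta> > 0}" "G2 holomorphic_on {\<zeta>. Im \<zeta> > 0}" "G3 holomorphic_on {\<zeta>. Im \<zeta> > 0}"
    unfolding G1_def G2_def G3_def by (intro holomorphic_intros to_disc_holomorphic hol1 hol2 h)+
  have fG: "f (to_disc \<theta> \<zeta>) = Complex (Re (G1 \<zeta>)) (Re (G2 \<zeta>))" if "Im \<zeta> > 0" for \<zeta>
    using f_eq[of "to_disc \<theta> \<zeta>"] that to_disc_in_ball by (simp add: G1_def G2_def)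
  have ev_H: "\<forall>\<^sub>F \<zeta> in at (of_real s) within {\<zeta>. Im \<zeta> > 0}. Im \<zeta> > 0" for s
    by (auto simp: eventually_at_topological)
  obtain B where B: "\<And>w. w \<in> ball 0 1 \<Longrightarrow> norm (f w) \<le> B" using f_bounded by blast
  have limf: "((\<lambda>\<zeta>. Re (G1 \<zeta>)) \<longlongrightarrow> Re y) (at (of_real s) within {\<zeta>. Im \<zeta> > 0}) \<and> ((\<lambda>\<zeta>. Re (G2 \<zeta>)) \<longlongrightarrow> Im y) (at (of_real s) within {\<zeta>. Im \<zeta> > 0})"
    if "(f \<longlongrightarrow> y) (at (cis (\<theta> + s)) within ball 0 1)" for s y
  proof -
    have l: "((\<lambda>\<zeta>. f (to_disc \<theta> \<zeta>)) \<longlongrightarrow> y) (at (of_real s) within {\<zeta>. Im \<zeta> > 0})"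
      using filterlim_compose[OF that filterlim_to_disc] .
    have e1: "\<forall>\<^sub>F \<zeta> in at (of_real s) within {\<zeta>. Im \<zeta> > 0}. Re (f (to_disc \<theta> \<zeta>)) = Re (G1 \<zeta>)"
      using ev_H by (rule eventually_mono) (simp add: fG)
    have e2: "\<forall>\<^sub>F \<zeta> in at (of_real s) within {\<zeta>. Im \<zeta> > 0}. Im (f (to_disc \<theta> \<zeta>)) = Re (G2 \<zeta>)"
      using ev_H by (rule eventually_mono) (simp add: fG)
    show ?thesis using tendsto_Re[OF l] tendsto_Im[OF l] tendsto_cong[OF e1] tendsto_cong[OF e2] by simp
  qed
  have bG: "\<bar>Re (G1 \<zeta>)\<bar> \<le> B" "\<bar>Re (G2 \<zeta>)\<bar> \<le> B" if "Im \<zeta> > 0" for \<zeta>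
  proof -
    have "norm (f (to_disc \<theta> \<zeta>)) \<le> B" using that to_disc_in_ball by (intro B) blast
    then show "\<bar>Re (G1 \<zeta>)\<bar> \<le> B" "\<bar>Re (G2 \<zeta>)\<bar> \<le> B"
      using abs_Re_le_cmod[of "f (to_disc \<theta> \<zeta>)"] abs_Im_le_cmod[of "f (to_disc \<theta> \<zeta>)"] fG[OF that] by auto
  qed
  obtain C1 d1 where J1: "d1 > 0" "C1 > 0"
    "\<And>\<zeta>. norm \<zeta> < d1 \<Longrightarrow> Im \<zeta> > 0 \<Longrightarrow> \<bar>Re (G1 \<zeta>) - (Re p + (Re n - Re p) / pi * Im (hlog \<zeta>))\<bar> \<le> C1 * Im \<zeta>"
    "\<And>\<zeta>. norm \<zeta> < d1 \<Longrightarrow> Im \<zeta> > 0 \<Longrightarrow> \<bar>Im (G1 \<zeta>) + (Re n - Re p) / pi * ln (norm \<zeta>)\<bar> \<le> C1"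
    "\<And>\<zeta>. norm \<zeta> < d1 \<Longrightarrow> Im \<zeta> > 0 \<Longrightarrow> norm (deriv G1 \<zeta> + \<i> * of_real ((Re n - Re p) / pi) / \<zeta>) \<le> C1"
    by (rule jump_asymptotics[OF G(1) a, of B "Re p" "Re n"]) (use bG limf[OF pos] limf[OF neg] in \<open>simp_all\<close>)
  obtain C2 d2 where J2: "d2 > 0" "C2 > 0"
    "\<And>\<zeta>. norm \<zeta> < d2 \<Longrightarrow> Im \<zeta> > 0 \<Longrightarrow> \<bar>Re (G2 \<zeta>) - (Im p + (Im n - Im p) / pi * Im (hlog \<zeta>))\<bar> \<le> C2 * Im \<zeta>"
    "\<And>\<zeta>. norm \<zeta> < d2 \<Longrightarrow> Im \<zeta> > 0 \<Longrightarrow> \<bar>Im (G2 \<zeta>) + (Im n - Im p) / pi * ln (norm \<zeta>)\<bar> \<le> C2"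
    "\<And>\<zeta>. norm \<zeta> < d2 \<Longrightarrow> Im \<zeta> > 0 \<Longrightarrow> norm (deriv G2 \<zeta> + \<i> * of_real ((Im n - Im p) / pi) / \<zeta>) \<le> C2"
    by (rule jump_asymptotics[OF G(2) a, of B "Im p" "Im n"]) (use bG limf[OF pos] limf[OF neg] in \<open>simp_all\<close>)
  define d12 where "d12 = min d1 d2"
  have d12: "d12 > 0" using J1(1) J2(1) by (simp add: d12_def)
  have fnear: "norm (f (to_disc \<theta> \<zeta>) - (p + (Im (hlog \<zeta>) / pi) *\<^sub>R (n - p))) \<le> (C1 + C2) * Im \<zeta>"
    if "norm \<zeta> < d12" "Im \<zeta> > 0" for \<zeta>
  proof -
    have "norm (f (to_disc \<theta> \<zeta>) - (p + (Im (hlog \<zeta>) / pi) *\<^sub>R (n - p))) \<le>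
        \<bar>Re (f (to_disc \<theta> \<zeta>) - (p + (Im (hlog \<zeta>) / pi) *\<^sub>R (n - p)))\<bar> + \<bar>Im (f (to_disc \<theta> \<zeta>) - (p + (Im (hlog \<zeta>) / pi) *\<^sub>R (n - p)))\<bar>"
      by (rule cmod_le)
    also have "\<dots> \<le> C1 * Im \<zeta> + C2 * Im \<zeta>"
    proof (rule add_mono)
      have "Re (f (to_disc \<theta> \<zeta>) - (p + (Im (hlog \<zeta>) / pi) *\<^sub>R (n - p))) = Re (G1 \<zeta>) - (Re p + (Re n - Re p) / pi * Im (hlog \<zeta>))"
        by (simp add: fG[OF that(2)])
      then show "\<bar>Re (f (to_disc \<theta> \<zeta>) - (p + (Im (hlog \<zeta>) / pi) *\<^sub>R (n - p)))\<bar> \<le> C1 * Im \<zeta>"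
        using J1(3)[of \<zeta>] that by (simp add: d12_def)
      have "Im (f (to_disc \<theta> \<zeta>) - (p + (Im (hlog \<zeta>) / pi) *\<^sub>R (n - p))) = Re (G2 \<zeta>) - (Im p + (Im n - Im p) / pi * Im (hlog \<zeta>))"
        by (simp add: fG[OF that(2)])
      then show "\<bar>Im (f (to_disc \<theta> \<zeta>) - (p + (Im (hlog \<zeta>) / pi) *\<^sub>R (n - p)))\<bar> \<le> C2 * Im \<zeta>"
        using J2(3)[of \<zeta>] that by (simp add: d12_def)
    qed
    finally show ?thesis by (simp add: ring_distribs)
  qed
  have seg: "closed_segment n p = closed_segment z\<^sub>1 z\<^sub>2" using zpn(1) z12 by (auto simp: doubleton_eq_iff closed_segment_commute)
  show cl_f: "cluster_set f (cis \<theta>) = closed_segment z\<^sub>1 z\<^sub>2"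
    using cluster_set_of_jump[OF d12 fnear] seg by simp
  have "norm (cis \<theta>) = 1" by simp
  obtain M dM where M: "dM > 0" "\<And>w. w \<in> ball 0 1 \<Longrightarrow> dist w (cis \<theta>) < dM \<Longrightarrow> \<bar>\<psi> (f w)\<bar> \<le> M"
  proof (rule bounded_near_cluster[of "cis \<theta>" \<psi>])
    show "\<exists>l. (\<psi> \<longlongrightarrow> l) (at q within \<Omega>)" if "q \<in> cluster_set f (cis \<theta>)" for q
      using lim[of q] that cl_f by blast
  qed (use that in auto)
  obtain a3 where a3: "a3 > 0" "a3 \<le> a" "\<And>\<zeta>. \<bar>Re \<zeta>\<bar> < a3 \<Longrightarrow> 0 < Im \<zeta> \<Longrightarrow> Im \<zeta> < a3 \<Longrightarrow> \<bar>Re (G3 \<zeta>)\<bar> \<le> M"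
  proof -
    have "isCont (to_disc \<theta>) 0" unfolding to_disc_def[abs_def] by (intro continuous_intros)
    then obtain d where d: "d > 0" "\<And>\<zeta>. dist \<zeta> 0 < d \<Longrightarrow> dist (to_disc \<theta> \<zeta>) (to_disc \<theta> 0) < dM"
      using M(1) unfolding continuous_at_eps_delta by blast
    have t0: "to_disc \<theta> 0 = cis \<theta>" by (simp add: to_disc_def cis_conv_exp)
    have "\<bar>Re (G3 \<zeta>)\<bar> \<le> M" if "\<bar>Re \<zeta>\<bar> < min a (d / 2)" "0 < Im \<zeta>" "Im \<zeta> < min a (d / 2)" for \<zeta>
    proof -
      have w: "to_disc \<theta> \<zeta> \<in> ball 0 1" using that(2) to_disc_in_ball by blast
      have "norm \<zeta> \<le> \<bar>Re \<zeta>\<bar> + \<bar>Im \<zeta>\<bar>" by (rule cmod_le)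
      then have "dist \<zeta> 0 < d" using that by simp
      from M(2)[OF w d(2)[OF this, unfolded t0]] show ?thesis using \<psi>[OF w] by (simp add: G3_def)
    qed
    then show ?thesis using that[of "min a (d / 2)"] a d(1) by simp
  qed
  have pnseg: "p \<in> closed_segment z\<^sub>1 z\<^sub>2" "n \<in> closed_segment z\<^sub>1 z\<^sub>2" using seg by auto
  have limpsi: "((\<lambda>\<zeta>. Re (G3 \<zeta>)) \<longlongrightarrow> v y) (at (of_real s) within {\<zeta>. Im \<zeta> > 0})"
    if y: "(f \<longlongrightarrow> y) (at (cis (\<theta> + s)) within ball 0 1)" "y \<in> frontier \<Omega>" "y \<in> closed_segment z\<^sub>1 z\<^sub>2" for s y
  proof -
    have "((\<lambda>w. \<psi> (f w)) \<longlongrightarrow> v y) (at (cis (\<theta> + s)) within ball 0 1)" by (rule f_tendsto_comp[OF y(2,1) lim[OF y(3)]])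
    from filterlim_compose[OF this filterlim_to_disc]
    have l: "((\<lambda>\<zeta>. \<psi> (f (to_disc \<theta> \<zeta>))) \<longlongrightarrow> v y) (at (of_real s) within {\<zeta>. Im \<zeta> > 0})" .
    have e1: "\<forall>\<^sub>F \<zeta> in at (of_real s) within {\<zeta>. Im \<zeta> > 0}. \<psi> (f (to_disc \<theta> \<zeta>)) = Re (G3 \<zeta>)"
      using ev_H
    proof (rule eventually_mono)
      fix \<zeta> :: complex assume "Im \<zeta> > 0"
      then show "\<psi> (f (to_disc \<theta> \<zeta>)) = Re (G3 \<zeta>)" using \<psi>[of "to_disc \<theta> \<zeta>"] to_disc_in_ball by (simp add: G3_def)
    qed
    show ?thesis using l tendsto_cong[OF e1] by simp
  qed
  obtain C3 d3 where J3: "d3 > 0" "C3 > 0"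
    "\<And>\<zeta>. norm \<zeta> < d3 \<Longrightarrow> Im \<zeta> > 0 \<Longrightarrow> \<bar>Re (G3 \<zeta>) - (v p + (v n - v p) / pi * Im (hlog \<zeta>))\<bar> \<le> C3 * Im \<zeta>"
    "\<And>\<zeta>. norm \<zeta> < d3 \<Longrightarrow> Im \<zeta> > 0 \<Longrightarrow> \<bar>Im (G3 \<zeta>) + (v n - v p) / pi * ln (norm \<zeta>)\<bar> \<le> C3"
    "\<And>\<zeta>. norm \<zeta> < d3 \<Longrightarrow> Im \<zeta> > 0 \<Longrightarrow> norm (deriv G3 \<zeta> + \<i> * of_real ((v n - v p) / pi) / \<zeta>) \<le> C3"
  proof (rule jump_asymptotics[OF G(3) a3(1), of M "v p" "v n"])
    show "\<bar>Re (G3 \<zeta>)\<bar> \<le> M" if "\<bar>Re \<zeta>\<bar> < a3" "0 < Im \<zeta>" "Im \<zeta> < a3" for \<zeta> by (rule a3(3)[OF that])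
    show "((\<lambda>\<zeta>. Re (G3 \<zeta>)) \<longlongrightarrow> v p) (at (of_real s) within {\<zeta>. Im \<zeta> > 0})" if "0 < s" "s < a3" for s
      using that a3(2) by (intro limpsi pos zpn pnseg) auto
    show "((\<lambda>\<zeta>. Re (G3 \<zeta>)) \<longlongrightarrow> v n) (at (of_real s) within {\<zeta>. Im \<zeta> > 0})" if "- a3 < s" "s < 0" for s
      using that a3(2) by (intro limpsi neg zpn pnseg) auto
  qed (use that in blast)
  define \<delta> where "\<delta> = min 1 (min d12 d3)"
  have \<delta>: "\<delta> > 0" "\<delta> \<le> d1" "\<delta> \<le> d2" "\<delta> \<le> d3" "\<delta> \<le> d12" "\<delta> \<le> 1" using d12 J3(1) by (auto simp: \<delta>_def d12_def)
  define C where "C = C1 + C2 + C3"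
  have C: "C1 \<le> C" "C2 \<le> C" "C3 \<le> C" "C > 0" using J1(2) J2(2) J3(2) by (auto simp: C_def)
  have dG: "deriv G1 \<zeta> = deriv \<Phi>\<^sub>1 (to_disc \<theta> \<zeta>) * (\<i> * to_disc \<theta> \<zeta>)"
    "deriv G2 \<zeta> = deriv \<Phi>\<^sub>2 (to_disc \<theta> \<zeta>) * (\<i> * to_disc \<theta> \<zeta>)"
    "deriv G3 \<zeta> = - \<i> * deriv h (to_disc \<theta> \<zeta>) * (\<i> * to_disc \<theta> \<zeta>)" if "Im \<zeta> > 0" for \<zeta>
  proof -
    show "deriv G1 \<zeta> = deriv \<Phi>\<^sub>1 (to_disc \<theta> \<zeta>) * (\<i> * to_disc \<theta> \<zeta>)" unfolding G1_def by (rule deriv_to_disc[OF hol1 that])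
    show "deriv G2 \<zeta> = deriv \<Phi>\<^sub>2 (to_disc \<theta> \<zeta>) * (\<i> * to_disc \<theta> \<zeta>)" unfolding G2_def by (rule deriv_to_disc[OF hol2 that])
    have "(\<lambda>\<zeta>. h (to_disc \<theta> \<zeta>)) field_differentiable (at \<zeta>)"
      using to_disc_holomorphic[OF h] that open_halfspace_Im_gt by (intro holomorphic_on_imp_differentiable_at) auto
    then have "deriv G3 \<zeta> = - \<i> * deriv (\<lambda>\<zeta>. h (to_disc \<theta> \<zeta>)) \<zeta>" unfolding G3_def by (rule deriv_cmult)
    then show "deriv G3 \<zeta> = - \<i> * deriv h (to_disc \<theta> \<zeta>) * (\<i> * to_disc \<theta> \<zeta>)" by (simp add: deriv_to_disc[OF h that])
  qed
  have nullG: "(deriv G1 \<zeta>)\<^sup>2 + (deriv G2 \<zeta>)\<^sup>2 = (deriv G3 \<zeta>)\<^sup>2" if "Im \<zeta> > 0" for \<zeta>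
  proof -
    have w: "to_disc \<theta> \<zeta> \<in> ball 0 1" using that to_disc_in_ball by blast
    have "(deriv G1 \<zeta>)\<^sup>2 + (deriv G2 \<zeta>)\<^sup>2 - (deriv G3 \<zeta>)\<^sup>2 =
      ((deriv \<Phi>\<^sub>1 (to_disc \<theta> \<zeta>))\<^sup>2 + (deriv \<Phi>\<^sub>2 (to_disc \<theta> \<zeta>))\<^sup>2 + (deriv h (to_disc \<theta> \<zeta>))\<^sup>2) * (\<i> * to_disc \<theta> \<zeta>)\<^sup>2"
      unfolding dG[OF that] by (simp add: power_mult_distrib algebra_simps)
    then show ?thesis using null[OF w] by simp
  qed
  have "((Re n - Re p) / pi)\<^sup>2 + ((Im n - Im p) / pi)\<^sup>2 = ((v n - v p) / pi)\<^sup>2"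
  proof (rule jump_null_relation[OF G nullG \<delta>(1), where C = C])
    fix \<zeta> :: complex assume z: "norm \<zeta> < \<delta>" "Im \<zeta> > 0"
    show "norm (deriv G1 \<zeta> + \<i> * of_real ((Re n - Re p) / pi) / \<zeta>) \<le> C" using J1(5)[of \<zeta>] z \<delta> C by linarith
    show "norm (deriv G2 \<zeta> + \<i> * of_real ((Im n - Im p) / pi) / \<zeta>) \<le> C" using J2(5)[of \<zeta>] z \<delta> C by linarith
    show "norm (deriv G3 \<zeta> + \<i> * of_real ((v n - v p) / pi) / \<zeta>) \<le> C" using J3(5)[of \<zeta>] z \<delta> C by linarith
  qed
  then have "(Re n - Re p)\<^sup>2 + (Im n - Im p)\<^sup>2 = (v n - v p)\<^sup>2" by (simp add: power_divide add_divide_distrib[symmetric])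
  then have sq: "(norm (n - p))\<^sup>2 = (v n - v p)\<^sup>2" by (simp add: cmod_power2)
  have npn: "n \<noteq> p" using zpn(1) z12 by (auto simp: doubleton_eq_iff)
  have Reh: "\<bar>Re (h w) - (v p - v n) / pi * (- ln (norm (from_disc \<theta> w)))\<bar> \<le> C3"
    if "norm (from_disc \<theta> w) < d3 \<and> Im (from_disc \<theta> w) > 0 \<and> to_disc \<theta> (from_disc \<theta> w) = w" for w
  proof -
    have "\<bar>Im (G3 (from_disc \<theta> w)) + (v n - v p) / pi * ln (norm (from_disc \<theta> w))\<bar> \<le> C3" using that by (intro J3(4)) auto
    moreover have "Im (G3 (from_disc \<theta> w)) + (v n - v p) / pi * ln (norm (from_disc \<theta> w)) =
        - (Re (h w) - (v p - v n) / pi * (- ln (norm (from_disc \<theta> w))))"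
      using that by (simp add: G3_def diff_divide_distrib algebra_simps)
    ultimately show ?thesis by simp
  qed
  \<comment> \<open>With the other sign the expansion would bound \<open>Re h\<close> from above
    near \<open>cis \<theta>\<close>; but \<open>F\<close> tends to \<open>cis \<theta>\<close> at
    \<open>q\<close>, and along it \<open>Re h\<close> tends to infinity.\<close>
  have "v p - v n > 0"
  proof (rule ccontr)
    assume "\<not> v p - v n > 0"
    then have np: "(v p - v n) / pi \<le> 0" by (simp add: divide_nonpos_pos)
    have "\<forall>\<^sub>F w in at (cis \<theta>) within ball 0 1. Re (h w) \<le> C3"
      using eventually_from_disc[OF \<open>\<delta> > 0\<close>, of \<theta>]
    proof (rule eventually_mono)
      fix w assume w: "w \<in> ball 0 1 \<and> norm (from_disc \<theta> w) < \<delta> \<and> Im (from_disc \<theta> w) > 0 \<and> to_disc \<theta> (from_disc \<theta> w) = w"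
      then have "norm (from_disc \<theta> w) < 1" "from_disc \<theta> w \<noteq> 0" using \<delta>(6) by auto
      then have "- ln (norm (from_disc \<theta> w)) \<ge> 0" by simp
      then have "(v p - v n) / pi * (- ln (norm (from_disc \<theta> w))) \<le> 0" using np by (intro mult_nonpos_nonneg)
      then show "Re (h w) \<le> C3" using Reh[of w] w \<delta>(4) by linarith
    qed
    moreover have "filterlim F (at (cis \<theta>) within ball 0 1) (at q within \<Omega>)"
    proof -
      have "\<forall>\<^sub>F z in at q within \<Omega>. z \<in> \<Omega>" by (auto simp: eventually_at_topological)
      then have "\<forall>\<^sub>F z in at q within \<Omega>. F z \<in> ball 0 1 \<and> F z \<noteq> cis \<theta>"
        by (rule eventually_mono) (use F_in in force)
      then show ?thesis using pole(2) unfolding filterlim_at by simp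
    qed
    ultimately have "\<forall>\<^sub>F z in at q within \<Omega>. Re (h (F z)) \<le> C3" by (rule eventually_compose_filterlim)
    moreover have "\<forall>\<^sub>F z in at q within \<Omega>. C3 < Re (h (F z))" using pole(3) unfolding filterlim_at_top_dense by blast
    ultimately have "\<forall>\<^sub>F z in at q within \<Omega>. False" by eventually_elim simp
    then show False using at_frontier_nontrivial[OF pole(1)] by (simp add: eventually_False)
  qed
  then have vpn: "v p - v n = norm (n - p)" using sq by (metis abs_of_pos norm_ge_zero power2_abs power2_commute power2_eq_imp_eq less_imp_le)
  show "filterlim (\<lambda>w. Re (h w)) at_top (at (cis \<theta>) within ball 0 1)"
  proof (rule filterlim_at_top_mono)
    have "filterlim (\<lambda>w. - C3 + (v p - v n) / pi * (- ln (norm (from_disc \<theta> w)))) at_top (at (cis \<theta>) within ball 0 1)"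
      using \<open>v p - v n > 0\<close>
      by (intro filterlim_tendsto_add_at_top[OF tendsto_const] filterlim_tendsto_pos_mult_at_top[OF tendsto_const _ filterlim_ln_from_disc]) auto
    then show "filterlim (\<lambda>w. - C3 + (v p - v n) / pi * (- ln (norm (from_disc \<theta> w)))) at_top (at (cis \<theta>) within ball 0 1)" .
    show "\<forall>\<^sub>F w in at (cis \<theta>) within ball 0 1. - C3 + (v p - v n) / pi * (- ln (norm (from_disc \<theta> w))) \<le> Re (h w)"
      using eventually_from_disc[OF J3(1), of \<theta>]
    proof (rule eventually_mono)
      fix w assume w: "w \<in> ball 0 1 \<and> norm (from_disc \<theta> w) < d3 \<and> Im (from_disc \<theta> w) > 0 \<and> to_disc \<theta> (from_disc \<theta> w) = w"
      then show "- C3 + (v p - v n) / pi * (- ln (norm (from_disc \<theta> w))) \<le> Re (h w)" using Reh[of w] by linarith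
    qed
  qed
  have pz: "p = z\<^sub>2 \<and> n = z\<^sub>1"
  proof (rule ccontr)
    assume "\<not> ?thesis"
    then have wrong: "p = z\<^sub>1" "n = z\<^sub>2" using zpn(1) by (auto simp: doubleton_eq_iff)
    \<comment> \<open>\<open>Re H1\<close> and \<open>Re H2\<close> are the coordinates of
      \<open>f\<close> along and across the segment, scaled by its length. Across, both one-sided
      limits are 0; along, the wrong order of the corners is a jump by
      \<open>(norm d)\<^sup>2 > 0\<close>, which orientation forbids.\<close>
    define d where "d = z\<^sub>2 - z\<^sub>1"
    have d0: "d \<noteq> 0" using z12 by (simp add: d_def)
    define H1 where "H1 = (\<lambda>\<zeta>. of_real (Re d) * G1 \<zeta> + of_real (Im d) * G2 \<zeta>)"
    define H2 where "H2 = (\<lambda>\<zeta>. of_real (Re d) * G2 \<zeta> - of_real (Im d) * G1 \<zeta> - of_real (Im (cnj d * z\<^sub>1)))"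
    have H: "H1 holomorphic_on {\<zeta>. Im \<zeta> > 0}" "H2 holomorphic_on {\<zeta>. Im \<zeta> > 0}"
      unfolding H1_def H2_def by (intro holomorphic_intros G)+
    have ReH2: "Re (H2 \<zeta>) = Im (cnj d * (f (to_disc \<theta> \<zeta>) - z\<^sub>1))" if "Im \<zeta> > 0" for \<zeta>
      by (simp add: H2_def fG[OF that] algebra_simps)
    have diffG: "G1 field_differentiable (at \<zeta>)" "G2 field_differentiable (at \<zeta>)" if "Im \<zeta> > 0" for \<zeta>
      using G that open_halfspace_Im_gt by (auto intro: holomorphic_on_imp_differentiable_at)
    have dH: "deriv H1 \<zeta> = of_real (Re d) * deriv G1 \<zeta> + of_real (Im d) * deriv G2 \<zeta>"
      "deriv H2 \<zeta> = of_real (Re d) * deriv G2 \<zeta> - of_real (Im d) * deriv G1 \<zeta>" if "Im \<zeta> > 0" for \<zeta>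
    proof -
      have g1: "(G1 has_field_derivative deriv G1 \<zeta>) (at \<zeta>)" and g2: "(G2 has_field_derivative deriv G2 \<zeta>) (at \<zeta>)"
        using diffG[OF that] by (simp_all add: DERIV_deriv_iff_field_differentiable)
      show "deriv H1 \<zeta> = of_real (Re d) * deriv G1 \<zeta> + of_real (Im d) * deriv G2 \<zeta>" unfolding H1_def
        by (rule DERIV_imp_deriv) (auto intro!: derivative_eq_intros g1 g2)
      show "deriv H2 \<zeta> = of_real (Re d) * deriv G2 \<zeta> - of_real (Im d) * deriv G1 \<zeta>" unfolding H2_def
        by (rule DERIV_imp_deriv) (auto intro!: derivative_eq_intros g1 g2)
    qed
    have jacH: "Im (deriv H1 \<zeta> * cnj (deriv H2 \<zeta>)) > 0" if "Im \<zeta> > 0" for \<zeta>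
    proof -
      have w: "to_disc \<theta> \<zeta> \<in> ball 0 1" using that to_disc_in_ball by blast
      define E where "E = \<i> * to_disc \<theta> \<zeta>"
      have "E \<noteq> 0" by (simp add: E_def to_disc_def)
      have "Im (deriv G1 \<zeta> * cnj (deriv G2 \<zeta>)) = (norm E)\<^sup>2 * Im (deriv \<Phi>\<^sub>1 (to_disc \<theta> \<zeta>) * cnj (deriv \<Phi>\<^sub>2 (to_disc \<theta> \<zeta>)))"
        unfolding dG[OF that] E_def[symmetric] cmod_power2 by (simp add: algebra_simps power2_eq_square)
      then have J: "Im (deriv G1 \<zeta> * cnj (deriv G2 \<zeta>)) > 0" using jac[OF w] \<open>E \<noteq> 0\<close> by simp
      have "Im (deriv H1 \<zeta> * cnj (deriv H2 \<zeta>)) = (norm d)\<^sup>2 * Im (deriv G1 \<zeta> * cnj (deriv G2 \<zeta>))"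
        unfolding dH[OF that] cmod_power2 by (simp add: algebra_simps power2_eq_square)
      then show ?thesis using J d0 by simp
    qed
    have limH2: "((\<lambda>\<zeta>. Re (H2 \<zeta>)) \<longlongrightarrow> 0) (at (of_real s) within {\<zeta>. Im \<zeta> > 0})"
      and limH1: "((\<lambda>\<zeta>. Re (H1 \<zeta>)) \<longlongrightarrow> Re (cnj d * y)) (at (of_real s) within {\<zeta>. Im \<zeta> > 0})"
      if y: "(f \<longlongrightarrow> y) (at (cis (\<theta> + s)) within ball 0 1)" "y = z\<^sub>1 \<or> y = z\<^sub>2" for s y
    proof -
      note l = conjunct1[OF limf[OF y(1)]] conjunct2[OF limf[OF y(1)]]
      have "((\<lambda>\<zeta>. Re d * Re (G2 \<zeta>) - Im d * Re (G1 \<zeta>) - Im (cnj d * z\<^sub>1)) \<longlongrightarrow> Re d * Im y - Im d * Re y - Im (cnj d * z\<^sub>1)) (at (of_real s) within {\<zeta>. Im \<zeta> > 0})"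
        by (intro tendsto_intros l)
      moreover have "Re d * Im y - Im d * Re y - Im (cnj d * z\<^sub>1) = 0" using y(2) by (auto simp: d_def algebra_simps)
      ultimately show "((\<lambda>\<zeta>. Re (H2 \<zeta>)) \<longlongrightarrow> 0) (at (of_real s) within {\<zeta>. Im \<zeta> > 0})" by (simp add: H2_def)
      have "((\<lambda>\<zeta>. Re d * Re (G1 \<zeta>) + Im d * Re (G2 \<zeta>)) \<longlongrightarrow> Re d * Re y + Im d * Im y) (at (of_real s) within {\<zeta>. Im \<zeta> > 0})"
        by (intro tendsto_intros l)
      then show "((\<lambda>\<zeta>. Re (H1 \<zeta>)) \<longlongrightarrow> Re (cnj d * y)) (at (of_real s) within {\<zeta>. Im \<zeta> > 0})" by (simp add: H1_def)
    qed
    have bH: "\<bar>Re (H1 \<zeta>)\<bar> \<le> (\<bar>Re d\<bar> + \<bar>Im d\<bar>) * B + \<bar>Im (cnj d * z\<^sub>1)\<bar>" "\<bar>Re (H2 \<zeta>)\<bar> \<le> (\<bar>Re d\<bar> + \<bar>Im d\<bar>) * B + \<bar>Im (cnj d * z\<^sub>1)\<bar>" if "Im \<zeta> > 0" for \<zeta>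
    proof -
      have "\<bar>x * Re (G1 \<zeta>)\<bar> \<le> \<bar>x\<bar> * B" "\<bar>x * Re (G2 \<zeta>)\<bar> \<le> \<bar>x\<bar> * B" for x
        unfolding abs_mult using bG[OF that] by (auto intro: mult_left_mono)
      note b = this(1)[of "Re d"] this(2)[of "Re d"] this(1)[of "Im d"] this(2)[of "Im d"]
      have "Re (H1 \<zeta>) = Re d * Re (G1 \<zeta>) + Im d * Re (G2 \<zeta>)" by (simp add: H1_def)
      then show "\<bar>Re (H1 \<zeta>)\<bar> \<le> (\<bar>Re d\<bar> + \<bar>Im d\<bar>) * B + \<bar>Im (cnj d * z\<^sub>1)\<bar>" using b unfolding ring_distribs by linarith
      have "Re (H2 \<zeta>) = Re d * Re (G2 \<zeta>) - Im d * Re (G1 \<zeta>) - Im (cnj d * z\<^sub>1)" by (simp add: H2_def)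
      then show "\<bar>Re (H2 \<zeta>)\<bar> \<le> (\<bar>Re d\<bar> + \<bar>Im d\<bar>) * B + \<bar>Im (cnj d * z\<^sub>1)\<bar>" using b unfolding ring_distribs by linarith
    qed
    obtain D1 e1 where K1: "e1 > 0" "D1 > 0"
      "\<And>\<zeta>. norm \<zeta> < e1 \<Longrightarrow> Im \<zeta> > 0 \<Longrightarrow> norm (deriv H1 \<zeta> + \<i> * of_real ((Re (cnj d * z\<^sub>2) - Re (cnj d * z\<^sub>1)) / pi) / \<zeta>) \<le> D1"
      by (rule jump_asymptotics[OF H(1) a bH(1), of "Re (cnj d * z\<^sub>1)" "Re (cnj d * z\<^sub>2)"])
         (use limH1[OF pos] limH1[OF neg] wrong in \<open>simp_all\<close>)
    obtain D2 e2 where K2: "e2 > 0" "D2 > 0"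
      "\<And>\<zeta>. norm \<zeta> < e2 \<Longrightarrow> Im \<zeta> > 0 \<Longrightarrow> \<bar>Re (H2 \<zeta>) - (0 + (0 - 0) / pi * Im (hlog \<zeta>))\<bar> \<le> D2 * Im \<zeta>"
      "\<And>\<zeta>. norm \<zeta> < e2 \<Longrightarrow> Im \<zeta> > 0 \<Longrightarrow> norm (deriv H2 \<zeta> + \<i> * of_real ((0 - 0) / pi) / \<zeta>) \<le> D2"
      by (rule jump_asymptotics[OF H(2) a bH(2), of 0 0])
         (use limH2[OF pos] limH2[OF neg] wrong in \<open>simp_all\<close>)
    \<comment> \<open>On the imaginary axis the expansion errs by at most
      \<open>(C1 + C2) * q\<close>; the last bound therefore keeps \<open>f\<close> within
      \<open>r\<close> of the midpoint, where \<Omega> lies to the left of the segment.\<close>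
    define \<epsilon> where "\<epsilon> = min (min e1 e2) (min d12 (r / (C1 + C2)))"
    have \<epsilon>: "\<epsilon> > 0" "\<epsilon> \<le> e1" "\<epsilon> \<le> e2" "\<epsilon> \<le> d12" "\<epsilon> \<le> r / (C1 + C2)"
      using K1(1) K2(1) d12 left(1) J1(2) J2(2) by (auto simp: \<epsilon>_def)
    have "(Re (cnj d * z\<^sub>2) - Re (cnj d * z\<^sub>1)) / pi \<le> 0"
    proof (rule jump_orientation[OF H jacH \<epsilon>(1), where C = "D1 + D2"])
      fix \<zeta> :: complex assume z: "norm \<zeta> < \<epsilon>" "Im \<zeta> > 0"
      show "norm (deriv H1 \<zeta> + \<i> * of_real ((Re (cnj d * z\<^sub>2) - Re (cnj d * z\<^sub>1)) / pi) / \<zeta>) \<le> D1 + D2"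
        using K1(3)[of \<zeta>] z \<epsilon> K2(2) by linarith
      show "norm (deriv H2 \<zeta>) \<le> D1 + D2" using K2(4)[of \<zeta>] z \<epsilon> K1(2) by simp
      have "\<bar>Re (H2 \<zeta>)\<bar> \<le> D2 * Im \<zeta>" using K2(3)[of \<zeta>] z \<epsilon> by simp
      also have "\<dots> \<le> (D1 + D2) * Im \<zeta>" using z K1(2) by (intro mult_right_mono) auto
      finally show "\<bar>Re (H2 \<zeta>)\<bar> \<le> (D1 + D2) * Im \<zeta>" .
    next
      fix q :: real assume q: "0 < q" "q < \<epsilon>"
      define \<zeta> where "\<zeta> = \<i> * complex_of_real q"
      have z: "norm \<zeta> < d12" "Im \<zeta> > 0" "Im \<zeta> = q" using q \<epsilon> by (auto simp: \<zeta>_def norm_mult)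
      \<comment> \<open>On the imaginary axis the argument is \<open>pi / 2\<close>, so the leading
        term of \<open>f\<close> is the midpoint.\<close>
      have "\<zeta> = of_real q * cis (pi / 2)" by (simp add: \<zeta>_def complex_eq_iff)
      then have "Im (hlog \<zeta>) = pi / 2" using hlog_polar[of q "pi / 2"] q by simp
      then have "p + (Im (hlog \<zeta>) / pi) *\<^sub>R (n - p) = midpoint z\<^sub>1 z\<^sub>2"
        by (simp add: wrong midpoint_def scaleR_diff_right scaleR_right_distrib[symmetric] complex_eq_iff) (simp add: algebra_simps)
      then have "dist (f (to_disc \<theta> \<zeta>)) (midpoint z\<^sub>1 z\<^sub>2) \<le> (C1 + C2) * q" using fnear[OF z(1,2)] z(3) by (simp add: dist_norm)
      also have "\<dots> < (C1 + C2) * \<epsilon>" using q J1(2) J2(2) by (intro mult_strict_left_mono) auto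
      also have "\<dots> \<le> r" using \<epsilon>(5) J1(2) J2(2) by (simp add: pos_le_divide_eq mult.commute)
      finally have "dist (f (to_disc \<theta> \<zeta>)) (midpoint z\<^sub>1 z\<^sub>2) < r" .
      moreover have "f (to_disc \<theta> \<zeta>) \<in> \<Omega>" using z(2) to_disc_in_ball f_in by blast
      ultimately show "Re (H2 (\<i> * complex_of_real q)) > 0"
        using left(2)[of "f (to_disc \<theta> \<zeta>)"] ReH2[OF z(2)] unfolding \<zeta>_def d_def by simp
    qed (assumption | rule add_pos_pos[OF K1(2) K2(2)])+
    moreover have "Re (cnj d * z\<^sub>2) - Re (cnj d * z\<^sub>1) = (norm d)\<^sup>2"
      unfolding cmod_power2 by (simp add: d_def power2_eq_square algebra_simps)
    ultimately have "(norm d)\<^sup>2 / pi \<le> 0" by (simp only:)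
    moreover have "(norm d)\<^sup>2 / pi > 0" using d0 by simp
    ultimately show False by linarith
  qed
  then show "v z\<^sub>2 - v z\<^sub>1 = norm (z\<^sub>2 - z\<^sub>1)" using vpn by (simp add: norm_minus_commute)
  have psinear: "\<bar>\<psi> (f (to_disc \<theta> \<zeta>)) - (v p + (Im (hlog \<zeta>) / pi) *\<^sub>R (v n - v p))\<bar> \<le> C3 * Im \<zeta>"
    if "norm \<zeta> < d3" "Im \<zeta> > 0" for \<zeta>
    using J3(3)[OF that] \<psi>[of "to_disc \<theta> \<zeta>"] that(2) to_disc_in_ball by (simp add: G3_def mult.commute)
  have "cluster_set (\<lambda>w. \<psi> (f w)) (cis \<theta>) = closed_segment (v n) (v p)"
    by (rule cluster_set_of_jump[OF J3(1), of "\<lambda>w. \<psi> (f w)"]) (use psinear in simp)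
  then show "cluster_set (\<lambda>w. \<psi> (f w)) (cis \<theta>) = {v z\<^sub>1..v z\<^sub>2}"
    using pz \<open>v p - v n > 0\<close> by (simp add: closed_segment_eq_real_ivl)
  have "cluster_set (\<lambda>w. (f w, \<psi> (f w))) (cis \<theta>) = closed_segment (n, v n) (p, v p)"
  proof (rule cluster_set_of_jump[OF \<delta>(1), of "\<lambda>w. (f w, \<psi> (f w))"])
    fix \<zeta> :: complex assume z: "norm \<zeta> < \<delta>" "Im \<zeta> > 0"
    have "norm ((f (to_disc \<theta> \<zeta>), \<psi> (f (to_disc \<theta> \<zeta>))) - ((p, v p) + (Im (hlog \<zeta>) / pi) *\<^sub>R ((n, v n) - (p, v p))))
      \<le> norm (f (to_disc \<theta> \<zeta>) - (p + (Im (hlog \<zeta>) / pi) *\<^sub>R (n - p))) + norm (\<psi> (f (to_disc \<theta> \<zeta>)) - (v p + (Im (hlog \<zeta>) / pi) *\<^sub>R (v n - v p)))"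
      using norm_Pair_le[of "f (to_disc \<theta> \<zeta>) - (p + (Im (hlog \<zeta>) / pi) *\<^sub>R (n - p))" "\<psi> (f (to_disc \<theta> \<zeta>)) - (v p + (Im (hlog \<zeta>) / pi) *\<^sub>R (v n - v p))"] by simp
    also have "\<dots> \<le> (C1 + C2) * Im \<zeta> + C3 * Im \<zeta>"
      using fnear[of \<zeta>] psinear[of \<zeta>] z \<delta> by (intro add_mono) auto
    finally show "norm ((f (to_disc \<theta> \<zeta>), \<psi> (f (to_disc \<theta> \<zeta>))) - ((p, v p) + (Im (hlog \<zeta>) / pi) *\<^sub>R ((n, v n) - (p, v p)))) \<le> C * Im \<zeta>"
      by (simp add: C_def ring_distribs)
  qed
  then show "cluster_set (\<lambda>w. (f w, \<psi> (f w))) (cis \<theta>) = closed_segment (z\<^sub>1, v z\<^sub>1) (z\<^sub>2, v z\<^sub>2)" using pz by simp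
  \<comment> \<open>Up to a bounded error \<open>g\<close> is \<open>- ln (norm \<zeta>)\<close>
    times \<open>(n - p) / pi\<close>. As \<open>- ln (norm \<zeta>)\<close> tends to plus infinity,
    the direction is that of \<open>n - p\<close>, which is
    \<open>z\<^sub>1 - z\<^sub>2\<close>.\<close>
  have "diverges_in_direction g (cis \<theta>) ((n - p) / of_real pi)"
  proof (rule diverges_of_log[OF \<delta>(1), where C = "C1 + C2"])
    show "(n - p) / of_real pi \<noteq> 0" using npn by simp
    fix \<zeta> :: complex assume z: "norm \<zeta> < \<delta>" "Im \<zeta> > 0"
    have gG: "g (to_disc \<theta> \<zeta>) = Complex (Im (G1 \<zeta>)) (Im (G2 \<zeta>))" using g z(2) to_disc_in_ball by (simp add: G1_def G2_def)
    have "norm (g (to_disc \<theta> \<zeta>) + of_real (ln (norm \<zeta>)) * ((n - p) / of_real pi)) \<le>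
       \<bar>Im (G1 \<zeta>) + (Re n - Re p) / pi * ln (norm \<zeta>)\<bar> + \<bar>Im (G2 \<zeta>) + (Im n - Im p) / pi * ln (norm \<zeta>)\<bar>"
      using cmod_le[of "g (to_disc \<theta> \<zeta>) + of_real (ln (norm \<zeta>)) * ((n - p) / of_real pi)"]
      by (simp add: gG Re_divide_of_real Im_divide_of_real mult.commute)
    then show "norm (g (to_disc \<theta> \<zeta>) + of_real (ln (norm \<zeta>)) * ((n - p) / of_real pi)) \<le> C1 + C2"
      using J1(4)[of \<zeta>] J2(4)[of \<zeta>] z \<delta> by linarith
  qed
  moreover have "sgn ((n - p) / of_real pi) = sgn (n - p)" by (simp add: sgn_eq norm_divide)
  ultimately show "diverges_in_direction g (cis \<theta>) (z\<^sub>1 - z\<^sub>2)" using pz by (simp add: diverges_in_direction_def)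
qed

end

section \<open>Boundary segments and corners\<close>

text \<open>Allowing two convex pieces covers re-entrant corners.\<close>

definition tame_at :: "complex set \<Rightarrow> complex \<Rightarrow> bool" where
  "tame_at \<Omega> q \<longleftrightarrow> (\<exists>r0>0. \<forall>r. 0 < r \<longrightarrow> r < r0 \<longrightarrow>
     (\<exists>A B. convex A \<and> convex B \<and> A \<inter> B \<noteq> {} \<and> \<Omega> \<inter> ball q r = A \<union> B))"

text \<open>The last clause keeps the rest of the boundary away from each interior point; the
  endpoints, where another side may join, are left to \<open>boundary_corner\<close>.\<close>

definition boundary_segment :: "complex set \<Rightarrow> complex \<Rightarrow> complex \<Rightarrow> bool" where
  "boundary_segment \<Omega> a b \<longleftrightarrow> a \<noteq> b \<and> (\<forall>q\<in>open_segment a b.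
     q \<in> frontier \<Omega> \<and> tame_at \<Omega> q \<and> (\<exists>r>0. ball q r \<inter> frontier \<Omega> \<subseteq> open_segment a b))"

text \<open>The nonzero imaginary part is the cross product of the two sides: it excludes straight
  angles and spikes alike.\<close>

definition boundary_corner :: "complex set \<Rightarrow> complex \<Rightarrow> complex \<Rightarrow> complex \<Rightarrow> bool" where
  "boundary_corner \<Omega> a b c \<longleftrightarrow> b \<in> frontier \<Omega> \<and> tame_at \<Omega> b \<and> Im (cnj (b - a) * (c - b)) \<noteq> 0 \<and>
     (\<exists>r>0. ball b r \<inter> frontier \<Omega> \<subseteq> closed_segment a b \<union> closed_segment b c)"

text \<open>The segment parameters are roots of a quadratic polynomial with leading coefficient
  \<open>(norm (b - a))\<^sup>2\<close>.\<close>

lemma finite_segment_sphere: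
  fixes a b q :: complex
  assumes "a \<noteq> b" shows "finite (closed_segment a b \<inter> sphere q r)"
proof -
  define d where "d = b - a"
  have d: "norm d \<noteq> 0" using assms by (simp add: d_def)
  have "closed_segment a b \<inter> sphere q r \<subseteq> (\<lambda>t. a + of_real t * d) ` {t. poly [:(norm (a - q))\<^sup>2 - r\<^sup>2, 2 * Re (cnj (a - q) * d), (norm d)\<^sup>2:] t = 0}"
  proof
    fix x assume x: "x \<in> closed_segment a b \<inter> sphere q r"
    then obtain t where t: "x = a + of_real t * d" by (auto simp: closed_segment_def d_def scaleR_conv_of_real algebra_simps)
    have "r\<^sup>2 = (norm (x - q))\<^sup>2" using x by (simp add: dist_norm norm_minus_commute)
    also have "\<dots> = (norm (a - q))\<^sup>2 + t * (2 * Re (cnj (a - q) * d)) + t\<^sup>2 * (norm d)\<^sup>2"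
      unfolding t cmod_power2 by (simp add: power2_eq_square algebra_simps)
    finally have "poly [:(norm (a - q))\<^sup>2 - r\<^sup>2, 2 * Re (cnj (a - q) * d), (norm d)\<^sup>2:] t = 0"
      by (simp add: power2_eq_square algebra_simps)
    then show "x \<in> (\<lambda>t. a + of_real t * d) ` {t. poly [:(norm (a - q))\<^sup>2 - r\<^sup>2, 2 * Re (cnj (a - q) * d), (norm d)\<^sup>2:] t = 0}"
      using t by blast
  qed
  moreover have "finite {t. poly [:(norm (a - q))\<^sup>2 - r\<^sup>2, 2 * Re (cnj (a - q) * d), (norm d)\<^sup>2:] t = 0}"
    using d by (intro poly_roots_finite) simp
  ultimately show ?thesis using finite_surj by blast
qed

lemma segment_sphere_endpoint:
  fixes a b :: complex
  assumes "x \<in> closed_segment b c" "x \<in> sphere b r" "b \<noteq> c"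
  shows "x = b + of_real (r / norm (c - b)) * (c - b)"
proof -
  obtain t where t: "0 \<le> t" "x = b + of_real t * (c - b)"
    using assms(1) by (auto simp: closed_segment_def scaleR_conv_of_real algebra_simps)
  have "r = norm (x - b)" using assms(2) by (simp add: dist_norm norm_minus_commute)
  also have "\<dots> = t * norm (c - b)" using t by (simp add: norm_mult)
  finally have "t = r / norm (c - b)" using assms(3) by simp
  then show ?thesis using t by simp
qed

context harmonic_homeomorphism
begin

lemma tame_imp_locally_connected:
  assumes "tame_at \<Omega> q" shows "locally_connected_at q"
  unfolding locally_connected_at_def
proof -
  obtain r0 where r0: "r0 > 0" "\<And>r. 0 < r \<Longrightarrow> r < r0 \<Longrightarrow> \<exists>A B. convex A \<and> convex B \<and> A \<inter> B \<noteq> {} \<and> \<Omega> \<inter> ball q r = A \<union> B"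
    using assms unfolding tame_at_def by blast
  have "connected (\<Omega> \<inter> ball q r)" if r: "0 < r" "r < r0" for r
  proof -
    obtain A B where AB: "convex A" "convex B" "A \<inter> B \<noteq> {}" "\<Omega> \<inter> ball q r = A \<union> B" using r0(2)[OF r] by blast
    show ?thesis unfolding AB(4) by (intro connected_Un convex_connected AB(1-3))
  qed
  then show "\<exists>r0>0. \<forall>r. 0 < r \<longrightarrow> r < r0 \<longrightarrow> connected (\<Omega> \<inter> ball q r)" using r0(1) by blast
qed

text \<open>The limits \<open>E q\<close> of \<open>F\<close> depend continuously on
  \<open>q\<close>. Near \<open>x\<close> they all belong to the finite set of limits at the points
  where a small circle about \<open>x\<close> meets the boundary segment. Continuity with finite
  range on a connected set gives local constancy, and connectedness of the segment the rest.\<close>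

lemma boundary_segment_F_limit:
  assumes ab: "boundary_segment \<Omega> a b" and h: "h holomorphic_on ball 0 1"
    and pole: "\<And>q. q \<in> open_segment a b \<Longrightarrow> filterlim (\<lambda>z. Re (h (F z))) at_top (at q within \<Omega>)"
  obtains e where "norm e = 1" "\<And>q. q \<in> open_segment a b \<Longrightarrow> (F \<longlongrightarrow> e) (at q within \<Omega>)"
proof -
  define I where "I = open_segment a b"
  have I: "q \<in> frontier \<Omega>" "tame_at \<Omega> q" "\<exists>r>0. ball q r \<inter> frontier \<Omega> \<subseteq> I" if "q \<in> I" for q
    using ab that by (auto simp: boundary_segment_def I_def)
  have neq: "a \<noteq> b" using ab by (simp add: boundary_segment_def)
  have "\<exists>e. norm e = 1 \<and> (F \<longlongrightarrow> e) (at q within \<Omega>)" if q: "q \<in> I" for q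
  proof -
    obtain e where "norm e = 1" "(F \<longlongrightarrow> e) (at q within \<Omega>)"
      by (rule tendsto_F_at_pole[OF I(1)[OF q] tame_imp_locally_connected[OF I(2)[OF q]] h pole[OF q[unfolded I_def]]])
    then show ?thesis by blast
  qed
  then obtain E where E: "\<And>q. q \<in> I \<Longrightarrow> norm (E q) = 1" "\<And>q. q \<in> I \<Longrightarrow> (F \<longlongrightarrow> E q) (at q within \<Omega>)" by metis
  have contE: "continuous_on I E"
    unfolding continuous_on_iff
  proof (intro ballI allI impI)
    fix x and e :: real assume x: "x \<in> I" and e: "e > 0"
    have "e / 2 > 0" using e by simp
    from tendstoD[OF E(2)[OF x] this] obtain d where d: "d > 0"
      "\<And>z. z \<in> \<Omega> \<Longrightarrow> z \<noteq> x \<Longrightarrow> dist z x < d \<Longrightarrow> dist (F z) (E x) < e / 2" unfolding eventually_at by blast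
    have "dist (E y) (E x) < e" if y: "y \<in> I" "dist y x < d" for y
    proof -
      have "\<forall>\<^sub>F z in nhds y. z \<in> ball x d" using y by (intro eventually_nhds_in_open) (auto simp: dist_commute)
      then have "\<forall>\<^sub>F z in at y within \<Omega>. dist (F z) (E x) \<le> e / 2" unfolding eventually_at_filter
      proof (rule eventually_mono, intro impI)
        fix z assume z: "z \<in> ball x d" "z \<in> \<Omega>"
        have "z \<noteq> x" using z(2) I(1)[OF x] by (auto simp: frontier_\<Omega>)
        then show "dist (F z) (E x) \<le> e / 2" using d(2)[of z] z by (simp add: dist_commute less_imp_le)
      qed
      from tendsto_upperbound[OF tendsto_dist[OF E(2)[OF y(1)] tendsto_const] this at_frontier_nontrivial[OF I(1)[OF y(1)]]]
      show ?thesis using e by simp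
    qed
    then show "\<exists>d>0. \<forall>x'\<in>I. dist x' x < d \<longrightarrow> dist (E x') (E x) < e" using d(1) by blast
  qed
  have locconst: "\<forall>\<^sub>F y in at x within I. E x = E y" if x: "x \<in> I" for x
  proof -
    obtain r0 where r0: "r0 > 0" "ball x r0 \<inter> frontier \<Omega> \<subseteq> I" using I(3)[OF x] by blast
    define r where "r = r0 / 2"
    have r: "r > 0" "cball x r \<inter> frontier \<Omega> \<subseteq> I" using r0 by (auto simp: r_def)
    define T where "T = E ` (sphere x r \<inter> frontier \<Omega>)"
    have "sphere x r \<inter> frontier \<Omega> \<subseteq> closed_segment a b \<inter> sphere x r"
    proof
      fix u assume u: "u \<in> sphere x r \<inter> frontier \<Omega>"
      then have "u \<in> open_segment a b" using r(2) by (auto simp: I_def)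
      then show "u \<in> closed_segment a b \<inter> sphere x r" using u open_closed_segment by blast
    qed
    then have finT: "finite T" unfolding T_def using finite_segment_sphere[OF neq] finite_subset by blast
    have ET: "E y \<in> T" if y: "y \<in> I" "y \<in> ball x r" for y
    proof (rule F_constant_near_pole[OF h, of x r T])
      show "filterlim (\<lambda>z. Re (h (F z))) at_top (at q within \<Omega>)" if "q \<in> frontier \<Omega>" "q \<in> cball x r" for q
        using r(2) that by (intro pole) (auto simp: I_def)
      show "\<exists>e\<in>T. (F \<longlongrightarrow> e) (at q within \<Omega>)" if "q \<in> sphere x r" "q \<in> frontier \<Omega>" for q
      proof -
        have "q \<in> I" using r(2) that by auto
        then show ?thesis using E(2)[of q] that unfolding T_def by blast
      qed
      show "closed T" using finT by (rule finite_imp_closed)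
    qed (use y I E in auto)
    have "E constant_on (I \<inter> ball x r)"
    proof (rule continuous_finite_range_constant)
      show "connected (I \<inter> ball x r)" unfolding I_def by (intro convex_connected convex_Int convex_open_segment convex_ball)
      show "continuous_on (I \<inter> ball x r) E" using contE by (rule continuous_on_subset) simp
      show "finite (E ` (I \<inter> ball x r))" using finT by (rule finite_subset[rotated]) (use ET in blast)
    qed
    then have "E x = E y" if "y \<in> I" "dist y x < r" for y
      using that x r(1) unfolding constant_on_def by (metis IntI centre_in_ball dist_commute mem_ball)
    then show ?thesis unfolding eventually_at using r(1) by blast
  qed
  have "connected I" unfolding I_def by (simp add: convex_connected convex_open_segment)
  then have const: "E x = E y" if "x \<in> I" "y \<in> I" for x y
    using connected_local_const[of I x y E] that locconst by blast
  have "midpoint a b \<in> I" using neq by (simp add: I_def midpoint_in_open_segment)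
  then show ?thesis using that[of "E (midpoint a b)"] E const unfolding I_def by metis
qed

text \<open>Points of the segment near \<open>a\<close> are approached by points of \<Omega> near
  \<open>a\<close> whose images tend to \<open>e\<close>; so the constant limit survives at the
  endpoint as a cluster value.\<close>

lemma limit_in_F_cluster:
  assumes I: "\<And>q. q \<in> open_segment a b \<Longrightarrow> q \<in> frontier \<Omega>" "a \<noteq> b"
    and lim: "\<And>q. q \<in> open_segment a b \<Longrightarrow> (F \<longlongrightarrow> e) (at q within \<Omega>)"
  shows "e \<in> F_cluster a"
  unfolding F_cluster_def
proof (intro CollectI allI impI)
  fix r :: real assume r: "r > 0"
  define t where "t = min (1/2) (r / (2 * norm (b - a)))"
  have nb: "norm (b - a) > 0" using I(2) by simp
  have t: "0 < t" "t < 1" "t * norm (b - a) < r"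
  proof -
    show "0 < t" "t < 1" using r nb by (auto simp: t_def)
    have "t * norm (b - a) \<le> r / (2 * norm (b - a)) * norm (b - a)" using nb by (intro mult_right_mono) (auto simp: t_def)
    also have "\<dots> < r" using nb r by simp
    finally show "t * norm (b - a) < r" .
  qed
  define q where "q = a + t *\<^sub>R (b - a)"
  have q: "q \<in> open_segment a b" unfolding in_segment using t I(2)
    by (intro conjI exI[of _ t]) (auto simp: q_def algebra_simps)
  have qa: "q \<in> ball a r" using t by (simp add: q_def dist_norm)
  have "\<forall>\<^sub>F z in nhds q. z \<in> ball a r" using qa by (intro eventually_nhds_in_open) auto
  then have "\<forall>\<^sub>F z in at q within \<Omega>. F z \<in> closure (F ` (\<Omega> \<inter> ball a r))" unfolding eventually_at_filter
    by (rule eventually_mono) (auto intro!: closure_subset[THEN subsetD])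
  from Lim_in_closed_set[OF closed_closure this at_frontier_nontrivial[OF I(1)[OF q]] lim[OF q]]
  show "e \<in> closure (F ` (\<Omega> \<inter> ball a r))" .
qed

text \<open>A common limit would put a point \<open>q0\<close> of one side on the chord from
  \<open>p1\<close> to \<open>p2\<close> of a small circle about the corner; as the sides are not
  collinear, this chord meets that side only at \<open>p2\<close>. So \<open>F\<close> has two
  distinct cluster values at the corner, hence an arc belongs to it.\<close>

lemma corner_arc:
  assumes corner: "boundary_corner \<Omega> a b c"
    and segs: "boundary_segment \<Omega> a b" "boundary_segment \<Omega> b c"
    and lim1: "\<And>q. q \<in> open_segment a b \<Longrightarrow> (F \<longlongrightarrow> e\<^sub>1) (at q within \<Omega>)"
    and lim2: "\<And>q. q \<in> open_segment b c \<Longrightarrow> (F \<longlongrightarrow> e\<^sub>2) (at q within \<Omega>)"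
    and e2: "norm e\<^sub>2 = 1"
  obtains \<alpha> \<beta> where "\<alpha> < \<beta>" "{cis \<alpha>, cis \<beta>} = {e\<^sub>1, e\<^sub>2}"
    "\<And>s. \<alpha> < s \<Longrightarrow> s < \<beta> \<Longrightarrow> (f \<longlongrightarrow> b) (at (cis s) within ball 0 1)"
proof -
  have b: "b \<in> frontier \<Omega>" "tame_at \<Omega> b" "Im (cnj (b - a) * (c - b)) \<noteq> 0" using corner by (auto simp: boundary_corner_def)
  obtain r0 where r0: "r0 > 0" "ball b r0 \<inter> frontier \<Omega> \<subseteq> closed_segment a b \<union> closed_segment b c"
    using corner by (auto simp: boundary_corner_def)
  have neq: "a \<noteq> b" "b \<noteq> c" using segs by (auto simp: boundary_segment_def)
  have "e\<^sub>1 \<noteq> e\<^sub>2"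
  proof
    assume eq: "e\<^sub>1 = e\<^sub>2"
    define r where "r = min r0 (min (norm (a - b)) (norm (c - b))) / 2"
    define m where "m = min r0 (min (norm (a - b)) (norm (c - b)))"
    have m: "m > 0" "m \<le> r0" "m \<le> norm (a - b)" "m \<le> norm (c - b)" using r0(1) neq by (auto simp: m_def)
    have "r = m / 2" by (simp add: r_def m_def)
    then have r: "r > 0" "r < r0" "r < norm (a - b)" "r < norm (c - b)" using m by linarith+
    define p1 where "p1 = b + of_real (r / norm (a - b)) * (a - b)"
    define p2 where "p2 = b + of_real (r / norm (c - b)) * (c - b)"
    define q0 where "q0 = b + of_real (r / (2 * norm (c - b))) * (c - b)"
    have q0seg: "q0 \<in> open_segment b c" unfolding in_segment
      using r neq by (intro conjI exI[of _ "r / (2 * norm (c - b))"]) (auto simp: q0_def scaleR_conv_of_real algebra_simps divide_simps)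
    have "q0 \<in> closed_segment p1 p2"
    proof (rule common_limit_imp_segment[OF b(1) e2, of r])
      show "(F \<longlongrightarrow> e\<^sub>2) (at q within \<Omega>)" if q: "q \<in> frontier \<Omega>" "q \<in> cball b r" "q \<noteq> b" for q
      proof -
        have "q \<in> ball b r0" using q(2) r by simp
        then have "q \<in> closed_segment a b \<union> closed_segment b c" using r0(2) q(1) by blast
        moreover have "q \<noteq> a" "q \<noteq> c" using q(2) r by (auto simp: dist_norm norm_minus_commute)
        ultimately have "q \<in> open_segment a b \<or> q \<in> open_segment b c" using q(3) by (auto simp: open_segment_def)
        then show ?thesis using lim1[of q] lim2[of q] eq by auto
      qed
      show "sphere b r \<inter> frontier \<Omega> \<subseteq> {p1, p2}"
      proof
        fix x assume x: "x \<in> sphere b r \<inter> frontier \<Omega>"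
        then have "x \<in> closed_segment b a \<or> x \<in> closed_segment b c" using r0(2) r by (auto simp: closed_segment_commute)
        then show "x \<in> {p1, p2}" using segment_sphere_endpoint[of x b a r] segment_sphere_endpoint[of x b c r] x neq
          by (auto simp: p1_def p2_def)
      qed
      show "b \<notin> sphere b r" using r by simp
      show "q0 \<in> frontier \<Omega>" using segs(2) q0seg by (auto simp: boundary_segment_def)
      have "norm (q0 - b) = \<bar>r / (2 * norm (c - b))\<bar> * norm (c - b)"
        unfolding q0_def by (simp only: add_diff_cancel_left' norm_mult norm_of_real)
      also have "\<dots> = r / 2" using r neq by simp
      finally show "q0 \<in> ball b r" using r by (simp add: dist_norm norm_minus_commute)
      show "q0 \<noteq> b" using r neq by (simp add: q0_def)
    qed
    then obtain u where u: "0 \<le> u" "u \<le> 1" "q0 = (1 - u) *\<^sub>R p1 + u *\<^sub>R p2" by (auto simp: closed_segment_def)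
    have "of_real (r / (2 * norm (c - b))) * (c - b) = of_real ((1 - u) * (r / norm (a - b))) * (a - b) + of_real (u * (r / norm (c - b))) * (c - b)"
      using u(3) by (simp add: q0_def p1_def p2_def scaleR_conv_of_real algebra_simps)
    then have *: "of_real (r / (2 * norm (c - b)) - u * (r / norm (c - b))) * (c - b) = of_real ((1 - u) * (r / norm (a - b))) * (a - b)"
      by (simp add: algebra_simps)
    \<comment> \<open>The cross product with \<open>c - b\<close> kills one side of the equation and
      forces \<open>u = 1\<close>; so \<open>q0 = p2\<close>, although \<open>q0\<close> is only
      half as far from \<open>b\<close>.\<close>
    have cross: "Im (cnj (c - b) * (a - b)) \<noteq> 0" using b(3) by (auto simp: algebra_simps)
    have scale: "Im (cnj x * (of_real k * y)) = k * Im (cnj x * y)" for x y :: complex and k :: real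
      by (simp add: algebra_simps)
    have "Im (cnj (c - b) * (of_real (r / (2 * norm (c - b)) - u * (r / norm (c - b))) * (c - b))) = 0"
      unfolding scale by (simp add: algebra_simps)
    then have "Im (cnj (c - b) * (of_real ((1 - u) * (r / norm (a - b))) * (a - b))) = 0" unfolding * .
    then have "(1 - u) * (r / norm (a - b)) * Im (cnj (c - b) * (a - b)) = 0" unfolding scale .
    then have "u = 1" using cross r neq by simp
    then have "q0 = p2" using u(3) by simp
    then have "r / (2 * norm (c - b)) = r / norm (c - b)" using neq by (simp add: q0_def p2_def)
    then show False using r neq by (simp add: field_simps)
  qed
  have "e\<^sub>1 \<in> F_cluster b"
    using limit_in_F_cluster[of b a e\<^sub>1] segs(1) lim1 neq by (auto simp: boundary_segment_def open_segment_commute)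
  moreover have "e\<^sub>2 \<in> F_cluster b"
    using limit_in_F_cluster[of b c e\<^sub>2] segs(2) lim2 neq by (auto simp: boundary_segment_def)
  ultimately show ?thesis
    using arc_of_two_clusters[OF b(1) tame_imp_locally_connected[OF b(2)] _ _ \<open>e\<^sub>1 \<noteq> e\<^sub>2\<close>] that by blast
qed

text \<open>The ends of the arc come as an unordered pair, so \<open>cis \<theta>\<close> may be
  either of them; this leaves open on which side of \<theta> the arc lies.\<close>

lemma one_sided_limit:
  assumes ab: "\<alpha> < \<beta>" "{cis \<alpha>, cis \<beta>} = {e, cis \<theta>}"
    and lim: "\<And>s. \<alpha> < s \<Longrightarrow> s < \<beta> \<Longrightarrow> (f \<longlongrightarrow> b) (at (cis s) within ball 0 1)"
  shows "\<exists>a>0. (\<forall>s. 0 < s \<longrightarrow> s < a \<longrightarrow> (f \<longlongrightarrow> b) (at (cis (\<theta> + s)) within ball 0 1)) \<or>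
               (\<forall>s. - a < s \<longrightarrow> s < 0 \<longrightarrow> (f \<longlongrightarrow> b) (at (cis (\<theta> + s)) within ball 0 1))"
proof -
  have "cis \<theta> \<in> {cis \<alpha>, cis \<beta>}" unfolding ab(2) by simp
  then consider "cis \<theta> = cis \<alpha>" | "cis \<theta> = cis \<beta>" by blast
  then show ?thesis
  proof cases
    case 1
    then have "cis (\<theta> + s) = cis (\<alpha> + s)" for s by (simp add: cis_mult[symmetric])
    then show ?thesis using lim ab(1) by (intro exI[of _ "\<beta> - \<alpha>"] conjI disjI1) auto
  next
    case 2
    then have "cis (\<theta> + s) = cis (\<beta> + s)" for s by (simp add: cis_mult[symmetric])
    then show ?thesis using lim ab(1) by (intro exI[of _ "\<beta> - \<alpha>"] conjI disjI2) auto
  qed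
qed

text \<open>Two limits on a common side would agree by uniqueness, so the two corners occupy
  different sides. Which of them takes which side is left to orientation.\<close>

lemma opposite_sides:
  assumes 1: "a\<^sub>1 > 0" "(\<forall>s. 0 < s \<longrightarrow> s < a\<^sub>1 \<longrightarrow> (f \<longlongrightarrow> z\<^sub>1) (at (cis (\<theta> + s)) within ball 0 1)) \<or>
               (\<forall>s. - a\<^sub>1 < s \<longrightarrow> s < 0 \<longrightarrow> (f \<longlongrightarrow> z\<^sub>1) (at (cis (\<theta> + s)) within ball 0 1))"
    and 2: "a\<^sub>2 > 0" "(\<forall>s. 0 < s \<longrightarrow> s < a\<^sub>2 \<longrightarrow> (f \<longlongrightarrow> z\<^sub>2) (at (cis (\<theta> + s)) within ball 0 1)) \<or>
               (\<forall>s. - a\<^sub>2 < s \<longrightarrow> s < 0 \<longrightarrow> (f \<longlongrightarrow> z\<^sub>2) (at (cis (\<theta> + s)) within ball 0 1))"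
    and z: "z\<^sub>1 \<noteq> z\<^sub>2"
  obtains a p n where "a > 0" "{p, n} = {z\<^sub>1, z\<^sub>2}"
    "\<And>s. 0 < s \<Longrightarrow> s < a \<Longrightarrow> (f \<longlongrightarrow> p) (at (cis (\<theta> + s)) within ball 0 1)"
    "\<And>s. - a < s \<Longrightarrow> s < 0 \<Longrightarrow> (f \<longlongrightarrow> n) (at (cis (\<theta> + s)) within ball 0 1)"
proof -
  define a where "a = min a\<^sub>1 a\<^sub>2"
  have a: "a > 0" "a \<le> a\<^sub>1" "a \<le> a\<^sub>2" using 1(1) 2(1) by (auto simp: a_def)
  have no: False if "(f \<longlongrightarrow> z\<^sub>1) (at (cis s) within ball 0 1)" "(f \<longlongrightarrow> z\<^sub>2) (at (cis s) within ball 0 1)" for s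
  proof -
    have "at (cis s) within ball 0 1 \<noteq> bot" by (simp add: at_within_ball_bot_iff)
    from tendsto_unique[OF this that] z show False by simp
  qed
  consider (pp) "\<And>s. 0 < s \<Longrightarrow> s < a \<Longrightarrow> (f \<longlongrightarrow> z\<^sub>1) (at (cis (\<theta> + s)) within ball 0 1)" "\<And>s. 0 < s \<Longrightarrow> s < a \<Longrightarrow> (f \<longlongrightarrow> z\<^sub>2) (at (cis (\<theta> + s)) within ball 0 1)"
    | (pn) "\<And>s. 0 < s \<Longrightarrow> s < a \<Longrightarrow> (f \<longlongrightarrow> z\<^sub>1) (at (cis (\<theta> + s)) within ball 0 1)" "\<And>s. - a < s \<Longrightarrow> s < 0 \<Longrightarrow> (f \<longlongrightarrow> z\<^sub>2) (at (cis (\<theta> + s)) within ball 0 1)"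
    | (np) "\<And>s. - a < s \<Longrightarrow> s < 0 \<Longrightarrow> (f \<longlongrightarrow> z\<^sub>1) (at (cis (\<theta> + s)) within ball 0 1)" "\<And>s. 0 < s \<Longrightarrow> s < a \<Longrightarrow> (f \<longlongrightarrow> z\<^sub>2) (at (cis (\<theta> + s)) within ball 0 1)"
    | (nn) "\<And>s. - a < s \<Longrightarrow> s < 0 \<Longrightarrow> (f \<longlongrightarrow> z\<^sub>1) (at (cis (\<theta> + s)) within ball 0 1)" "\<And>s. - a < s \<Longrightarrow> s < 0 \<Longrightarrow> (f \<longlongrightarrow> z\<^sub>2) (at (cis (\<theta> + s)) within ball 0 1)"
    using 1(2) 2(2) a by (elim disjE) (auto 0 3)
  then show ?thesis
  proof cases
    case pp
    show ?thesis using no[OF pp[of "a / 2"]] a(1) by simp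
  next
    case pn
    then show ?thesis using that[of a z\<^sub>1 z\<^sub>2] a(1) by blast
  next
    case np
    then show ?thesis using that[of a z\<^sub>2 z\<^sub>1] a(1) by blast
  next
    case nn
    show ?thesis using no[OF nn[of "- a / 2"]] a(1) by simp
  qed
qed

end

section \<open>The domain to the left of its boundary boundary_curve\<close>

text \<open>For \<open>w\<close> on the segment the quotient \<open>(w - z) / (a - z)\<close> avoids
  the nonpositive axis, since \<open>z\<close> is off the segment; so its principal logarithm is a
  primitive of the kernel.\<close>

lemma winding_number_linepath_Ln:
  assumes z: "z \<notin> closed_segment a b"
  shows "winding_number (linepath a b) z = Ln ((b - z) / (a - z)) / (2 * pi * \<i>)"
proof -
  have az: "a - z \<noteq> 0" using z by auto
  have nonpos: "(w - z) / (a - z) \<notin> \<real>\<^sub>\<le>\<^sub>0" if w: "w \<in> closed_segment a b" for w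
  proof
    assume "(w - z) / (a - z) \<in> \<real>\<^sub>\<le>\<^sub>0"
    then obtain x where x: "x \<le> 0" "(w - z) / (a - z) = of_real x" by (auto elim: nonpos_Reals_cases)
    then have wz: "w - z = of_real x * (a - z)" using az by (simp add: field_simps)
    \<comment> \<open>A nonpositive quotient \<open>x\<close> would make \<open>z\<close> the convex
      combination of \<open>w\<close> and \<open>a\<close> with weight \<open>u\<close> at
      \<open>w\<close>.\<close>
    define u where "u = 1 / (1 - x)"
    have u: "0 \<le> u" "u \<le> 1" "u * (1 - x) = 1" using x(1) by (auto simp: u_def)
    have "of_real (1 - x) * z = w - of_real x * a" using wz by (simp add: algebra_simps)
    then have "of_real u * (of_real (1 - x) * z) = of_real u * (w - of_real x * a)" by simp
    then have "of_real (u * (1 - x)) * z = of_real u * w - of_real (u * x) * a" by (simp add: algebra_simps)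
    moreover have "u * x = u - 1" using u(3) by (simp add: algebra_simps)
    ultimately have "z = of_real u * w + of_real (1 - u) * a" using u(3) by (simp add: algebra_simps)
    then have "z \<in> closed_segment a w" using u(1,2)
      by (auto simp: closed_segment_def scaleR_conv_of_real intro!: exI[of _ u])
    moreover have "closed_segment a w \<subseteq> closed_segment a b" using w by (simp add: subset_closed_segment)
    ultimately show False using z by blast
  qed
  have "((\<lambda>w. 1 / (w - z)) has_contour_integral (Ln ((pathfinish (linepath a b) - z) / (a - z)) - Ln ((pathstart (linepath a b) - z) / (a - z)))) (linepath a b)"
  proof (rule contour_integral_primitive[of "closed_segment a b" "\<lambda>w. Ln ((w - z) / (a - z))"])
    fix w assume w: "w \<in> closed_segment a b"
    have "w - z \<noteq> 0" using w z by auto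
    have "((\<lambda>w. (w - z) / (a - z)) has_field_derivative 1 / (a - z)) (at w within closed_segment a b)"
      using az by (auto intro!: derivative_eq_intros)
    from DERIV_chain2[OF has_field_derivative_Ln[OF nonpos[OF w]] this]
    have "((\<lambda>w. Ln ((w - z) / (a - z))) has_field_derivative inverse ((w - z) / (a - z)) * (1 / (a - z))) (at w within closed_segment a b)" .
    moreover have "inverse ((w - z) / (a - z)) * (1 / (a - z)) = 1 / (w - z)" using az \<open>w - z \<noteq> 0\<close> by simp
    ultimately show "((\<lambda>w. Ln ((w - z) / (a - z))) has_field_derivative 1 / (w - z)) (at w within closed_segment a b)" by simp
  qed auto
  then have "contour_integral (linepath a b) (\<lambda>w. 1 / (w - z)) = Ln ((b - z) / (a - z))"
    using az by (simp add: contour_integral_unique)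
  then show ?thesis using z by (subst winding_number_valid_path) auto
qed

text \<open>The parametrization of the segment is arbitrary; the linear homotopy to
  \<open>linepath\<close> stays in the segment by convexity.\<close>

lemma winding_number_segment_subpath:
  assumes \<gamma>: "path \<gamma>" and st: "0 \<le> s" "s \<le> t" "t \<le> 1" and im: "\<gamma> ` {s..t} = closed_segment (\<gamma> s) (\<gamma> t)"
    and z: "z \<notin> closed_segment (\<gamma> s) (\<gamma> t)"
  shows "winding_number (subpath s t \<gamma>) z = winding_number (linepath (\<gamma> s) (\<gamma> t)) z"
proof (rule winding_number_homotopic_paths[OF homotopic_paths_linear])
  have p: "path (subpath s t \<gamma>)" using \<gamma> st by simp
  show "path (subpath s t \<gamma>)" by (rule p)
  have img: "path_image (subpath s t \<gamma>) = closed_segment (\<gamma> s) (\<gamma> t)" using st im by (simp add: path_image_subpath)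
  show "closed_segment (subpath s t \<gamma> x) (linepath (\<gamma> s) (\<gamma> t) x) \<subseteq> - {z}" if "x \<in> {0..1}" for x
  proof -
    have "subpath s t \<gamma> x \<in> closed_segment (\<gamma> s) (\<gamma> t)" using that img by (auto simp: path_image_def)
    moreover have "linepath (\<gamma> s) (\<gamma> t) x \<in> closed_segment (\<gamma> s) (\<gamma> t)" using that by (simp add: linepath_in_path)
    ultimately have "closed_segment (subpath s t \<gamma> x) (linepath (\<gamma> s) (\<gamma> t) x) \<subseteq> closed_segment (\<gamma> s) (\<gamma> t)"
      by (simp add: closed_segment_subset)
    then show ?thesis using z by blast
  qed
qed auto

text \<open>The quotient is \<open>((1 - u) - \<i> * e) / (- (u + \<i> * e))\<close>, a positive
  multiple of \<open>Complex (e\<^sup>2 - u * (1 - u)) e\<close>. For small \<open>e\<close> this is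
  close in direction to the negative axis, on the side given by the sign of \<open>e\<close>: the
  source of the jump of the argument.\<close>

lemma Im_left_of_segment:
  assumes p: "p = a + of_real u * d" "b = a + of_real 1 * d" and u: "0 < u" "u < 1" and d: "d \<noteq> 0" and e: "e \<noteq> 0"
  shows "Im (Ln ((b - (p + \<i> * of_real e * d)) / (a - (p + \<i> * of_real e * d)))) =
     Arg (Complex (e\<^sup>2 - u * (1 - u)) e)"
proof -
  have n: "u\<^sup>2 + e\<^sup>2 > 0" using u by (simp add: add_pos_nonneg)
  have ne: "of_real u + \<i> * of_real e \<noteq> 0" using u by (simp add: complex_eq_iff)
  have "(b - (p + \<i> * of_real e * d)) / (a - (p + \<i> * of_real e * d)) = (of_real (1 - u) - \<i> * of_real e) / (- (of_real u + \<i> * of_real e))"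
  proof -
    have "b - (p + \<i> * of_real e * d) = (of_real (1 - u) - \<i> * of_real e) * d"
      "a - (p + \<i> * of_real e * d) = - (of_real u + \<i> * of_real e) * d" unfolding p by (simp_all add: algebra_simps)
    then show ?thesis using d by simp
  qed
  also have "\<dots> = of_real (1 / (u\<^sup>2 + e\<^sup>2)) * Complex (e\<^sup>2 - u * (1 - u)) e"
  proof -
    have "(of_real (1 - u) - \<i> * of_real e) * of_real (u\<^sup>2 + e\<^sup>2) = Complex (e\<^sup>2 - u * (1 - u)) e * (- (of_real u + \<i> * of_real e))"
      by (simp add: complex_eq_iff power2_eq_square algebra_simps del: of_real_add of_real_mult)
    then have "of_real (1 / (u\<^sup>2 + e\<^sup>2)) * ((of_real (1 - u) - \<i> * of_real e) * of_real (u\<^sup>2 + e\<^sup>2)) =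
        of_real (1 / (u\<^sup>2 + e\<^sup>2)) * (Complex (e\<^sup>2 - u * (1 - u)) e * (- (of_real u + \<i> * of_real e)))" by simp
    moreover have "of_real (1 / (u\<^sup>2 + e\<^sup>2)) * of_real (u\<^sup>2 + e\<^sup>2) = (1::complex)"
    proof -
      have "1 / (u\<^sup>2 + e\<^sup>2) * (u\<^sup>2 + e\<^sup>2) = 1" using n by (intro nonzero_eq_divide_eq[THEN iffD1]) auto
      then show ?thesis by (simp only: of_real_mult[symmetric] of_real_1)
    qed
    ultimately have "of_real (1 - u) - \<i> * of_real e = (of_real (1 / (u\<^sup>2 + e\<^sup>2)) * Complex (e\<^sup>2 - u * (1 - u)) e) * (- (of_real u + \<i> * of_real e))"
      by (metis mult.assoc mult.commute mult.right_neutral)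
    moreover have "- (of_real u + \<i> * of_real e) \<noteq> 0" using ne by (simp only: neg_equal_0_iff_equal not_False_eq_True)
    ultimately show ?thesis by (simp only: nonzero_divide_eq_eq not_False_eq_True)
  qed
  finally have eq: "(b - (p + \<i> * of_real e * d)) / (a - (p + \<i> * of_real e * d)) = of_real (1 / (u\<^sup>2 + e\<^sup>2)) * Complex (e\<^sup>2 - u * (1 - u)) e" .
  have "Complex (e\<^sup>2 - u * (1 - u)) e \<noteq> 0" using e by (simp add: complex_eq_iff)
  then have "Ln (of_real (1 / (u\<^sup>2 + e\<^sup>2)) * Complex (e\<^sup>2 - u * (1 - u)) e) = of_real (ln (1 / (u\<^sup>2 + e\<^sup>2))) + Ln (Complex (e\<^sup>2 - u * (1 - u)) e)"
    using n Ln_of_real[of "1 / (u\<^sup>2 + e\<^sup>2)"] Ln_times_of_real[of "1 / (u\<^sup>2 + e\<^sup>2)" "Complex (e\<^sup>2 - u * (1 - u)) e"]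
    by (simp only: zero_less_divide_1_iff simp_thms)
  then have "Im (Ln (of_real (1 / (u\<^sup>2 + e\<^sup>2)) * Complex (e\<^sup>2 - u * (1 - u)) e)) = Im (Ln (Complex (e\<^sup>2 - u * (1 - u)) e))"
    by (simp only: plus_complex.sel Im_complex_of_real add_0_left)
  also have "\<dots> = Arg (Complex (e\<^sup>2 - u * (1 - u)) e)" using \<open>Complex _ _ \<noteq> 0\<close> by (simp add: Arg_eq_Im_Ln)
  finally show ?thesis unfolding eq .
qed

text \<open>Crossing a boundary segment changes the winding number by one, so the left side is inside.\<close>

lemma winding_number_across_segment:
  assumes \<gamma>: "simple_path \<gamma>" "pathfinish \<gamma> = pathstart \<gamma>"
    and st: "0 \<le> s" "s < t" "t \<le> 1" and im: "\<gamma> ` {s..t} = closed_segment (\<gamma> s) (\<gamma> t)"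
    and p: "p \<in> open_segment (\<gamma> s) (\<gamma> t)" "p \<notin> \<gamma> ` ({0..s} \<union> {t..1})"
  obtains e\<^sub>0 where "e\<^sub>0 > 0" "\<And>e. 0 < e \<Longrightarrow> e < e\<^sub>0 \<Longrightarrow>
      winding_number \<gamma> (p + \<i> * of_real e * (\<gamma> t - \<gamma> s)) = winding_number \<gamma> (p - \<i> * of_real e * (\<gamma> t - \<gamma> s)) + 1"
proof -
  define a b d where "a = \<gamma> s" "b = \<gamma> t" "d = \<gamma> t - \<gamma> s"
  have path: "path \<gamma>" using \<gamma>(1) simple_path_imp_path by blast
  have ab: "a \<noteq> b" using p(1) by (auto simp: a_b_d_def open_segment_def)
  then have d: "d \<noteq> 0" "b = a + d" by (auto simp: a_b_d_def)
  obtain u where u: "0 < u" "u < 1" "p = a + of_real u * d"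
    using p(1) by (auto simp: in_segment a_b_d_def scaleR_conv_of_real algebra_simps)
  define A where "A = subpath 0 s \<gamma>"
  define E where "E = subpath t 1 \<gamma>"
  have AE: "path A" "path E" "path_image A = \<gamma> ` {0..s}" "path_image E = \<gamma> ` {t..1}"
    using path st by (auto simp: A_def E_def path_image_subpath)
  \<comment> \<open>\<open>W\<close> collects the rest of the curve, whose contribution is
    continuous at \<open>p\<close>; the jump is due to the segment alone.\<close>
  define W where "W = (\<lambda>z. winding_number A z + winding_number E z)"
  have contW: "isCont W p" unfolding W_def using AE p(2)
    by (intro continuous_intros continuous_at_winding_number) auto
  then obtain r1 where r1: "r1 > 0" "\<And>z. dist z p < r1 \<Longrightarrow> dist (W z) (W p) < 1/8"
    unfolding continuous_at_eps_delta by (metis zero_less_divide_1_iff zero_less_numeral)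
  have "closed (path_image A \<union> path_image E)" using AE(1,2) by (simp add: closed_path_image closed_Un)
  then have "open (- (path_image A \<union> path_image E))" by blast
  moreover have "p \<in> - (path_image A \<union> path_image E)" using p(2) AE by auto
  ultimately obtain r2 where r2: "r2 > 0" "ball p r2 \<subseteq> - (path_image A \<union> path_image E)" unfolding open_contains_ball by blast
  \<comment> \<open>Small enough to stay off the rest of the curve, to keep \<open>W\<close> within
    an eighth of its value at \<open>p\<close>, and, through \<open>u * (1 - u)\<close>, to have
    \<open>e\<^sup>2 < u * (1 - u)\<close>, so that the argument exceeds
    \<open>pi / 2\<close>.\<close>
  define e\<^sub>0 where "e\<^sub>0 = min (min r1 r2 / norm d) (u * (1 - u))"
  have e0: "e\<^sub>0 > 0" using r1(1) r2(1) d(1) u by (simp add: e\<^sub>0_def)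
  have split: "winding_number \<gamma> z = W z + winding_number (linepath a b) z"
    if z: "z \<notin> path_image \<gamma>" for z
  proof -
    have "winding_number (subpath 0 s \<gamma>) z + winding_number (subpath s t \<gamma>) z = winding_number (subpath 0 t \<gamma>) z"
      using path z st by (intro winding_number_subpath_combine) auto
    moreover have "winding_number (subpath 0 t \<gamma>) z + winding_number (subpath t 1 \<gamma>) z = winding_number (subpath 0 1 \<gamma>) z"
      using path z st by (intro winding_number_subpath_combine) auto
    moreover have "\<gamma> ` {s..t} \<subseteq> path_image \<gamma>" using st unfolding path_image_def by (intro image_mono) auto
    then have "z \<notin> closed_segment (\<gamma> s) (\<gamma> t)" using z im by blast
    then have "winding_number (subpath s t \<gamma>) z = winding_number (linepath a b) z"
      using winding_number_segment_subpath[OF path _ _ _ im] st by (simp add: a_b_d_def)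
    ultimately have "winding_number \<gamma> z = winding_number (subpath 0 s \<gamma>) z + winding_number (linepath a b) z + winding_number (subpath t 1 \<gamma>) z"
      unfolding subpath_trivial by metis
    then show ?thesis by (simp add: W_def A_def E_def)
  qed
  have off: "p + \<i> * of_real e * d \<notin> path_image \<gamma>" "p + \<i> * of_real e * d \<notin> closed_segment a b" "dist (p + \<i> * of_real e * d) p < r1"
    if e: "e \<noteq> 0" "\<bar>e\<bar> < e\<^sub>0" for e
  proof -
    have n: "dist (p + \<i> * of_real e * d) p = \<bar>e\<bar> * norm d" by (simp add: dist_norm norm_mult)
    have "\<bar>e\<bar> < min r1 r2 / norm d" using e by (simp add: e\<^sub>0_def)
    then have "\<bar>e\<bar> * norm d < min r1 r2" using d(1) by (simp add: pos_less_divide_eq)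
    then show "dist (p + \<i> * of_real e * d) p < r1" unfolding n by simp
    have "p + \<i> * of_real e * d \<in> ball p r2" using \<open>\<bar>e\<bar> * norm d < min r1 r2\<close> n by (simp add: dist_commute)
    then have notAE: "p + \<i> * of_real e * d \<notin> \<gamma> ` {0..s}" "p + \<i> * of_real e * d \<notin> \<gamma> ` {t..1}" using r2(2) AE by auto
    show seg: "p + \<i> * of_real e * d \<notin> closed_segment a b"
    proof
      assume "p + \<i> * of_real e * d \<in> closed_segment a b"
      then obtain x where "p + \<i> * of_real e * d = a + of_real x * d"
        by (auto simp: closed_segment_def d scaleR_conv_of_real algebra_simps)
      then have "(of_real (u - x) + \<i> * of_real e) * d = 0" unfolding u(3) by (simp add: algebra_simps)
      then have "of_real (u - x) + \<i> * of_real e = 0" using d(1) by simp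
      then have "e = 0" by (simp add: complex_eq_iff)
      then show False using e by simp
    qed
    have "{0..1} = {0..s} \<union> {s..t} \<union> {t..1}" using st by auto
    then have "path_image \<gamma> = \<gamma> ` {0..s} \<union> closed_segment a b \<union> \<gamma> ` {t..1}"
      using im by (simp add: path_image_def image_Un a_b_d_def)
    then show "p + \<i> * of_real e * d \<notin> path_image \<gamma>" using notAE seg by blast
  qed
  have Reln: "Re (winding_number (linepath a b) (p + \<i> * of_real e * d)) = Arg (Complex (e\<^sup>2 - u * (1 - u)) e) / (2 * pi)"
    if e: "e \<noteq> 0" "\<bar>e\<bar> < e\<^sub>0" for e
  proof -
    have "winding_number (linepath a b) (p + \<i> * of_real e * d) = Ln ((b - (p + \<i> * of_real e * d)) / (a - (p + \<i> * of_real e * d))) / (2 * pi * \<i>)"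
      by (rule winding_number_linepath_Ln[OF off(2)[OF e]])
    then have "Re (winding_number (linepath a b) (p + \<i> * of_real e * d)) = Im (Ln ((b - (p + \<i> * of_real e * d)) / (a - (p + \<i> * of_real e * d)))) / (2 * pi)"
      by (simp add: Re_divide power2_eq_square)
    also have "\<dots> = Arg (Complex (e\<^sup>2 - u * (1 - u)) e) / (2 * pi)"
      using Im_left_of_segment[OF u(3) _ u(1,2) d(1) e(1)] d(2) by simp
    finally show ?thesis .
  qed
  show ?thesis
  proof (rule that[OF e0])
    fix e assume e: "0 < e" "e < e\<^sub>0"
    have "e < u * (1 - u)" using e by (simp add: e\<^sub>0_def)
    moreover have "u * (1 - u) < 1" using u mult_strict_mono[of u 1 "1 - u" 1] by simp
    ultimately have "e < 1" by linarith
    then have "e * e < e * 1" using e(1) by (rule mult_strict_left_mono)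
    then have e2: "e\<^sup>2 < u * (1 - u)" using \<open>e < u * (1 - u)\<close> by (simp add: power2_eq_square)
    define y where "y = Complex (e\<^sup>2 - u * (1 - u)) e"
    have y: "Re y < 0" "Im y > 0" using e2 e by (auto simp: y_def)
    have arg1: "pi / 2 < Arg y" "Arg y < pi"
    proof -
      have "0 < Arg y" "Arg y < pi" using y(2) Arg_lt_pi[of y] by (auto simp: Arg_pos_iff)
      moreover have "\<not> \<bar>Arg y\<bar> \<le> pi / 2"
        using y(1) Re_Ln_pos_le[of y] by (metis Arg_eq_Im_Ln not_le y(1) less_irrefl zero_complex.sel(1))
      ultimately show "pi / 2 < Arg y" "Arg y < pi" by auto
    qed
    have cnjy: "Complex ((- e)\<^sup>2 - u * (1 - u)) (- e) = cnj y" by (simp add: y_def complex_eq_iff)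
    have arg2: "Arg (cnj y) = - Arg y"
    proof -
      have "y \<notin> \<real>\<^sub>\<le>\<^sub>0" "y \<noteq> 0" "cnj y \<noteq> 0" using y(2) by (auto simp: complex_nonpos_Reals_iff)
      then have "Arg (cnj y) = Im (cnj (Ln y))" using cnj_Ln[of y] by (simp add: Arg_eq_Im_Ln del: complex_cnj_zero_iff)
      also have "\<dots> = - Arg y" using \<open>y \<noteq> 0\<close> by (simp add: Arg_eq_Im_Ln)
      finally show ?thesis .
    qed
    have m: "p - \<i> * of_real e * d = p + \<i> * of_real (- e) * d" by simp
    have ee: "e \<noteq> 0" "\<bar>e\<bar> < e\<^sub>0" "- e \<noteq> 0" "\<bar>- e\<bar> < e\<^sub>0" using e by auto
    define w1 where "w1 = winding_number \<gamma> (p + \<i> * of_real e * d)"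
    define w2 where "w2 = winding_number \<gamma> (p - \<i> * of_real e * d)"
    have int: "w1 \<in> \<int>" "w2 \<in> \<int>" unfolding w1_def w2_def m
      using integer_winding_number[OF path \<gamma>(2)] off(1)[OF ee(1,2)] off(1)[OF ee(3,4)] by auto
    have "Re w1 - Re w2 = Re (W (p + \<i> * of_real e * d)) - Re (W (p + \<i> * of_real (- e) * d)) + (Arg y - Arg (cnj y)) / (2 * pi)"
      unfolding w1_def w2_def m split[OF off(1)[OF ee(1,2)]] split[OF off(1)[OF ee(3,4)]]
      using Reln[OF ee(1,2)] Reln[OF ee(3,4)] unfolding cnjy y_def[symmetric] by (simp add: diff_divide_distrib)
    moreover have "\<bar>Re (W (p + \<i> * of_real e * d)) - Re (W p)\<bar> < 1/8" "\<bar>Re (W (p + \<i> * of_real (- e) * d)) - Re (W p)\<bar> < 1/8"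
      using r1(2)[OF off(3)[OF ee(1,2)]] r1(2)[OF off(3)[OF ee(3,4)]]
        abs_Re_le_cmod[of "W (p + \<i> * of_real e * d) - W p"] abs_Re_le_cmod[of "W (p + \<i> * of_real (- e) * d) - W p"]
      by (auto simp: dist_norm simp del: of_real_minus)
    moreover have "(Arg y - Arg (cnj y)) / (2 * pi) = Arg y / pi" unfolding arg2 by simp
    moreover have "1 / 2 < Arg y / pi" "Arg y / pi < 1" using arg1 by (auto simp: field_simps)
    \<comment> \<open>The segment contributes \<open>Arg y / pi\<close>, strictly between
      \<open>1 / 2\<close> and 1, and the rest less than \<open>1 / 4\<close> in absolute value; the
      only integer in the resulting range is 1.\<close>
    ultimately have range: "1/4 < Re w1 - Re w2" "Re w1 - Re w2 < 5/4" by linarith+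
    from int obtain k l :: int where kl: "w1 = of_int k" "w2 = of_int l" by (auto elim!: Ints_cases)
    have "1/4 < real_of_int (k - l)" "real_of_int (k - l) < 5/4" using range kl by auto
    then have "k = l + 1" by linarith
    then have "w1 = w2 + 1" unfolding kl by simp
    then show "winding_number \<gamma> (p + \<i> * of_real e * (\<gamma> t - \<gamma> s)) = winding_number \<gamma> (p - \<i> * of_real e * (\<gamma> t - \<gamma> s)) + 1"
      unfolding w1_def w2_def a_b_d_def(3) .
  qed
qed

section \<open>Cross products and half planes\<close>

definition cross :: "complex \<Rightarrow> complex \<Rightarrow> real" where
  "cross d z = Im (cnj d * z)"

lemma cross_eq: "cross d z = Re d * Im z - Im d * Re z"
  by (simp add: cross_def)

lemma cross_linear:
  "cross d (x + y) = cross d x + cross d y" "cross d (x - y) = cross d x - cross d y"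
  "cross d (of_real t * x) = t * cross d x" "cross d (t *\<^sub>R x) = t * cross d x" "cross d d = 0" "cross d 0 = 0" "cross d (- x) = - cross d x"
  by (simp_all add: cross_eq algebra_simps)

lemma cross_anticommute: "cross d x = - cross x d"
  by (simp add: cross_eq algebra_simps)

lemma cross_i: "cross d (\<i> * of_real e * d) = e * (norm d)\<^sup>2"
  unfolding cmod_power2 by (simp add: cross_eq power2_eq_square algebra_simps)

lemma convex_halfplanes: "convex {z. cross d (z - b) > 0}" "convex {z. cross d (z - b) < 0}"
proof -
  have eq: "cross d (z - b) = inner (\<i> * d) z - inner (\<i> * d) b" for z
    by (simp add: cross_eq inner_complex_def algebra_simps)
  have "{z. cross d (z - b) > 0} = {z. inner (\<i> * d) z > inner (\<i> * d) b}" "{z. cross d (z - b) < 0} = {z. inner (\<i> * d) z < inner (\<i> * d) b}"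
    unfolding eq by auto
  then show "convex {z. cross d (z - b) > 0}" "convex {z. cross d (z - b) < 0}"
    using convex_halfspace_gt convex_halfspace_lt by metis+
qed

lemma cross_zero_imp_multiple:
  assumes "cross d z = 0" "d \<noteq> 0"
  obtains x where "z = of_real x * d"
proof
  have "Im (z / d) = 0" using assms by (simp add: cross_eq Im_divide power2_eq_square algebra_simps)
  then have "z / d = of_real (Re (z / d))" by (simp add: complex_eq_iff)
  then show "z = of_real (Re (z / d)) * d" using assms(2) by (metis nonzero_divide_eq_eq)
qed

lemma connected_subset_domain:
  assumes "connected S" "S \<inter> frontier \<Omega> = {}" "x \<in> S" "x \<in> \<Omega>"
  shows "S \<subseteq> \<Omega>"
  using connected_Int_frontier[OF assms(1), of \<Omega>] assms by blast

section \<open>A positively oriented Jordan curve near a boundary segment\<close>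

context
  fixes \<gamma> :: "real \<Rightarrow> complex" and \<Omega> :: "complex set"
  assumes \<gamma>\<Omega>: "positive_boundary_curve \<gamma> \<Omega>"
begin

lemma boundary_curve: "simple_path \<gamma>" "pathfinish \<gamma> = pathstart \<gamma>" "path \<gamma>" "\<Omega> = inside (path_image \<gamma>)"
    "frontier \<Omega> = path_image \<gamma>" "open \<Omega>"
  using \<gamma>\<Omega> positive_boundary_curve_domain[OF \<gamma>\<Omega>] simple_path_imp_path by (auto simp: positive_boundary_curve_def)

lemma winding_number_cases:
  assumes "z \<notin> path_image \<gamma>"
  shows "z \<in> \<Omega> \<and> winding_number \<gamma> z = 1 \<or> z \<notin> \<Omega> \<and> winding_number \<gamma> z = 0"
proof (cases "z \<in> \<Omega>")
  case True
  then show ?thesis using \<gamma>\<Omega> by (simp add: positive_boundary_curve_def)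
next
  case False
  then have "z \<in> outside (path_image \<gamma>)" using assms boundary_curve(4) inside_Un_outside[of "path_image \<gamma>"] by blast
  then show ?thesis using winding_number_zero_in_outside[OF boundary_curve(3,2)] False by blast
qed

text \<open>\<open>x\<close> is kept away from 0 and 1, the two parameters at which the closed curve
  takes the same value.\<close>

lemma simple_curve_inj:
  assumes "\<gamma> x = \<gamma> y" "0 < x" "x < 1" "0 \<le> y" "y \<le> 1"
  shows "x = y"
  using boundary_curve(1) assms unfolding simple_path_def loop_free_def by fastforce

context
  fixes s t :: real
  assumes st: "0 \<le> s" "s < t" "t \<le> 1" and im: "\<gamma> ` {s..t} = closed_segment (\<gamma> s) (\<gamma> t)"
begin

text \<open>With equal ends the closed segment is a point, and \<gamma> would be constant on an
  interval.\<close>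

lemma curve_segment_neq: "\<gamma> s \<noteq> \<gamma> t"
proof
  assume eq: "\<gamma> s = \<gamma> t"
  then have "\<gamma> ((s + t) / 2) = \<gamma> s" using im st by auto
  then have "(s + t) / 2 = s" using st by (intro simple_curve_inj) auto
  then show False using st by simp
qed

lemma open_segment_off_rest:
  assumes "p \<in> open_segment (\<gamma> s) (\<gamma> t)" shows "p \<notin> \<gamma> ` ({0..s} \<union> {t..1})"
proof
  assume "p \<in> \<gamma> ` ({0..s} \<union> {t..1})"
  then obtain y where "y \<in> {0..s} \<union> {t..1}" and "\<gamma> y = p" by blast
  then have y: "0 \<le> y" "y \<le> 1" "y \<le> s \<or> t \<le> y" "\<gamma> y = p" using st by auto
  have "p \<in> closed_segment (\<gamma> s) (\<gamma> t)" "p \<noteq> \<gamma> s" "p \<noteq> \<gamma> t" using assms by (auto simp: open_segment_def)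
  moreover from this(1) have "p \<in> \<gamma> ` {s..t}" unfolding im .
  ultimately obtain x where x: "s \<le> x" "x \<le> t" "\<gamma> x = p" by auto
  have "x \<noteq> s" "x \<noteq> t" using \<open>p \<noteq> \<gamma> s\<close> \<open>p \<noteq> \<gamma> t\<close> x(3) by auto
  then have "s < x" "x < t" using x by auto
  then have "x = y" using x y st by (intro simple_curve_inj) auto
  then show False using y(3) \<open>s < x\<close> \<open>x < t\<close> by simp
qed

text \<open>The two open half discs at \<open>p\<close> miss the curve, so each is wholly inside or
  wholly outside. Winding numbers off the curve are 0 or 1 and differ by 1 across the segment; so
  the left half disc is inside and the right one outside.\<close>

lemma left_of_segment_inside:
  assumes p: "p \<in> open_segment (\<gamma> s) (\<gamma> t)"
  obtains r where "r > 0" "ball p r \<inter> path_image \<gamma> \<subseteq> open_segment (\<gamma> s) (\<gamma> t)"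
    "\<Omega> \<inter> ball p r = ball p r \<inter> {z. cross (\<gamma> t - \<gamma> s) (z - p) > 0}"
proof -
  define a b d where "a = \<gamma> s" "b = \<gamma> t" "d = \<gamma> t - \<gamma> s"
  have d: "d \<noteq> 0" "b = a + d" using curve_segment_neq by (auto simp: a_b_d_def)
  have off: "p \<notin> \<gamma> ` ({0..s} \<union> {t..1})" by (rule open_segment_off_rest[OF p])
  have "continuous_on ({0..s} \<union> {t..1}) \<gamma>" by (rule continuous_on_subset[OF boundary_curve(3)[unfolded path_def]]) (use st in auto)
  then have "compact (\<gamma> ` ({0..s} \<union> {t..1}))" by (intro compact_continuous_image compact_Un) auto
  then have "open (- (\<gamma> ` ({0..s} \<union> {t..1})))" using compact_imp_closed by blast
  then obtain r where r: "r > 0" "ball p r \<subseteq> - (\<gamma> ` ({0..s} \<union> {t..1}))" using off unfolding open_contains_ball by blast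
  have "{0..1} = {s..t} \<union> ({0..s} \<union> {t..1})" using st by auto
  then have pim: "path_image \<gamma> = closed_segment a b \<union> \<gamma> ` ({0..s} \<union> {t..1})"
    by (simp only: path_image_def image_Un im a_b_d_def)
  have ab_notin: "a \<notin> ball p r" "b \<notin> ball p r" using r(2) st by (auto simp: a_b_d_def)
  have sub: "ball p r \<inter> path_image \<gamma> \<subseteq> open_segment a b"
    using pim r(2) ab_notin by (auto simp: open_segment_def)
  obtain u where u: "0 < u" "u < 1" "p = a + of_real u * d"
    using p by (auto simp: in_segment a_b_d_def scaleR_conv_of_real algebra_simps)
  have cross_seg: "cross d (x - p) = 0" if x: "x \<in> open_segment a b" for x
  proof -
    obtain v where "x = a + of_real v * d" using x by (auto simp: in_segment d scaleR_conv_of_real algebra_simps)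
    then have "x - p = of_real (v - u) * d" using u by (simp add: algebra_simps)
    then show ?thesis by (simp only: cross_linear mult_zero_right)
  qed
  define P where "P = ball p r \<inter> {z. cross d (z - p) > 0}"
  define N where "N = ball p r \<inter> {z. cross d (z - p) < 0}"
  have offPN: "P \<inter> path_image \<gamma> = {}" "N \<inter> path_image \<gamma> = {}" using sub cross_seg by (force simp: P_def N_def)+
  have conPN: "connected P" "connected N" unfolding P_def N_def
    by (intro convex_connected convex_Int convex_ball convex_halfplanes)+
  obtain e0 where e0: "e0 > 0" "\<And>e. 0 < e \<Longrightarrow> e < e0 \<Longrightarrow> winding_number \<gamma> (p + \<i> * of_real e * d) = winding_number \<gamma> (p - \<i> * of_real e * d) + 1"
    using winding_number_across_segment[OF boundary_curve(1,2) st im p off] unfolding a_b_d_def by metis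
  define e where "e = min (e0 / 2) (r / (2 * norm d))"
  have e: "0 < e" "e < e0" "e * norm d < r"
  proof -
    show "0 < e" "e < e0" using e0(1) r(1) d(1) by (auto simp: e_def)
    have "e * norm d \<le> r / (2 * norm d) * norm d" by (intro mult_right_mono) (auto simp: e_def)
    also have "\<dots> < r" using d(1) r(1) by simp
    finally show "e * norm d < r" .
  qed
  define zp where "zp = p + \<i> * of_real e * d"
  define zn where "zn = p - \<i> * of_real e * d"
  have nd: "(norm d)\<^sup>2 > 0" using d(1) by simp
  have zP: "zp \<in> P" using e nd by (simp add: P_def zp_def dist_norm norm_mult cross_i)
  have zN: "zn \<in> N" using e nd cross_i[of d "-e"] by (simp add: N_def zn_def dist_norm norm_mult)
  have "winding_number \<gamma> zp = winding_number \<gamma> zn + 1" unfolding zp_def zn_def by (rule e0(2)[OF e(1,2)])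
  moreover have "zp \<notin> path_image \<gamma>" "zn \<notin> path_image \<gamma>" using zP zN offPN by auto
  ultimately have side: "zp \<in> \<Omega>" "zn \<notin> \<Omega>" using winding_number_cases[of zp] winding_number_cases[of zn] by auto
  have Pin: "P \<subseteq> \<Omega>" by (rule connected_subset_domain[OF conPN(1) _ zP side(1)]) (use offPN boundary_curve(5) in auto)
  have Nout: "N \<inter> \<Omega> = {}"
  proof (rule ccontr)
    assume "N \<inter> \<Omega> \<noteq> {}"
    then obtain y where "y \<in> N" "y \<in> \<Omega>" by blast
    then have "N \<subseteq> \<Omega>" using connected_subset_domain[OF conPN(2)] offPN boundary_curve(5) by auto
    then show False using zN side(2) by blast
  qed
  \<comment> \<open>Points of the line within the ball belong to the segment, because both of its
    ends are outside the ball; so they are frontier points.\<close>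
  have line: "z \<notin> \<Omega>" if z: "z \<in> ball p r" "cross d (z - p) = 0" for z
  proof -
    obtain x where x: "z - p = of_real x * d" by (rule cross_zero_imp_multiple[OF z(2) d(1)])
    have "norm (z - p) < r" using z(1) by (simp add: dist_norm norm_minus_commute)
    moreover have "norm (z - p) = \<bar>x\<bar> * norm d" unfolding x by (simp add: norm_mult)
    ultimately have "\<bar>x\<bar> * norm d < r" by simp
    moreover have "r \<le> u * norm d" using ab_notin(1) u by (simp add: dist_norm norm_mult)
    moreover have "r \<le> (1 - u) * norm d"
    proof -
      have "p - b = of_real (- (1 - u)) * d" using u(3) d(2) by (simp add: algebra_simps)
      then have "dist p b = (1 - u) * norm d" using u by (simp add: dist_norm norm_mult del: of_real_minus of_real_diff)
      then show ?thesis using ab_notin(2) by simp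
    qed
    ultimately have "\<bar>x\<bar> * norm d < u * norm d" "\<bar>x\<bar> * norm d < (1 - u) * norm d" by linarith+
    then have "\<bar>x\<bar> < u" "\<bar>x\<bar> < 1 - u" using d(1) by (auto simp: mult_less_cancel_right)
    then have "0 < u + x" "u + x < 1" by linarith+
    moreover have "z = a + of_real (u + x) * d" using x u(3) by (simp add: algebra_simps)
    ultimately have "z \<in> closed_segment a b"
      unfolding closed_segment_def d(2) by (intro CollectI exI[of _ "u + x"]) (auto simp: scaleR_conv_of_real algebra_simps)
    then have "z \<in> frontier \<Omega>" using pim boundary_curve(5) by blast
    then show ?thesis using boundary_curve(6) by (simp add: frontier_def interior_open)
  qed
  have "\<Omega> \<inter> ball p r = P"
  proof
    show "P \<subseteq> \<Omega> \<inter> ball p r" using Pin by (auto simp: P_def)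
    show "\<Omega> \<inter> ball p r \<subseteq> P"
    proof
      fix z assume z: "z \<in> \<Omega> \<inter> ball p r"
      then have "cross d (z - p) \<noteq> 0" using line by blast
      moreover have "\<not> cross d (z - p) < 0" using z Nout by (auto simp: N_def)
      ultimately show "z \<in> P" using z by (auto simp: P_def)
    qed
  qed
  then show ?thesis using that[OF r(1)] sub unfolding P_def a_b_d_def by blast
qed

lemma curve_boundary_segment: "boundary_segment \<Omega> (\<gamma> s) (\<gamma> t)"
  unfolding boundary_segment_def
proof (intro conjI ballI)
  show "\<gamma> s \<noteq> \<gamma> t" by (rule curve_segment_neq)
  fix q assume q: "q \<in> open_segment (\<gamma> s) (\<gamma> t)"
  obtain r where r: "r > 0" "ball q r \<inter> path_image \<gamma> \<subseteq> open_segment (\<gamma> s) (\<gamma> t)"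
    "\<Omega> \<inter> ball q r = ball q r \<inter> {z. cross (\<gamma> t - \<gamma> s) (z - q) > 0}"
    by (rule left_of_segment_inside[OF q])
  have "\<gamma> ` {s..t} \<subseteq> path_image \<gamma>" using st unfolding path_image_def by (intro image_mono) auto
  then show "q \<in> frontier \<Omega>" using q im boundary_curve(5) by (auto simp: open_segment_def)
  show "\<exists>r>0. ball q r \<inter> frontier \<Omega> \<subseteq> open_segment (\<gamma> s) (\<gamma> t)" using r(1,2) boundary_curve(5) by auto
  show "tame_at \<Omega> q" unfolding tame_at_def
  proof (intro exI[of _ r] conjI allI impI)
    show "r > 0" by fact
    fix r' assume r': "0 < r'" "r' < r"
    \<comment> \<open>One half disc is enough here and serves as both convex pieces.\<close>
    define A where "A = ball q r' \<inter> {z. cross (\<gamma> t - \<gamma> s) (z - q) > 0}"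
    have sub: "ball q r' \<subseteq> ball q r" using r' by (simp add: subset_ball)
    then have "\<Omega> \<inter> ball q r' = (\<Omega> \<inter> ball q r) \<inter> ball q r'" by blast
    also have "\<dots> = A" unfolding r(3) A_def using sub by blast
    finally have eq: "\<Omega> \<inter> ball q r' = A \<union> A" by simp
    have "convex A" unfolding A_def by (intro convex_Int convex_ball convex_halfplanes)
    moreover have "A \<noteq> {}"
    proof -
      define d where "d = \<gamma> t - \<gamma> s"
      have d: "norm d > 0" using curve_segment_neq by (simp add: d_def)
      define e where "e = r' / (2 * norm d)"
      have "e > 0" "e * norm d < r'" using r' d by (auto simp: e_def)
      then have "q + \<i> * of_real e * d \<in> A" using d unfolding A_def d_def[symmetric]
        by (simp add: dist_norm norm_mult cross_i)
      then show ?thesis by blast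
    qed
    ultimately show "\<exists>A B. convex A \<and> convex B \<and> A \<inter> B \<noteq> {} \<and> \<Omega> \<inter> ball q r' = A \<union> B"
      using eq by (intro exI[of _ A]) auto
  qed
qed

end

end

section \<open>A positively oriented Jordan curve near a corner\<close>

lemma small_multiple:
  fixes w :: complex
  assumes "r > 0" obtains \<eta> where "\<eta> > 0" "\<eta> * norm w < r" "\<eta> < 1"
proof
  define k where "k = norm w + 1"
  define \<eta> where "\<eta> = min (1/2) (r / (2 * k))"
  have n: "k > 0" by (simp add: add_nonneg_pos k_def)
  show "\<eta> > 0" "\<eta> < 1" using assms n by (auto simp: \<eta>_def)
  have "\<eta> * norm w \<le> r / (2 * k) * k"
    using assms n by (intro mult_mono) (auto simp: \<eta>_def k_def)
  also have "\<dots> = r / 2" using n by simp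
  finally show "\<eta> * norm w < r" using assms by linarith
qed

text \<open>Near the corner only the two sides divide the ball, and the sign of the turn \<kappa>
  decides between two pictures: the part to the left is the intersection of the left half discs of
  both sides if \<kappa> is positive, and their union if it is negative. Test points on either side
  of the outgoing segment show that this part is the one inside.\<close>

lemma curve_boundary_corner:
  assumes \<gamma>\<Omega>: "positive_boundary_curve \<gamma> \<Omega>"
    and st: "0 \<le> s" "s < t" "t < u" "u \<le> 1"
    and im: "\<gamma> ` {s..t} = closed_segment (\<gamma> s) (\<gamma> t)" "\<gamma> ` {t..u} = closed_segment (\<gamma> t) (\<gamma> u)"
    and turn: "cross (\<gamma> t - \<gamma> s) (\<gamma> u - \<gamma> t) \<noteq> 0"
  shows "boundary_corner \<Omega> (\<gamma> s) (\<gamma> t) (\<gamma> u)"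
proof -
  note C = boundary_curve[OF \<gamma>\<Omega>]
  define a b c d1 d2 \<kappa> where "a = \<gamma> s" "b = \<gamma> t" "c = \<gamma> u" "d1 = b - a" "d2 = c - b" "\<kappa> = cross d1 d2"
  note defs = a_b_c_d1_d2_\<kappa>_def
  have turn': "\<kappa> \<noteq> 0" using turn by (simp add: defs)
  have d: "d1 \<noteq> 0" "d2 \<noteq> 0" using turn' by (auto simp: defs(6) cross_eq)
  have \<kappa>': "cross d2 d1 = - \<kappa>" using cross_anticommute[of d2 d1] by (simp add: defs)
  define I1 where "I1 = (\<lambda>z. cross d1 (z - b))"
  define I2 where "I2 = (\<lambda>z. cross d2 (z - b))"
  have bnot: "b \<notin> \<gamma> ` ({0..s} \<union> {u..1})"
  proof
    assume "b \<in> \<gamma> ` ({0..s} \<union> {u..1})"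
    then obtain y where y': "y \<in> {0..s} \<union> {u..1}" "b = \<gamma> y" by blast
    then have y: "y \<in> {0..s} \<union> {u..1}" "\<gamma> t = \<gamma> y" by (simp_all add: defs)
    have "t = y" by (rule simple_curve_inj[OF \<gamma>\<Omega> y(2)]) (use y(1) st in auto)
    then show False using y(1) st by auto
  qed
  have "continuous_on ({0..s} \<union> {u..1}) \<gamma>"
    by (rule continuous_on_subset[OF C(3)[unfolded path_def]]) (use st in auto)
  then have "compact (\<gamma> ` ({0..s} \<union> {u..1}))" by (intro compact_continuous_image compact_Un) auto
  then have "open (- (\<gamma> ` ({0..s} \<union> {u..1})))" using compact_imp_closed by blast
  then obtain r where r: "r > 0" "ball b r \<subseteq> - (\<gamma> ` ({0..s} \<union> {u..1}))" using bnot unfolding open_contains_ball by blast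
  have "{0..1} = ({s..t} \<union> {t..u}) \<union> ({0..s} \<union> {u..1})" using st by auto
  then have pim: "path_image \<gamma> = (closed_segment a b \<union> closed_segment b c) \<union> \<gamma> ` ({0..s} \<union> {u..1})"
    by (simp only: path_image_def image_Un im defs)
  have sub: "ball b r \<inter> path_image \<gamma> \<subseteq> closed_segment a b \<union> closed_segment b c" using pim r(2) by blast
  have ac: "r \<le> norm d1" "r \<le> norm d2"
  proof -
    have "a \<notin> ball b r" "c \<notin> ball b r" using r(2) st by (auto simp: defs)
    then show "r \<le> norm d1" "r \<le> norm d2" by (auto simp: defs dist_norm norm_minus_commute)
  qed
  have vk: "\<kappa> * (v * \<kappa>) \<ge> 0" if "v \<ge> 0" for v
  proof -
    have "0 \<le> v * \<kappa>\<^sup>2" using that by simp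
    also have "v * \<kappa>\<^sup>2 = \<kappa> * (v * \<kappa>)" by (simp add: power2_eq_square)
    finally show ?thesis .
  qed
  \<comment> \<open>The factor \<kappa> lets one statement cover both turns: each side lies on the
    half of one of the lines \<open>I1 = 0\<close>, \<open>I2 = 0\<close> where \<kappa> times the
    other function is nonnegative. \<open>lineA\<close> and \<open>lineB\<close> are the
    converse.\<close>
  have segI: "(I1 x = 0 \<and> \<kappa> * I2 x \<ge> 0) \<or> (I2 x = 0 \<and> \<kappa> * I1 x \<ge> 0)" if x: "x \<in> ball b r \<inter> path_image \<gamma>" for x
  proof -
    have "x \<in> closed_segment b a \<or> x \<in> closed_segment b c" using x sub by (auto simp: closed_segment_commute)
    then show ?thesis
    proof
      assume "x \<in> closed_segment b a"
      then obtain v where v: "0 \<le> v" "x = b + of_real (- v) * d1"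
        by (auto simp: closed_segment_def defs scaleR_conv_of_real algebra_simps)
      then have "I1 x = 0" "I2 x = v * \<kappa>" by (simp_all add: I1_def I2_def cross_linear \<kappa>' del: of_real_minus)
      then show ?thesis using vk[OF v(1)] by simp
    next
      assume "x \<in> closed_segment b c"
      then obtain v where v: "0 \<le> v" "x = b + of_real v * d2"
        by (auto simp: closed_segment_def defs scaleR_conv_of_real algebra_simps)
      then have "I2 x = 0" "I1 x = v * \<kappa>" by (simp_all add: I1_def I2_def cross_linear defs(6))
      then show ?thesis using vk[OF v(1)] by simp
    qed
  qed
  have lineA: "z \<in> path_image \<gamma>" if z: "z \<in> ball b r" "I1 z = 0" "\<kappa> * I2 z \<ge> 0" for z
  proof -
    obtain x where x: "z - b = of_real x * d1" using cross_zero_imp_multiple[of d1 "z - b"] z(2) d(1) unfolding I1_def by metis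
    have "I2 z = - (x * \<kappa>)" unfolding I2_def x by (simp add: cross_linear \<kappa>')
    then have "0 \<le> - x * \<kappa>\<^sup>2" using z(3) by (simp add: power2_eq_square mult.left_commute)
    then have x0: "x \<le> 0" using turn' by (simp add: mult_le_0_iff)
    have "norm (z - b) < norm d1" using z(1) ac(1) by (simp add: dist_norm norm_minus_commute)
    then have "\<bar>x\<bar> * norm d1 < 1 * norm d1" unfolding x by (simp add: norm_mult)
    then have "\<bar>x\<bar> < 1" using d(1) by (simp add: mult_less_cancel_right)
    moreover have "z = a + of_real (1 + x) * d1" using x by (simp add: defs algebra_simps)
    ultimately have "z \<in> closed_segment a b" using x0
      by (auto simp: closed_segment_def scaleR_conv_of_real defs algebra_simps intro!: exI[of _ "1 + x"])
    then show ?thesis using pim by blast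
  qed
  have lineB: "z \<in> path_image \<gamma>" if z: "z \<in> ball b r" "I2 z = 0" "\<kappa> * I1 z \<ge> 0" for z
  proof -
    obtain x where x: "z - b = of_real x * d2" using cross_zero_imp_multiple[of d2 "z - b"] z(2) d(2) unfolding I2_def by metis
    have "I1 z = x * \<kappa>" unfolding I1_def x by (simp add: cross_linear defs(6))
    then have "0 \<le> x * \<kappa>\<^sup>2" using z(3) by (simp add: power2_eq_square mult.left_commute)
    then have x0: "x \<ge> 0" using turn' by (simp add: zero_le_mult_iff)
    have "norm (z - b) < norm d2" using z(1) ac(2) by (simp add: dist_norm norm_minus_commute)
    then have "\<bar>x\<bar> * norm d2 < 1 * norm d2" unfolding x by (simp add: norm_mult)
    then have "\<bar>x\<bar> < 1" using d(2) by (simp add: mult_less_cancel_right)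
    moreover have "z = b + of_real x * d2" using x by (simp add: algebra_simps)
    ultimately have "z \<in> closed_segment b c" using x0
      by (auto simp: closed_segment_def scaleR_conv_of_real defs algebra_simps intro!: exI[of _ x])
    then show ?thesis using pim by blast
  qed
  have frontier_notin: "z \<notin> \<Omega>" if "z \<in> path_image \<gamma>" for z
    using that C(5,6) by (auto simp: frontier_def interior_open)
  \<comment> \<open>Both come from a point \<open>q\<close> of the outgoing side, moved by
    \<open>\<delta> * norm d2\<close> to the left and to the right. The bound on \<delta> keeps them
    in both balls and keeps the sign of \<open>I1\<close>, which at \<open>q\<close> is that of
    \<kappa>.\<close>
  obtain zp zn where test: "zp \<in> \<Omega>" "zn \<notin> \<Omega>" "zp \<in> ball b r" "zn \<in> ball b r" "I2 zp > 0" "I2 zn < 0" "\<kappa> * I1 zp > 0" "\<kappa> * I1 zn > 0"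
  proof -
    obtain \<epsilon> where \<epsilon>: "\<epsilon> > 0" "\<epsilon> * norm d2 < r" "\<epsilon> < 1" by (rule small_multiple[OF r(1)])
    define q where "q = b + of_real \<epsilon> * d2"
    have q: "q \<in> open_segment b c" unfolding in_segment using \<epsilon> d(2)
      by (intro conjI exI[of _ \<epsilon>]) (auto simp: q_def defs scaleR_conv_of_real algebra_simps)
    obtain rq where rq: "rq > 0" "\<Omega> \<inter> ball q rq = ball q rq \<inter> {z. cross d2 (z - q) > 0}"
      using left_of_segment_inside[OF \<gamma>\<Omega> _ st(3,4) im(2), of q] q st unfolding defs by (metis less_imp_le order_trans)
    define m where "m = cross d1 (\<i> * d2)"
    have "min (min rq (r - \<epsilon> * norm d2)) (\<epsilon> * \<bar>\<kappa>\<bar>) > 0" using rq(1) \<epsilon> turn' by simp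
    from small_multiple[OF this, of "of_real (norm d2 + \<bar>m\<bar>)"] obtain \<delta> where \<delta>: "\<delta> > 0"
      "\<delta> * norm (complex_of_real (norm d2 + \<bar>m\<bar>)) < min (min rq (r - \<epsilon> * norm d2)) (\<epsilon> * \<bar>\<kappa>\<bar>)" by metis
    have "norm (complex_of_real (norm d2 + \<bar>m\<bar>)) = norm d2 + \<bar>m\<bar>" by (simp only: norm_of_real) simp
    then have sm: "\<delta> * norm d2 + \<delta> * \<bar>m\<bar> < min (min rq (r - \<epsilon> * norm d2)) (\<epsilon> * \<bar>\<kappa>\<bar>)" using \<delta>(2) by (simp only: ring_distribs)
    have nn: "\<delta> * norm d2 \<ge> 0" "\<delta> * \<bar>m\<bar> \<ge> 0" using \<delta>(1) by auto
    have in_both: "q + \<i> * of_real e * d2 \<in> ball q rq" "q + \<i> * of_real e * d2 \<in> ball b r" if "\<bar>e\<bar> = \<delta>" for e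
    proof -
      have n: "norm (\<i> * of_real e * d2) = \<delta> * norm d2" using that by (simp add: norm_mult)
      then show "q + \<i> * of_real e * d2 \<in> ball q rq" using sm nn by (simp add: dist_norm)
      have "norm (of_real \<epsilon> * d2 + \<i> * of_real e * d2) \<le> \<epsilon> * norm d2 + \<delta> * norm d2"
        using norm_triangle_ineq[of "of_real \<epsilon> * d2" "\<i> * of_real e * d2"] \<epsilon>(1) that by (simp add: norm_mult)
      also have "\<dots> < r" using sm nn by simp
      also have "of_real \<epsilon> * d2 + \<i> * of_real e * d2 = q + \<i> * of_real e * d2 - b" by (simp add: q_def)
      finally have "norm (q + \<i> * of_real e * d2 - b) < r" .
      then show "q + \<i> * of_real e * d2 \<in> ball b r" by (simp only: mem_ball dist_norm norm_minus_commute)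
    qed
    have I2e: "I2 (q + \<i> * of_real e * d2) = e * (norm d2)\<^sup>2" "cross d2 (q + \<i> * of_real e * d2 - q) = e * (norm d2)\<^sup>2" for e
    proof -
      have "q + \<i> * of_real e * d2 - b = of_real \<epsilon> * d2 + \<i> * of_real e * d2" by (simp add: q_def)
      then show "I2 (q + \<i> * of_real e * d2) = e * (norm d2)\<^sup>2" unfolding I2_def by (simp only: cross_linear cross_i mult_zero_right add_0_left)
      show "cross d2 (q + \<i> * of_real e * d2 - q) = e * (norm d2)\<^sup>2" by (simp add: cross_i)
    qed
    have I1e: "\<kappa> * I1 (q + \<i> * of_real e * d2) > 0" if e: "\<bar>e\<bar> = \<delta>" for e
    proof -
      have "q + \<i> * of_real e * d2 - b = of_real \<epsilon> * d2 + of_real e * (\<i> * d2)" by (simp add: q_def)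
      then have I: "I1 (q + \<i> * of_real e * d2) = \<epsilon> * \<kappa> + e * m" unfolding I1_def by (simp only: cross_linear m_def defs(6))
      have "\<delta> * norm d2 + \<delta> * \<bar>m\<bar> < \<epsilon> * \<bar>\<kappa>\<bar>" using sm by simp
      then have "\<bar>e * m\<bar> < \<epsilon> * \<bar>\<kappa>\<bar>" unfolding abs_mult e using nn by linarith
      then have "\<bar>\<kappa>\<bar> * \<bar>e * m\<bar> < \<bar>\<kappa>\<bar> * (\<epsilon> * \<bar>\<kappa>\<bar>)" using turn' by (intro mult_strict_left_mono) auto
      moreover have "\<bar>\<kappa>\<bar> * (\<epsilon> * \<bar>\<kappa>\<bar>) = \<epsilon> * \<kappa>\<^sup>2" by (simp add: power2_eq_square mult.left_commute)
      ultimately have "\<bar>\<kappa> * (e * m)\<bar> < \<epsilon> * \<kappa>\<^sup>2" unfolding abs_mult[of \<kappa>] by simp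
      moreover have "\<kappa> * (\<epsilon> * \<kappa> + e * m) = \<epsilon> * \<kappa>\<^sup>2 + \<kappa> * (e * m)" by (simp add: power2_eq_square algebra_simps)
      ultimately show ?thesis unfolding I by linarith
    qed
    have e1: "\<bar>\<delta>\<bar> = \<delta>" "\<bar>- \<delta>\<bar> = \<delta>" using \<delta>(1) by auto
    have nd: "(norm d2)\<^sup>2 > 0" using d(2) by simp
    show thesis
    proof (rule that[of "q + \<i> * of_real \<delta> * d2" "q + \<i> * of_real (- \<delta>) * d2"])
      have "q + \<i> * of_real \<delta> * d2 \<in> ball q rq \<inter> {z. cross d2 (z - q) > 0}"
        using in_both(1)[OF e1(1)] I2e(2)[of \<delta>] \<delta>(1) nd by simp
      then show "q + \<i> * of_real \<delta> * d2 \<in> \<Omega>" using rq(2) by blast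
      have "cross d2 (q + \<i> * of_real (- \<delta>) * d2 - q) < 0" unfolding I2e(2) using \<delta>(1) nd by simp
      then show "q + \<i> * of_real (- \<delta>) * d2 \<notin> \<Omega>" using rq(2) in_both(1)[OF e1(2)] by (metis IntD2 IntI mem_Collect_eq not_less_iff_gr_or_eq)
      show "I2 (q + \<i> * of_real \<delta> * d2) > 0" "I2 (q + \<i> * of_real (- \<delta>) * d2) < 0" unfolding I2e(1) using \<delta>(1) nd by simp_all
    qed (intro in_both I1e e1)+
  qed
  have conv: "convex (ball b r' \<inter> {z. I1 z > 0})" "convex (ball b r' \<inter> {z. I2 z > 0})"
    "convex (ball b r' \<inter> {z. I1 z < 0})" "convex (ball b r' \<inter> {z. I2 z < 0})" for r'
    unfolding I1_def I2_def by (intro convex_Int convex_ball convex_halfplanes)+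
  have pt: "\<exists>z\<in>ball b r'. \<kappa> * I1 z < 0 \<and> \<kappa> * I2 z < 0" "\<exists>z\<in>ball b r'. \<kappa> * I1 z > 0 \<and> \<kappa> * I2 z > 0" if r': "r' > 0" for r'
  proof -
    \<comment> \<open>At \<open>b + e * (d1 - d2)\<close> both \<open>I1\<close> and
      \<open>I2\<close> equal \<open>- e * \<kappa>\<close>, so a small positive and a small
      negative \<open>e\<close> give the two witnesses.\<close>
    obtain \<eta> where \<eta>: "\<eta> > 0" "\<eta> * norm (d1 - d2) < r'" by (rule small_multiple[OF r'])
    have k2: "\<kappa> * \<kappa> > 0" using turn' by (simp add: zero_less_mult_iff) linarith
    have v: "I1 (b + of_real e * (d1 - d2)) = - e * \<kappa>" "I2 (b + of_real e * (d1 - d2)) = - e * \<kappa>" for e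
      by (simp_all add: I1_def I2_def cross_linear \<kappa>' flip: defs(6))
    have b1: "b + of_real e * (d1 - d2) \<in> ball b r'" if "\<bar>e\<bar> = \<eta>" for e using \<eta>(2) that by (simp add: dist_norm norm_mult)
    show "\<exists>z\<in>ball b r'. \<kappa> * I1 z < 0 \<and> \<kappa> * I2 z < 0"
      using v[of \<eta>] k2 \<eta>(1) by (intro bexI[OF _ b1[of \<eta>]]) (auto simp: mult.left_commute)
    show "\<exists>z\<in>ball b r'. \<kappa> * I1 z > 0 \<and> \<kappa> * I2 z > 0"
      using v[of "- \<eta>"] k2 \<eta>(1) by (intro bexI[OF _ b1[of "- \<eta>"]]) (auto simp: mult.left_commute)
  qed
  have tame: "tame_at \<Omega> b"
  proof (cases "\<kappa> > 0")
    case True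
    have sgn: "\<kappa> * x > 0 \<longleftrightarrow> x > 0" "\<kappa> * x \<ge> 0 \<longleftrightarrow> x \<ge> 0" "\<kappa> * x < 0 \<longleftrightarrow> x < 0" for x
      using True by (auto simp: zero_less_mult_iff zero_le_mult_iff mult_less_0_iff)
    \<comment> \<open>Convex corner: the inside is an intersection of half discs. The outside
      \<open>N\<close> is a union, connected because its two halves share a witness of
      \<open>pt\<close>.\<close>
    define P where "P = ball b r \<inter> {z. I1 z > 0} \<inter> (ball b r \<inter> {z. I2 z > 0})"
    define N where "N = (ball b r \<inter> {z. I1 z < 0}) \<union> (ball b r \<inter> {z. I2 z < 0})"
    have cP: "connected P" unfolding P_def by (intro convex_connected convex_Int conv)
    have cN: "connected N" unfolding N_def
      using pt(1)[OF r(1)] unfolding sgn by (intro connected_Un convex_connected conv) blast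
    have off: "P \<inter> frontier \<Omega> = {}" "N \<inter> frontier \<Omega> = {}"
      using segI unfolding sgn C(5) by (force simp: P_def N_def)+
    have PO: "P \<subseteq> \<Omega>" by (rule connected_subset_domain[OF cP off(1) _ test(1)]) (use test sgn in \<open>auto simp: P_def\<close>)
    have NO: "N \<inter> \<Omega> = {}"
    proof (rule ccontr)
      assume "N \<inter> \<Omega> \<noteq> {}"
      then have "N \<subseteq> \<Omega>" using connected_subset_domain[OF cN off(2)] by blast
      then show False using test(2,4,6) by (auto simp: N_def)
    qed
    have eq: "\<Omega> \<inter> ball b r = P"
    proof
      show "P \<subseteq> \<Omega> \<inter> ball b r" using PO by (auto simp: P_def)
      show "\<Omega> \<inter> ball b r \<subseteq> P"
      proof
        fix z assume z: "z \<in> \<Omega> \<inter> ball b r"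
        then have "z \<notin> N" "z \<notin> path_image \<gamma>" using NO frontier_notin by blast+
        then have nn: "I1 z \<ge> 0" "I2 z \<ge> 0" using z by (auto simp: N_def not_less)
        then have "I1 z \<noteq> 0" "I2 z \<noteq> 0" using lineA[of z] lineB[of z] z \<open>z \<notin> path_image \<gamma>\<close> unfolding sgn by auto
        then show "z \<in> P" using nn z by (auto simp: P_def)
      qed
    qed
    show ?thesis unfolding tame_at_def
    proof (intro exI[of _ r] conjI allI impI)
      show "r > 0" by fact
      fix r' assume r': "0 < r'" "r' < r"
      define A where "A = ball b r' \<inter> {z. I1 z > 0} \<inter> (ball b r' \<inter> {z. I2 z > 0})"
      have "ball b r' \<subseteq> ball b r" using r' by (simp add: subset_ball)
      then have "\<Omega> \<inter> ball b r' = (\<Omega> \<inter> ball b r) \<inter> ball b r'" by blast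
      also have "\<dots> = A" unfolding eq P_def A_def using \<open>ball b r' \<subseteq> ball b r\<close> by blast
      finally have eqA: "\<Omega> \<inter> ball b r' = A" .
      have "A \<noteq> {}" using pt(2)[OF r'(1)] unfolding sgn A_def by blast
      moreover have "convex A" unfolding A_def by (intro convex_Int conv)
      ultimately show "\<exists>A B. convex A \<and> convex B \<and> A \<inter> B \<noteq> {} \<and> \<Omega> \<inter> ball b r' = A \<union> B"
        using eqA by (intro exI[of _ A]) simp
    qed
  next
    case False
    then have "\<kappa> < 0" using turn' by simp
    then have sgn: "\<kappa> * x > 0 \<longleftrightarrow> x < 0" "\<kappa> * x \<ge> 0 \<longleftrightarrow> x \<le> 0" "\<kappa> * x < 0 \<longleftrightarrow> x > 0" for x
      by (auto simp: zero_less_mult_iff zero_le_mult_iff mult_less_0_iff)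
    \<comment> \<open>Re-entrant corner: union and intersection change roles, and two convex pieces
      are really used.\<close>
    define P where "P = (ball b r \<inter> {z. I1 z > 0}) \<union> (ball b r \<inter> {z. I2 z > 0})"
    define N where "N = ball b r \<inter> {z. I1 z < 0} \<inter> (ball b r \<inter> {z. I2 z < 0})"
    have cN: "connected N" unfolding N_def by (intro convex_connected convex_Int conv)
    have cP: "connected P" unfolding P_def
      using pt(1)[OF r(1)] unfolding sgn by (intro connected_Un convex_connected conv) blast
    have off: "P \<inter> frontier \<Omega> = {}" "N \<inter> frontier \<Omega> = {}"
      using segI unfolding sgn C(5) by (force simp: P_def N_def)+
    have PO: "P \<subseteq> \<Omega>" by (rule connected_subset_domain[OF cP off(1) _ test(1)]) (use test in \<open>auto simp: P_def\<close>)
    have NO: "N \<inter> \<Omega> = {}"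
    proof (rule ccontr)
      assume "N \<inter> \<Omega> \<noteq> {}"
      then have "N \<subseteq> \<Omega>" using connected_subset_domain[OF cN off(2)] by blast
      then show False using test(2,4,6,8) sgn by (auto simp: N_def)
    qed
    have eq: "\<Omega> \<inter> ball b r = P"
    proof
      show "P \<subseteq> \<Omega> \<inter> ball b r" using PO by (auto simp: P_def)
      show "\<Omega> \<inter> ball b r \<subseteq> P"
      proof
        fix z assume z: "z \<in> \<Omega> \<inter> ball b r"
        then have zN: "z \<notin> N" "z \<notin> path_image \<gamma>" using NO frontier_notin by blast+
        show "z \<in> P"
        proof (rule ccontr)
          assume "z \<notin> P"
          then have le: "I1 z \<le> 0" "I2 z \<le> 0" using z by (auto simp: P_def not_less)
          then have "I1 z \<noteq> 0" "I2 z \<noteq> 0" using lineA[of z] lineB[of z] z zN(2) unfolding sgn by auto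
          then show False using le z zN(1) by (auto simp: N_def)
        qed
      qed
    qed
    show ?thesis unfolding tame_at_def
    proof (intro exI[of _ r] conjI allI impI)
      show "r > 0" by fact
      fix r' assume r': "0 < r'" "r' < r"
      define A where "A = ball b r' \<inter> {z. I1 z > 0}"
      define B where "B = ball b r' \<inter> {z. I2 z > 0}"
      have "ball b r' \<subseteq> ball b r" using r' by (simp add: subset_ball)
      then have "\<Omega> \<inter> ball b r' = (\<Omega> \<inter> ball b r) \<inter> ball b r'" by blast
      also have "\<dots> = A \<union> B" unfolding eq P_def A_def B_def using \<open>ball b r' \<subseteq> ball b r\<close> by blast
      finally have eqA: "\<Omega> \<inter> ball b r' = A \<union> B" .
      have "A \<inter> B \<noteq> {}" using pt(1)[OF r'(1)] unfolding sgn A_def B_def by blast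
      moreover have "convex A" "convex B" unfolding A_def B_def by (rule conv)+
      ultimately show "\<exists>A B. convex A \<and> convex B \<and> A \<inter> B \<noteq> {} \<and> \<Omega> \<inter> ball b r' = A \<union> B"
        using eqA by blast
    qed
  qed
  have "b \<in> path_image \<gamma>" using pim by blast
  then show ?thesis unfolding boundary_corner_def
    using tame turn' sub r(1) C(5) by (auto simp: defs cross_def)
qed

text \<open>Collinear sides make the quotient in the angle a real number \<open>x\<close>. Negative
  \<open>x\<close> is the excluded angle \<open>pi\<close>; positive \<open>x\<close> is a spike,
  where the two sides overlap near the corner, against injectivity.\<close>

lemma interior_angle_imp_turn:
  assumes \<gamma>\<Omega>: "positive_boundary_curve \<gamma> \<Omega>"
    and st: "0 \<le> s" "s < t" "t < u" "u \<le> 1"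
    and im: "\<gamma> ` {s..t} = closed_segment (\<gamma> s) (\<gamma> t)" "\<gamma> ` {t..u} = closed_segment (\<gamma> t) (\<gamma> u)"
    and angle: "interior_angle (\<gamma> s) (\<gamma> t) (\<gamma> u) \<noteq> pi"
  shows "cross (\<gamma> t - \<gamma> s) (\<gamma> u - \<gamma> t) \<noteq> 0"
proof
  assume c0: "cross (\<gamma> t - \<gamma> s) (\<gamma> u - \<gamma> t) = 0"
  have neq: "\<gamma> s \<noteq> \<gamma> t" "\<gamma> t \<noteq> \<gamma> u"
    using curve_segment_neq[OF \<gamma>\<Omega> _ _ _ im(1)] curve_segment_neq[OF \<gamma>\<Omega> _ _ _ im(2)] st by auto
  have "cross (\<gamma> u - \<gamma> t) (\<gamma> s - \<gamma> t) = 0" using c0 by (simp add: cross_eq algebra_simps)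
  then obtain x where x: "\<gamma> s - \<gamma> t = of_real x * (\<gamma> u - \<gamma> t)" by (rule cross_zero_imp_multiple) (use neq in auto)
  then have "(\<gamma> s - \<gamma> t) / (\<gamma> u - \<gamma> t) = of_real x" using neq by (simp add: divide_eq_eq)
  then have "x \<ge> 0" using angle by (simp add: interior_angle_def Arg2pi_of_real split: if_splits)
  moreover have "x \<noteq> 0" using x neq by auto
  ultimately have x0: "x > 0" by simp
  \<comment> \<open>Below 1 and below \<open>x\<close>, so that the point at fraction
    \<open>e\<close> of the second side, counted from the corner, is on the first side at fraction
    \<open>e / x\<close>.\<close>
  define e where "e = min (1/2) (x / 2)"
  have e: "0 < e" "e < 1" "e / x < 1" "0 < e / x" using x0 by (auto simp: e_def min_def field_simps)
  define p where "p = \<gamma> t + of_real e * (\<gamma> u - \<gamma> t)"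
  have p2: "p \<in> closed_segment (\<gamma> t) (\<gamma> u)"
    using e by (auto simp: closed_segment_def p_def scaleR_conv_of_real algebra_simps intro!: exI[of _ e])
  define k where "k = e / x"
  have "p = \<gamma> t + of_real k * (\<gamma> s - \<gamma> t)" unfolding x p_def k_def using x0 by simp
  moreover have "0 < k" "k < 1" using e by (auto simp: k_def)
  ultimately have "p \<in> open_segment (\<gamma> t) (\<gamma> s)" unfolding in_segment using neq
    by (intro conjI exI[of _ k]) (auto simp: scaleR_conv_of_real algebra_simps)
  then have "p \<in> open_segment (\<gamma> s) (\<gamma> t)" by (simp add: open_segment_commute)
  from open_segment_off_rest[OF \<gamma>\<Omega> _ _ _ im(1) this] have off: "p \<notin> \<gamma> ` ({0..s} \<union> {t..1})" using st by auto
  have "p \<in> \<gamma> ` {t..u}" using p2 unfolding im(2) .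
  moreover have "\<gamma> ` {t..u} \<subseteq> \<gamma> ` ({0..s} \<union> {t..1})" using st by (intro image_mono) auto
  ultimately show False using off by blast
qed

section \<open>The dual and the null relation\<close>

text \<open>The gradient of \<psi> is that of \<phi> turned by a right angle and divided by the area
  density, so its norm is at most 1. Convexity keeps the joining segment inside \<Omega>.\<close>

lemma dual_Lipschitz:
  assumes dual: "is_dual \<Omega> \<phi> \<psi>" and S: "convex S" "S \<subseteq> \<Omega>" and xy: "x \<in> S" "y \<in> S"
  shows "\<bar>\<psi> x - \<psi> y\<bar> \<le> dist x y"
proof -
  define p where "p = (\<lambda>z. pdx \<phi> z / area_density \<phi> z)"
  define q where "q = (\<lambda>z. pdy \<phi> z / area_density \<phi> z)"
  have pq: "(p z)\<^sup>2 + (q z)\<^sup>2 \<le> 1" for z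
  proof -
    have a: "(area_density \<phi> z)\<^sup>2 = 1 + (pdx \<phi> z)\<^sup>2 + (pdy \<phi> z)\<^sup>2"
      unfolding area_density_def by (rule real_sqrt_pow2) simp
    have "(area_density \<phi> z)\<^sup>2 > 0" unfolding a by (simp add: add_pos_nonneg)
    then show ?thesis unfolding p_def q_def power_divide add_divide_distrib[symmetric] using a by simp
  qed
  have "norm (\<psi> x - \<psi> y) \<le> 1 * norm (x - y)"
  proof (rule differentiable_bound[OF S(1) _ _ xy])
    fix z assume z: "z \<in> S"
    show "(\<psi> has_derivative (\<lambda>h. - q z * Re h + p z * Im h)) (at z within S)"
      using dual S(2) z unfolding is_dual_def p_def q_def by (blast intro: has_derivative_at_withinI)
    show "onorm (\<lambda>h. - q z * Re h + p z * Im h) \<le> 1"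
    proof (rule onorm_le)
      fix h
      \<comment> \<open>Lagrange's identity; dropping the second square leaves the Cauchy--Schwarz
        inequality.\<close>
      have "(- q z * Re h + p z * Im h)\<^sup>2 + (q z * Im h + p z * Re h)\<^sup>2 = ((p z)\<^sup>2 + (q z)\<^sup>2) * (norm h)\<^sup>2"
        unfolding cmod_power2 by (simp add: power2_eq_square algebra_simps)
      also have "\<dots> \<le> 1 * (norm h)\<^sup>2" using pq by (intro mult_right_mono) auto
      finally have "(- q z * Re h + p z * Im h)\<^sup>2 \<le> (norm h)\<^sup>2" using zero_le_power2[of "q z * Im h + p z * Re h"] by linarith
      then have "\<bar>- q z * Re h + p z * Im h\<bar> \<le> \<bar>norm h\<bar>" by (rule abs_le_square_iff[THEN iffD2])
      then show "norm (- q z * Re h + p z * Im h) \<le> 1 * norm h" by simp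
    qed
  qed
  then show ?thesis by (simp add: dist_norm)
qed

text \<open>Two points of a small ball are compared through a point \<open>c\<close> common to both
  convex pieces, at distance at most \<open>2 * r\<close> from each; so the oscillation is at most
  \<open>4 * r\<close>.\<close>

lemma dual_limit_at_tame:
  assumes dual: "is_dual \<Omega> \<phi> \<psi>" and q: "q \<in> closure \<Omega>" "tame_at \<Omega> q"
  shows "\<exists>l. (\<psi> \<longlongrightarrow> l) (at q within \<Omega>)"
proof -
  obtain r0 where r0: "r0 > 0" "\<And>r. 0 < r \<Longrightarrow> r < r0 \<Longrightarrow> \<exists>A B. convex A \<and> convex B \<and> A \<inter> B \<noteq> {} \<and> \<Omega> \<inter> ball q r = A \<union> B"
    using q(2) unfolding tame_at_def by blast
  have osc: "\<bar>\<psi> x - \<psi> y\<bar> \<le> 4 * r" if r: "0 < r" "r < r0" and xy: "x \<in> \<Omega>" "dist x q < r" "y \<in> \<Omega>" "dist y q < r" for x y r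
  proof -
    obtain A B where AB: "convex A" "convex B" "A \<inter> B \<noteq> {}" "\<Omega> \<inter> ball q r = A \<union> B" using r0(2)[OF r] by blast
    obtain c where c: "c \<in> A" "c \<in> B" using AB(3) by blast
    have "c \<in> \<Omega> \<inter> ball q r" unfolding AB(4) using c by blast
    then have cq: "dist c q < r" by (simp add: dist_commute)
    have sub: "A \<subseteq> \<Omega>" "B \<subseteq> \<Omega>" using AB(4) by blast+
    have one: "\<bar>\<psi> z - \<psi> c\<bar> \<le> 2 * r" if z: "z \<in> \<Omega>" "dist z q < r" for z
    proof -
      have "z \<in> \<Omega> \<inter> ball q r" using z by (simp add: dist_commute)
      then have "z \<in> A \<or> z \<in> B" unfolding AB(4) by blast
      then have "\<bar>\<psi> z - \<psi> c\<bar> \<le> dist z c"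
        using dual_Lipschitz[OF dual AB(1) sub(1)] dual_Lipschitz[OF dual AB(2) sub(2)] c by blast
      also have "\<dots> \<le> 2 * r" using dist_triangle2[of z c q] z(2) cq by simp
      finally show ?thesis .
    qed
    show ?thesis using one[OF xy(1,2)] one[OF xy(3,4)] by linarith
  qed
  obtain z where z: "\<And>n. z n \<in> \<Omega>" "z \<longlonglongrightarrow> q" using q(1) unfolding closure_sequential by auto
  have ev: "\<exists>N. \<forall>n\<ge>N. dist (z n) q < r" if "r > 0" for r using z(2) that unfolding lim_sequentially by blast
  have "Cauchy (\<lambda>n. \<psi> (z n))"
    unfolding Cauchy_def
  proof (intro allI impI)
    fix e :: real assume e: "e > 0"
    define r where "r = min (r0 / 2) (e / 8)"
    have r: "0 < r" "r < r0" "4 * r < e" using r0(1) e by (auto simp: r_def)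
    obtain N where N: "\<And>n. n \<ge> N \<Longrightarrow> dist (z n) q < r" using ev[OF r(1)] by blast
    have "dist (\<psi> (z m)) (\<psi> (z n)) < e" if "m \<ge> N" "n \<ge> N" for m n
      using osc[OF r(1,2) z(1)[of m] N[OF that(1)] z(1)[of n] N[OF that(2)]] r(3) by (simp add: dist_real_def)
    then show "\<exists>M. \<forall>m\<ge>M. \<forall>n\<ge>M. dist (\<psi> (z m)) (\<psi> (z n)) < e" by blast
  qed
  then obtain l where l: "(\<lambda>n. \<psi> (z n)) \<longlonglongrightarrow> l" using Cauchy_convergent_iff convergent_def by blast
  have "(\<psi> \<longlongrightarrow> l) (at q within \<Omega>)"
    unfolding tendsto_iff
  proof (intro allI impI)
    fix e :: real assume e: "e > 0"
    define r where "r = min (r0 / 2) (e / 8)"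
    have r: "0 < r" "r < r0" "4 * r < e" using r0(1) e by (auto simp: r_def)
    obtain N where N: "\<And>n. n \<ge> N \<Longrightarrow> dist (z n) q < r" using ev[OF r(1)] by blast
    have "dist (\<psi> x) l < e" if x: "x \<in> \<Omega>" "dist x q < r" for x
    proof -
      have "(\<lambda>n. \<bar>\<psi> x - \<psi> (z n)\<bar>) \<longlonglongrightarrow> \<bar>\<psi> x - l\<bar>" by (intro tendsto_intros l)
      then have "\<bar>\<psi> x - l\<bar> \<le> 4 * r"
        by (rule LIMSEQ_le_const2) (use osc[OF r(1,2) x z(1) N] in blast)
      then show ?thesis using r(3) by (simp add: dist_real_def)
    qed
    then show "\<forall>\<^sub>F x in at q within \<Omega>. dist (\<psi> x) l < e" unfolding eventually_at using r(1) by blast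
  qed
  then show ?thesis by blast
qed

text \<open>Limits from within \<Omega> also control nearby points \<open>y\<close> of
  \<open>T\<close>, because \<open>g y\<close> is itself a limit of values of \<open>g\<close> on
  \<Omega> near \<open>y\<close>.\<close>

lemma continuous_on_extension_by_limits:
  fixes g :: "'a::metric_space \<Rightarrow> 'b::metric_space"
  assumes \<Omega>: "open \<Omega>" "continuous_on \<Omega> g" and T: "T \<subseteq> frontier \<Omega>"
    and lim: "\<And>q. q \<in> T \<Longrightarrow> (g \<longlongrightarrow> g q) (at q within \<Omega>)"
  shows "continuous_on (\<Omega> \<union> T) g"
  unfolding continuous_on_iff
proof (intro ballI allI impI)
  fix x and e :: real assume x: "x \<in> \<Omega> \<union> T" and e: "e > 0"
  have nontriv: "at q within \<Omega> \<noteq> bot" "q \<notin> \<Omega>" if "q \<in> T" for q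
  proof -
    have "q \<in> closure \<Omega> - \<Omega>" using that T \<Omega>(1) by (auto simp: frontier_def interior_open)
    then show "q \<notin> \<Omega>" "at q within \<Omega> \<noteq> bot"
      by (auto simp: at_within_eq_bot_iff)
  qed
  show "\<exists>d>0. \<forall>x'\<in>\<Omega> \<union> T. dist x' x < d \<longrightarrow> dist (g x') (g x) < e"
  proof (cases "x \<in> \<Omega>")
    case True
    obtain d1 where d1: "d1 > 0" "ball x d1 \<subseteq> \<Omega>" using \<Omega>(1) True unfolding open_contains_ball by blast
    obtain d2 where d2: "d2 > 0" "\<And>y. y \<in> \<Omega> \<Longrightarrow> dist y x < d2 \<Longrightarrow> dist (g y) (g x) < e"
      using \<Omega>(2) True e unfolding continuous_on_iff by blast
    have "dist (g y) (g x) < e" if "dist y x < min d1 d2" for y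
      using that d1(2) by (intro d2(2)) (auto simp: dist_commute subset_iff)
    then show ?thesis using d1(1) d2(1) by (intro exI[of _ "min d1 d2"]) auto
  next
    case False
    then have xT: "x \<in> T" using x by blast
    have "e / 2 > 0" using e by simp
    from tendstoD[OF lim[OF xT] this] obtain d where d: "d > 0"
      "\<And>z. z \<in> \<Omega> \<Longrightarrow> z \<noteq> x \<Longrightarrow> dist z x < d \<Longrightarrow> dist (g z) (g x) < e / 2" unfolding eventually_at by blast
    have "dist (g y) (g x) < e" if y: "y \<in> \<Omega> \<union> T" "dist y x < d" for y
    proof (cases "y \<in> \<Omega>")
      case True
      then have "dist (g y) (g x) < e / 2" using d(2)[of y] y(2) False by blast
      then show ?thesis using e by linarith
    next
      case yn: False
      then have yT: "y \<in> T" using y(1) by blast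
      have "\<forall>\<^sub>F z in nhds y. z \<in> ball x d" using y by (intro eventually_nhds_in_open) (auto simp: dist_commute)
      then have "\<forall>\<^sub>F z in at y within \<Omega>. dist (g z) (g x) \<le> e / 2" unfolding eventually_at_filter
      proof (rule eventually_mono, intro impI)
        fix z assume z: "z \<in> ball x d" "z \<in> \<Omega>"
        then have "z \<noteq> x" using False by blast
        then show "dist (g z) (g x) \<le> e / 2" using d(2)[of z] z by (simp add: dist_commute less_imp_le)
      qed
      from tendsto_upperbound[OF tendsto_dist[OF lim[OF yT] tendsto_const] this nontriv(1)[OF yT]]
      show ?thesis using e by simp
    qed
    then show ?thesis using d(1) by blast
  qed
qed

text \<open>Here \<open>(a, b)\<close> and \<open>(c, d)\<close> are the partial derivatives of
  \<open>f\<close>, \<open>(A, B)\<close> is the gradient of \<phi> and \<open>W\<close> the area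
  density. Lagrange's identity gives that the Jacobian times \<open>W\<close> has the same square as
  the conformal factor \<open>E\<close>, and positivity of the Jacobian selects the root. Multiplied
  by the Jacobian, both conclusions are polynomial identities modulo the isothermal
  conditions.\<close>

lemma isothermal_dual_algebra:
  fixes a b c d A B W :: real
  assumes W: "W > 0" "W\<^sup>2 = 1 + A\<^sup>2 + B\<^sup>2"
    and iso: "a\<^sup>2 + b\<^sup>2 + (A * a + B * b)\<^sup>2 = c\<^sup>2 + d\<^sup>2 + (A * c + B * d)\<^sup>2"
      "a * c + b * d + (A * a + B * b) * (A * c + B * d) = 0"
    and J: "a * d - b * c > 0"
  shows "B * a - A * b = W * (A * c + B * d)" "A * d - B * c = W * (A * a + B * b)"
proof -
  define E where "E = a\<^sup>2 + b\<^sup>2 + (A * a + B * b)\<^sup>2"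
  have "((a * d - b * c) * W)\<^sup>2 = (a * d - b * c)\<^sup>2 * (1 + A\<^sup>2 + B\<^sup>2)" by (simp add: power_mult_distrib W(2))
  also have "\<dots> = (a\<^sup>2 + b\<^sup>2 + (A * a + B * b)\<^sup>2) * (c\<^sup>2 + d\<^sup>2 + (A * c + B * d)\<^sup>2) - (a * c + b * d + (A * a + B * b) * (A * c + B * d))\<^sup>2"
    by (simp add: power2_eq_square algebra_simps)
  also have "\<dots> = E\<^sup>2" unfolding iso(2) iso(1)[symmetric] E_def by (simp add: power2_eq_square)
  finally have "((a * d - b * c) * W)\<^sup>2 = E\<^sup>2" .
  moreover have "(a * d - b * c) * W \<ge> 0" "E \<ge> 0" using J W(1) by (auto simp: E_def)
  ultimately have JW: "(a * d - b * c) * W = E" using power2_eq_imp_eq by blast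
  have "(a * d - b * c) * (B * a - A * b) = E * (A * c + B * d) - (a * c + b * d + (A * a + B * b) * (A * c + B * d)) * (A * a + B * b)"
    unfolding E_def by (simp add: power2_eq_square algebra_simps)
  then have "(a * d - b * c) * (B * a - A * b) = (a * d - b * c) * (W * (A * c + B * d))" unfolding iso(2) JW[symmetric] by simp
  then show "B * a - A * b = W * (A * c + B * d)" using J by simp
  have "(a * d - b * c) * (A * d - B * c) = (c\<^sup>2 + d\<^sup>2 + (A * c + B * d)\<^sup>2) * (A * a + B * b) - (a * c + b * d + (A * a + B * b) * (A * c + B * d)) * (A * c + B * d)"
    by (simp add: power2_eq_square algebra_simps)
  then have "(a * d - b * c) * (A * d - B * c) = (a * d - b * c) * (W * (A * a + B * b))"
    unfolding iso(2) iso(1)[symmetric] E_def[symmetric] JW[symmetric] by simp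
  then show "A * d - B * c = W * (A * a + B * b)" using J by simp
qed

section \<open>Cauchy--Riemann equations for the height and its dual\<close>

context
  fixes \<Omega> :: "complex set" and \<phi> \<psi> :: "complex \<Rightarrow> real" and f :: "complex \<Rightarrow> complex"
  assumes \<phi>: "\<forall>z\<in>\<Omega>. \<phi> differentiable (at z)" and dual: "is_dual \<Omega> \<phi> \<psi>"
    and chm: "corresponding_harmonic_mapping \<Omega> \<phi> f"
begin

lemma holomorphic_height:
  assumes w: "w \<in> ball 0 1"
  shows "((\<lambda>w. Complex (\<phi> (f w)) (\<psi> (f w))) has_field_derivative
     Complex (pdx \<phi> (f w) * Re (pdx f w) + pdy \<phi> (f w) * Im (pdx f w)) (- (pdx \<phi> (f w) * Re (pdy f w) + pdy \<phi> (f w) * Im (pdy f w)))) (at w)"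
    (is "(_ has_field_derivative Complex ?tu (- ?tv)) _")
  and isothermal_components:
    "(Re (pdx f w))\<^sup>2 + (Im (pdx f w))\<^sup>2 + (pdx \<phi> (f w) * Re (pdx f w) + pdy \<phi> (f w) * Im (pdx f w))\<^sup>2 =
     (Re (pdy f w))\<^sup>2 + (Im (pdy f w))\<^sup>2 + (pdx \<phi> (f w) * Re (pdy f w) + pdy \<phi> (f w) * Im (pdy f w))\<^sup>2" (is ?iso1)
    "Re (pdx f w) * Re (pdy f w) + Im (pdx f w) * Im (pdy f w) +
      (pdx \<phi> (f w) * Re (pdx f w) + pdy \<phi> (f w) * Im (pdx f w)) * (pdx \<phi> (f w) * Re (pdy f w) + pdy \<phi> (f w) * Im (pdy f w)) = 0" (is ?iso2)
proof -
  have fw: "f w \<in> \<Omega>" using chm w unfolding corresponding_harmonic_mapping_def bij_betw_def by blast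
  have df: "f differentiable (at w)"
    using chm w unfolding corresponding_harmonic_mapping_def harmonic_on_def C2_on_def C1_on_def by blast
  define D where "D = frechet_derivative f (at w)"
  have D: "(f has_derivative D) (at w)" unfolding D_def using df frechet_derivative_works by blast
  define P where "P = frechet_derivative \<phi> (at (f w))"
  have P: "(\<phi> has_derivative P) (at (f w))" unfolding P_def using \<phi> fw frechet_derivative_works by blast
  define A where "A = pdx \<phi> (f w)"
  define B where "B = pdy \<phi> (f w)"
  define W where "W = area_density \<phi> (f w)"
  have linP: "linear P" using P has_derivative_linear by blast
  have Ph: "P h = A * Re h + B * Im h" for h
  proof -
    have "h = Re h *\<^sub>R 1 + Im h *\<^sub>R \<i>" by (simp add: complex_eq_iff)
    then have "P h = P (Re h *\<^sub>R 1 + Im h *\<^sub>R \<i>)" by simp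
    also have "\<dots> = Re h * P 1 + Im h * P \<i>" using linP by (simp add: linear_add linear_scale)
    finally show ?thesis by (simp add: A_def B_def pdx_def pdy_def P_def)
  qed
  have linD: "linear D" using D has_derivative_linear by blast
  have Dh: "D k = Re k *\<^sub>R pdx f w + Im k *\<^sub>R pdy f w" for k
  proof -
    have "k = Re k *\<^sub>R 1 + Im k *\<^sub>R \<i>" by (simp add: complex_eq_iff)
    then have "D k = D (Re k *\<^sub>R 1 + Im k *\<^sub>R \<i>)" by simp
    also have "\<dots> = Re k *\<^sub>R D 1 + Im k *\<^sub>R D \<i>" using linD by (simp add: linear_add linear_scale)
    finally show ?thesis by (simp add: pdx_def pdy_def D_def)
  qed
  have t: "((\<lambda>w. \<phi> (f w)) has_derivative (\<lambda>k. P (D k))) (at w)" using has_derivative_compose[OF D P] .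
  have X: "((\<lambda>w. (f w, \<phi> (f w))) has_derivative (\<lambda>k. (D k, P (D k)))) (at w)" by (rule has_derivative_Pair[OF D t])
  have fX: "frechet_derivative (\<lambda>w. (f w, \<phi> (f w))) (at w) = (\<lambda>k. (D k, P (D k)))"
    using frechet_derivative_at[OF X] by simp
  have Xuv: "pdx (\<lambda>w. (f w, \<phi> (f w))) w = (pdx f w, ?tu)" "pdy (\<lambda>w. (f w, \<phi> (f w))) w = (pdy f w, ?tv)"
  proof -
    have "pdx (\<lambda>w. (f w, \<phi> (f w))) w = (D 1, P (D 1))" "pdy (\<lambda>w. (f w, \<phi> (f w))) w = (D \<i>, P (D \<i>))"
      unfolding pdx_def pdy_def fX by simp_all
    then show "pdx (\<lambda>w. (f w, \<phi> (f w))) w = (pdx f w, ?tu)" "pdy (\<lambda>w. (f w, \<phi> (f w))) w = (pdy f w, ?tv)"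
      by (simp_all add: Dh Ph A_def B_def)
  qed
  have iso: "pdx (\<lambda>w. (f w, \<phi> (f w))) w \<bullet> pdx (\<lambda>w. (f w, \<phi> (f w))) w = pdy (\<lambda>w. (f w, \<phi> (f w))) w \<bullet> pdy (\<lambda>w. (f w, \<phi> (f w))) w"
    "pdx (\<lambda>w. (f w, \<phi> (f w))) w \<bullet> pdy (\<lambda>w. (f w, \<phi> (f w))) w = 0"
    using chm w unfolding corresponding_harmonic_mapping_def isothermal_on_def by blast+
  show iso1: ?iso1 using iso(1) unfolding Xuv by (simp add: inner_complex_def power2_eq_square)
  show iso2: ?iso2 using iso(2) unfolding Xuv by (simp add: inner_complex_def)
  have "Im (cnj (pdx f w) * pdy f w) > 0"
    using chm w unfolding corresponding_harmonic_mapping_def orientation_preserving_on_def by blast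
  then have J: "Re (pdx f w) * Im (pdy f w) - Im (pdx f w) * Re (pdy f w) > 0" by simp
  have W2: "W\<^sup>2 = 1 + A\<^sup>2 + B\<^sup>2" unfolding W_def area_density_def A_def B_def by (rule real_sqrt_pow2) simp
  have W0: "W > 0" unfolding W_def area_density_def by (rule real_sqrt_gt_zero) (simp add: add_pos_nonneg)
  note alg = isothermal_dual_algebra[OF W0 W2 iso1[folded A_def B_def] iso2[folded A_def B_def] J]
  define S where "S = (\<lambda>h. - (B / W) * Re h + A / W * Im h)"
  have Sd: "(\<psi> has_derivative S) (at (f w))" using dual fw unfolding is_dual_def S_def A_def B_def W_def by blast
  have s: "((\<lambda>w. \<psi> (f w)) has_derivative (\<lambda>k. S (D k))) (at w)" using has_derivative_compose[OF D Sd] .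
  \<comment> \<open>The Cauchy--Riemann equations: the dual has derivatives \<open>- ?tv\<close> and
    \<open>?tu\<close> in the two coordinate directions. They are the two algebraic identities
    divided by \<open>W\<close>.\<close>
  have Suv: "S (pdx f w) = - ?tv" "S (pdy f w) = ?tu"
  proof -
    have "S h = (A * Im h - B * Re h) / W" for h by (simp add: S_def diff_divide_distrib)
    moreover have "A * Im (pdx f w) - B * Re (pdx f w) = W * (- ?tv)" "A * Im (pdy f w) - B * Re (pdy f w) = W * ?tu"
      using alg unfolding A_def[symmetric] B_def[symmetric] by argo+
    ultimately show "S (pdx f w) = - ?tv" "S (pdy f w) = ?tu" using W0 by simp_all
  qed
  have SD: "S (D k) = Re k * (- ?tv) + Im k * ?tu" for k
  proof -
    have "linear S" using Sd has_derivative_linear by blast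
    then have "S (D k) = Re k * S (pdx f w) + Im k * S (pdy f w)" unfolding Dh by (simp add: linear_add linear_scale)
    then show ?thesis unfolding Suv .
  qed
  have PD: "P (D k) = Re k * ?tu + Im k * ?tv" for k
    unfolding Dh Ph by (simp add: A_def B_def algebra_simps)
  have "((\<lambda>w. Complex (\<phi> (f w)) (\<psi> (f w))) has_derivative (\<lambda>k. Complex (P (D k)) (S (D k)))) (at w)"
  proof -
    have "((\<lambda>w. of_real (\<phi> (f w)) + \<i> * of_real (\<psi> (f w))) has_derivative (\<lambda>k. of_real (P (D k)) + \<i> * of_real (S (D k)))) (at w)"
      by (intro derivative_intros t s)
    then show ?thesis by (simp only: Complex_eq)
  qed
  moreover have "(\<lambda>k. Complex (P (D k)) (S (D k))) = (*) (Complex ?tu (- ?tv))"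
    unfolding SD PD by (rule ext) (simp add: complex_eq_iff algebra_simps)
  ultimately show "((\<lambda>w. Complex (\<phi> (f w)) (\<psi> (f w))) has_field_derivative Complex ?tu (- ?tv)) (at w)"
    unfolding has_field_derivative_def by simp
qed

text \<open>The derivative of \<open>L \<circ> f\<close> is computed once through \<open>G\<close>
  and once through \<open>f\<close>; the directions 1 and \<open>\<i>\<close> give the real part and
  minus the imaginary part of \<open>deriv G w\<close>.\<close>

lemma deriv_of_harmonic_part:
  assumes w: "w \<in> ball 0 1" and L: "bounded_linear L" and G: "G holomorphic_on ball 0 1" "\<And>w. Re (G w) = L (f w)"
  shows "deriv G w = Complex (L (pdx f w)) (- L (pdy f w))"
proof -
  have df: "f differentiable (at w)"
    using chm w unfolding corresponding_harmonic_mapping_def harmonic_on_def C2_on_def C1_on_def by blast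
  define D where "D = frechet_derivative f (at w)"
  have D: "(f has_derivative D) (at w)" unfolding D_def using df frechet_derivative_works by blast
  have "(G has_derivative (*) (deriv G w)) (at w)"
    using holomorphic_derivI[OF G(1) open_ball w] unfolding has_field_derivative_def .
  from bounded_linear.has_derivative[OF bounded_linear_Re this]
  have 1: "((\<lambda>w. L (f w)) has_derivative (\<lambda>k. Re (deriv G w * k))) (at w)" by (simp add: G(2))
  have 2: "((\<lambda>w. L (f w)) has_derivative (\<lambda>k. L (D k))) (at w)" by (rule bounded_linear.has_derivative[OF L D])
  have eq: "Re (deriv G w * k) = L (D k)" for k using has_derivative_unique[OF 1 2] by (rule fun_cong)
  show ?thesis using eq[of 1] eq[of \<i>] by (simp add: complex_eq_iff pdx_def pdy_def D_def)
qed

end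

section \<open>Assembly at the boundary point to which the middle segment collapses\<close>

theorem corollary1p4:
  fixes \<Omega> :: "complex set" and \<gamma> :: "real \<Rightarrow> complex" and z0 z1 z2 z3 :: complex
    and \<phi> \<psi> :: "complex \<Rightarrow> real" and f f_conj :: "complex \<Rightarrow> complex"
  assumes "positive_boundary_curve \<gamma> \<Omega>"
    and "consecutive_segments \<gamma> z0 z1 z2 z3"
    and "interior_angle z0 z1 z2 \<noteq> pi"
    and "interior_angle z1 z2 z3 \<noteq> pi"
    and "minimal_surface_solution \<Omega> \<phi>"
    and "tends_on \<Omega> \<phi> at_top (open_segment z1 z2)"
    and "tends_on \<Omega> \<phi> at_top (open_segment z0 z1) \<or> tends_on \<Omega> \<phi> at_bot (open_segment z0 z1)"
    and "tends_on \<Omega> \<phi> at_top (open_segment z2 z3) \<or> tends_on \<Omega> \<phi> at_bot (open_segment z2 z3)"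
    and "is_dual \<Omega> \<phi> \<psi>"
    and "corresponding_harmonic_mapping \<Omega> \<phi> f"
    and "conjugate_mapping f f_conj"
  shows "\<exists>\<psi>_ext :: complex \<Rightarrow> real.
    continuous_on (\<Omega> \<union> open_segment z0 z1 \<union> {z1} \<union> open_segment z1 z2 \<union> {z2} \<union> open_segment z2 z3) \<psi>_ext \<and>
    (\<forall>z\<in>\<Omega>. \<psi>_ext z = \<psi> z) \<and>
    (\<exists>w2 \<in> sphere 0 1.
      \<comment> \<open>X_min = (f, t)\<close>
      (cluster_set f w2 = closed_segment z1 z2 \<and>
       filterlim (\<lambda>w. \<phi> (f w)) at_top (at w2 within ball 0 1)) \<and>
      \<comment> \<open>X_max = (f, t*)\<close>
      (cluster_set (\<lambda>w. (f w, \<psi> (f w))) w2 = closed_segment (z1, \<psi>_ext z1) (z2, \<psi>_ext z2) \<and>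
       \<psi>_ext z2 - \<psi>_ext z1 = norm (z2 - z1)) \<and>
      \<comment> \<open>the conjugate (f*, t*) of X_min\<close>
      (diverges_in_direction f_conj w2 (z1 - z2) \<and>
       (\<exists>a b. b - a = norm (z2 - z1) \<and> cluster_set (\<lambda>w. \<psi> (f w)) w2 = {a..b})) \<and>
      \<comment> \<open>the conjugate (f*, -t) of X_max\<close>
      (diverges_in_direction f_conj w2 (z1 - z2) \<and>
       filterlim (\<lambda>w. - \<phi> (f w)) at_bot (at w2 within ball 0 1)))"
proof -
  note \<gamma>\<Omega> = assms(1) and chm = assms(10) and dual = assms(9)
  note dom = positive_boundary_curve_domain[OF \<gamma>\<Omega>]
  obtain s0 s1 s2 s3 where s: "0 \<le> s0" "s0 < s1" "s1 < s2" "s2 < s3" "s3 \<le> 1"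
    and \<gamma>s: "\<gamma> s0 = z0" "\<gamma> s1 = z1" "\<gamma> s2 = z2" "\<gamma> s3 = z3"
    and im: "\<gamma> ` {s0..s1} = closed_segment z0 z1" "\<gamma> ` {s1..s2} = closed_segment z1 z2" "\<gamma> ` {s2..s3} = closed_segment z2 z3"
    using assms(2) unfolding consecutive_segments_def by blast
  have seg: "boundary_segment \<Omega> z0 z1" "boundary_segment \<Omega> z1 z2" "boundary_segment \<Omega> z2 z3"
    using curve_boundary_segment[OF \<gamma>\<Omega>, of s0 s1] curve_boundary_segment[OF \<gamma>\<Omega>, of s1 s2] curve_boundary_segment[OF \<gamma>\<Omega>, of s2 s3] s im
    unfolding \<gamma>s by auto
  have turn: "cross (z1 - z0) (z2 - z1) \<noteq> 0" "cross (z2 - z1) (z3 - z2) \<noteq> 0"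
    using interior_angle_imp_turn[OF \<gamma>\<Omega>, of s0 s1 s2] interior_angle_imp_turn[OF \<gamma>\<Omega>, of s1 s2 s3] s im assms(3,4)
    unfolding \<gamma>s by auto
  have corner: "boundary_corner \<Omega> z0 z1 z2" "boundary_corner \<Omega> z1 z2 z3"
    using curve_boundary_corner[OF \<gamma>\<Omega>, of s0 s1 s2] curve_boundary_corner[OF \<gamma>\<Omega>, of s1 s2 s3] s im turn
    unfolding \<gamma>s by auto
  have z12: "z1 \<noteq> z2" using seg(2) by (simp add: boundary_segment_def)
  define \<Phi>\<^sub>1 where "\<Phi>\<^sub>1 = (\<lambda>w. Complex (Re (f w)) (Re (f_conj w)))"
  define \<Phi>\<^sub>2 where "\<Phi>\<^sub>2 = (\<lambda>w. Complex (Im (f w)) (Im (f_conj w)))"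
  define h where "h = (\<lambda>w. Complex (\<phi> (f w)) (\<psi> (f w)))"
  have hol: "\<Phi>\<^sub>1 holomorphic_on ball 0 1" "\<Phi>\<^sub>2 holomorphic_on ball 0 1"
    using assms(11) by (simp_all add: conjugate_mapping_def conjugate_harmonic_def \<Phi>\<^sub>1_def \<Phi>\<^sub>2_def)
  have f_eq: "f w = Complex (Re (\<Phi>\<^sub>1 w)) (Re (\<Phi>\<^sub>2 w))" for w by (simp add: \<Phi>\<^sub>1_def \<Phi>\<^sub>2_def)
  have d\<phi>: "\<forall>z\<in>\<Omega>. \<phi> differentiable (at z)"
    using assms(5) unfolding minimal_surface_solution_def C2_on_def C1_on_def by blast
  have h: "h holomorphic_on ball 0 1" unfolding h_def
  proof (rule holomorphic_onI)
    fix w :: complex assume w: "w \<in> ball 0 1"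
    show "(\<lambda>w. Complex (\<phi> (f w)) (\<psi> (f w))) field_differentiable at w within ball 0 1"
      by (rule field_differentiable_at_within, unfold field_differentiable_def) (rule exI, rule holomorphic_height[OF d\<phi> dual chm w])
  qed
  have bij: "bij_betw f (ball 0 1) \<Omega>" using chm by (simp add: corresponding_harmonic_mapping_def)
  \<comment> \<open>A continuous injection of an open set of the plane is a homeomorphism onto its
    image, by invariance of domain.\<close>
  obtain F where F: "homeomorphism (ball 0 1) \<Omega> f F"
  proof -
    have cont: "continuous_on (ball 0 1) f"
    proof -
      have "continuous_on (ball 0 1) (\<lambda>w. of_real (Re (\<Phi>\<^sub>1 w)) + \<i> * of_real (Re (\<Phi>\<^sub>2 w)))"
        by (intro continuous_intros holomorphic_on_imp_continuous_on hol)
      then show ?thesis by (subst f_eq[abs_def]) (simp only: Complex_eq)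
    qed
    have "inj_on f (ball 0 1)" "f ` ball 0 1 = \<Omega>" using bij by (auto simp: bij_betw_def)
    then show ?thesis using invariance_of_domain_homeomorphism[OF open_ball cont] that by auto
  qed
  interpret harmonic_homeomorphism \<Omega> f F \<Phi>\<^sub>1 \<Phi>\<^sub>2
    using dom F hol f_eq by unfold_locales auto
  have in\<Omega>: "\<forall>\<^sub>F z in at q within \<Omega>. z \<in> \<Omega>" for q by (auto simp: eventually_at_topological)
  have pole: "filterlim (\<lambda>z. Re (h (F z))) G (at q within \<Omega>)" if "filterlim \<phi> G (at q within \<Omega>)" for q G
  proof -
    have "\<forall>\<^sub>F z in at q within \<Omega>. Re (h (F z)) = \<phi> z"
      using in\<Omega> by (rule eventually_mono) (simp add: h_def fF)
    from filterlim_cong[OF refl refl this] that show ?thesis by simp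
  qed
  \<comment> \<open>Divergence to minus infinity is divergence to plus infinity for
    \<open>- h\<close>, so both alternatives give one limit of \<open>F\<close> per segment.\<close>
  have limF: "\<exists>e. norm e = 1 \<and> (\<forall>q\<in>open_segment a b. (F \<longlongrightarrow> e) (at q within \<Omega>))"
    if ab: "boundary_segment \<Omega> a b" and inf: "tends_on \<Omega> \<phi> at_top (open_segment a b) \<or> tends_on \<Omega> \<phi> at_bot (open_segment a b)" for a b
    using inf
  proof
    assume "tends_on \<Omega> \<phi> at_top (open_segment a b)"
    then have top: "filterlim (\<lambda>z. Re (h (F z))) at_top (at q within \<Omega>)" if "q \<in> open_segment a b" for q
      using that by (intro pole) (simp add: tends_on_def)
    obtain e where "norm e = 1" "\<And>q. q \<in> open_segment a b \<Longrightarrow> (F \<longlongrightarrow> e) (at q within \<Omega>)"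
      using boundary_segment_F_limit[OF ab h top] by blast
    then show ?thesis by blast
  next
    assume "tends_on \<Omega> \<phi> at_bot (open_segment a b)"
    then have "filterlim (\<lambda>z. Re (h (F z))) at_bot (at q within \<Omega>)" if "q \<in> open_segment a b" for q
      using that by (intro pole) (simp add: tends_on_def)
    then have top: "filterlim (\<lambda>z. Re ((\<lambda>w. - h w) (F z))) at_top (at q within \<Omega>)" if "q \<in> open_segment a b" for q
      using that by (simp add: filterlim_uminus_at_bot)
    obtain e where "norm e = 1" "\<And>q. q \<in> open_segment a b \<Longrightarrow> (F \<longlongrightarrow> e) (at q within \<Omega>)"
      using boundary_segment_F_limit[OF ab holomorphic_on_minus[OF h] top] by blast
    then show ?thesis by blast
  qed
  obtain e1 where e1: "\<And>q. q \<in> open_segment z0 z1 \<Longrightarrow> (F \<longlongrightarrow> e1) (at q within \<Omega>)" using limF[OF seg(1) assms(7)] by blast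
  obtain e2 where e2: "norm e2 = 1" "\<And>q. q \<in> open_segment z1 z2 \<Longrightarrow> (F \<longlongrightarrow> e2) (at q within \<Omega>)" using limF[OF seg(2)] assms(6) by blast
  obtain e3 where e3: "norm e3 = 1" "\<And>q. q \<in> open_segment z2 z3 \<Longrightarrow> (F \<longlongrightarrow> e3) (at q within \<Omega>)" using limF[OF seg(3) assms(8)] by blast
  define \<theta> where "\<theta> = Arg e2"
  have \<theta>: "e2 = cis \<theta>" using e2(1) cis_Arg[of e2] by (cases "e2 = 0") (auto simp: \<theta>_def sgn_div_norm)
  obtain a1 where a1: "a1 > 0" "(\<forall>s. 0 < s \<longrightarrow> s < a1 \<longrightarrow> (f \<longlongrightarrow> z1) (at (cis (\<theta> + s)) within ball 0 1)) \<or>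
               (\<forall>s. - a1 < s \<longrightarrow> s < 0 \<longrightarrow> (f \<longlongrightarrow> z1) (at (cis (\<theta> + s)) within ball 0 1))"
  proof -
    obtain \<alpha> \<beta> where ab: "\<alpha> < \<beta>" "{cis \<alpha>, cis \<beta>} = {e1, cis \<theta>}" "\<And>s. \<alpha> < s \<Longrightarrow> s < \<beta> \<Longrightarrow> (f \<longlongrightarrow> z1) (at (cis s) within ball 0 1)"
      using corner_arc[OF corner(1) seg(1,2) e1 e2(2) e2(1)] unfolding \<theta> by blast
    show ?thesis using one_sided_limit[OF ab] that by blast
  qed
  obtain a2 where a2: "a2 > 0" "(\<forall>s. 0 < s \<longrightarrow> s < a2 \<longrightarrow> (f \<longlongrightarrow> z2) (at (cis (\<theta> + s)) within ball 0 1)) \<or>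
               (\<forall>s. - a2 < s \<longrightarrow> s < 0 \<longrightarrow> (f \<longlongrightarrow> z2) (at (cis (\<theta> + s)) within ball 0 1))"
  proof -
    obtain \<alpha> \<beta> where ab: "\<alpha> < \<beta>" "{cis \<alpha>, cis \<beta>} = {cis \<theta>, e3}" "\<And>s. \<alpha> < s \<Longrightarrow> s < \<beta> \<Longrightarrow> (f \<longlongrightarrow> z2) (at (cis s) within ball 0 1)"
      using corner_arc[OF corner(2) seg(2,3) e2(2) e3(2) e3(1)] unfolding \<theta> by blast
    have "{cis \<alpha>, cis \<beta>} = {e3, cis \<theta>}" unfolding ab(2) by (rule insert_commute)
    from one_sided_limit[OF ab(1) this ab(3)] show ?thesis using that by blast
  qed
  obtain a p n where sides: "a > 0" "{p, n} = {z1, z2}"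
    "\<And>s. 0 < s \<Longrightarrow> s < a \<Longrightarrow> (f \<longlongrightarrow> p) (at (cis (\<theta> + s)) within ball 0 1)"
    "\<And>s. - a < s \<Longrightarrow> s < 0 \<Longrightarrow> (f \<longlongrightarrow> n) (at (cis (\<theta> + s)) within ball 0 1)"
    using opposite_sides[OF a1 a2 z12] by blast
  define T where "T = open_segment z0 z1 \<union> {z1} \<union> open_segment z1 z2 \<union> {z2} \<union> open_segment z2 z3"
  have T: "q \<in> frontier \<Omega>" "tame_at \<Omega> q" if "q \<in> T" for q
    using that seg corner by (auto simp: T_def boundary_segment_def boundary_corner_def)
  have "\<forall>q\<in>T. \<exists>l. (\<psi> \<longlongrightarrow> l) (at q within \<Omega>)"
    using T dual_limit_at_tame[OF dual] by (auto simp: frontier_\<Omega>)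
  then obtain v where v: "\<And>q. q \<in> T \<Longrightarrow> (\<psi> \<longlongrightarrow> v q) (at q within \<Omega>)" by metis
  \<comment> \<open>On the boundary part \<open>T\<close> the extension takes the limits
    \<open>v\<close>; frontier points are not in the open set \<Omega>, so the two cases do not
    conflict.\<close>
  define \<psi>_ext where "\<psi>_ext = (\<lambda>z. if z \<in> \<Omega> then \<psi> z else v z)"
  have ext\<Omega>: "\<psi>_ext z = \<psi> z" if "z \<in> \<Omega>" for z using that by (simp add: \<psi>_ext_def)
  have extT: "\<psi>_ext q = v q" if "q \<in> T" for q using T(1)[OF that] by (simp add: \<psi>_ext_def frontier_\<Omega>)
  have lim: "(\<psi> \<longlongrightarrow> \<psi>_ext q) (at q within \<Omega>)" if "q \<in> T" for q using v[OF that] extT[OF that] by simp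
  have cont_ext: "continuous_on (\<Omega> \<union> T) \<psi>_ext"
  proof (rule continuous_on_extension_by_limits[OF open_\<Omega>])
    have "continuous_on \<Omega> \<psi>"
      using dual unfolding is_dual_def by (intro continuous_at_imp_continuous_on ballI) (blast intro: has_derivative_continuous)
    then show "continuous_on \<Omega> \<psi>_ext" using ext\<Omega> by (subst continuous_on_cong[OF refl]) auto
    show "T \<subseteq> frontier \<Omega>" using T(1) by blast
    show "(\<psi>_ext \<longlongrightarrow> \<psi>_ext q) (at q within \<Omega>)" if "q \<in> T" for q
    proof -
      have "\<forall>\<^sub>F z in at q within \<Omega>. \<psi>_ext z = \<psi> z" using in\<Omega> by (rule eventually_mono) (rule ext\<Omega>)
      from tendsto_cong[OF this] lim[OF that] show ?thesis by simp
    qed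
  qed
  have closedT: "closed_segment z1 z2 \<subseteq> T" by (auto simp: T_def closed_segment_eq_open)
  \<comment> \<open>The midpoint serves twice: as a boundary point where \<phi> has a pole and
    \<open>F\<close> tends to \<open>cis \<theta>\<close>, and as the place where \<Omega> is seen
    to lie to the left.\<close>
  define m where "m = midpoint z1 z2"
  have m: "m \<in> open_segment z1 z2" using z12 by (simp add: m_def midpoint_in_open_segment)
  have m\<gamma>: "m \<in> open_segment (\<gamma> s1) (\<gamma> s2)" and s12: "0 \<le> s1" "s2 \<le> 1" "\<gamma> ` {s1..s2} = closed_segment (\<gamma> s1) (\<gamma> s2)"
    using m s im(2) by (simp_all add: \<gamma>s)
  obtain r where r: "r > 0" "\<Omega> \<inter> ball m r = ball m r \<inter> {z. cross (\<gamma> s2 - \<gamma> s1) (z - m) > 0}"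
    by (rule left_of_segment_inside[OF \<gamma>\<Omega> s12(1) s(3) s12(2,3) m\<gamma>])
  note r = r[unfolded \<gamma>s]
  have left: "Im (cnj (z2 - z1) * (z - z1)) > 0" if z: "z \<in> \<Omega>" "dist z (midpoint z1 z2) < r" for z
  proof -
    have "z \<in> \<Omega> \<inter> ball m r" using z by (simp add: m_def dist_commute)
    then have "cross (z2 - z1) (z - m) > 0" unfolding r(2) by blast
    moreover have "z - z1 = (z - m) + of_real (1/2) * (z2 - z1)"
      by (simp add: m_def midpoint_def scaleR_conv_of_real complex_eq_iff) (simp add: field_simps)
    ultimately have "cross (z2 - z1) (z - z1) > 0" by (simp only: cross_linear mult_zero_right add_0_right)
    then show ?thesis by (simp add: cross_def)
  qed
  have components: "deriv h w = Complex (pdx \<phi> (f w) * Re (pdx f w) + pdy \<phi> (f w) * Im (pdx f w)) (- (pdx \<phi> (f w) * Re (pdy f w) + pdy \<phi> (f w) * Im (pdy f w)))"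
    "deriv \<Phi>\<^sub>1 w = Complex (Re (pdx f w)) (- Re (pdy f w))" "deriv \<Phi>\<^sub>2 w = Complex (Im (pdx f w)) (- Im (pdy f w))" if w: "w \<in> ball 0 1" for w
  proof -
    show "deriv h w = Complex (pdx \<phi> (f w) * Re (pdx f w) + pdy \<phi> (f w) * Im (pdx f w)) (- (pdx \<phi> (f w) * Re (pdy f w) + pdy \<phi> (f w) * Im (pdy f w)))"
      unfolding h_def by (rule DERIV_imp_deriv, rule holomorphic_height[OF d\<phi> dual chm w])
    show "deriv \<Phi>\<^sub>1 w = Complex (Re (pdx f w)) (- Re (pdy f w))"
      by (rule deriv_of_harmonic_part[OF d\<phi> dual chm w bounded_linear_Re hol(1)]) (simp_all add: \<Phi>\<^sub>1_def)
    show "deriv \<Phi>\<^sub>2 w = Complex (Im (pdx f w)) (- Im (pdy f w))"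
      by (rule deriv_of_harmonic_part[OF d\<phi> dual chm w bounded_linear_Im hol(2)]) (simp_all add: \<Phi>\<^sub>2_def)
  qed
  \<comment> \<open>The real and the imaginary part of this equation are the two isothermal
    conditions.\<close>
  have null: "(deriv \<Phi>\<^sub>1 w)\<^sup>2 + (deriv \<Phi>\<^sub>2 w)\<^sup>2 + (deriv h w)\<^sup>2 = 0" if w: "w \<in> ball 0 1" for w
    using isothermal_components[OF d\<phi> dual chm w] unfolding components[OF w]
    by (simp add: complex_eq_iff power2_eq_square algebra_simps)
  \<comment> \<open>The imaginary part of the product is the Jacobian of \<open>f\<close>.\<close>
  have jac: "Im (deriv \<Phi>\<^sub>1 w * cnj (deriv \<Phi>\<^sub>2 w)) > 0" if w: "w \<in> ball 0 1" for w
    using chm w unfolding components[OF w] corresponding_harmonic_mapping_def orientation_preserving_on_def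
    by (auto simp: algebra_simps simp del: mem_ball)
  have pn: "p \<in> frontier \<Omega>" "n \<in> frontier \<Omega>"
  proof -
    have "p \<in> {z1, z2}" "n \<in> {z1, z2}" using sides(2) by blast+
    then have "p \<in> T" "n \<in> T" by (auto simp: T_def)
    then show "p \<in> frontier \<Omega>" "n \<in> frontier \<Omega>" using T(1) by auto
  qed
  have poleq: "m \<in> frontier \<Omega>" "(F \<longlongrightarrow> cis \<theta>) (at m within \<Omega>)" "filterlim (\<lambda>z. Re (h (F z))) at_top (at m within \<Omega>)"
    using T(1)[of m] m e2(2)[OF m] \<theta> pole[of at_top m] assms(6) by (auto simp: T_def tends_on_def)
  have \<psi>h: "\<psi> (f w) = Im (h w)" for w by (simp add: h_def)
  have fc: "f_conj w = Complex (Im (\<Phi>\<^sub>1 w)) (Im (\<Phi>\<^sub>2 w))" for w by (simp add: \<Phi>\<^sub>1_def \<Phi>\<^sub>2_def)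
  have limseg: "(\<psi> \<longlongrightarrow> \<psi>_ext q) (at q within \<Omega>)" if "q \<in> closed_segment z1 z2" for q using lim closedT that by blast
  note jump = jump_behaviour[OF h \<psi>h null jac z12 sides(2) pn sides(1) sides(3,4) limseg r(1) left poleq fc]
  have "filterlim (\<lambda>w. Re (h w)) at_top (at (cis \<theta>) within ball 0 1)" by (rule jump(1))
  then have top: "filterlim (\<lambda>w. \<phi> (f w)) at_top (at (cis \<theta>) within ball 0 1)" by (simp add: h_def)
  have cluster: "cluster_set f (cis \<theta>) = closed_segment z1 z2" by (rule jump(2))
  have cluster_pair: "cluster_set (\<lambda>w. (f w, \<psi> (f w))) (cis \<theta>) = closed_segment (z1, \<psi>_ext z1) (z2, \<psi>_ext z2)" by (rule jump(4))
  have cluster_dual: "cluster_set (\<lambda>w. \<psi> (f w)) (cis \<theta>) = {\<psi>_ext z1..\<psi>_ext z2}" by (rule jump(5))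
  have lightlike: "\<psi>_ext z2 - \<psi>_ext z1 = norm (z2 - z1)" by (rule jump(3))
  have diverges: "diverges_in_direction f_conj (cis \<theta>) (z1 - z2)" by (rule jump(6))
  have bot: "filterlim (\<lambda>w. - \<phi> (f w)) at_bot (at (cis \<theta>) within ball 0 1)" using top by (simp add: filterlim_uminus_at_top)
  have "\<Omega> \<union> T = \<Omega> \<union> open_segment z0 z1 \<union> {z1} \<union> open_segment z1 z2 \<union> {z2} \<union> open_segment z2 z3"
    unfolding T_def by blast
  with cont_ext have cont: "continuous_on (\<Omega> \<union> open_segment z0 z1 \<union> {z1} \<union> open_segment z1 z2 \<union> {z2} \<union> open_segment z2 z3) \<psi>_ext" by simp
  have sphere: "cis \<theta> \<in> sphere 0 1" by simp
  show ?thesis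
    by (rule exI[of _ \<psi>_ext], intro conjI ballI bexI[OF _ sphere])
      (rule cont ext\<Omega> cluster cluster_pair cluster_dual lightlike top bot diverges exI[of _ "\<psi>_ext z1"] exI[of _ "\<psi>_ext z2"] conjI | assumption)+
qed

end
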